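(* Let $k$ be a field, let $A$ be a finite dimensional $k$-algebra and let $\mathcal{B}$ be a functorially finite subcategory of $\mathrm{mod}\,A$ containing $A$. Let $\underline{\mathcal{B}}=\mathcal{B}/[\mathrm{proj}\,A]$. Then there exists an equivalence $$\frac{\mathrm{mod}\,\mathcal{B}}{\mathrm{mod}\,\underline{\mathcal{B}}}\xrightarrow{\ \sim\ }\mathrm{mod}\,A,$$ where the left-hand side is a Serre quotient.
   Context: All categories and functors are additive and $k$-linear. $\mathrm{mod}\,A$ is the category of finite dimensional right $A$-modules and $\mathrm{proj}\,A$ its full subcategory of projective modules. For an essentially small $k$-linear category $\mathcal{C}$, $\mathrm{Mod}\,\mathcal{C}$ is the category of $k$-linear contravariant functors $\mathcal{C}\to\mathrm{Mod}\,k$; a $\mathcal{C}$-module $X$ is finitely generated if there is an epimorphism $\mathcal{C}(-,c)\to X$, and finitely presented if there is an exact sequence $\mathcal{C}(-,c_1)\to\mathcal{C}(-,c_0)\to X\to0$ with $c_0,c_1\in\mathcal C$; $\mathrm{mod}\,\mathcal{C}$ is the full subcategory of finitely presented $\mathcal{C}$-modules. A full subcategory $\mathcal{B}$ of a category $\mathcal{M}$ is functorially finite if for every $x\in\mathcal{M}$ the $\mathcal{B}$-module $\mathcal{M}(-,x)|_{\mathcal{B}}$ and the $\mathcal{B}^{\mathrm{op}}$-module $\mathcal{M}(x,-)|_{\mathcal{B}}$ are finitely generated. $\mathcal{B}$ is assumed additive and Krull-Schmidt (every object of $\mathcal B$ is a finite direct sum of objects of $\mathcal B$ with local endomorphism algebras),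 so $\mathcal{B}$ contains $\mathrm{proj}\,A$ up to isomorphism. $\mathcal{B}/[\mathrm{proj}\,A]$ is the ideal quotient of $\mathcal{B}$ by the ideal of morphisms factoring through an object of $\mathrm{proj}\,A$. The category $\mathrm{mod}\,\underline{\mathcal{B}}$ is regarded as a Serre subcategory of $\mathrm{mod}\,\mathcal{B}$ via the fully faithful functor given by precomposition with the projection $\mathcal{B}\to\underline{\mathcal{B}}$ (its essential image consists of the finitely presented $\mathcal{B}$-modules vanishing on $\mathrm{proj}\,A$). *)

theory Defs
  imports "HOL-Algebra.Module" "HOL-Algebra.AbelCoset"
begin

section \<open>Linear categories and functors\<close>

text \<open>
  The morphisms from x to y form a K-module \<open>Hom C x y\<close>. A raw morphism need not determine its
  source and target, so \<open>Cmp C x y z g f\<close> carries the objects of f : x \<rightarrow> y and g : y \<rightarrow> z.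
  The record type \<open>module\<close> of HOL-Algebra extends that of rings; for modules that are not
  algebras, the fields \<open>mult\<close> and \<open>one\<close> are junk and never used.
\<close>

record ('o, 'm, 'k) lin_cat =
  Ob :: "'o set"
  Hom :: "'o \<Rightarrow> 'o \<Rightarrow> ('k, 'm) module"
  Idm :: "'o \<Rightarrow> 'm"
  Cmp :: "'o \<Rightarrow> 'o \<Rightarrow> 'o \<Rightarrow> 'm \<Rightarrow> 'm \<Rightarrow> 'm"

definition k_space :: "'v set \<Rightarrow> 'v \<Rightarrow> ('v \<Rightarrow> 'v \<Rightarrow> 'v) \<Rightarrow> ('k \<Rightarrow> 'v \<Rightarrow> 'v) \<Rightarrow> ('k, 'v) module" where
  "k_space V z p s =
    \<lparr>carrier = V, mult = undefined, one = undefined, zero = z, add = p, smult = s\<rparr>"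

locale linear_category =
  fixes K :: "'k ring" and C :: "('o, 'm, 'k) lin_cat"
  assumes Hom_module: "\<lbrakk>x \<in> Ob C; y \<in> Ob C\<rbrakk> \<Longrightarrow> module K (Hom C x y)"
    and Idm_closed: "x \<in> Ob C \<Longrightarrow> Idm C x \<in> carrier (Hom C x x)"
    and Cmp_closed: "\<lbrakk>x \<in> Ob C; y \<in> Ob C; z \<in> Ob C; f \<in> carrier (Hom C x y); g \<in> carrier (Hom C y z)\<rbrakk>
      \<Longrightarrow> Cmp C x y z g f \<in> carrier (Hom C x z)"
    and Cmp_Idm_right: "\<lbrakk>x \<in> Ob C; y \<in> Ob C; f \<in> carrier (Hom C x y)\<rbrakk>
      \<Longrightarrow> Cmp C x x y f (Idm C x) = f"
    and Cmp_Idm_left: "\<lbrakk>x \<in> Ob C; y \<in> Ob C; f \<in> carrier (Hom C x y)\<rbrakk>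
      \<Longrightarrow> Cmp C x y y (Idm C y) f = f"
    and Cmp_assoc: "\<lbrakk>w \<in> Ob C; x \<in> Ob C; y \<in> Ob C; z \<in> Ob C; f \<in> carrier (Hom C w x);
        g \<in> carrier (Hom C x y); h \<in> carrier (Hom C y z)\<rbrakk>
      \<Longrightarrow> Cmp C w y z h (Cmp C w x y g f) = Cmp C w x z (Cmp C x y z h g) f"
    and Cmp_add_right: "\<lbrakk>x \<in> Ob C; y \<in> Ob C; z \<in> Ob C; f \<in> carrier (Hom C x y);
        f' \<in> carrier (Hom C x y); g \<in> carrier (Hom C y z)\<rbrakk>
      \<Longrightarrow> Cmp C x y z g (f \<oplus>\<^bsub>Hom C x y\<^esub> f') =
        Cmp C x y z g f \<oplus>\<^bsub>Hom C x z\<^esub> Cmp C x y z g f'"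
    and Cmp_add_left: "\<lbrakk>x \<in> Ob C; y \<in> Ob C; z \<in> Ob C; f \<in> carrier (Hom C x y);
        g \<in> carrier (Hom C y z); g' \<in> carrier (Hom C y z)\<rbrakk>
      \<Longrightarrow> Cmp C x y z (g \<oplus>\<^bsub>Hom C y z\<^esub> g') f =
        Cmp C x y z g f \<oplus>\<^bsub>Hom C x z\<^esub> Cmp C x y z g' f"
    and Cmp_smult_right: "\<lbrakk>x \<in> Ob C; y \<in> Ob C; z \<in> Ob C; c \<in> carrier K; f \<in> carrier (Hom C x y);
        g \<in> carrier (Hom C y z)\<rbrakk>
      \<Longrightarrow> Cmp C x y z g (c \<odot>\<^bsub>Hom C x y\<^esub> f) = c \<odot>\<^bsub>Hom C x z\<^esub> Cmp C x y z g f"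
    and Cmp_smult_left: "\<lbrakk>x \<in> Ob C; y \<in> Ob C; z \<in> Ob C; c \<in> carrier K; f \<in> carrier (Hom C x y);
        g \<in> carrier (Hom C y z)\<rbrakk>
      \<Longrightarrow> Cmp C x y z (c \<odot>\<^bsub>Hom C y z\<^esub> g) f = c \<odot>\<^bsub>Hom C x z\<^esub> Cmp C x y z g f"

definition full_sub :: "('o, 'm, 'k) lin_cat \<Rightarrow> 'o set \<Rightarrow> ('o, 'm, 'k) lin_cat" where
  "full_sub C S = C\<lparr>Ob := S\<rparr>"

definition op_cat :: "('o, 'm, 'k) lin_cat \<Rightarrow> ('o, 'm, 'k) lin_cat" where
  "op_cat C = C\<lparr>Hom := (\<lambda>x y. Hom C y x), Cmp := (\<lambda>x y z g f. Cmp C z y x f g)\<rparr>"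

definition iso_arr :: "('o, 'm, 'k) lin_cat \<Rightarrow> 'o \<Rightarrow> 'o \<Rightarrow> 'm \<Rightarrow> bool" where
  "iso_arr C x y f \<longleftrightarrow> f \<in> carrier (Hom C x y) \<and>
    (\<exists>g\<in>carrier (Hom C y x). Cmp C x y x g f = Idm C x \<and> Cmp C y x y f g = Idm C y)"

definition isomorphic :: "('o, 'm, 'k) lin_cat \<Rightarrow> 'o \<Rightarrow> 'o \<Rightarrow> bool" where
  "isomorphic C x y \<longleftrightarrow> x \<in> Ob C \<and> y \<in> Ob C \<and> (\<exists>f. iso_arr C x y f)"

record ('o, 'm, 'p, 'n) fctr =
  fob :: "'o \<Rightarrow> 'p"
  far :: "'o \<Rightarrow> 'o \<Rightarrow> 'm \<Rightarrow> 'n"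

locale linear_functor =
  fixes K :: "'k ring" and C :: "('o, 'm, 'k) lin_cat" and D :: "('p, 'n, 'k) lin_cat"
    and F :: "('o, 'm, 'p, 'n) fctr"
  assumes fob_closed: "x \<in> Ob C \<Longrightarrow> fob F x \<in> Ob D"
    and far_closed: "\<lbrakk>x \<in> Ob C; y \<in> Ob C; f \<in> carrier (Hom C x y)\<rbrakk>
      \<Longrightarrow> far F x y f \<in> carrier (Hom D (fob F x) (fob F y))"
    and far_Idm: "x \<in> Ob C \<Longrightarrow> far F x x (Idm C x) = Idm D (fob F x)"
    and far_Cmp: "\<lbrakk>x \<in> Ob C; y \<in> Ob C; z \<in> Ob C; f \<in> carrier (Hom C x y); g \<in> carrier (Hom C y z)\<rbrakk>
      \<Longrightarrow> far F x z (Cmp C x y z g f) =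
        Cmp D (fob F x) (fob F y) (fob F z) (far F y z g) (far F x y f)"
    and far_add: "\<lbrakk>x \<in> Ob C; y \<in> Ob C; f \<in> carrier (Hom C x y); g \<in> carrier (Hom C x y)\<rbrakk>
      \<Longrightarrow> far F x y (f \<oplus>\<^bsub>Hom C x y\<^esub> g) =
        far F x y f \<oplus>\<^bsub>Hom D (fob F x) (fob F y)\<^esub> far F x y g"
    and far_smult: "\<lbrakk>x \<in> Ob C; y \<in> Ob C; c \<in> carrier K; f \<in> carrier (Hom C x y)\<rbrakk>
      \<Longrightarrow> far F x y (c \<odot>\<^bsub>Hom C x y\<^esub> f) = c \<odot>\<^bsub>Hom D (fob F x) (fob F y)\<^esub> far F x y f"

definition id_fctr :: "('o, 'm, 'o, 'm) fctr" where
  "id_fctr = \<lparr>fob = (\<lambda>x. x), far = (\<lambda>x y f. f)\<rparr>"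

definition comp_fctr ::
  "('p, 'n, 'q, 'l) fctr \<Rightarrow> ('o, 'm, 'p, 'n) fctr \<Rightarrow> ('o, 'm, 'q, 'l) fctr" where
  "comp_fctr G F = \<lparr>fob = (\<lambda>x. fob G (fob F x)),
    far = (\<lambda>x y f. far G (fob F x) (fob F y) (far F x y f))\<rparr>"

definition op_fctr :: "('o, 'm, 'p, 'n) fctr \<Rightarrow> ('o, 'm, 'p, 'n) fctr" where
  "op_fctr F = \<lparr>fob = fob F, far = (\<lambda>x y. far F y x)\<rparr>"

definition naturally_isomorphic :: "('o, 'm, 'k) lin_cat \<Rightarrow> ('p, 'n, 'k) lin_cat \<Rightarrow>
    ('o, 'm, 'p, 'n) fctr \<Rightarrow> ('o, 'm, 'p, 'n) fctr \<Rightarrow> bool" where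
  "naturally_isomorphic C D F G \<longleftrightarrow> (\<exists>\<eta>.
    (\<forall>x\<in>Ob C. iso_arr D (fob F x) (fob G x) (\<eta> x)) \<and>
    (\<forall>x\<in>Ob C. \<forall>y\<in>Ob C. \<forall>f\<in>carrier (Hom C x y).
      Cmp D (fob F x) (fob F y) (fob G y) (\<eta> y) (far F x y f) =
      Cmp D (fob F x) (fob G x) (fob G y) (far G x y f) (\<eta> x)))"

definition linear_equivalence :: "'k ring \<Rightarrow> ('o, 'm, 'k) lin_cat \<Rightarrow> ('p, 'n, 'k) lin_cat \<Rightarrow>
    ('o, 'm, 'p, 'n) fctr \<Rightarrow> bool" where
  "linear_equivalence K C D F \<longleftrightarrow>
    linear_category K C \<and> linear_category K D \<and> linear_functor K C D F \<and>
    (\<exists>G. linear_functor K D C G \<and>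
      naturally_isomorphic C C (comp_fctr G F) id_fctr \<and>
      naturally_isomorphic D D (comp_fctr F G) id_fctr)"


section \<open>Additive and Krull-Schmidt categories\<close>

definition direct_sum :: "('o, 'm, 'k) lin_cat \<Rightarrow> 'o \<Rightarrow> 'o list \<Rightarrow> bool" where
  "direct_sum C z xs \<longleftrightarrow> (\<exists>\<iota> \<pi>.
    (\<forall>i<length xs. \<iota> i \<in> carrier (Hom C (xs ! i) z) \<and> \<pi> i \<in> carrier (Hom C z (xs ! i))) \<and>
    (\<forall>i<length xs. \<forall>j<length xs. Cmp C (xs ! j) z (xs ! i) (\<pi> i) (\<iota> j) =
      (if i = j then Idm C (xs ! i) else \<zero>\<^bsub>Hom C (xs ! j) (xs ! i)\<^esub>)) \<and>
    (\<Oplus>\<^bsub>Hom C z z\<^esub>i\<in>{..<length xs}. Cmp C z (xs ! i) z (\<iota> i) (\<pi> i)) = Idm C z)"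

text \<open>The empty list accounts for the zero object.\<close>

definition additive :: "('o, 'm, 'k) lin_cat \<Rightarrow> bool" where
  "additive C \<longleftrightarrow> (\<forall>xs. set xs \<subseteq> Ob C \<longrightarrow> (\<exists>z\<in>Ob C. direct_sum C z xs))"

definition End_ring :: "('o, 'm, 'k) lin_cat \<Rightarrow> 'o \<Rightarrow> ('k, 'm) module" where
  "End_ring C x = (Hom C x x)\<lparr>mult := Cmp C x x x, one := Idm C x\<rparr>"

definition local_ring :: "('r, 's) ring_scheme \<Rightarrow> bool" where
  "local_ring R \<longleftrightarrow> ring R \<and> \<one>\<^bsub>R\<^esub> \<noteq> \<zero>\<^bsub>R\<^esub> \<and>
    (\<forall>a\<in>carrier R - Units R. \<forall>b\<in>carrier R - Units R. a \<oplus>\<^bsub>R\<^esub> b \<notin> Units R)"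

definition krull_schmidt :: "('o, 'm, 'k) lin_cat \<Rightarrow> bool" where
  "krull_schmidt C \<longleftrightarrow> (\<forall>x\<in>Ob C. \<exists>ys. set ys \<subseteq> {y \<in> Ob C. local_ring (End_ring C y)} \<and>
    direct_sum C x ys)"


section \<open>Vector spaces and modules over a finite dimensional algebra\<close>

text \<open>
  HOL has no category of all modules. The carriers of the modules below are
  arbitrary subsets of a type \<open>'u\<close>, which plays the role of a universe and which the theorem
  allows to be any type that is large enough.

  Linear maps are extensional functions, so that equality of morphisms is equality of functions.
\<close>

definition lin_hom ::
  "'k ring \<Rightarrow> ('k, 'u, 'r) module_scheme \<Rightarrow> ('k, 'v, 's) module_scheme \<Rightarrow> ('u \<Rightarrow> 'v) set" where
  "lin_hom K V W = {f \<in> carrier V \<rightarrow>\<^sub>E carrier W.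
    (\<forall>v\<in>carrier V. \<forall>w\<in>carrier V. f (v \<oplus>\<^bsub>V\<^esub> w) = f v \<oplus>\<^bsub>W\<^esub> f w) \<and>
    (\<forall>c\<in>carrier K. \<forall>v\<in>carrier V. f (c \<odot>\<^bsub>V\<^esub> v) = c \<odot>\<^bsub>W\<^esub> f v)}"

definition map_space :: "('k, 'u, 'r) module_scheme \<Rightarrow> ('k, 'v, 's) module_scheme \<Rightarrow>
    ('u \<Rightarrow> 'v) set \<Rightarrow> ('k, 'u \<Rightarrow> 'v) module" where
  "map_space V W H = k_space H
    (\<lambda>v\<in>carrier V. \<zero>\<^bsub>W\<^esub>)
    (\<lambda>f g. \<lambda>v\<in>carrier V. f v \<oplus>\<^bsub>W\<^esub> g v)
    (\<lambda>c f. \<lambda>v\<in>carrier V. c \<odot>\<^bsub>W\<^esub> f v)"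

definition vect :: "'u itself \<Rightarrow> 'k ring \<Rightarrow> (('k, 'u) module, 'u \<Rightarrow> 'u, 'k) lin_cat" where
  "vect u K = \<lparr>Ob = {V. module K V}, Hom = (\<lambda>V W. map_space V W (lin_hom K V W)),
    Idm = (\<lambda>V. \<lambda>v\<in>carrier V. v), Cmp = (\<lambda>U V W g f. compose (carrier U) g f)\<rparr>"

definition fin_dim :: "'k ring \<Rightarrow> ('k, 'v, 'r) module_scheme \<Rightarrow> bool" where
  "fin_dim K V \<longleftrightarrow> (\<exists>S. finite S \<and> S \<subseteq> carrier V \<and>
    (\<forall>H. submodule H K V \<and> S \<subseteq> H \<longrightarrow> H = carrier V))"

definition fd_algebra :: "'k ring \<Rightarrow> ('k, 'a) module \<Rightarrow> bool" where
  "fd_algebra K A \<longleftrightarrow> ring A \<and> module K A \<and> fin_dim K A \<and>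
    (\<forall>c\<in>carrier K. \<forall>a\<in>carrier A. \<forall>b\<in>carrier A.
      (c \<odot>\<^bsub>A\<^esub> a) \<otimes>\<^bsub>A\<^esub> b = c \<odot>\<^bsub>A\<^esub> (a \<otimes>\<^bsub>A\<^esub> b) \<and> a \<otimes>\<^bsub>A\<^esub> (c \<odot>\<^bsub>A\<^esub> b) = c \<odot>\<^bsub>A\<^esub> (a \<otimes>\<^bsub>A\<^esub> b))"

record ('k, 'u, 'a) right_module = "('k, 'u) module" +
  ract :: "'u \<Rightarrow> 'a \<Rightarrow> 'u"

locale right_mod =
  fixes K :: "'k ring" and A :: "('k, 'a) module" and M :: "('k, 'u, 'a) right_module"
  assumes vector_space: "module K M"
    and ract_closed: "\<lbrakk>m \<in> carrier M; a \<in> carrier A\<rbrakk> \<Longrightarrow> ract M m a \<in> carrier M"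
    and ract_add_left: "\<lbrakk>m \<in> carrier M; n \<in> carrier M; a \<in> carrier A\<rbrakk>
      \<Longrightarrow> ract M (m \<oplus>\<^bsub>M\<^esub> n) a = ract M m a \<oplus>\<^bsub>M\<^esub> ract M n a"
    and ract_add_right: "\<lbrakk>m \<in> carrier M; a \<in> carrier A; b \<in> carrier A\<rbrakk>
      \<Longrightarrow> ract M m (a \<oplus>\<^bsub>A\<^esub> b) = ract M m a \<oplus>\<^bsub>M\<^esub> ract M m b"
    and ract_smult_left: "\<lbrakk>c \<in> carrier K; m \<in> carrier M; a \<in> carrier A\<rbrakk>
      \<Longrightarrow> ract M (c \<odot>\<^bsub>M\<^esub> m) a = c \<odot>\<^bsub>M\<^esub> ract M m a"
    and ract_smult_right: "\<lbrakk>c \<in> carrier K; m \<in> carrier M; a \<in> carrier A\<rbrakk>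
      \<Longrightarrow> ract M m (c \<odot>\<^bsub>A\<^esub> a) = c \<odot>\<^bsub>M\<^esub> ract M m a"
    and ract_mult: "\<lbrakk>m \<in> carrier M; a \<in> carrier A; b \<in> carrier A\<rbrakk>
      \<Longrightarrow> ract M m (a \<otimes>\<^bsub>A\<^esub> b) = ract M (ract M m a) b"
    and ract_one: "m \<in> carrier M \<Longrightarrow> ract M m \<one>\<^bsub>A\<^esub> = m"

definition right_hom :: "'k ring \<Rightarrow> ('k, 'a) module \<Rightarrow>
    ('k, 'u, 'a) right_module \<Rightarrow> ('k, 'v, 'a) right_module \<Rightarrow> ('u \<Rightarrow> 'v) set" where
  "right_hom K A M N = {f \<in> lin_hom K M N.
    \<forall>m\<in>carrier M. \<forall>a\<in>carrier A. f (ract M m a) = ract N (f m) a}"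

definition mod_alg :: "'u itself \<Rightarrow> 'k ring \<Rightarrow> ('k, 'a) module \<Rightarrow>
    (('k, 'u, 'a) right_module, 'u \<Rightarrow> 'u, 'k) lin_cat" where
  "mod_alg u K A = \<lparr>Ob = {M. right_mod K A M \<and> fin_dim K M},
    Hom = (\<lambda>M N. map_space M N (right_hom K A M N)),
    Idm = (\<lambda>M. \<lambda>m\<in>carrier M. m), Cmp = (\<lambda>L M N g f. compose (carrier L) g f)\<rparr>"

definition regular_module :: "('k, 'a) module \<Rightarrow> ('k, 'a, 'a) right_module" where
  "regular_module A = \<lparr>carrier = carrier A, mult = mult A, one = one A, zero = zero A,
    add = add A, smult = smult A, ract = mult A\<rparr>"

text \<open>Isomorphic modules may have carriers in different types here.\<close>

definition isomorphic_modules :: "'k ring \<Rightarrow> ('k, 'a) module \<Rightarrow>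
    ('k, 'u, 'a) right_module \<Rightarrow> ('k, 'v, 'a) right_module \<Rightarrow> bool" where
  "isomorphic_modules K A M N \<longleftrightarrow>
    (\<exists>\<phi>\<in>right_hom K A M N. bij_betw \<phi> (carrier M) (carrier N))"

definition proj_alg :: "'u itself \<Rightarrow> 'k ring \<Rightarrow> ('k, 'a) module \<Rightarrow>
    ('k, 'u, 'a) right_module set" where
  "proj_alg u K A = {P \<in> Ob (mod_alg u K A).
    \<forall>M\<in>Ob (mod_alg u K A). \<forall>N\<in>Ob (mod_alg u K A).
    \<forall>g\<in>right_hom K A M N. \<forall>f\<in>right_hom K A P N. g ` carrier M = carrier N \<longrightarrow>
      (\<exists>h\<in>right_hom K A P M. compose (carrier P) g h = f)}"


section \<open>Modules over a linear category\<close>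

text \<open>
  A C-module is a linear functor from \<open>op_cat C\<close> to vector spaces. The homomorphisms are defined
  for modules with values in two possibly different universes, because the values of the
  representable modules are spaces of morphisms of C.
\<close>

definition nat_maps :: "'k ring \<Rightarrow> ('o, 'm, 'k) lin_cat \<Rightarrow>
    ('o, 'm, ('k, 'u) module, 'u \<Rightarrow> 'u) fctr \<Rightarrow> ('o, 'm, ('k, 'v) module, 'v \<Rightarrow> 'v) fctr \<Rightarrow>
    ('o \<Rightarrow> 'u \<Rightarrow> 'v) set" where
  "nat_maps K C X Y = {\<eta> \<in> (\<Pi>\<^sub>E x\<in>Ob C. lin_hom K (fob X x) (fob Y x)).
    \<forall>x\<in>Ob C. \<forall>y\<in>Ob C. \<forall>f\<in>carrier (Hom C x y). \<forall>v\<in>carrier (fob X y).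
      \<eta> x (far X y x f v) = far Y y x f (\<eta> y v)}"

definition Mod_cat :: "'u itself \<Rightarrow> 'k ring \<Rightarrow> ('o, 'm, 'k) lin_cat \<Rightarrow>
    (('o, 'm, ('k, 'u) module, 'u \<Rightarrow> 'u) fctr, 'o \<Rightarrow> 'u \<Rightarrow> 'u, 'k) lin_cat" where
  "Mod_cat u K C = \<lparr>Ob = {X. linear_functor K (op_cat C) (vect u K) X},
    Hom = (\<lambda>X Y. k_space (nat_maps K C X Y)
      (\<lambda>x\<in>Ob C. \<zero>\<^bsub>Hom (vect u K) (fob X x) (fob Y x)\<^esub>)
      (\<lambda>\<eta> \<theta>. \<lambda>x\<in>Ob C. \<eta> x \<oplus>\<^bsub>Hom (vect u K) (fob X x) (fob Y x)\<^esub> \<theta> x)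
      (\<lambda>c \<eta>. \<lambda>x\<in>Ob C. c \<odot>\<^bsub>Hom (vect u K) (fob X x) (fob Y x)\<^esub> \<eta> x)),
    Idm = (\<lambda>X. \<lambda>x\<in>Ob C. Idm (vect u K) (fob X x)),
    Cmp = (\<lambda>X Y Z \<theta> \<eta>. \<lambda>x\<in>Ob C. Cmp (vect u K) (fob X x) (fob Y x) (fob Z x) (\<theta> x) (\<eta> x))\<rparr>"

text \<open>
  The module C(-,c). If \<open>D = full_sub C S\<close> and c is an object of C, it is also read as the
  restriction of C(-,c) to D, since functor records do not mention the set of objects.
\<close>

definition yoneda :: "('o, 'm, 'k) lin_cat \<Rightarrow> 'o \<Rightarrow> ('o, 'm, ('k, 'm) module, 'm \<Rightarrow> 'm) fctr" where
  "yoneda C c = \<lparr>fob = (\<lambda>x. Hom C x c),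
    far = (\<lambda>x y f. \<lambda>g\<in>carrier (Hom C x c). Cmp C y x c g f)\<rparr>"

definition finitely_generated :: "'k ring \<Rightarrow> ('o, 'm, 'k) lin_cat \<Rightarrow>
    ('o, 'm, ('k, 'u) module, 'u \<Rightarrow> 'u) fctr \<Rightarrow> bool" where
  "finitely_generated K C X \<longleftrightarrow> (\<exists>c\<in>Ob C. \<exists>\<epsilon>\<in>nat_maps K C (yoneda C c) X.
    \<forall>x\<in>Ob C. \<epsilon> x ` carrier (Hom C x c) = carrier (fob X x))"

definition finitely_presented :: "'k ring \<Rightarrow> ('o, 'm, 'k) lin_cat \<Rightarrow>
    ('o, 'm, ('k, 'u) module, 'u \<Rightarrow> 'u) fctr \<Rightarrow> bool" where
  "finitely_presented K C X \<longleftrightarrow> (\<exists>c\<^sub>1\<in>Ob C. \<exists>c\<^sub>0\<in>Ob C.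
    \<exists>\<delta>\<in>nat_maps K C (yoneda C c\<^sub>1) (yoneda C c\<^sub>0). \<exists>\<epsilon>\<in>nat_maps K C (yoneda C c\<^sub>0) X.
    \<forall>x\<in>Ob C. \<epsilon> x ` carrier (Hom C x c\<^sub>0) = carrier (fob X x) \<and>
      \<delta> x ` carrier (Hom C x c\<^sub>1) = {g \<in> carrier (Hom C x c\<^sub>0). \<epsilon> x g = \<zero>\<^bsub>fob X x\<^esub>})"

definition mod_cat :: "'u itself \<Rightarrow> 'k ring \<Rightarrow> ('o, 'm, 'k) lin_cat \<Rightarrow>
    (('o, 'm, ('k, 'u) module, 'u \<Rightarrow> 'u) fctr, 'o \<Rightarrow> 'u \<Rightarrow> 'u, 'k) lin_cat" where
  "mod_cat u K C = full_sub (Mod_cat u K C) {X \<in> Ob (Mod_cat u K C). finitely_presented K C X}"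

definition functorially_finite :: "'k ring \<Rightarrow> ('o, 'm, 'k) lin_cat \<Rightarrow> 'o set \<Rightarrow> bool" where
  "functorially_finite K M B \<longleftrightarrow> (\<forall>x\<in>Ob M.
    finitely_generated K (full_sub M B) (yoneda M x) \<and>
    finitely_generated K (op_cat (full_sub M B)) (yoneda (op_cat M) x))"


section \<open>Ideal quotients\<close>

definition ideal_quotient ::
  "('o, 'm, 'k) lin_cat \<Rightarrow> ('o \<Rightarrow> 'o \<Rightarrow> 'm set) \<Rightarrow> ('o, 'm set, 'k) lin_cat" where
  "ideal_quotient C I = \<lparr>Ob = Ob C,
    Hom = (\<lambda>x y. k_space (a_rcosets\<^bsub>Hom C x y\<^esub> (I x y)) (I x y) (set_add (Hom C x y))
      (\<lambda>c p. \<Union>f\<in>p. I x y +>\<^bsub>Hom C x y\<^esub> (c \<odot>\<^bsub>Hom C x y\<^esub> f))),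
    Idm = (\<lambda>x. I x x +>\<^bsub>Hom C x x\<^esub> Idm C x),
    Cmp = (\<lambda>x y z q p. \<Union>g\<in>q. \<Union>f\<in>p. I x z +>\<^bsub>Hom C x z\<^esub> Cmp C x y z g f)\<rparr>"

definition projection ::
  "('o, 'm, 'k) lin_cat \<Rightarrow> ('o \<Rightarrow> 'o \<Rightarrow> 'm set) \<Rightarrow> ('o, 'm, 'o, 'm set) fctr" where
  "projection C I = \<lparr>fob = (\<lambda>x. x), far = (\<lambda>x y f. I x y +>\<^bsub>Hom C x y\<^esub> f)\<rparr>"

definition factoring :: "('o, 'm, 'k) lin_cat \<Rightarrow> 'o set \<Rightarrow> 'o \<Rightarrow> 'o \<Rightarrow> 'm set" where
  "factoring C P x y = {Cmp C x p y v u | p u v.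
    p \<in> P \<and> u \<in> carrier (Hom C x p) \<and> v \<in> carrier (Hom C p y)}"

text \<open>
  The essential image in mod C of the functor from mod C/I given by precomposition with the
  projection C \<rightarrow> C/I.
\<close>

definition inflated_modules :: "'u itself \<Rightarrow> 'k ring \<Rightarrow> ('o, 'm, 'k) lin_cat \<Rightarrow>
    ('o \<Rightarrow> 'o \<Rightarrow> 'm set) \<Rightarrow> ('o, 'm, ('k, 'u) module, 'u \<Rightarrow> 'u) fctr set" where
  "inflated_modules u K C I = {X \<in> Ob (mod_cat u K C).
    \<exists>Y\<in>Ob (mod_cat u K (ideal_quotient C I)).
      isomorphic (mod_cat u K C) X (comp_fctr Y (op_fctr (projection C I)))}"


section \<open>Serre quotients\<close>

definition is_kernel :: "('o, 'm, 'k) lin_cat \<Rightarrow> 'o \<Rightarrow> 'o \<Rightarrow> 'm \<Rightarrow> 'o \<Rightarrow> 'm \<Rightarrow> bool" where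
  "is_kernel C x y f k i \<longleftrightarrow> k \<in> Ob C \<and> i \<in> carrier (Hom C k x) \<and>
    Cmp C k x y f i = \<zero>\<^bsub>Hom C k y\<^esub> \<and>
    (\<forall>z\<in>Ob C. \<forall>g\<in>carrier (Hom C z x). Cmp C z x y f g = \<zero>\<^bsub>Hom C z y\<^esub> \<longrightarrow>
      (\<exists>!h. h \<in> carrier (Hom C z k) \<and> Cmp C z k x i h = g))"

definition is_cokernel :: "('o, 'm, 'k) lin_cat \<Rightarrow> 'o \<Rightarrow> 'o \<Rightarrow> 'm \<Rightarrow> 'o \<Rightarrow> 'm \<Rightarrow> bool" where
  "is_cokernel C x y f c p \<longleftrightarrow> is_kernel (op_cat C) y x f c p"

text \<open>
  The Serre quotient of an abelian category C by a Serre subcategory S, given as a replete class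
  of objects, is the localisation of C at the morphisms with kernel and cokernel in S. These form
  a multiplicative system, and the localisation is constructed by its calculus of right fractions:
  a morphism x \<rightarrow> y is an equivalence class of roofs (z, s, f) with f : z \<rightarrow> y and with s : z \<rightarrow> x
  among the inverted morphisms; it stands for the composite of f with the inverse of s.
\<close>

definition inverted :: "('o, 'm, 'k) lin_cat \<Rightarrow> 'o set \<Rightarrow> 'o \<Rightarrow> 'o \<Rightarrow> 'm set" where
  "inverted C S x y = {s \<in> carrier (Hom C x y).
    (\<exists>k\<in>S. \<exists>i. is_kernel C x y s k i) \<and> (\<exists>c\<in>S. \<exists>p. is_cokernel C x y s c p)}"

definition roofs :: "('o, 'm, 'k) lin_cat \<Rightarrow> 'o set \<Rightarrow> 'o \<Rightarrow> 'o \<Rightarrow> ('o \<times> 'm \<times> 'm) set" where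
  "roofs C S x y = {(z, s, f). z \<in> Ob C \<and> s \<in> inverted C S z x \<and> f \<in> carrier (Hom C z y)}"

definition fraction ::
  "('o, 'm, 'k) lin_cat \<Rightarrow> 'o set \<Rightarrow> 'o \<Rightarrow> 'o \<Rightarrow> 'o \<times> 'm \<times> 'm \<Rightarrow> ('o \<times> 'm \<times> 'm) set" where
  "fraction C S x y = (\<lambda>(z, s, f). {(z', s', f') \<in> roofs C S x y.
    \<exists>w\<in>Ob C. \<exists>u\<in>carrier (Hom C w z). \<exists>u'\<in>carrier (Hom C w z').
      Cmp C w z x s u \<in> inverted C S w x \<and>
      Cmp C w z x s u = Cmp C w z' x s' u' \<and> Cmp C w z y f u = Cmp C w z' y f' u'})"

text \<open>
  The operations on equivalence classes do not depend on the choices of roofs with a common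
  denominator (for sums) and of w, u, v (for composites), so each union below is a single class.
\<close>

definition serre_quotient ::
  "('o, 'm, 'k) lin_cat \<Rightarrow> 'o set \<Rightarrow> ('o, ('o \<times> 'm \<times> 'm) set, 'k) lin_cat" where
  "serre_quotient C S = \<lparr>Ob = Ob C,
    Hom = (\<lambda>x y. k_space (fraction C S x y ` roofs C S x y)
      (fraction C S x y (x, Idm C x, \<zero>\<^bsub>Hom C x y\<^esub>))
      (\<lambda>p q. \<Union>{fraction C S x y (z, s, f \<oplus>\<^bsub>Hom C z y\<^esub> g) | z s f g. (z, s, f) \<in> p \<and> (z, s, g) \<in> q})
      (\<lambda>c p. \<Union>{fraction C S x y (z, s, c \<odot>\<^bsub>Hom C z y\<^esub> f) | z s f. (z, s, f) \<in> p})),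
    Idm = (\<lambda>x. fraction C S x x (x, Idm C x, Idm C x)),
    Cmp = (\<lambda>x y z q p. \<Union>{fraction C S x z (w, Cmp C w a x s u, Cmp C w b z g v) | a s f b t g w u v.
      (a, s, f) \<in> p \<and> (b, t, g) \<in> q \<and> w \<in> Ob C \<and>
      u \<in> inverted C S w a \<and> v \<in> carrier (Hom C w b) \<and> Cmp C w a y f u = Cmp C w b y t v})\<rparr>"

end

theory Submission
  imports Defs
begin

text \<open>
  Let R be a copy of A in B. Evaluation at R is an exact functor from mod B to mod A, and a
  finitely presented B-module vanishes at R exactly when it is inflated from the quotient of B by
  the projectives. Since B has weak pullbacks (approximate a kernel in mod A by B), mod B
  has kernels; cokernels always exist. Hence a morphism of mod B is inverted in the Serre quotient
  exactly when its value at R is bijective. A presentation of an A-module N by free modules,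
  read as a presentation of a B-module, computes a left adjoint L of evaluation whose unit
  N \<open>\<rightarrow>\<close> (L N)(R) is an isomorphism. The counits L(X(R)) \<open>\<rightarrow>\<close> X are therefore inverted, every roof can be
  replaced by one that starts at L(X(R)), and the morphisms X \<open>\<rightarrow>\<close> Y of the Serre quotient are in
  bijection with the A-linear maps X(R) \<open>\<rightarrow>\<close> Y(R).
\<close>

section \<open>Vector spaces and linear maps\<close>

text \<open>Three obstacles shape the proof. A representable B-module takes values in spaces of
  functions on \<open>'u\<close>, whereas modules must have carriers in \<open>'u\<close> itself.
  Finite dimensionality turns linear maps into lists of scalars, and the assumption on such lists
  puts every Hom space, and every quotient of one, back into \<open>'u\<close>; only then do modules
  with a prescribed presentation exist. Another obstacle is that the Serre quotient consists of
  classes of roofs with operations written as unions. The Ore conditions are not verified on their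
  own. Each class is shown to be the set of roofs that represent one morphism of the target
  category, and all operations are computed on these labels. Lifting a morphism out of L(X(R))
  replaces every common denominator and every Ore square. Finally, evaluation sees a single object
  of B. This is enough because a B-module sends a direct sum of copies of R to a product of copies
  of its value at R. If generators and relations of a module sit at such sums, a map out of it is
  determined by its component at R, and every A-linear map at R extends. For this reason L uses
  presentations by free modules.\<close>

context abelian_group
begin

lemma diff_eq_zero_iff:
  assumes "x \<in> carrier G" "y \<in> carrier G"
  shows "x \<ominus> y = \<zero> \<longleftrightarrow> x = y"
proof
  assume *: "x \<ominus> y = \<zero>"
  have "x = (x \<ominus> y) \<oplus> y" using assms by (simp add: a_minus_def a_assoc l_neg)
  then show "x = y" using * assms by simp
qed (use assms in \<open>simp add: a_minus_def r_neg\<close>)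

lemma diff_diff_diff:
  assumes "x \<in> carrier G" "y \<in> carrier G" "z \<in> carrier G"
  shows "(x \<ominus> z) \<ominus> (y \<ominus> z) = x \<ominus> y"
proof -
  have "(x \<ominus> z) \<ominus> (y \<ominus> z) = x \<oplus> ((\<ominus> z \<oplus> z) \<oplus> \<ominus> y)"
    using assms by (simp add: a_minus_def minus_add a_assoc a_comm[of "\<ominus> y" z])
  then show ?thesis using assms by (simp add: a_minus_def l_neg)
qed

lemma diff_diff_cancel:
  assumes "x \<in> carrier G" "y \<in> carrier G"
  shows "x \<ominus> (x \<ominus> y) = y"
proof -
  have "x \<ominus> (x \<ominus> y) = (x \<oplus> \<ominus> x) \<oplus> y"
    using assms by (simp add: a_minus_def minus_add a_assoc)
  then show ?thesis using assms by (simp add: r_neg)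
qed

lemma add_diff_cancel: "\<lbrakk>x \<in> carrier G; y \<in> carrier G\<rbrakk> \<Longrightarrow> y \<oplus> (x \<ominus> y) = x"
  by (simp add: a_minus_def a_lcomm r_neg)

text \<open>Cosets of N are replaced by chosen elements of the old carrier, so that a quotient needs
  no new type. The choice depends only on the coset: membership of x - r in N, as a condition on r,
  does not change when x moves by an element of N.\<close>

lemma coset_representatives:
  assumes N: "N \<subseteq> carrier G" "\<zero> \<in> N" "\<And>x y. \<lbrakk>x \<in> N; y \<in> N\<rbrakk> \<Longrightarrow> x \<ominus> y \<in> N"
  obtains q where "\<And>x. x \<in> carrier G \<Longrightarrow> q x \<in> carrier G"
    "\<And>x y. \<lbrakk>x \<in> carrier G; y \<in> carrier G\<rbrakk> \<Longrightarrow> q x = q y \<longleftrightarrow> x \<ominus> y \<in> N"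
proof -
  define q where "q x = (SOME r. r \<in> carrier G \<and> x \<ominus> r \<in> N)" for x
  have q: "q x \<in> carrier G \<and> x \<ominus> q x \<in> N" if "x \<in> carrier G" for x
    unfolding q_def by (rule someI[of _ x]) (use that N diff_eq_zero_iff[of x x] in simp)
  have "q x = q y" if xy: "x \<in> carrier G" "y \<in> carrier G" "x \<ominus> y \<in> N" for x y
  proof -
    have "x \<ominus> r \<in> N \<longleftrightarrow> y \<ominus> r \<in> N" if r: "r \<in> carrier G" for r
    proof
      assume "x \<ominus> r \<in> N"
      then have "(x \<ominus> r) \<ominus> (x \<ominus> y) \<in> N" using N(3) xy(3) by blast
      moreover have "(x \<ominus> r) \<ominus> (x \<ominus> y) = (x \<ominus> (x \<ominus> y)) \<ominus> r"
        using xy r by (simp add: a_minus_def a_ac)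
      ultimately show "y \<ominus> r \<in> N" using xy r by (simp add: diff_diff_cancel)
    next
      assume "y \<ominus> r \<in> N"
      moreover have "\<zero> \<ominus> (x \<ominus> y) \<in> N" using N(2,3) xy(3) by blast
      ultimately have "(y \<ominus> r) \<ominus> (\<zero> \<ominus> (x \<ominus> y)) \<in> N" using N(3) by blast
      moreover have "(y \<ominus> r) \<ominus> (\<zero> \<ominus> (x \<ominus> y)) = (y \<oplus> (x \<ominus> y)) \<ominus> r"
        using xy r by (simp add: a_minus_def a_ac minus_add)
      ultimately show "x \<ominus> r \<in> N" using xy r by (simp add: add_diff_cancel)
    qed
    then have "(\<lambda>r. r \<in> carrier G \<and> x \<ominus> r \<in> N) = (\<lambda>r. r \<in> carrier G \<and> y \<ominus> r \<in> N)" by blast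
    then show ?thesis by (simp add: q_def)
  qed
  moreover have "x \<ominus> y \<in> N" if "x \<in> carrier G" "y \<in> carrier G" "q x = q y" for x y
  proof -
    have "(x \<ominus> q x) \<ominus> (y \<ominus> q x) \<in> N" using q[OF that(1)] q[OF that(2)] that(3) N(3) by simp
    then show ?thesis using that q by (simp add: diff_diff_diff)
  qed
  ultimately show thesis using that[of q] q by blast
qed

end

text \<open>Linearity without the extensionality that \<open>lin_hom\<close> imposes, so that lambda
  terms and composites can be handled before they are restricted to a carrier. Preservation of zero
  is derived once both sides are known to be modules.\<close>

definition linear_map ::
  "'k ring \<Rightarrow> ('k, 'u, 'r) module_scheme \<Rightarrow> ('k, 'v, 's) module_scheme \<Rightarrow> ('u \<Rightarrow> 'v) \<Rightarrow> bool" where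
  "linear_map K V W f \<longleftrightarrow> f \<in> carrier V \<rightarrow> carrier W \<and>
    (\<forall>v\<in>carrier V. \<forall>w\<in>carrier V. f (v \<oplus>\<^bsub>V\<^esub> w) = f v \<oplus>\<^bsub>W\<^esub> f w) \<and>
    (\<forall>c\<in>carrier K. \<forall>v\<in>carrier V. f (c \<odot>\<^bsub>V\<^esub> v) = c \<odot>\<^bsub>W\<^esub> f v)"

lemma linear_mapI:
  assumes "\<And>v. v \<in> carrier V \<Longrightarrow> f v \<in> carrier W"
    and "\<And>v w. \<lbrakk>v \<in> carrier V; w \<in> carrier V\<rbrakk> \<Longrightarrow> f (v \<oplus>\<^bsub>V\<^esub> w) = f v \<oplus>\<^bsub>W\<^esub> f w"
    and "\<And>c v. \<lbrakk>c \<in> carrier K; v \<in> carrier V\<rbrakk> \<Longrightarrow> f (c \<odot>\<^bsub>V\<^esub> v) = c \<odot>\<^bsub>W\<^esub> f v"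
  shows "linear_map K V W f"
  using assms by (auto simp: linear_map_def)

lemma linear_map_closed: "\<lbrakk>linear_map K V W f; v \<in> carrier V\<rbrakk> \<Longrightarrow> f v \<in> carrier W"
  and linear_map_add: "\<lbrakk>linear_map K V W f; v \<in> carrier V; w \<in> carrier V\<rbrakk>
    \<Longrightarrow> f (v \<oplus>\<^bsub>V\<^esub> w) = f v \<oplus>\<^bsub>W\<^esub> f w"
  and linear_map_smult: "\<lbrakk>linear_map K V W f; c \<in> carrier K; v \<in> carrier V\<rbrakk>
    \<Longrightarrow> f (c \<odot>\<^bsub>V\<^esub> v) = c \<odot>\<^bsub>W\<^esub> f v"
  by (auto simp: linear_map_def)

lemma lin_hom_iff: "f \<in> lin_hom K V W \<longleftrightarrow> linear_map K V W f \<and> f \<in> extensional (carrier V)"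
  by (auto simp: lin_hom_def linear_map_def PiE_def)

lemma linear_map_cong:
  assumes "\<And>v. v \<in> carrier V \<Longrightarrow> f v = g v" "module K V"
  shows "linear_map K V W f \<longleftrightarrow> linear_map K V W g"
proof -
  interpret V: module K V by fact
  show ?thesis by (auto simp: linear_map_def Pi_def assms(1))
qed

lemma linear_map_restrict:
  assumes "linear_map K V W f" "module K V"
  shows "restrict f (carrier V) \<in> lin_hom K V W"
  using assms linear_map_cong[of V "restrict f (carrier V)" f K W] by (simp add: lin_hom_iff)

lemma linear_map_zero:
  assumes "linear_map K V W f" "module K V" "module K W"
  shows "f \<zero>\<^bsub>V\<^esub> = \<zero>\<^bsub>W\<^esub>"
proof -
  interpret V: module K V by fact
  interpret W: module K W by fact
  have "f (\<zero>\<^bsub>K\<^esub> \<odot>\<^bsub>V\<^esub> \<zero>\<^bsub>V\<^esub>) = \<zero>\<^bsub>K\<^esub> \<odot>\<^bsub>W\<^esub> f \<zero>\<^bsub>V\<^esub>"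
    by (rule linear_map_smult[OF assms(1)]) auto
  then show ?thesis using linear_map_closed[OF assms(1)] by simp
qed

lemma linear_map_minus:
  assumes "linear_map K V W f" "module K V" "module K W" "v \<in> carrier V" "w \<in> carrier V"
  shows "f (v \<ominus>\<^bsub>V\<^esub> w) = f v \<ominus>\<^bsub>W\<^esub> f w"
proof -
  interpret V: module K V by fact
  interpret W: module K W by fact
  have *: "\<ominus>\<^bsub>V\<^esub> w = (\<ominus>\<^bsub>K\<^esub> \<one>\<^bsub>K\<^esub>) \<odot>\<^bsub>V\<^esub> w" "\<ominus>\<^bsub>W\<^esub> f w = (\<ominus>\<^bsub>K\<^esub> \<one>\<^bsub>K\<^esub>) \<odot>\<^bsub>W\<^esub> f w"
    using assms linear_map_closed[OF assms(1)] by (simp_all add: V.smult_l_minus W.smult_l_minus)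
  show ?thesis unfolding a_minus_def * using assms
    by (simp add: linear_map_add linear_map_smult)
qed

lemma linear_map_finsum:
  assumes "linear_map K V W f" "module K V" "module K W" "finite S" "g \<in> S \<rightarrow> carrier V"
  shows "f (\<Oplus>\<^bsub>V\<^esub>i\<in>S. g i) = (\<Oplus>\<^bsub>W\<^esub>i\<in>S. f (g i))"
proof -
  interpret V: module K V by fact
  interpret W: module K W by fact
  have "g \<in> S \<rightarrow> carrier V \<longrightarrow> f (\<Oplus>\<^bsub>V\<^esub>i\<in>S. g i) = (\<Oplus>\<^bsub>W\<^esub>i\<in>S. f (g i))"
    using assms(4)
  proof (induction S)
    case empty
    then show ?case using linear_map_zero[OF assms(1-3)] by simp
  next
    case (insert i S)
    show ?case
    proof
      assume g: "g \<in> insert i S \<rightarrow> carrier V"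
      then have "(\<lambda>i. f (g i)) \<in> S \<rightarrow> carrier W" "f (g i) \<in> carrier W"
        using linear_map_closed[OF assms(1)] by auto
      with g insert show "f (\<Oplus>\<^bsub>V\<^esub>i\<in>insert i S. g i) = (\<Oplus>\<^bsub>W\<^esub>i\<in>insert i S. f (g i))"
        by (auto simp: linear_map_add[OF assms(1)] Pi_def)
    qed
  qed
  with assms(5) show ?thesis by blast
qed

lemma linear_map_compose:
  assumes "linear_map K U V f" "linear_map K V W g"
  shows "linear_map K U W (\<lambda>u. g (f u))"
  using assms by (auto simp: linear_map_def Pi_def)

lemma linear_map_iff_lin_hom:
  "f \<in> lin_hom K V W \<Longrightarrow> linear_map K V W f"
  by (simp add: lin_hom_iff)

text \<open>The module axioms are equations, so they may be tested after the jointly injective maps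
  \<open>j i\<close>; for M itself only closure has to be known. The additive inverse of v is taken
  to be (-1)v. The maps \<open>j i\<close> can be evaluations at points, the components of a natural
  transformation, or a single inclusion of a subset.\<close>

lemma module_jointly_embedded:
  assumes K: "cring K" and V: "\<And>i. i \<in> I \<Longrightarrow> module K (V i)"
    and lin: "\<And>i. i \<in> I \<Longrightarrow> linear_map K M (V i) (j i)"
    and j_zero: "\<And>i. i \<in> I \<Longrightarrow> j i \<zero>\<^bsub>M\<^esub> = \<zero>\<^bsub>V i\<^esub>"
    and zero: "\<zero>\<^bsub>M\<^esub> \<in> carrier M"
    and add: "\<And>v w. \<lbrakk>v \<in> carrier M; w \<in> carrier M\<rbrakk> \<Longrightarrow> v \<oplus>\<^bsub>M\<^esub> w \<in> carrier M"
    and smult: "\<And>c v. \<lbrakk>c \<in> carrier K; v \<in> carrier M\<rbrakk> \<Longrightarrow> c \<odot>\<^bsub>M\<^esub> v \<in> carrier M"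
    and inj: "\<And>v w. \<lbrakk>v \<in> carrier M; w \<in> carrier M; \<And>i. i \<in> I \<Longrightarrow> j i v = j i w\<rbrakk> \<Longrightarrow> v = w"
  shows "module K M"
proof (rule moduleI)
  interpret K: cring K by fact
  have closed [simp]: "j i v \<in> carrier (V i)" if "i \<in> I" "v \<in> carrier M" for i v
    using linear_map_closed[OF lin] that by blast
  have [simp]: "j i (v \<oplus>\<^bsub>M\<^esub> w) = j i v \<oplus>\<^bsub>V i\<^esub> j i w"
    if "i \<in> I" "v \<in> carrier M" "w \<in> carrier M" for i v w
    using linear_map_add[OF lin] that by blast
  have [simp]: "j i (c \<odot>\<^bsub>M\<^esub> v) = c \<odot>\<^bsub>V i\<^esub> j i v" if "i \<in> I" "c \<in> carrier K" "v \<in> carrier M" for i c v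
    using linear_map_smult[OF lin] that by blast
  have ag: "abelian_group (V i)" "abelian_monoid (V i)" if "i \<in> I" for i
    using V[OF that] by (simp_all add: module_def abelian_group.axioms(1))
  note [simp] = j_zero zero add smult
  show "abelian_group M"
  proof (rule abelian_groupI)
    fix u v w assume uvw: "u \<in> carrier M" "v \<in> carrier M" "w \<in> carrier M"
    show "u \<oplus>\<^bsub>M\<^esub> v \<oplus>\<^bsub>M\<^esub> w = u \<oplus>\<^bsub>M\<^esub> (v \<oplus>\<^bsub>M\<^esub> w)"
      by (rule inj) (use uvw ag in \<open>auto simp: abelian_monoid.a_assoc\<close>)
  next
    fix v w assume vw: "v \<in> carrier M" "w \<in> carrier M"
    show "v \<oplus>\<^bsub>M\<^esub> w = w \<oplus>\<^bsub>M\<^esub> v"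
      by (rule inj) (use vw ag in \<open>auto simp: abelian_monoid.a_comm\<close>)
  next
    fix v assume v: "v \<in> carrier M"
    show "\<zero>\<^bsub>M\<^esub> \<oplus>\<^bsub>M\<^esub> v = v"
      by (rule inj) (use v ag in \<open>auto simp: abelian_monoid.l_zero\<close>)
    have "(\<ominus>\<^bsub>K\<^esub> \<one>\<^bsub>K\<^esub>) \<odot>\<^bsub>M\<^esub> v \<oplus>\<^bsub>M\<^esub> v = \<zero>\<^bsub>M\<^esub>"
    proof (rule inj)
      fix i assume i: "i \<in> I"
      interpret V: module K "V i" by (rule V[OF i])
      show "j i ((\<ominus>\<^bsub>K\<^esub> \<one>\<^bsub>K\<^esub>) \<odot>\<^bsub>M\<^esub> v \<oplus>\<^bsub>M\<^esub> v) = j i \<zero>\<^bsub>M\<^esub>"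
        using i v by (simp add: V.smult_l_minus V.M.l_neg)
    qed (use v in auto)
    then show "\<exists>w\<in>carrier M. w \<oplus>\<^bsub>M\<^esub> v = \<zero>\<^bsub>M\<^esub>" using v by auto
  qed auto
next
  interpret K: cring K by fact
  have closed [simp]: "j i v \<in> carrier (V i)" if "i \<in> I" "v \<in> carrier M" for i v
    using linear_map_closed[OF lin] that by blast
  have [simp]: "j i (v \<oplus>\<^bsub>M\<^esub> w) = j i v \<oplus>\<^bsub>V i\<^esub> j i w"
    if "i \<in> I" "v \<in> carrier M" "w \<in> carrier M" for i v w
    using linear_map_add[OF lin] that by blast
  have [simp]: "j i (c \<odot>\<^bsub>M\<^esub> v) = c \<odot>\<^bsub>V i\<^esub> j i v" if "i \<in> I" "c \<in> carrier K" "v \<in> carrier M" for i c v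
    using linear_map_smult[OF lin] that by blast
  have dist: "a \<odot>\<^bsub>V i\<^esub> (x \<oplus>\<^bsub>V i\<^esub> y) = a \<odot>\<^bsub>V i\<^esub> x \<oplus>\<^bsub>V i\<^esub> a \<odot>\<^bsub>V i\<^esub> y"
    if "i \<in> I" "a \<in> carrier K" "x \<in> carrier (V i)" "y \<in> carrier (V i)" for i a x y
    using module.smult_r_distr[OF V] that by blast
  note [simp] = j_zero zero add smult
  fix a b v w assume h: "a \<in> carrier K" "b \<in> carrier K" "v \<in> carrier M" "w \<in> carrier M"
  show "(a \<oplus>\<^bsub>K\<^esub> b) \<odot>\<^bsub>M\<^esub> v = a \<odot>\<^bsub>M\<^esub> v \<oplus>\<^bsub>M\<^esub> b \<odot>\<^bsub>M\<^esub> v"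
    by (rule inj) (use h V in \<open>auto simp: module.smult_l_distr\<close>)
  show "a \<odot>\<^bsub>M\<^esub> (v \<oplus>\<^bsub>M\<^esub> w) = a \<odot>\<^bsub>M\<^esub> v \<oplus>\<^bsub>M\<^esub> a \<odot>\<^bsub>M\<^esub> w"
    by (rule inj) (use h in \<open>auto simp: dist\<close>)
  show "a \<otimes>\<^bsub>K\<^esub> b \<odot>\<^bsub>M\<^esub> v = a \<odot>\<^bsub>M\<^esub> (b \<odot>\<^bsub>M\<^esub> v)"
    by (rule inj) (use h V in \<open>auto simp: module.smult_assoc1\<close>)
next
  interpret K: cring K by fact
  fix v assume v: "v \<in> carrier M"
  show "\<one>\<^bsub>K\<^esub> \<odot>\<^bsub>M\<^esub> v = v"
    by (rule inj)
      (use v smult V linear_map_closed[OF lin] linear_map_smult[OF lin] in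
        \<open>auto simp: module.smult_one\<close>)
qed (use K smult in auto)

text \<open>The counterpart for quotients: M is a priori a mere record, and the axioms descend to it
  along a surjection from a known module that respects the operations.\<close>

lemma module_image:
  assumes V: "module K V" and lin: "linear_map K V M q"
    and surj: "q ` carrier V = carrier M" and q_zero: "q \<zero>\<^bsub>V\<^esub> = \<zero>\<^bsub>M\<^esub>"
  shows "module K M"
proof (rule moduleI)
  interpret V: module K V by fact
  note add = linear_map_add[OF lin, symmetric] and smult = linear_map_smult[OF lin, symmetric]
  have ex: "\<exists>v\<in>carrier V. m = q v" if "m \<in> carrier M" for m using that surj by blast
  have cl [simp]: "q v \<in> carrier M" if "v \<in> carrier V" for v using that surj by blast
  show "abelian_group M"
  proof (rule abelian_groupI)
    fix x y assume "x \<in> carrier M" "y \<in> carrier M"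
    then obtain u v where uv: "u \<in> carrier V" "v \<in> carrier V" "x = q u" "y = q v"
      by (meson ex)
    then show "x \<oplus>\<^bsub>M\<^esub> y \<in> carrier M" by (simp add: add)
    from uv show "x \<oplus>\<^bsub>M\<^esub> y = y \<oplus>\<^bsub>M\<^esub> x" by (simp add: add V.M.a_comm)
    fix z assume "z \<in> carrier M"
    then obtain w where w: "w \<in> carrier V" "z = q w" by (meson ex)
    with uv show "x \<oplus>\<^bsub>M\<^esub> y \<oplus>\<^bsub>M\<^esub> z = x \<oplus>\<^bsub>M\<^esub> (y \<oplus>\<^bsub>M\<^esub> z)" by (simp add: add V.M.a_assoc)
  next
    show "\<zero>\<^bsub>M\<^esub> \<in> carrier M" using q_zero cl[of "\<zero>\<^bsub>V\<^esub>"] by simp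
  next
    fix x assume "x \<in> carrier M"
    then obtain u where u: "u \<in> carrier V" "x = q u" by (meson ex)
    then show "\<zero>\<^bsub>M\<^esub> \<oplus>\<^bsub>M\<^esub> x = x" by (simp add: add flip: q_zero)
    have "q (\<ominus>\<^bsub>V\<^esub> u) \<oplus>\<^bsub>M\<^esub> x = \<zero>\<^bsub>M\<^esub>" using u by (simp add: add V.M.l_neg q_zero)
    then show "\<exists>y\<in>carrier M. y \<oplus>\<^bsub>M\<^esub> x = \<zero>\<^bsub>M\<^esub>" using u by auto
  qed
  fix x y assume "x \<in> carrier M" "y \<in> carrier M"
  then obtain u v where uv: "u \<in> carrier V" "v \<in> carrier V" "x = q u" "y = q v" by (meson ex)
  show "\<one>\<^bsub>K\<^esub> \<odot>\<^bsub>M\<^esub> x = x" using uv by (simp add: smult)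
  fix a b assume ab: "a \<in> carrier K" "b \<in> carrier K"
  show "a \<odot>\<^bsub>M\<^esub> x \<in> carrier M" using uv ab by (simp add: smult)
  show "(a \<oplus>\<^bsub>K\<^esub> b) \<odot>\<^bsub>M\<^esub> x = a \<odot>\<^bsub>M\<^esub> x \<oplus>\<^bsub>M\<^esub> b \<odot>\<^bsub>M\<^esub> x"
    using uv ab by (simp add: smult add V.smult_l_distr)
  show "a \<odot>\<^bsub>M\<^esub> (x \<oplus>\<^bsub>M\<^esub> y) = a \<odot>\<^bsub>M\<^esub> x \<oplus>\<^bsub>M\<^esub> a \<odot>\<^bsub>M\<^esub> y"
    using uv ab by (simp add: smult add V.smult_r_distr)
  show "a \<otimes>\<^bsub>K\<^esub> b \<odot>\<^bsub>M\<^esub> x = a \<odot>\<^bsub>M\<^esub> (b \<odot>\<^bsub>M\<^esub> x)"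
    using uv ab by (simp add: smult V.smult_assoc1)
qed (use V in \<open>auto simp: module_def\<close>)

text \<open>Both maps have the same kernel. One inclusion of kernels makes the factorisation through
  the surjection well defined, the other makes it injective.\<close>

lemma linear_factor:
  assumes U: "module K U" and V: "module K V" and W: "module K W"
    and \<phi>: "linear_map K U V \<phi>" "\<phi> ` carrier U = carrier V" and \<psi>: "linear_map K U W \<psi>"
    and ker: "\<And>x. x \<in> carrier U \<Longrightarrow> \<phi> x = \<zero>\<^bsub>V\<^esub> \<longleftrightarrow> \<psi> x = \<zero>\<^bsub>W\<^esub>"
  obtains \<theta> where "\<theta> \<in> lin_hom K V W" "inj_on \<theta> (carrier V)" "\<forall>x\<in>carrier U. \<theta> (\<phi> x) = \<psi> x"
proof -
  interpret U: module K U by fact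
  interpret V: module K V by fact
  interpret W: module K W by fact
  have eq: "\<phi> x = \<phi> y \<longleftrightarrow> \<psi> x = \<psi> y" if xy: "x \<in> carrier U" "y \<in> carrier U" for x y
  proof -
    have "\<phi> x = \<phi> y \<longleftrightarrow> \<phi> (x \<ominus>\<^bsub>U\<^esub> y) = \<zero>\<^bsub>V\<^esub>"
      using linear_map_minus[OF \<phi>(1) U V xy] V.M.diff_eq_zero_iff linear_map_closed[OF \<phi>(1)] xy by simp
    also have "\<dots> \<longleftrightarrow> \<psi> (x \<ominus>\<^bsub>U\<^esub> y) = \<zero>\<^bsub>W\<^esub>" using ker xy by simp
    also have "\<dots> \<longleftrightarrow> \<psi> x = \<psi> y"
      using linear_map_minus[OF \<psi> U W xy] W.M.diff_eq_zero_iff linear_map_closed[OF \<psi>] xy by simp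
    finally show ?thesis .
  qed
  define \<theta> where "\<theta> = (\<lambda>v\<in>carrier V. \<psi> (inv_into (carrier U) \<phi> v))"
  have \<theta>: "\<theta> (\<phi> x) = \<psi> x" if x: "x \<in> carrier U" for x
  proof -
    have "\<phi> x \<in> \<phi> ` carrier U" using x by blast
    then have "inv_into (carrier U) \<phi> (\<phi> x) \<in> carrier U" "\<phi> (inv_into (carrier U) \<phi> (\<phi> x)) = \<phi> x"
      by (simp_all add: inv_into_into f_inv_into_f)
    then show ?thesis using eq x linear_map_closed[OF \<phi>(1) x] by (simp add: \<theta>_def)
  qed
  have ex: "\<exists>x\<in>carrier U. v = \<phi> x" if "v \<in> carrier V" for v
  proof -
    have "v \<in> \<phi> ` carrier U" using that \<phi>(2) by simp
    then show ?thesis by blast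
  qed
  have "linear_map K V W \<theta>"
  proof (rule linear_mapI)
    fix v w c assume "v \<in> carrier V"
    then obtain x where x: "x \<in> carrier U" "v = \<phi> x" using ex by blast
    show "\<theta> v \<in> carrier W" using x \<theta> linear_map_closed[OF \<psi>] by simp
    show "\<theta> (c \<odot>\<^bsub>V\<^esub> v) = c \<odot>\<^bsub>W\<^esub> \<theta> v" if "c \<in> carrier K"
      using x that \<theta> linear_map_smult[OF \<phi>(1) that x(1), symmetric] linear_map_smult[OF \<psi> that x(1)]
        by simp
    assume "w \<in> carrier V"
    then obtain y where y: "y \<in> carrier U" "w = \<phi> y" using ex by blast
    show "\<theta> (v \<oplus>\<^bsub>V\<^esub> w) = \<theta> v \<oplus>\<^bsub>W\<^esub> \<theta> w"
      using x y \<theta> linear_map_add[OF \<phi>(1) x(1) y(1), symmetric] linear_map_add[OF \<psi> x(1) y(1)] by simp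
  qed
  then have 1: "\<theta> \<in> lin_hom K V W" by (simp add: lin_hom_iff \<theta>_def)
  have 2: "inj_on \<theta> (carrier V)"
  proof (rule inj_onI)
    fix v w assume v: "v \<in> carrier V" and w: "w \<in> carrier V" and "\<theta> v = \<theta> w"
    obtain x where x: "x \<in> carrier U" "v = \<phi> x" using ex[OF v] by blast
    obtain y where y: "y \<in> carrier U" "w = \<phi> y" using ex[OF w] by blast
    show "v = w" using x y \<theta> eq \<open>\<theta> v = \<theta> w\<close> by simp
  qed
  show thesis by (rule that[OF 1 2]) (use \<theta> in blast)
qed

section \<open>Spaces of linear maps and the categories that they form\<close>

lemma k_space_simps [simp]:
  "carrier (k_space V z p s) = V" "\<zero>\<^bsub>k_space V z p s\<^esub> = z"
  "v \<oplus>\<^bsub>k_space V z p s\<^esub> w = p v w" "c \<odot>\<^bsub>k_space V z p s\<^esub> v = s c v"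
  by (simp_all add: k_space_def)

lemma map_space_simps [simp]:
  "carrier (map_space V W H) = H" "\<zero>\<^bsub>map_space V W H\<^esub> = (\<lambda>v\<in>carrier V. \<zero>\<^bsub>W\<^esub>)"
  "f \<oplus>\<^bsub>map_space V W H\<^esub> g = (\<lambda>v\<in>carrier V. f v \<oplus>\<^bsub>W\<^esub> g v)"
  "c \<odot>\<^bsub>map_space V W H\<^esub> f = (\<lambda>v\<in>carrier V. c \<odot>\<^bsub>W\<^esub> f v)"
  by (simp_all add: map_space_def)

text \<open>Evaluations at the points of V embed H jointly into W.\<close>

lemma module_map_space:
  fixes K :: "'k ring"
  assumes K: "cring K" and W: "module K W" and H: "H \<subseteq> carrier V \<rightarrow>\<^sub>E carrier W"
    and "(\<lambda>v\<in>carrier V. \<zero>\<^bsub>W\<^esub>) \<in> H"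
    and "\<And>f g. \<lbrakk>f \<in> H; g \<in> H\<rbrakk> \<Longrightarrow> (\<lambda>v\<in>carrier V. f v \<oplus>\<^bsub>W\<^esub> g v) \<in> H"
    and "\<And>c f. \<lbrakk>c \<in> carrier K; f \<in> H\<rbrakk> \<Longrightarrow> (\<lambda>v\<in>carrier V. c \<odot>\<^bsub>W\<^esub> f v) \<in> H"
  shows "module K (map_space V W H)"
proof (rule module_jointly_embedded[where I = "carrier V" and V = "\<lambda>_. W" and j = "\<lambda>v f. f v"])
  fix f g assume "f \<in> carrier (map_space V W H)" "g \<in> carrier (map_space V W H)"
    and "\<And>v. v \<in> carrier V \<Longrightarrow> f v = g v"
  then show "f = g" using H PiE_ext[of f "carrier V" "\<lambda>_. carrier W" g] by auto
qed (use assms in \<open>auto simp: linear_map_def\<close>)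

lemma lin_hom_zero:
  assumes "module K V" "module K W"
  shows "(\<lambda>v\<in>carrier V. \<zero>\<^bsub>W\<^esub>) \<in> lin_hom K V W"
proof -
  interpret V: module K V by fact
  interpret W: module K W by fact
  show ?thesis by (auto simp: lin_hom_def)
qed

lemma lin_hom_add:
  assumes "module K V" "module K W" "f \<in> lin_hom K V W" "g \<in> lin_hom K V W"
  shows "(\<lambda>v\<in>carrier V. f v \<oplus>\<^bsub>W\<^esub> g v) \<in> lin_hom K V W"
proof -
  interpret V: module K V by fact
  interpret W: module K W by fact
  show ?thesis using assms(3,4)
    by (auto simp: lin_hom_iff linear_map_def W.M.a_ac W.smult_r_distr Pi_def)
qed

lemma lin_hom_smult:
  assumes "module K V" "module K W" "c \<in> carrier K" "f \<in> lin_hom K V W"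
  shows "(\<lambda>v\<in>carrier V. c \<odot>\<^bsub>W\<^esub> f v) \<in> lin_hom K V W"
proof -
  interpret V: module K V by fact
  interpret W: module K W by fact
  have "c \<odot>\<^bsub>W\<^esub> (d \<odot>\<^bsub>W\<^esub> f v) = d \<odot>\<^bsub>W\<^esub> (c \<odot>\<^bsub>W\<^esub> f v)" if "d \<in> carrier K" "v \<in> carrier V" for d v
    using that assms(3,4)
    by (metis V.R.m_comm W.smult_assoc1 linear_map_closed linear_map_iff_lin_hom)
  then show ?thesis using assms(3,4)
    by (auto simp: lin_hom_iff linear_map_def W.smult_r_distr Pi_def)
qed

lemma lin_hom_compose:
  assumes "module K U" "f \<in> lin_hom K U V" "g \<in> lin_hom K V W"
  shows "compose (carrier U) g f \<in> lin_hom K U W"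
  using linear_map_restrict[OF linear_map_compose[of K U V f W g] assms(1)] assms(2,3)
  by (simp add: lin_hom_iff compose_def)

lemma lin_hom_id: "module K V \<Longrightarrow> (\<lambda>v\<in>carrier V. v) \<in> lin_hom K V V"
  by (rule linear_map_restrict) (auto simp: linear_map_def)

text \<open>Common ground of vector spaces and of modules over an algebra: morphisms are extensional
  linear maps from a class closed under all operations. Module schemes are used because right
  modules extend the record of spaces.\<close>

lemma linear_category_maps:
  fixes H :: "('k, 'u, 'r) module_scheme \<Rightarrow> ('k, 'u, 'r) module_scheme \<Rightarrow> ('u \<Rightarrow> 'u) set"
  assumes C: "C = \<lparr>Ob = Obs, Hom = (\<lambda>V W. map_space V W (H V W)),
      Idm = (\<lambda>V. \<lambda>v\<in>carrier V. v), Cmp = (\<lambda>U V W g f. compose (carrier U) g f)\<rparr>"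
    and Obs: "\<And>V. V \<in> Obs \<Longrightarrow> module K V"
    and H: "\<And>V W. \<lbrakk>V \<in> Obs; W \<in> Obs\<rbrakk> \<Longrightarrow> H V W \<subseteq> lin_hom K V W"
    and zero: "\<And>V W. \<lbrakk>V \<in> Obs; W \<in> Obs\<rbrakk> \<Longrightarrow> (\<lambda>v\<in>carrier V. \<zero>\<^bsub>W\<^esub>) \<in> H V W"
    and add: "\<And>V W f g. \<lbrakk>V \<in> Obs; W \<in> Obs; f \<in> H V W; g \<in> H V W\<rbrakk>
      \<Longrightarrow> (\<lambda>v\<in>carrier V. f v \<oplus>\<^bsub>W\<^esub> g v) \<in> H V W"
    and smult: "\<And>V W c f. \<lbrakk>V \<in> Obs; W \<in> Obs; c \<in> carrier K; f \<in> H V W\<rbrakk>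
      \<Longrightarrow> (\<lambda>v\<in>carrier V. c \<odot>\<^bsub>W\<^esub> f v) \<in> H V W"
    and id: "\<And>V. V \<in> Obs \<Longrightarrow> (\<lambda>v\<in>carrier V. v) \<in> H V V"
    and comp: "\<And>U V W f g. \<lbrakk>U \<in> Obs; V \<in> Obs; W \<in> Obs; f \<in> H U V; g \<in> H V W\<rbrakk>
      \<Longrightarrow> compose (carrier U) g f \<in> H U W"
  shows "linear_category K C"
proof (rule linear_category.intro)
  have cl: "f v \<in> carrier W" if "V \<in> Obs" "W \<in> Obs" "f \<in> H V W" "v \<in> carrier V" for V W f v
    using H[OF that(1,2)] that(3,4) by (auto simp: lin_hom_def)
  have ext: "f \<in> extensional (carrier V)" if "V \<in> Obs" "W \<in> Obs" "f \<in> H V W" for V W f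
    using H[OF that(1,2)] that(3) by (auto simp: lin_hom_iff)
  have lin: "linear_map K V W f" if "V \<in> Obs" "W \<in> Obs" "f \<in> H V W" for V W f
    using H[OF that(1,2)] that(3) by (auto simp: lin_hom_iff)
  show "module K (Hom C x y)" if "x \<in> Ob C" "y \<in> Ob C" for x y
  proof -
    have "x \<in> Obs" "y \<in> Obs" using that by (auto simp: C)
    moreover from this have "cring K" "H x y \<subseteq> carrier x \<rightarrow>\<^sub>E carrier y"
      using Obs H[of x y] by (auto simp: module_def lin_hom_def)
    ultimately show ?thesis
      by (simp add: C) (rule module_map_space, simp_all add: Obs zero add smult)
  qed
  show "Cmp C x x y f (Idm C x) = f"
    if "x \<in> Ob C" "y \<in> Ob C" "f \<in> carrier (Hom C x y)" for x y f
    by (rule extensionalityI[where A = "carrier x"])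
      (use that ext[of x y f] in \<open>simp_all add: C compose_def\<close>)
  show "Cmp C x y y (Idm C y) f = f"
    if "x \<in> Ob C" "y \<in> Ob C" "f \<in> carrier (Hom C x y)" for x y f
    by (rule extensionalityI[where A = "carrier x"])
      (use that ext[of x y f] cl[of x y f] in \<open>simp_all add: C compose_def\<close>)
  show "Cmp C w y z h (Cmp C w x y g f) = Cmp C w x z (Cmp C x y z h g) f"
    if "w \<in> Ob C" "x \<in> Ob C" "y \<in> Ob C" "z \<in> Ob C" "f \<in> carrier (Hom C w x)"
      "g \<in> carrier (Hom C x y)" "h \<in> carrier (Hom C y z)" for w x y z f g h
    using that by (auto simp: C compose_def cl intro!: restrict_ext)
  fix x y z f g
  assume "x \<in> Ob C" "y \<in> Ob C" "z \<in> Ob C" "f \<in> carrier (Hom C x y)"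
    "g \<in> carrier (Hom C y z)"
  then have O: "x \<in> Obs" "y \<in> Obs" "z \<in> Obs" "f \<in> H x y" "g \<in> H y z" by (auto simp: C)
  note g_lin = lin[of y z g]
  {
    fix f' assume "f' \<in> carrier (Hom C x y)"
    then show "Cmp C x y z g (f \<oplus>\<^bsub>Hom C x y\<^esub> f') = Cmp C x y z g f \<oplus>\<^bsub>Hom C x z\<^esub> Cmp C x y z g f'"
      using O by (auto simp: C compose_def cl linear_map_add[OF g_lin] intro!: restrict_ext)
  }
  {
    fix g' assume "g' \<in> carrier (Hom C y z)"
    then show "Cmp C x y z (g \<oplus>\<^bsub>Hom C y z\<^esub> g') f = Cmp C x y z g f \<oplus>\<^bsub>Hom C x z\<^esub> Cmp C x y z g' f"
      using O by (auto simp: C compose_def cl intro!: restrict_ext)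
  }
  fix c assume "c \<in> carrier K"
  then show "Cmp C x y z g (c \<odot>\<^bsub>Hom C x y\<^esub> f) = c \<odot>\<^bsub>Hom C x z\<^esub> Cmp C x y z g f"
    and "Cmp C x y z (c \<odot>\<^bsub>Hom C y z\<^esub> g) f = c \<odot>\<^bsub>Hom C x z\<^esub> Cmp C x y z g f"
    using O by (auto simp: C compose_def cl linear_map_smult[OF g_lin] intro!: restrict_ext)
qed (use id comp in \<open>auto simp: C\<close>)

lemma linear_category_vect: "linear_category K (vect TYPE('u) K)"
  by (rule linear_category_maps[OF vect_def[of "TYPE('u)" K]])
    (simp_all add: lin_hom_zero lin_hom_add lin_hom_smult lin_hom_id lin_hom_compose)

lemma right_mod_linear: 
  assumes "right_mod K A M" "a \<in> carrier A"
  shows "linear_map K M M (\<lambda>m. ract M m a)"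
  using assms by (auto intro!: linear_mapI simp: right_mod.ract_closed right_mod.ract_add_left
    right_mod.ract_smult_left)

lemma linear_category_mod_alg:
  fixes K :: "'k ring" and A :: "('k, 'a) module"
  shows "linear_category K (mod_alg TYPE('u) K A)"
proof (rule linear_category_maps[OF mod_alg_def[of "TYPE('u)" K A]])
  fix L M N :: "('k, 'u, 'a) right_module" and f g c
  assume L: "L \<in> {M. right_mod K A M \<and> fin_dim K M}" and M: "M \<in> {M. right_mod K A M \<and> fin_dim K M}"
    and N: "N \<in> {M. right_mod K A M \<and> fin_dim K M}"
  then interpret L: right_mod K A L by simp
  interpret M: right_mod K A M using M by simp
  interpret N: right_mod K A N using N by simp
  interpret LL: module K L by (rule L.vector_space)
  interpret MM: module K M by (rule M.vector_space)
  interpret NN: module K N by (rule N.vector_space)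
  show "module K M" by (rule M.vector_space)
  show "right_hom K A M N \<subseteq> lin_hom K M N" by (auto simp: right_hom_def)
  show "(\<lambda>v\<in>carrier M. \<zero>\<^bsub>N\<^esub>) \<in> right_hom K A M N"
    using linear_map_zero[OF right_mod_linear[OF N.right_mod_axioms]]
    by (auto simp: right_hom_def lin_hom_zero M.vector_space N.vector_space M.ract_closed)
  show "(\<lambda>v\<in>carrier M. v) \<in> right_hom K A M M"
    by (auto simp: right_hom_def lin_hom_id M.vector_space M.ract_closed)
  show "(\<lambda>v\<in>carrier M. f v \<oplus>\<^bsub>N\<^esub> g v) \<in> right_hom K A M N"
    if "f \<in> right_hom K A M N" "g \<in> right_hom K A M N"
    using that lin_hom_add[OF M.vector_space N.vector_space, of f g]
    by (auto simp: right_hom_def M.ract_closed N.ract_add_left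
      linear_map_closed[OF linear_map_iff_lin_hom])
  show "(\<lambda>v\<in>carrier M. c \<odot>\<^bsub>N\<^esub> f v) \<in> right_hom K A M N"
    if "f \<in> right_hom K A M N" "c \<in> carrier K"
    using that lin_hom_smult[OF M.vector_space N.vector_space, of c f]
    by (auto simp: right_hom_def M.ract_closed N.ract_smult_left
      linear_map_closed[OF linear_map_iff_lin_hom])
  show "compose (carrier L) g f \<in> right_hom K A L N"
    if "f \<in> right_hom K A L M" "g \<in> right_hom K A M N"
    using that lin_hom_compose[OF L.vector_space, of f M g N]
    by (auto simp: right_hom_def lin_hom_iff linear_map_closed compose_def L.ract_closed)
qed

text \<open>Each axiom for C is the image of the same axiom for D, since the maps
  \<open>q x y\<close> are onto and respect all operations. It serves for ideal quotients, where q
  sends a morphism to its coset, and for Serre quotients, where q sends a morphism of the target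
  category to the class of roofs that it labels. In the second case \<open>Fo\<close> is the functor
  on objects and not the identity.\<close>

lemma linear_category_image:
  assumes D: "linear_category K D" and Fo: "\<And>x. x \<in> Ob C \<Longrightarrow> Fo x \<in> Ob D"
    and lin: "\<And>x y. \<lbrakk>x \<in> Ob C; y \<in> Ob C\<rbrakk> \<Longrightarrow> linear_map K (Hom D (Fo x) (Fo y)) (Hom C x y) (q x y)"
    and surj: "\<And>x y. \<lbrakk>x \<in> Ob C; y \<in> Ob C\<rbrakk>
      \<Longrightarrow> q x y ` carrier (Hom D (Fo x) (Fo y)) = carrier (Hom C x y)"
    and zero: "\<And>x y. \<lbrakk>x \<in> Ob C; y \<in> Ob C\<rbrakk>
      \<Longrightarrow> q x y \<zero>\<^bsub>Hom D (Fo x) (Fo y)\<^esub> = \<zero>\<^bsub>Hom C x y\<^esub>"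
    and idm: "\<And>x. x \<in> Ob C \<Longrightarrow> q x x (Idm D (Fo x)) = Idm C x"
    and cmp: "\<And>x y z f g. \<lbrakk>x \<in> Ob C; y \<in> Ob C; z \<in> Ob C; f \<in> carrier (Hom D (Fo x) (Fo y));
        g \<in> carrier (Hom D (Fo y) (Fo z))\<rbrakk>
      \<Longrightarrow> q x z (Cmp D (Fo x) (Fo y) (Fo z) g f) = Cmp C x y z (q y z g) (q x y f)"
  shows "linear_category K C"
proof (rule linear_category.intro)
  interpret D: linear_category K D by fact
  have ex: "\<exists>f'\<in>carrier (Hom D (Fo x) (Fo y)). f = q x y f'"
    if "x \<in> Ob C" "y \<in> Ob C" "f \<in> carrier (Hom C x y)" for x y f
    using surj[OF that(1,2)] that(3) by blast
  note cl = linear_map_closed[OF lin]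
  note add = linear_map_add[OF lin, symmetric]
  note smult = linear_map_smult[OF lin, symmetric]
  have D_add: "f \<oplus>\<^bsub>Hom D (Fo x) (Fo y)\<^esub> g \<in> carrier (Hom D (Fo x) (Fo y))"
    if "x \<in> Ob C" "y \<in> Ob C" "f \<in> carrier (Hom D (Fo x) (Fo y))"
      "g \<in> carrier (Hom D (Fo x) (Fo y))" for x y f g
    using D.Hom_module[of "Fo x" "Fo y"] that Fo
    by (simp add: module_def abelian_group_def abelian_monoid.a_closed)
  have D_smult: "c \<odot>\<^bsub>Hom D (Fo x) (Fo y)\<^esub> f \<in> carrier (Hom D (Fo x) (Fo y))"
    if "x \<in> Ob C" "y \<in> Ob C" "f \<in> carrier (Hom D (Fo x) (Fo y))" "c \<in> carrier K" for x y c f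
    using D.Hom_module[of "Fo x" "Fo y"] that Fo by (simp add: module.smult_closed)
  show "module K (Hom C x y)" if "x \<in> Ob C" "y \<in> Ob C" for x y
    using module_image[OF _ lin surj zero] D.Hom_module Fo that by blast
  show "Idm C x \<in> carrier (Hom C x x)" if "x \<in> Ob C" for x
    using cl idm D.Idm_closed Fo that by metis
  {
    fix x y f assume xy: "x \<in> Ob C" "y \<in> Ob C" and "f \<in> carrier (Hom C x y)"
    then obtain f' where f': "f' \<in> carrier (Hom D (Fo x) (Fo y))" "f = q x y f'" using ex by blast
    show "Cmp C x x y f (Idm C x) = f"
      using xy f' Fo D.Idm_closed
      by (simp add: D.Cmp_Idm_right flip: idm cmp)
    show "Cmp C x y y (Idm C y) f = f"
      using xy f' Fo D.Idm_closed
      by (simp add: D.Cmp_Idm_left flip: idm cmp)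
  }
  {
    fix x y z f g assume xyz: "x \<in> Ob C" "y \<in> Ob C" "z \<in> Ob C"
      and "f \<in> carrier (Hom C x y)" "g \<in> carrier (Hom C y z)"
    then obtain f' g' where f': "f' \<in> carrier (Hom D (Fo x) (Fo y))" "f = q x y f'"
      and g': "g' \<in> carrier (Hom D (Fo y) (Fo z))" "g = q y z g'" using ex by meson
    show "Cmp C x y z g f \<in> carrier (Hom C x z)"
      using xyz f' g' Fo D.Cmp_closed by (simp add: cl flip: cmp)
    {
      fix h assume "h \<in> carrier (Hom C x y)"
      with xyz obtain h' where h': "h' \<in> carrier (Hom D (Fo x) (Fo y))" "h = q x y h'"
        using ex by blast
      show "Cmp C x y z g (f \<oplus>\<^bsub>Hom C x y\<^esub> h) = Cmp C x y z g f \<oplus>\<^bsub>Hom C x z\<^esub> Cmp C x y z g h"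
        using xyz f' g' h' Fo by (simp add: add D_add D.Cmp_closed D.Cmp_add_right flip: cmp)
    }
    {
      fix h assume "h \<in> carrier (Hom C y z)"
      with xyz obtain h' where h': "h' \<in> carrier (Hom D (Fo y) (Fo z))" "h = q y z h'"
        using ex by blast
      show "Cmp C x y z (g \<oplus>\<^bsub>Hom C y z\<^esub> h) f = Cmp C x y z g f \<oplus>\<^bsub>Hom C x z\<^esub> Cmp C x y z h f"
        using xyz f' g' h' Fo by (simp add: add D_add D.Cmp_closed D.Cmp_add_left flip: cmp)
    }
    {
      fix w h assume w: "w \<in> Ob C" "h \<in> carrier (Hom C w x)"
      with xyz obtain h' where h': "h' \<in> carrier (Hom D (Fo w) (Fo x))" "h = q w x h'"
        using ex by blast
      show "Cmp C w y z g (Cmp C w x y f h) = Cmp C w x z (Cmp C x y z g f) h"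
        using xyz w f' g' h' Fo by (simp add: D.Cmp_closed D.Cmp_assoc flip: cmp)
    }
    fix c assume c: "c \<in> carrier K"
    show "Cmp C x y z g (c \<odot>\<^bsub>Hom C x y\<^esub> f) = c \<odot>\<^bsub>Hom C x z\<^esub> Cmp C x y z g f"
      and "Cmp C x y z (c \<odot>\<^bsub>Hom C y z\<^esub> g) f = c \<odot>\<^bsub>Hom C x z\<^esub> Cmp C x y z g f"
      using xyz c f' g' Fo
      by (simp_all add: smult D_smult D.Cmp_closed D.Cmp_smult_right D.Cmp_smult_left flip: cmp)
  }
qed

lemma full_sub_simps [simp]:
  "Ob (full_sub C S) = S" "Hom (full_sub C S) = Hom C" "Idm (full_sub C S) = Idm C"
  "Cmp (full_sub C S) = Cmp C"
  by (simp_all add: full_sub_def)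

lemma op_cat_simps [simp]:
  "Ob (op_cat C) = Ob C" "Hom (op_cat C) x y = Hom C y x" "Idm (op_cat C) = Idm C"
  "Cmp (op_cat C) x y z g f = Cmp C z y x f g"
  by (simp_all add: op_cat_def)

lemma linear_category_full_sub:
  assumes "linear_category K C" "S \<subseteq> Ob C"
  shows "linear_category K (full_sub C S)"
proof -
  interpret linear_category K C by fact
  have [simp]: "x \<in> Ob C" if "x \<in> S" for x using that assms(2) by blast
  show ?thesis
    by (rule linear_category.intro)
      (simp_all add: Hom_module Idm_closed Cmp_closed Cmp_Idm_left Cmp_Idm_right Cmp_assoc
        Cmp_add_left Cmp_add_right Cmp_smult_left Cmp_smult_right)
qed

section \<open>Modules over a linear category\<close>

abbreviation cat_module :: "'k ring \<Rightarrow> ('o, 'm, 'k) lin_cat \<Rightarrow>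
    ('o, 'm, ('k, 'u) module, 'u \<Rightarrow> 'u) fctr \<Rightarrow> bool" where
  "cat_module K C X \<equiv> linear_functor K (op_cat C) (vect TYPE('u) K) X"

lemma vect_simps [simp]:
  "Ob (vect TYPE('u) K) = {V. module K V}"
  "Hom (vect TYPE('u) K) V W = map_space V W (lin_hom K V W)"
  "Idm (vect TYPE('u) K) V = (\<lambda>v\<in>carrier V. v)"
  "Cmp (vect TYPE('u) K) U V W g f = compose (carrier U) g f"
  by (simp_all add: vect_def)

lemma lin_homD: "\<lbrakk>f \<in> lin_hom K V W; v \<in> carrier V\<rbrakk> \<Longrightarrow> f v \<in> carrier W"
  by (auto simp: lin_hom_def)

lemma lin_hom_eqI:
  assumes "f \<in> lin_hom K V W" "g \<in> lin_hom K V W'" "\<And>v. v \<in> carrier V \<Longrightarrow> f v = g v"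
  shows "f = g"
  using assms by (auto simp: lin_hom_iff intro: extensionalityI)

text \<open>Functoriality in elementwise form. A morphism f from x to y acts as
  \<open>far X y x f\<close>, from the value at y to the value at x, and equations between
  extensional maps reduce to equations between their values.\<close>

lemma cat_moduleI:
  fixes X :: "('o, 'm, ('k, 'u) module, 'u \<Rightarrow> 'u) fctr"
  assumes "\<And>x. x \<in> Ob C \<Longrightarrow> module K (fob X x)"
    and far: "\<And>x y f. \<lbrakk>x \<in> Ob C; y \<in> Ob C; f \<in> carrier (Hom C x y)\<rbrakk>
      \<Longrightarrow> far X y x f \<in> lin_hom K (fob X y) (fob X x)"
    and idm: "\<And>x v. \<lbrakk>x \<in> Ob C; v \<in> carrier (fob X x)\<rbrakk> \<Longrightarrow> far X x x (Idm C x) v = v"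
    and cmp: "\<And>x y z f g v. \<lbrakk>x \<in> Ob C; y \<in> Ob C; z \<in> Ob C; f \<in> carrier (Hom C x y);
        g \<in> carrier (Hom C y z); v \<in> carrier (fob X z)\<rbrakk>
      \<Longrightarrow> far X z x (Cmp C x y z g f) v = far X y x f (far X z y g v)"
    and add: "\<And>x y f g v. \<lbrakk>x \<in> Ob C; y \<in> Ob C; f \<in> carrier (Hom C x y);
        g \<in> carrier (Hom C x y); v \<in> carrier (fob X y)\<rbrakk>
      \<Longrightarrow> far X y x (f \<oplus>\<^bsub>Hom C x y\<^esub> g) v = far X y x f v \<oplus>\<^bsub>fob X x\<^esub> far X y x g v"
    and smult: "\<And>x y c f v. \<lbrakk>x \<in> Ob C; y \<in> Ob C; c \<in> carrier K; f \<in> carrier (Hom C x y);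
        v \<in> carrier (fob X y)\<rbrakk>
      \<Longrightarrow> far X y x (c \<odot>\<^bsub>Hom C x y\<^esub> f) v = c \<odot>\<^bsub>fob X x\<^esub> far X y x f v"
    and C: "linear_category K C"
  shows "cat_module K C X"
proof (rule linear_functor.intro)
  interpret C: linear_category K C by fact
  note [simp] = C.Idm_closed C.Cmp_closed
  have ext: "far X y x f \<in> extensional (carrier (fob X y))"
    if "x \<in> Ob C" "y \<in> Ob C" "f \<in> carrier (Hom C x y)" for x y f
    using far[OF that] by (simp add: lin_hom_iff)
  have [simp]: "f \<oplus>\<^bsub>Hom C x y\<^esub> g \<in> carrier (Hom C x y)"
    if "x \<in> Ob C" "y \<in> Ob C" "f \<in> carrier (Hom C x y)" "g \<in> carrier (Hom C x y)" for x y f g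
    using C.Hom_module[of x y] that by (simp add: module_def abelian_group_def abelian_monoid.a_closed)
  have [simp]: "c \<odot>\<^bsub>Hom C x y\<^esub> f \<in> carrier (Hom C x y)"
    if "x \<in> Ob C" "y \<in> Ob C" "f \<in> carrier (Hom C x y)" "c \<in> carrier K" for x y c f
    using C.Hom_module[of x y] that by (simp add: module.smult_closed)
  fix x y z f g c
  assume x: "x \<in> Ob (op_cat C)"
  show "fob X x \<in> Ob (vect TYPE('u) K)" using x assms(1) by simp
  show "far X x x (Idm (op_cat C) x) = Idm (vect TYPE('u) K) (fob X x)"
    using x by (auto simp: idm intro: extensionalityI[OF ext])
  assume y: "y \<in> Ob (op_cat C)" and f: "f \<in> carrier (Hom (op_cat C) x y)"
  show "far X x y f \<in> carrier (Hom (vect TYPE('u) K) (fob X x) (fob X y))"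
    using x y f far by simp
  {
    fix g assume g: "g \<in> carrier (Hom (op_cat C) x y)"
    show "far X x y (f \<oplus>\<^bsub>Hom (op_cat C) x y\<^esub> g) =
        far X x y f \<oplus>\<^bsub>Hom (vect TYPE('u) K) (fob X x) (fob X y)\<^esub> far X x y g"
      using x y f g by (auto simp: add intro: extensionalityI[OF ext])
  }
  {
    assume c: "c \<in> carrier K"
    show "far X x y (c \<odot>\<^bsub>Hom (op_cat C) x y\<^esub> f) =
        c \<odot>\<^bsub>Hom (vect TYPE('u) K) (fob X x) (fob X y)\<^esub> far X x y f"
      using x y f c by (auto simp: smult intro: extensionalityI[OF ext])
  }
  assume z: "z \<in> Ob (op_cat C)" and g: "g \<in> carrier (Hom (op_cat C) y z)"
  show "far X x z (Cmp (op_cat C) x y z g f) =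
      Cmp (vect TYPE('u) K) (fob X x) (fob X y) (fob X z) (far X y z g) (far X x y f)"
    using x y z f g by (auto simp: cmp compose_def intro: extensionalityI[OF ext])
qed

context
  fixes K :: "'k ring" and C :: "('o, 'm, 'k) lin_cat"
    and X :: "('o, 'm, ('k, 'u) module, 'u \<Rightarrow> 'u) fctr"
  assumes X: "cat_module K C X"
begin

lemma cat_module_fob: "x \<in> Ob C \<Longrightarrow> module K (fob X x)"
  using linear_functor.fob_closed[OF X, of x] by simp

lemma cat_module_far:
  "\<lbrakk>x \<in> Ob C; y \<in> Ob C; f \<in> carrier (Hom C x y)\<rbrakk> \<Longrightarrow> far X y x f \<in> lin_hom K (fob X y) (fob X x)"
  using linear_functor.far_closed[OF X, of y x f] by simp

lemma cat_module_linear: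
  "\<lbrakk>x \<in> Ob C; y \<in> Ob C; f \<in> carrier (Hom C x y)\<rbrakk> \<Longrightarrow> linear_map K (fob X y) (fob X x) (far X y x f)"
  by (rule linear_map_iff_lin_hom[OF cat_module_far])

lemma cat_module_closed:
  "\<lbrakk>x \<in> Ob C; y \<in> Ob C; f \<in> carrier (Hom C x y); v \<in> carrier (fob X y)\<rbrakk>
    \<Longrightarrow> far X y x f v \<in> carrier (fob X x)"
  by (rule lin_homD[OF cat_module_far])

lemma cat_module_Idm:
  "\<lbrakk>x \<in> Ob C; v \<in> carrier (fob X x)\<rbrakk> \<Longrightarrow> far X x x (Idm C x) v = v"
  using linear_functor.far_Idm[OF X, of x] by simp

lemma cat_module_Cmp:
  "\<lbrakk>x \<in> Ob C; y \<in> Ob C; z \<in> Ob C; f \<in> carrier (Hom C x y); g \<in> carrier (Hom C y z);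
    v \<in> carrier (fob X z)\<rbrakk> \<Longrightarrow> far X z x (Cmp C x y z g f) v = far X y x f (far X z y g v)"
  using linear_functor.far_Cmp[OF X, of z y x g f] by (simp add: compose_def)

lemma cat_module_add:
  "\<lbrakk>x \<in> Ob C; y \<in> Ob C; f \<in> carrier (Hom C x y); g \<in> carrier (Hom C x y);
    v \<in> carrier (fob X y)\<rbrakk>
    \<Longrightarrow> far X y x (f \<oplus>\<^bsub>Hom C x y\<^esub> g) v = far X y x f v \<oplus>\<^bsub>fob X x\<^esub> far X y x g v"
  using linear_functor.far_add[OF X, of y x f g] by simp

lemma cat_module_smult:
  "\<lbrakk>x \<in> Ob C; y \<in> Ob C; c \<in> carrier K; f \<in> carrier (Hom C x y); v \<in> carrier (fob X y)\<rbrakk>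
    \<Longrightarrow> far X y x (c \<odot>\<^bsub>Hom C x y\<^esub> f) v = c \<odot>\<^bsub>fob X x\<^esub> far X y x f v"
  using linear_functor.far_smult[OF X, of y x c f] by simp

lemma cat_module_eval_linear:
  "\<lbrakk>x \<in> Ob C; y \<in> Ob C; v \<in> carrier (fob X y)\<rbrakk>
    \<Longrightarrow> linear_map K (Hom C x y) (fob X x) (\<lambda>f. far X y x f v)"
  by (rule linear_mapI) (auto simp: cat_module_closed cat_module_add cat_module_smult)

end

section \<open>Natural transformations and the category of all modules\<close>

lemma nat_mapsI:
  assumes "\<And>x. x \<in> Ob C \<Longrightarrow> \<eta> x \<in> lin_hom K (fob X x) (fob Y x)" "\<eta> \<in> extensional (Ob C)"
    and "\<And>x y f v. \<lbrakk>x \<in> Ob C; y \<in> Ob C; f \<in> carrier (Hom C x y); v \<in> carrier (fob X y)\<rbrakk>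
      \<Longrightarrow> \<eta> x (far X y x f v) = far Y y x f (\<eta> y v)"
  shows "\<eta> \<in> nat_maps K C X Y"
  using assms by (auto simp: nat_maps_def PiE_def)

lemma nat_maps_extensional: "\<eta> \<in> nat_maps K C X Y \<Longrightarrow> \<eta> \<in> extensional (Ob C)"
  by (auto simp: nat_maps_def PiE_iff)

lemma nat_maps_lin_hom: "\<lbrakk>\<eta> \<in> nat_maps K C X Y; x \<in> Ob C\<rbrakk> \<Longrightarrow> \<eta> x \<in> lin_hom K (fob X x) (fob Y x)"
  by (auto simp: nat_maps_def)

lemma nat_maps_linear:
  "\<lbrakk>\<eta> \<in> nat_maps K C X Y; x \<in> Ob C\<rbrakk> \<Longrightarrow> linear_map K (fob X x) (fob Y x) (\<eta> x)"
  by (rule linear_map_iff_lin_hom[OF nat_maps_lin_hom])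

lemma nat_maps_closed:
  "\<lbrakk>\<eta> \<in> nat_maps K C X Y; x \<in> Ob C; v \<in> carrier (fob X x)\<rbrakk> \<Longrightarrow> \<eta> x v \<in> carrier (fob Y x)"
  by (rule lin_homD[OF nat_maps_lin_hom])

lemma nat_maps_natural:
  "\<lbrakk>\<eta> \<in> nat_maps K C X Y; x \<in> Ob C; y \<in> Ob C; f \<in> carrier (Hom C x y); v \<in> carrier (fob X y)\<rbrakk>
    \<Longrightarrow> \<eta> x (far X y x f v) = far Y y x f (\<eta> y v)"
  by (auto simp: nat_maps_def)

text \<open>The two targets may differ, so that a transformation into a submodule can be compared
  with one into the ambient module.\<close>

lemma nat_maps_eqI:
  assumes "\<eta> \<in> nat_maps K C X Y" "\<theta> \<in> nat_maps K C X Y'"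
    and "\<And>x v. \<lbrakk>x \<in> Ob C; v \<in> carrier (fob X x)\<rbrakk> \<Longrightarrow> \<eta> x v = \<theta> x v"
  shows "\<eta> = \<theta>"
proof (rule extensionalityI)
  show "\<eta> \<in> extensional (Ob C)" "\<theta> \<in> extensional (Ob C)"
    using assms by (simp_all add: nat_maps_extensional)
  fix x assume "x \<in> Ob C"
  then show "\<eta> x = \<theta> x"
    using assms by (intro lin_hom_eqI[OF nat_maps_lin_hom nat_maps_lin_hom])
qed

lemma Mod_cat_simps [simp]:
  "Ob (Mod_cat TYPE('u) K C) = {X. cat_module K C X}"
  "carrier (Hom (Mod_cat TYPE('u) K C) X Y) = nat_maps K C X Y"
  "\<zero>\<^bsub>Hom (Mod_cat TYPE('u) K C) X Y\<^esub> = (\<lambda>x\<in>Ob C. \<lambda>v\<in>carrier (fob X x). \<zero>\<^bsub>fob Y x\<^esub>)"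
  "\<eta> \<oplus>\<^bsub>Hom (Mod_cat TYPE('u) K C) X Y\<^esub> \<theta> =
    (\<lambda>x\<in>Ob C. \<lambda>v\<in>carrier (fob X x). \<eta> x v \<oplus>\<^bsub>fob Y x\<^esub> \<theta> x v)"
  "c \<odot>\<^bsub>Hom (Mod_cat TYPE('u) K C) X Y\<^esub> \<eta> =
    (\<lambda>x\<in>Ob C. \<lambda>v\<in>carrier (fob X x). c \<odot>\<^bsub>fob Y x\<^esub> \<eta> x v)"
  "Idm (Mod_cat TYPE('u) K C) X = (\<lambda>x\<in>Ob C. \<lambda>v\<in>carrier (fob X x). v)"
  "Cmp (Mod_cat TYPE('u) K C) X Y Z \<theta> \<eta> = (\<lambda>x\<in>Ob C. \<lambda>v\<in>carrier (fob X x). \<theta> x (\<eta> x v))"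
  by (simp_all add: Mod_cat_def compose_def)

lemma nat_maps_Idm:
  "cat_module K C X \<Longrightarrow> (\<lambda>x\<in>Ob C. \<lambda>v\<in>carrier (fob X x). v) \<in> nat_maps K C X X"
  by (rule nat_mapsI) (auto simp: lin_hom_id cat_module_closed cat_module_fob)

lemma nat_maps_Cmp:
  assumes X: "cat_module K C X" and "\<eta> \<in> nat_maps K C X Y" "\<theta> \<in> nat_maps K C Y Z"
  shows "(\<lambda>x\<in>Ob C. \<lambda>v\<in>carrier (fob X x). \<theta> x (\<eta> x v)) \<in> nat_maps K C X Z"
proof (rule nat_mapsI)
  fix x assume "x \<in> Ob C"
  then show "(\<lambda>x\<in>Ob C. \<lambda>v\<in>carrier (fob X x). \<theta> x (\<eta> x v)) x \<in> lin_hom K (fob X x) (fob Z x)"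
    using lin_hom_compose[OF cat_module_fob[OF X], of x "\<eta> x" "fob Y x" "\<theta> x" "fob Z x"] assms
    by (simp add: compose_def nat_maps_lin_hom)
qed (use assms in \<open>auto simp: nat_maps_natural nat_maps_closed cat_module_closed\<close>)

text \<open>The components at the objects of C embed a space of natural transformations jointly into
  spaces of linear maps, which supplies the module axioms; the laws of composition hold
  objectwise.\<close>

lemma linear_category_Mod_cat:
  fixes K :: "'k ring" and C :: "('o, 'm, 'k) lin_cat"
  assumes K: "cring K"
  shows "linear_category K (Mod_cat TYPE('u) K C)"
proof (rule linear_category.intro)
  fix X Y Z :: "('o, 'm, ('k, 'u) module, 'u \<Rightarrow> 'u) fctr"
  let ?M = "Mod_cat TYPE('u) K C"
  have mod: "module K (fob X x)" if "x \<in> Ob C" "X \<in> Ob ?M"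
    for X :: "('o, 'm, ('k, 'u) module, 'u \<Rightarrow> 'u) fctr" and x
    using that cat_module_fob by auto
  {
    fix X Y :: "('o, 'm, ('k, 'u) module, 'u \<Rightarrow> 'u) fctr"
    assume XY: "X \<in> Ob ?M" "Y \<in> Ob ?M"
    then have X: "cat_module K C X" and Y: "cat_module K C Y" by simp_all
    show "module K (Hom ?M X Y)"
    proof (rule module_jointly_embedded[where I = "Ob C" and j = "\<lambda>x \<eta>. \<eta> x" and
          V = "\<lambda>x. map_space (fob X x) (fob Y x) (lin_hom K (fob X x) (fob Y x))"])
      show "module K (map_space (fob X x) (fob Y x) (lin_hom K (fob X x) (fob Y x)))"
        if "x \<in> Ob C" for x
        using linear_category.Hom_module[OF linear_category_vect, of "fob X x" K "fob Y x"]
          mod[OF that] XY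
        by simp
      show "linear_map K (Hom ?M X Y) (map_space (fob X x) (fob Y x)
          (lin_hom K (fob X x) (fob Y x))) (\<lambda>\<eta>. \<eta> x)" if "x \<in> Ob C" for x
        by (rule linear_mapI) (use that in \<open>auto simp: nat_maps_lin_hom\<close>)
      show "\<zero>\<^bsub>Hom ?M X Y\<^esub> \<in> carrier (Hom ?M X Y)"
        unfolding Mod_cat_simps
        by (rule nat_mapsI)
          (use X Y mod XY in \<open>auto simp: lin_hom_zero cat_module_closed
            linear_map_zero[OF cat_module_linear[OF Y]]\<close>)
      show "\<eta> \<oplus>\<^bsub>Hom ?M X Y\<^esub> \<theta> \<in> carrier (Hom ?M X Y)"
        if "\<eta> \<in> carrier (Hom ?M X Y)" "\<theta> \<in> carrier (Hom ?M X Y)" for \<eta> \<theta>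
        using that unfolding Mod_cat_simps
        by (intro nat_mapsI)
          (use X Y mod XY in \<open>auto simp: lin_hom_add cat_module_closed nat_maps_natural nat_maps_lin_hom
            nat_maps_closed linear_map_add[OF cat_module_linear[OF Y]]\<close>)
      show "c \<odot>\<^bsub>Hom ?M X Y\<^esub> \<eta> \<in> carrier (Hom ?M X Y)"
        if "c \<in> carrier K" "\<eta> \<in> carrier (Hom ?M X Y)" for c \<eta>
        using that unfolding Mod_cat_simps
        by (intro nat_mapsI)
          (use X Y mod XY in \<open>auto simp: lin_hom_smult cat_module_closed nat_maps_natural nat_maps_lin_hom
            nat_maps_closed linear_map_smult[OF cat_module_linear[OF Y]]\<close>)
      show "\<eta> = \<theta>" if "\<eta> \<in> carrier (Hom ?M X Y)" "\<theta> \<in> carrier (Hom ?M X Y)"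
        "\<And>x. x \<in> Ob C \<Longrightarrow> \<eta> x = \<theta> x" for \<eta> \<theta>
        using that by (auto intro: nat_maps_eqI)
    qed (use K in auto)
    show "Idm ?M X \<in> carrier (Hom ?M X X)"
      using nat_maps_Idm[OF X] by simp
    fix \<eta> assume \<eta>: "\<eta> \<in> carrier (Hom ?M X Y)"
    then have [simp]: "\<eta> \<in> nat_maps K C X Y" by simp
    show "Cmp ?M X X Y \<eta> (Idm ?M X) = \<eta>"
      by (rule nat_maps_eqI[of _ K C X Y _ Y])
        (use nat_maps_Cmp[OF X nat_maps_Idm[OF X], of \<eta> Y] in simp_all)
    show "Cmp ?M X Y Y (Idm ?M Y) \<eta> = \<eta>"
      by (rule nat_maps_eqI[of _ K C X Y _ Y])
        (use nat_maps_Cmp[OF X _ nat_maps_Idm[OF Y], of \<eta>]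
          nat_maps_closed[of \<eta> K C X Y] in simp_all)
  }
  assume XYZ: "X \<in> Ob ?M" "Y \<in> Ob ?M" "Z \<in> Ob ?M"
  then have X: "cat_module K C X" and Y: "cat_module K C Y" and Z: "cat_module K C Z" by simp_all
  fix \<eta> \<theta> assume \<eta>: "\<eta> \<in> carrier (Hom ?M X Y)" and \<theta>: "\<theta> \<in> carrier (Hom ?M Y Z)"
  then have [simp]: "\<eta> \<in> nat_maps K C X Y" "\<theta> \<in> nat_maps K C Y Z" by simp_all
  show "Cmp ?M X Y Z \<theta> \<eta> \<in> carrier (Hom ?M X Z)"
    using nat_maps_Cmp[of K C X \<eta> Y \<theta> Z] \<eta> \<theta> X mod XYZ by simp
  show "Cmp ?M X Y Z \<theta> (\<eta> \<oplus>\<^bsub>Hom ?M X Y\<^esub> \<eta>') =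
      Cmp ?M X Y Z \<theta> \<eta> \<oplus>\<^bsub>Hom ?M X Z\<^esub> Cmp ?M X Y Z \<theta> \<eta>'" if "\<eta>' \<in> carrier (Hom ?M X Y)" for \<eta>'
    using that by (auto intro!: restrict_ext
      simp: linear_map_add[OF nat_maps_linear[of \<theta> K C Y Z]] nat_maps_closed[of _ K C X Y])
  show "Cmp ?M X Y Z (\<theta> \<oplus>\<^bsub>Hom ?M Y Z\<^esub> \<theta>') \<eta> =
      Cmp ?M X Y Z \<theta> \<eta> \<oplus>\<^bsub>Hom ?M X Z\<^esub> Cmp ?M X Y Z \<theta>' \<eta>" if "\<theta>' \<in> carrier (Hom ?M Y Z)" for \<theta>'
    using that by (auto intro!: restrict_ext simp: nat_maps_closed[of _ K C X Y])
  show "Cmp ?M X Y Z \<theta> (c \<odot>\<^bsub>Hom ?M X Y\<^esub> \<eta>) = c \<odot>\<^bsub>Hom ?M X Z\<^esub> Cmp ?M X Y Z \<theta> \<eta>"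
    "Cmp ?M X Y Z (c \<odot>\<^bsub>Hom ?M Y Z\<^esub> \<theta>) \<eta> = c \<odot>\<^bsub>Hom ?M X Z\<^esub> Cmp ?M X Y Z \<theta> \<eta>"
    if "c \<in> carrier K" for c
    using that by (auto intro!: restrict_ext
      simp: linear_map_smult[OF nat_maps_linear[of \<theta> K C Y Z]] nat_maps_closed[of _ K C X Y])
  fix W :: "('o, 'm, ('k, 'u) module, 'u \<Rightarrow> 'u) fctr" and \<omega>
  assume "W \<in> Ob ?M" "\<omega> \<in> carrier (Hom ?M W X)"
  then show "Cmp ?M W Y Z \<theta> (Cmp ?M W X Y \<eta> \<omega>) = Cmp ?M W X Z (Cmp ?M X Y Z \<theta> \<eta>) \<omega>"
    by (auto intro!: restrict_ext simp: nat_maps_closed[of \<omega> K C W X])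
qed

lemma mod_cat_simps [simp]:
  "Ob (mod_cat TYPE('u) K C) = {X. cat_module K C X \<and> finitely_presented K C X}"
  "carrier (Hom (mod_cat TYPE('u) K C) X Y) = nat_maps K C X Y"
  "\<zero>\<^bsub>Hom (mod_cat TYPE('u) K C) X Y\<^esub> = (\<lambda>x\<in>Ob C. \<lambda>v\<in>carrier (fob X x). \<zero>\<^bsub>fob Y x\<^esub>)"
  "\<eta> \<oplus>\<^bsub>Hom (mod_cat TYPE('u) K C) X Y\<^esub> \<theta> =
    (\<lambda>x\<in>Ob C. \<lambda>v\<in>carrier (fob X x). \<eta> x v \<oplus>\<^bsub>fob Y x\<^esub> \<theta> x v)"
  "c \<odot>\<^bsub>Hom (mod_cat TYPE('u) K C) X Y\<^esub> \<eta> =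
    (\<lambda>x\<in>Ob C. \<lambda>v\<in>carrier (fob X x). c \<odot>\<^bsub>fob Y x\<^esub> \<eta> x v)"
  "Idm (mod_cat TYPE('u) K C) X = (\<lambda>x\<in>Ob C. \<lambda>v\<in>carrier (fob X x). v)"
  "Cmp (mod_cat TYPE('u) K C) X Y Z \<theta> \<eta> = (\<lambda>x\<in>Ob C. \<lambda>v\<in>carrier (fob X x). \<theta> x (\<eta> x v))"
  by (simp_all add: mod_cat_def)

lemma linear_category_mod_cat:
  "cring K \<Longrightarrow> linear_category K (mod_cat TYPE('u) K C)"
  unfolding mod_cat_def by (rule linear_category_full_sub[OF linear_category_Mod_cat]) auto

section \<open>Linear categories and equivalences\<close>

context linear_category
begin

abbreviation hom :: "'o \<Rightarrow> 'o \<Rightarrow> 'm set" where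
  "hom x y \<equiv> carrier (Hom C x y)"

lemma Hom_zero: "\<lbrakk>x \<in> Ob C; y \<in> Ob C\<rbrakk> \<Longrightarrow> \<zero>\<^bsub>Hom C x y\<^esub> \<in> carrier (Hom C x y)"
  using Hom_module[of x y] by (simp add: module_def abelian_group_def abelian_monoid.zero_closed)

lemma Hom_add: "\<lbrakk>x \<in> Ob C; y \<in> Ob C; f \<in> carrier (Hom C x y); g \<in> carrier (Hom C x y)\<rbrakk>
    \<Longrightarrow> f \<oplus>\<^bsub>Hom C x y\<^esub> g \<in> carrier (Hom C x y)"
  using Hom_module[of x y] by (simp add: module_def abelian_group_def abelian_monoid.a_closed)

lemma Hom_minus: "\<lbrakk>x \<in> Ob C; y \<in> Ob C; f \<in> carrier (Hom C x y); g \<in> carrier (Hom C x y)\<rbrakk>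
    \<Longrightarrow> f \<ominus>\<^bsub>Hom C x y\<^esub> g \<in> carrier (Hom C x y)"
  using Hom_module[of x y] by (simp add: module_def abelian_group.minus_closed)

lemma Hom_smult: "\<lbrakk>x \<in> Ob C; y \<in> Ob C; c \<in> carrier K; f \<in> carrier (Hom C x y)\<rbrakk>
    \<Longrightarrow> c \<odot>\<^bsub>Hom C x y\<^esub> f \<in> carrier (Hom C x y)"
  using Hom_module[of x y] by (simp add: module.smult_closed)

lemma Cmp_linear_right: "\<lbrakk>x \<in> Ob C; y \<in> Ob C; z \<in> Ob C; g \<in> carrier (Hom C y z)\<rbrakk>
    \<Longrightarrow> linear_map K (Hom C x y) (Hom C x z) (\<lambda>f. Cmp C x y z g f)"
  by (rule linear_mapI) (simp_all add: Cmp_closed Cmp_add_right Cmp_smult_right)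

lemma Cmp_linear_left: "\<lbrakk>x \<in> Ob C; y \<in> Ob C; z \<in> Ob C; f \<in> carrier (Hom C x y)\<rbrakk>
    \<Longrightarrow> linear_map K (Hom C y z) (Hom C x z) (\<lambda>g. Cmp C x y z g f)"
  by (rule linear_mapI) (simp_all add: Cmp_closed Cmp_add_left Cmp_smult_left)

lemma Cmp_zero_right: "\<lbrakk>x \<in> Ob C; y \<in> Ob C; z \<in> Ob C; g \<in> carrier (Hom C y z)\<rbrakk>
    \<Longrightarrow> Cmp C x y z g \<zero>\<^bsub>Hom C x y\<^esub> = \<zero>\<^bsub>Hom C x z\<^esub>"
  using linear_map_zero[OF Cmp_linear_right] Hom_module by blast

lemma Cmp_zero_left: "\<lbrakk>x \<in> Ob C; y \<in> Ob C; z \<in> Ob C; f \<in> carrier (Hom C x y)\<rbrakk>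
    \<Longrightarrow> Cmp C x y z \<zero>\<^bsub>Hom C y z\<^esub> f = \<zero>\<^bsub>Hom C x z\<^esub>"
  using linear_map_zero[OF Cmp_linear_left] Hom_module by blast

lemma iso_arr_cancel_right:
  assumes "x \<in> Ob C" "y \<in> Ob C" "z \<in> Ob C" "iso_arr C x y s"
    and "f \<in> carrier (Hom C y z)" "g \<in> carrier (Hom C y z)" "Cmp C x y z f s = Cmp C x y z g s"
  shows "f = g"
proof -
  obtain t where t: "t \<in> carrier (Hom C y x)" "Cmp C y x y s t = Idm C y"
    using assms(4) by (auto simp: iso_arr_def)
  have s: "s \<in> carrier (Hom C x y)" using assms(4) by (simp add: iso_arr_def)
  have "Cmp C y x z (Cmp C x y z f s) t = Cmp C y x z (Cmp C x y z g s) t" using assms(7) by simp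
  then have "Cmp C y y z f (Cmp C y x y s t) = Cmp C y y z g (Cmp C y x y s t)"
    using assms s t(1) by (simp add: Cmp_assoc)
  then show ?thesis using assms t by (simp add: Cmp_Idm_right)
qed

lemma iso_arr_factor_right:
  assumes "x \<in> Ob C" "y \<in> Ob C" "z \<in> Ob C" "iso_arr C x y s" "f \<in> carrier (Hom C x z)"
  obtains h where "h \<in> carrier (Hom C y z)" "Cmp C x y z h s = f"
proof -
  obtain t where t: "t \<in> carrier (Hom C y x)" "Cmp C x y x t s = Idm C x"
    using assms(4) by (auto simp: iso_arr_def)
  have s: "s \<in> carrier (Hom C x y)" using assms(4) by (simp add: iso_arr_def)
  show thesis
    by (rule that[of "Cmp C y x z f t"])
      (use assms s t in \<open>simp_all add: Cmp_closed Cmp_Idm_right flip: Cmp_assoc\<close>)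
qed

lemma iso_arr_factor_left:
  assumes "x \<in> Ob C" "y \<in> Ob C" "z \<in> Ob C" "iso_arr C x y s" "f \<in> carrier (Hom C z y)"
  obtains h where "h \<in> carrier (Hom C z x)" "Cmp C z x y s h = f"
proof -
  obtain t where t: "t \<in> carrier (Hom C y x)" "Cmp C y x y s t = Idm C y"
    using assms(4) by (auto simp: iso_arr_def)
  have s: "s \<in> carrier (Hom C x y)" using assms(4) by (simp add: iso_arr_def)
  show thesis
    by (rule that[of "Cmp C z y x t f"])
      (use assms s t in \<open>simp_all add: Cmp_closed Cmp_Idm_left Cmp_assoc\<close>)
qed

lemma iso_arr_Idm: "x \<in> Ob C \<Longrightarrow> iso_arr C x x (Idm C x)"
  unfolding iso_arr_def by (auto intro!: Idm_closed Cmp_Idm_left bexI[of _ "Idm C x"])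

lemma iso_arr_Cmp:
  assumes "x \<in> Ob C" "y \<in> Ob C" "z \<in> Ob C" "iso_arr C x y s" "iso_arr C y z t"
  shows "iso_arr C x z (Cmp C x y z t s)"
proof -
  obtain s' where s': "s' \<in> carrier (Hom C y x)" "Cmp C y x y s s' = Idm C y" "Cmp C x y x s' s = Idm C x"
    using assms(4) by (auto simp: iso_arr_def)
  obtain t' where t': "t' \<in> carrier (Hom C z y)" "Cmp C z y z t t' = Idm C z" "Cmp C y z y t' t = Idm C y"
    using assms(5) by (auto simp: iso_arr_def)
  have c: "s \<in> carrier (Hom C x y)" "t \<in> carrier (Hom C y z)"
    using assms by (simp_all add: iso_arr_def)
  have "Cmp C x z x (Cmp C z y x s' t') (Cmp C x y z t s) =
    Cmp C x y x s' (Cmp C x z y t' (Cmp C x y z t s))"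
    using assms c s' t' by (simp add: Cmp_closed Cmp_assoc[of x z y x])
  also have "Cmp C x z y t' (Cmp C x y z t s) = s"
    using assms c s' t' by (simp add: Cmp_assoc Cmp_Idm_left)
  finally have 1: "Cmp C x z x (Cmp C z y x s' t') (Cmp C x y z t s) = Idm C x" using s' by simp
  have "Cmp C z x z (Cmp C x y z t s) (Cmp C z y x s' t') =
    Cmp C z y z t (Cmp C z x y s (Cmp C z y x s' t'))"
    using assms c s' t' by (simp add: Cmp_closed Cmp_assoc[of z x y z])
  also have "Cmp C z x y s (Cmp C z y x s' t') = t'"
    using assms c s' t' by (simp add: Cmp_assoc Cmp_Idm_left)
  finally have 2: "Cmp C z x z (Cmp C x y z t s) (Cmp C z y x s' t') = Idm C z" using t' by simp
  show ?thesis unfolding iso_arr_def using assms c s' t' 1 2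
    by (auto intro!: Cmp_closed bexI[of _ "Cmp C z y x s' t'"])
qed

end

section \<open>Fully faithful functors and equivalences\<close>

locale fully_faithful = C: linear_category K C + D: linear_category K D + linear_functor K C D F
  for K :: "'k ring" and C :: "('o, 'm, 'k) lin_cat" and D :: "('p, 'n, 'k) lin_cat" and F +
  assumes far_bij: "\<lbrakk>x \<in> Ob C; y \<in> Ob C\<rbrakk>
    \<Longrightarrow> bij_betw (far F x y) (C.hom x y) (D.hom (fob F x) (fob F y))"
begin

lemma far_eqD: "\<lbrakk>x \<in> Ob C; y \<in> Ob C; f \<in> C.hom x y; g \<in> C.hom x y;
    far F x y f = far F x y g\<rbrakk> \<Longrightarrow> f = g"
  using far_bij[of x y] by (auto simp: bij_betw_def inj_on_def)

definition preimage where
  "preimage x y h = inv_into (C.hom x y) (far F x y) h"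

lemma preimage_closed: "\<lbrakk>x \<in> Ob C; y \<in> Ob C; h \<in> D.hom (fob F x) (fob F y)\<rbrakk>
    \<Longrightarrow> preimage x y h \<in> C.hom x y"
  and far_preimage: "\<lbrakk>x \<in> Ob C; y \<in> Ob C; h \<in> D.hom (fob F x) (fob F y)\<rbrakk>
    \<Longrightarrow> far F x y (preimage x y h) = h"
  using far_bij[of x y] unfolding preimage_def bij_betw_def
  by (metis inv_into_into, metis f_inv_into_f)

lemma reflects_iso:
  assumes "x \<in> Ob C" "y \<in> Ob C" "s \<in> C.hom x y"
    and iso: "iso_arr D (fob F x) (fob F y) (far F x y s)"
  shows "iso_arr C x y s"
proof -
  obtain t where t: "t \<in> D.hom (fob F y) (fob F x)"
    "Cmp D (fob F x) (fob F y) (fob F x) t (far F x y s) = Idm D (fob F x)"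
    "Cmp D (fob F y) (fob F x) (fob F y) (far F x y s) t = Idm D (fob F y)"
    using iso by (auto simp: iso_arr_def)
  define t' where "t' = preimage y x t"
  have t': "t' \<in> C.hom y x" "far F y x t' = t"
    unfolding t'_def using assms t by (simp_all add: preimage_closed far_preimage)
  have "Cmp C x y x t' s = Idm C x"
    by (rule far_eqD[of x x]) (use assms t t'
      in \<open>simp_all add: C.Cmp_closed C.Idm_closed far_Cmp far_Idm\<close>)
  moreover have "Cmp C y x y s t' = Idm C y"
    by (rule far_eqD[of y y]) (use assms t t'
      in \<open>simp_all add: C.Cmp_closed C.Idm_closed far_Cmp far_Idm\<close>)
  ultimately show ?thesis using assms t' by (auto simp: iso_arr_def)
qed

text \<open>By choice every d gets an object \<open>X d\<close> and an isomorphism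
  \<open>\<theta> d\<close> from its image to d. The quasi-inverse sends h to the unique preimage of
  its conjugate by these isomorphisms, and every law for it is checked after applying the faithful
  functor F.\<close>

lemma linear_equivalence_if_essentially_surjective:
  assumes ess: "\<And>d. d \<in> Ob D \<Longrightarrow> \<exists>x\<in>Ob C. isomorphic D (fob F x) d"
  shows "linear_equivalence K C D F"
proof -
  have "\<forall>d\<in>Ob D. \<exists>x \<theta> \<theta>'. x \<in> Ob C \<and> \<theta> \<in> D.hom (fob F x) d \<and>
      \<theta>' \<in> D.hom d (fob F x) \<and> Cmp D (fob F x) d (fob F x) \<theta>' \<theta> = Idm D (fob F x) \<and>
      Cmp D d (fob F x) d \<theta> \<theta>' = Idm D d"
    using ess by (fastforce simp: isomorphic_def iso_arr_def)
  then obtain X \<theta> \<theta>' where 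
    X: "\<And>d. d \<in> Ob D \<Longrightarrow> X d \<in> Ob C"
    and \<theta>: "\<And>d. d \<in> Ob D \<Longrightarrow> \<theta> d \<in> D.hom (fob F (X d)) d"
    and \<theta>': "\<And>d. d \<in> Ob D \<Longrightarrow> \<theta>' d \<in> D.hom d (fob F (X d))"
    and \<theta>'\<theta>: "\<And>d. d \<in> Ob D \<Longrightarrow> Cmp D (fob F (X d)) d (fob F (X d)) (\<theta>' d) (\<theta> d) = Idm D (fob F (X d))"
    and \<theta>\<theta>': "\<And>d. d \<in> Ob D \<Longrightarrow> Cmp D d (fob F (X d)) d (\<theta> d) (\<theta>' d) = Idm D d"
    by metis
  define conj where "conj d e h = Cmp D (fob F (X d)) e (fob F (X e)) (\<theta>' e)
    (Cmp D (fob F (X d)) d e h (\<theta> d))" for d e h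
  define G where "G = \<lparr>fob = X, far = (\<lambda>d e h. preimage (X d) (X e) (conj d e h))\<rparr>"
  note FX = fob_closed[OF X]
  have conj_closed: "conj d e h \<in> D.hom (fob F (X d)) (fob F (X e))"
    if "d \<in> Ob D" "e \<in> Ob D" "h \<in> D.hom d e" for d e h
    unfolding conj_def using that X FX \<theta> \<theta>' by (auto intro!: D.Cmp_closed)
  have G_closed: "far G d e h \<in> C.hom (X d) (X e)"
    and F_G: "far F (X d) (X e) (far G d e h) = conj d e h"
    if "d \<in> Ob D" "e \<in> Ob D" "h \<in> D.hom d e" for d e h
    using that X conj_closed unfolding G_def by (simp_all add: preimage_closed far_preimage)
  have [simp]: "fob G = X" by (simp add: G_def)
  have \<theta>_conj: "Cmp D (fob F (X d)) (fob F (X e)) e (\<theta> e) (conj d e h) = Cmp D (fob F (X d)) d e h (\<theta> d)"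
    if "d \<in> Ob D" "e \<in> Ob D" "h \<in> D.hom d e" for d e h
    unfolding conj_def using that FX \<theta> \<theta>' \<theta>\<theta>' by (simp add: D.Cmp_assoc D.Cmp_closed D.Cmp_Idm_left)
  have conj_Cmp: "conj c e (Cmp D c d e h g) =
      Cmp D (fob F (X c)) (fob F (X d)) (fob F (X e)) (conj d e h) (conj c d g)"
    if "c \<in> Ob D" "d \<in> Ob D" "e \<in> Ob D" "g \<in> D.hom c d" "h \<in> D.hom d e"
    for c d e g h
  proof -
    have "Cmp D (fob F (X c)) (fob F (X d)) (fob F (X e)) (conj d e h) (conj c d g) =
      Cmp D (fob F (X c)) e (fob F (X e)) (\<theta>' e) (Cmp D (fob F (X c)) (fob F (X d)) e
        (Cmp D (fob F (X d)) d e h (\<theta> d)) (conj c d g))"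
      unfolding conj_def[of d e h] using that FX \<theta> \<theta>' conj_closed by (simp add: D.Cmp_assoc D.Cmp_closed)
    also have "Cmp D (fob F (X c)) (fob F (X d)) e (Cmp D (fob F (X d)) d e h (\<theta> d)) (conj c d g) =
       Cmp D (fob F (X c)) c e (Cmp D c d e h g) (\<theta> c)"
      using that FX \<theta> \<theta>' conj_closed by (simp add: \<theta>_conj flip: D.Cmp_assoc)
    finally show ?thesis by (simp add: conj_def)
  qed
  have conj_Idm: "conj d d (Idm D d) = Idm D (fob F (X d))" if "d \<in> Ob D" for d
    unfolding conj_def using that FX \<theta> \<theta>' \<theta>'\<theta> by (simp add: D.Cmp_Idm_left)
  have G: "linear_functor K D C G"
  proof (rule linear_functor.intro)
    fix c d e g h k
    assume c: "c \<in> Ob D"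
    show "fob G c \<in> Ob C" using X c by simp
    show "far G c c (Idm D c) = Idm C (fob G c)"
      by (rule far_eqD[of "X c" "X c"])
        (use c X in \<open>simp_all add: G_closed D.Idm_closed C.Idm_closed F_G conj_Idm far_Idm\<close>)
    assume d: "d \<in> Ob D" and g: "g \<in> D.hom c d"
    show "far G c d g \<in> C.hom (fob G c) (fob G d)" using G_closed c d g by simp
    {
      fix g' assume g': "g' \<in> D.hom c d"
      show "far G c d (g \<oplus>\<^bsub>Hom D c d\<^esub> g') = far G c d g \<oplus>\<^bsub>Hom C (fob G c) (fob G d)\<^esub> far G c d g'"
        by (rule far_eqD[of "X c" "X d"]) 
          (use c d g g' X FX \<theta> \<theta>' in \<open>simp_all add: G_closed D.Hom_add C.Hom_add F_G far_add conj_def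
             D.Cmp_add_left D.Cmp_add_right D.Cmp_closed\<close>)
    }
    {
      assume k: "k \<in> carrier K"
      show "far G c d (k \<odot>\<^bsub>Hom D c d\<^esub> g) = k \<odot>\<^bsub>Hom C (fob G c) (fob G d)\<^esub> far G c d g"
        by (rule far_eqD[of "X c" "X d"]) 
          (use c d g k X FX \<theta> \<theta>' in \<open>simp_all add: G_closed D.Hom_smult C.Hom_smult F_G far_smult conj_def
             D.Cmp_smult_left D.Cmp_smult_right D.Cmp_closed\<close>)
    }
    assume e: "e \<in> Ob D" and h: "h \<in> D.hom d e"
    show "far G c e (Cmp D c d e h g) = Cmp C (fob G c) (fob G d) (fob G e) (far G d e h) (far G c d g)"
      by (rule far_eqD[of "X c" "X e"])
        (use c d e g h X in \<open>simp_all add: G_closed D.Cmp_closed C.Cmp_closed F_G far_Cmp conj_Cmp\<close>)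
  qed
  have FG: "naturally_isomorphic D D (comp_fctr F G) id_fctr"
    unfolding naturally_isomorphic_def
  proof (intro exI[of _ \<theta>] conjI ballI)
    show "iso_arr D (fob (comp_fctr F G) d) (fob id_fctr d) (\<theta> d)" if "d \<in> Ob D" for d
      unfolding iso_arr_def comp_fctr_def id_fctr_def
      using that \<theta> \<theta>' \<theta>\<theta>' \<theta>'\<theta> by (auto intro!: bexI[of _ "\<theta>' d"])
  qed (simp add: comp_fctr_def id_fctr_def F_G \<theta>_conj)
  \<comment> \<open>The isomorphism from G(F x) to x is the preimage under F of
    \<open>\<theta>\<close> at F x, so its naturality and invertibility are inherited from those of
    \<open>\<theta>\<close>.\<close>
  define \<eta> where "\<eta> = (\<lambda>x. preimage (X (fob F x)) x (\<theta> (fob F x)))"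
  have \<eta>: "\<eta> x \<in> C.hom (X (fob F x)) x" "far F (X (fob F x)) x (\<eta> x) = \<theta> (fob F x)"
    if "x \<in> Ob C" for x
    unfolding \<eta>_def using that X \<theta> fob_closed by (simp_all add: preimage_closed far_preimage)
  have GF: "naturally_isomorphic C C (comp_fctr G F) id_fctr"
    unfolding naturally_isomorphic_def
  proof (intro exI[of _ \<eta>] conjI ballI)
    show "iso_arr C (fob (comp_fctr G F) x) (fob id_fctr x) (\<eta> x)" if x: "x \<in> Ob C" for x
    proof -
      have "iso_arr D (fob F (X (fob F x))) (fob F x) (far F (X (fob F x)) x (\<eta> x))"
        unfolding iso_arr_def using x fob_closed[OF x] \<theta> \<theta>' \<theta>\<theta>' \<theta>'\<theta> \<eta>
        by (auto intro!: bexI[of _ "\<theta>' (fob F x)"])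
      with x fob_closed[OF x] X \<eta> show ?thesis by (simp add: comp_fctr_def id_fctr_def reflects_iso)
    qed
    fix x y f assume xy: "x \<in> Ob C" "y \<in> Ob C" and f: "f \<in> C.hom x y"
    note [simp] = fob_closed far_closed
    have "Cmp C (X (fob F x)) (X (fob F y)) y (\<eta> y) (far G (fob F x) (fob F y) (far F x y f)) =
      Cmp C (X (fob F x)) x y f (\<eta> x)"
      by (rule far_eqD[of "X (fob F x)" y])
        (use xy f X \<eta> in \<open>simp_all add: C.Cmp_closed G_closed far_Cmp F_G \<theta>_conj\<close>)
    then show "Cmp C (fob (comp_fctr G F) x) (fob (comp_fctr G F) y) (fob id_fctr y) (\<eta> y)
        (far (comp_fctr G F) x y f) =
      Cmp C (fob (comp_fctr G F) x) (fob id_fctr x) (fob id_fctr y) (far id_fctr x y f) (\<eta> x)"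
      by (simp add: comp_fctr_def id_fctr_def)
  qed
  show ?thesis unfolding linear_equivalence_def
    using C.linear_category_axioms D.linear_category_axioms linear_functor_axioms G FG GF by blast
qed

end

section \<open>Serre quotients as localisations\<close>

lemma Union_singleton_image: "\<lbrakk>\<And>X. X \<in> A \<Longrightarrow> X = B; A \<noteq> {}\<rbrakk> \<Longrightarrow> \<Union>A = B"
  by blast

lemma ne_if_in: "x \<in> A \<Longrightarrow> A \<noteq> {}"
  by blast

text \<open>The object \<open>w\<close> below plays the role of \<open>L (F x)\<close> for a left adjoint \<open>L\<close> of the functor.\<close>

locale localising_functor = C: linear_category K C + D: linear_category K D + linear_functor K C D F
  for K :: "'k ring" and C :: "('o, 'm, 'k) lin_cat" and D :: "('p, 'n, 'k) lin_cat" and F +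
  fixes S :: "'o set"
  assumes inverted_iso: "\<lbrakk>x \<in> Ob C; y \<in> Ob C; s \<in> inverted C S x y\<rbrakk>
      \<Longrightarrow> iso_arr D (fob F x) (fob F y) (far F x y s)"
    and coreflection: "x \<in> Ob C \<Longrightarrow> \<exists>w\<in>Ob C. \<exists>e\<in>inverted C S w x. \<forall>z\<in>Ob C.
      bij_betw (far F w z) (C.hom w z) (D.hom (fob F w) (fob F z))"
begin

text \<open>A morphism h of D represents the roof \<open>(z, s, f)\<close> if it is \<open>F f\<close> after the inverse of \<open>F s\<close>.\<close>

definition represents where
  "represents x y r h = (case r of (z, s, f) \<Rightarrow> z \<in> Ob C \<and> s \<in> C.hom z x \<and>
    f \<in> C.hom z y \<and> iso_arr D (fob F z) (fob F x) (far F z x s) \<and>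
    h \<in> D.hom (fob F x) (fob F y) \<and>
    Cmp D (fob F z) (fob F x) (fob F y) h (far F z x s) = far F z y f)"

text \<open>These sets will turn out to be the morphisms of the Serre quotient, labelled by
  morphisms h of D. \<open>represents\<close> asks of a denominator only that F makes it invertible;
  intersecting with \<open>roofs\<close> restores the condition that it be inverted in the sense of
  S.\<close>

definition cls where "cls x y h = {r \<in> roofs C S x y. represents x y r h}"

abbreviation "Q \<equiv> serre_quotient C S"

lemma inverted_closed: "s \<in> inverted C S x y \<Longrightarrow> s \<in> C.hom x y"
  by (simp add: inverted_def)

lemma represents_unique:
  assumes "x \<in> Ob C" "y \<in> Ob C" "represents x y r h" "represents x y r h'"
  shows "h = h'"
proof -
  obtain z s f where r: "r = (z, s, f)" by (cases r)
  show ?thesis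
    by (rule D.iso_arr_cancel_right[of "fob F z" "fob F x" "fob F y" "far F z x s"])
      (use assms in \<open>simp_all add: r represents_def fob_closed\<close>)
qed

lemma roofs_represent:
  assumes "x \<in> Ob C" "y \<in> Ob C" "r \<in> roofs C S x y"
  obtains h where "represents x y r h"
proof -
  obtain z s f where r: "r = (z, s, f)" "z \<in> Ob C" "s \<in> inverted C S z x" "f \<in> C.hom z y"
    using assms(3) by (auto simp: roofs_def)
  have iso: "iso_arr D (fob F z) (fob F x) (far F z x s)" using r assms inverted_iso by simp
  obtain h where "h \<in> D.hom (fob F x) (fob F y)"
    "Cmp D (fob F z) (fob F x) (fob F y) h (far F z x s) = far F z y f"
    by (rule D.iso_arr_factor_right[OF _ _ _ iso, of "fob F y" "far F z y f"])
      (use assms r in \<open>simp_all add: fob_closed far_closed\<close>)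
  then show thesis using that r assms iso inverted_closed by (simp add: represents_def)
qed

text \<open>Morphisms out of w are the same as morphisms of D out of F w. This holds when w is a
  value of a left adjoint of F at an object where the unit is an isomorphism.\<close>

definition coreflective where
  "coreflective w \<longleftrightarrow> w \<in> Ob C \<and> (\<forall>z\<in>Ob C.
    bij_betw (far F w z) (C.hom w z) (D.hom (fob F w) (fob F z)))"

lemma coreflective_lift:
  assumes "coreflective w" "z \<in> Ob C" "h \<in> D.hom (fob F w) (fob F z)"
  shows "\<exists>g\<in>C.hom w z. far F w z g = h"
proof -
  have "h \<in> far F w z ` C.hom w z"
    using assms by (simp add: coreflective_def bij_betw_def)
  then show ?thesis by blast
qed

lemma coreflective_inj:
  assumes "coreflective w" "z \<in> Ob C" "f \<in> C.hom w z" "g \<in> C.hom w z"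
    and "far F w z f = far F w z g"
  shows "f = g"
proof -
  have "inj_on (far F w z) (C.hom w z)"
    using assms by (simp add: coreflective_def bij_betw_def)
  then show ?thesis using assms by (simp add: inj_on_def)
qed

lemma coreflectionE:
  assumes "x \<in> Ob C"
  obtains w e where "coreflective w" "w \<in> Ob C" "e \<in> inverted C S w x" "e \<in> C.hom w x"
    "iso_arr D (fob F w) (fob F x) (far F w x e)"
proof -
  obtain w e where w: "w \<in> Ob C" "e \<in> inverted C S w x" and "coreflective w"
    using coreflection[OF assms] unfolding coreflective_def by blast
  then show thesis using that assms inverted_iso[OF w(1) assms w(2)] inverted_closed[OF w(2)] by blast
qed

text \<open>Since F s is invertible, F e factors through it in D, and the factor lifts back to C
  because it starts at F w. This takes the place of the Ore condition.\<close>

lemma coreflective_factor: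
  assumes x: "x \<in> Ob C" "z \<in> Ob C" "s \<in> C.hom z x" "iso_arr D (fob F z) (fob F x) (far F z x s)"
    and w: "coreflective w" "e \<in> C.hom w x"
  obtains u where "u \<in> C.hom w z" "Cmp C w z x s u = e"
proof -
  have w': "w \<in> Ob C" using w by (simp add: coreflective_def)
  obtain k where k: "k \<in> D.hom (fob F w) (fob F z)"
    "Cmp D (fob F w) (fob F z) (fob F x) (far F z x s) k = far F w x e"
    by (rule D.iso_arr_factor_left[OF _ _ _ x(4), of "fob F w" "far F w x e"])
      (use x w w' in \<open>simp_all add: fob_closed far_closed\<close>)
  obtain u where u: "u \<in> C.hom w z" "far F w z u = k"
    using coreflective_lift[OF w(1) x(2) k(1)] by blast
  have "Cmp C w z x s u = e"
    by (rule coreflective_inj[OF w(1) x(1)]) (use x w w' u k in \<open>simp_all add: C.Cmp_closed far_Cmp\<close>)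
  with u show thesis using that by blast
qed

text \<open>Equivalence of roofs is equality of the morphisms that they represent. Applying F to a
  common refinement gives one direction. For the other, both roofs are refined by one coreflective w
  over x, and equality of morphisms out of w can be tested in D. Of r it is only asked that it
  represents h, so a composite of denominators can be used as soon as F makes it invertible.\<close>

lemma fraction_eq_cls:
  assumes x: "x \<in> Ob C" and y: "y \<in> Ob C" and r: "represents x y r h"
  shows "fraction C S x y r = cls x y h"
proof -
  obtain z s f where r_eq: "r = (z, s, f)" by (cases r)
  have z: "z \<in> Ob C" "s \<in> C.hom z x" "f \<in> C.hom z y"
    "iso_arr D (fob F z) (fob F x) (far F z x s)" "h \<in> D.hom (fob F x) (fob F y)"
    "far F z y f = Cmp D (fob F z) (fob F x) (fob F y) h (far F z x s)"
    using r by (simp_all add: r_eq represents_def)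
  have "r' \<in> cls x y h" if "r' \<in> fraction C S x y r" for r'
  proof -
    obtain z' s' f' where r': "r' = (z', s', f')" by (cases r')
    with that obtain w u u' where roof: "(z', s', f') \<in> roofs C S x y" and w: "w \<in> Ob C"
      "u \<in> C.hom w z" "u' \<in> C.hom w z'"
      "Cmp C w z x s u \<in> inverted C S w x"
      "Cmp C w z x s u = Cmp C w z' x s' u'" "Cmp C w z y f u = Cmp C w z' y f' u'"
      unfolding r_eq fraction_def by blast
    obtain h' where h': "represents x y (z', s', f') h'"
      using roofs_represent[OF x y roof] .
    then have z': "z' \<in> Ob C" "s' \<in> C.hom z' x" "f' \<in> C.hom z' y"
      "h' \<in> D.hom (fob F x) (fob F y)"
      "far F z' y f' = Cmp D (fob F z') (fob F x) (fob F y) h' (far F z' x s')"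
      by (simp_all add: represents_def)
    note [simp] = fob_closed far_closed D.Cmp_closed C.Cmp_closed
    have "Cmp D (fob F w) (fob F x) (fob F y) h (far F w x (Cmp C w z x s u)) =
        far F w y (Cmp C w z y f u)"
      using x y z w(1,2) by (simp add: far_Cmp D.Cmp_assoc)
    also have "\<dots> = Cmp D (fob F w) (fob F x) (fob F y) h' (far F w x (Cmp C w z x s u))"
      using x y z' w(1-3) unfolding w(5,6) by (simp add: far_Cmp D.Cmp_assoc)
    finally have "h = h'"
      by (rule D.iso_arr_cancel_right[OF _ _ _ inverted_iso[OF w(1) x w(4)], rotated -1])
        (use x y z z' w(1) in simp_all)
    with h' roof r' show ?thesis by (simp add: cls_def)
  qed
  moreover have "r' \<in> fraction C S x y r" if "r' \<in> cls x y h" for r'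
  proof -
    obtain z' s' f' where r'_eq: "r' = (z', s', f')" by (cases r')
    have r': "r' \<in> roofs C S x y" "represents x y r' h" using that by (simp_all add: cls_def)
    then have z': "z' \<in> Ob C" "s' \<in> C.hom z' x" "f' \<in> C.hom z' y"
      "iso_arr D (fob F z') (fob F x) (far F z' x s')"
      "far F z' y f' = Cmp D (fob F z') (fob F x) (fob F y) h (far F z' x s')"
      by (simp_all add: r'_eq represents_def)
    \<comment> \<open>A single w refines both roofs, because e factors through s and through
      \<open>s'\<close>.\<close>
    obtain w e where w: "w \<in> Ob C" "e \<in> inverted C S w x" "e \<in> C.hom w x"
      and co: "coreflective w"
      using coreflectionE[OF x] by blast
    obtain u where u: "u \<in> C.hom w z" "Cmp C w z x s u = e"
      using coreflective_factor[OF x z(1,2,4) co w(3)] by blast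
    obtain u' where u': "u' \<in> C.hom w z'" "Cmp C w z' x s' u' = e"
      using coreflective_factor[OF x z'(1,2,4) co w(3)] by blast
    have "far F w y (Cmp C w z y f u) = Cmp D (fob F w) (fob F x) (fob F y) h
      (far F w x (Cmp C w z x s u))"
      using x y z w u(1) by (simp add: far_Cmp D.Cmp_assoc fob_closed far_closed)
    moreover have "far F w y (Cmp C w z' y f' u') =
      Cmp D (fob F w) (fob F x) (fob F y) h (far F w x (Cmp C w z' x s' u'))"
      using x y z z' w u'(1) by (simp add: far_Cmp D.Cmp_assoc fob_closed far_closed)
    ultimately have "Cmp C w z y f u = Cmp C w z' y f' u'"
      using x y z z' w u u' by (intro coreflective_inj[OF co y]) (simp_all add: C.Cmp_closed)
    then have "\<exists>w\<in>Ob C. \<exists>u\<in>C.hom w z. \<exists>u'\<in>C.hom w z'.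
        Cmp C w z x s u \<in> inverted C S w x \<and> Cmp C w z x s u = Cmp C w z' x s' u' \<and>
        Cmp C w z y f u = Cmp C w z' y f' u'"
      using w u u' by (intro bexI[of _ w] bexI[of _ u] bexI[of _ u']) simp_all
    then show ?thesis using r' unfolding fraction_def r_eq r'_eq by simp
  qed
  ultimately show ?thesis by blast
qed

text \<open>The quantifiers give one denominator for all h: a map e from a coreflective w to x, with
  the lift of h after F e as numerator. Sums of classes require roofs with such a common
  denominator.\<close>

lemma cls_nonempty:
  assumes "x \<in> Ob C" "y \<in> Ob C"
  shows "\<exists>z s. \<forall>h\<in>D.hom (fob F x) (fob F y). \<exists>f. (z, s, f) \<in> cls x y h"
proof -
  obtain w e where w: "w \<in> Ob C" "e \<in> inverted C S w x" "e \<in> C.hom w x"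
      "iso_arr D (fob F w) (fob F x) (far F w x e)" and co: "coreflective w"
    using coreflectionE[OF assms(1)] by blast
  show ?thesis
  proof (rule exI[of _ w], rule exI[of _ e], rule ballI)
    fix h assume h: "h \<in> D.hom (fob F x) (fob F y)"
    obtain f where "f \<in> C.hom w y"
      "far F w y f = Cmp D (fob F w) (fob F x) (fob F y) h (far F w x e)"
      using coreflective_lift[OF co assms(2)] D.Cmp_closed[of "fob F w" "fob F x" "fob F y"] h w assms
      by (meson fob_closed far_closed)
    with w h have "(w, e, f) \<in> cls x y h" by (auto simp: cls_def roofs_def represents_def)
    then show "\<exists>f. (w, e, f) \<in> cls x y h" ..
  qed
qed

lemma cls_inj:
  assumes "x \<in> Ob C" "y \<in> Ob C" "h \<in> D.hom (fob F x) (fob F y)" "cls x y h = cls x y h'"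
  shows "h = h'"
proof -
  obtain z s where "\<forall>h\<in>D.hom (fob F x) (fob F y). \<exists>f. (z, s, f) \<in> cls x y h"
    using cls_nonempty[OF assms(1,2)] by blast
  then obtain r where "r \<in> cls x y h" using assms(3) by blast
  moreover from this have "r \<in> cls x y h'" using assms(4) by simp
  ultimately show ?thesis using represents_unique[OF assms(1,2), of r h h'] by (simp add: cls_def)
qed

section \<open>Hom spaces and operations of the Serre quotient, labelled by morphisms of the
  target\<close>

lemma Q_carrier:
  assumes "x \<in> Ob C" "y \<in> Ob C"
  shows "cls x y ` D.hom (fob F x) (fob F y) = carrier (Hom Q x y)"
proof -
  have "fraction C S x y ` roofs C S x y = cls x y ` D.hom (fob F x) (fob F y)"
  proof (intro equalityI subsetI)
    fix p assume "p \<in> fraction C S x y ` roofs C S x y"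
    then obtain r where r: "r \<in> roofs C S x y" "p = fraction C S x y r" by blast
    then obtain h where "represents x y r h" using roofs_represent assms by blast
    then show "p \<in> cls x y ` D.hom (fob F x) (fob F y)"
      using r assms fraction_eq_cls by (auto simp: represents_def)
  next
    fix p assume "p \<in> cls x y ` D.hom (fob F x) (fob F y)"
    then obtain h where h: "h \<in> D.hom (fob F x) (fob F y)" "p = cls x y h" by blast
    obtain z s where "\<forall>h\<in>D.hom (fob F x) (fob F y). \<exists>f. (z, s, f) \<in> cls x y h"
      using cls_nonempty[OF assms] by blast
    then obtain r where "r \<in> cls x y h" using h by blast
    then show "p \<in> fraction C S x y ` roofs C S x y"
      using h fraction_eq_cls[OF assms, of r h] by (auto simp: cls_def)
  qed
  then show ?thesis by (simp add: serre_quotient_def)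
qed

lemma Q_zero:
  assumes "x \<in> Ob C" "y \<in> Ob C"
  shows "\<zero>\<^bsub>Hom Q x y\<^esub> = cls x y \<zero>\<^bsub>Hom D (fob F x) (fob F y)\<^esub>"
proof -
  have "linear_map K (Hom C x y) (Hom D (fob F x) (fob F y)) (far F x y)"
    using assms by (simp add: linear_mapI far_closed far_add far_smult)
  from linear_map_zero[OF this C.Hom_module[OF assms] D.Hom_module]
  have "far F x y \<zero>\<^bsub>Hom C x y\<^esub> = \<zero>\<^bsub>Hom D (fob F x) (fob F y)\<^esub>"
    using assms by (simp add: fob_closed)
  then have "represents x y (x, Idm C x, \<zero>\<^bsub>Hom C x y\<^esub>) \<zero>\<^bsub>Hom D (fob F x) (fob F y)\<^esub>"
    using assms by (simp add: represents_def C.Idm_closed C.Hom_zero D.Hom_zero fob_closed far_Idm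
      D.iso_arr_Idm D.Cmp_Idm_right)
  then show ?thesis using fraction_eq_cls assms by (simp add: serre_quotient_def)
qed

lemma Q_Idm:
  assumes "x \<in> Ob C"
  shows "Idm Q x = cls x x (Idm D (fob F x))"
proof -
  have "represents x x (x, Idm C x, Idm C x) (Idm D (fob F x))"
    using assms by (simp add: represents_def C.Idm_closed D.Idm_closed fob_closed far_Idm
      D.iso_arr_Idm D.Cmp_Idm_right)
  then show ?thesis using fraction_eq_cls assms by (simp add: serre_quotient_def)
qed

text \<open>Every roof that contributes to the union represents the sum of h and k, by additivity of
  F, so all the contributed classes coincide; a common denominator shows that there is at least
  one.\<close>

lemma Q_add:
  assumes xy: "x \<in> Ob C" "y \<in> Ob C"
    and h: "h \<in> D.hom (fob F x) (fob F y)" "k \<in> D.hom (fob F x) (fob F y)"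
  shows "cls x y h \<oplus>\<^bsub>Hom Q x y\<^esub> cls x y k = cls x y (h \<oplus>\<^bsub>Hom D (fob F x) (fob F y)\<^esub> k)"
proof -
  have "\<Union>{fraction C S x y (z, s, f \<oplus>\<^bsub>Hom C z y\<^esub> g) | z s f g.
      (z, s, f) \<in> cls x y h \<and> (z, s, g) \<in> cls x y k} = cls x y (h \<oplus>\<^bsub>Hom D (fob F x) (fob F y)\<^esub> k)"
  proof (rule Union_singleton_image)
    obtain z s where "\<forall>h\<in>D.hom (fob F x) (fob F y). \<exists>f. (z, s, f) \<in> cls x y h"
      using cls_nonempty[OF xy] by blast
    from bspec[OF this h(1)] bspec[OF this h(2)]
    obtain f g where "(z, s, f) \<in> cls x y h" "(z, s, g) \<in> cls x y k" by blast
    then have "fraction C S x y (z, s, f \<oplus>\<^bsub>Hom C z y\<^esub> g) \<in>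
      {fraction C S x y (z, s, f \<oplus>\<^bsub>Hom C z y\<^esub> g) | z s f g.
      (z, s, f) \<in> cls x y h \<and> (z, s, g) \<in> cls x y k}" by blast
    then show "{fraction C S x y (z, s, f \<oplus>\<^bsub>Hom C z y\<^esub> g) | z s f g.
      (z, s, f) \<in> cls x y h \<and> (z, s, g) \<in> cls x y k} \<noteq> {}" by (rule ne_if_in)
  next
    fix p assume "p \<in> {fraction C S x y (z, s, f \<oplus>\<^bsub>Hom C z y\<^esub> g) | z s f g.
      (z, s, f) \<in> cls x y h \<and> (z, s, g) \<in> cls x y k}"
    then obtain z s f g where p: "p = fraction C S x y (z, s, f \<oplus>\<^bsub>Hom C z y\<^esub> g)"
      "(z, s, f) \<in> cls x y h" "(z, s, g) \<in> cls x y k" by blast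
    then have "represents x y (z, s, f \<oplus>\<^bsub>Hom C z y\<^esub> g) (h \<oplus>\<^bsub>Hom D (fob F x) (fob F y)\<^esub> k)"
      using xy h
      by (auto simp: cls_def represents_def C.Hom_add D.Hom_add fob_closed far_add D.Cmp_add_left
        far_closed)
    then show "p = cls x y (h \<oplus>\<^bsub>Hom D (fob F x) (fob F y)\<^esub> k)"
      using p fraction_eq_cls xy by simp
  qed
  then show ?thesis by (simp add: serre_quotient_def)
qed

lemma Q_smult:
  assumes xy: "x \<in> Ob C" "y \<in> Ob C"
    and h: "h \<in> D.hom (fob F x) (fob F y)" "c \<in> carrier K"
  shows "c \<odot>\<^bsub>Hom Q x y\<^esub> cls x y h = cls x y (c \<odot>\<^bsub>Hom D (fob F x) (fob F y)\<^esub> h)"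
proof -
  have "\<Union>{fraction C S x y (z, s, c \<odot>\<^bsub>Hom C z y\<^esub> f) | z s f.
      (z, s, f) \<in> cls x y h} = cls x y (c \<odot>\<^bsub>Hom D (fob F x) (fob F y)\<^esub> h)"
  proof (rule Union_singleton_image)
    obtain z s where "\<forall>h\<in>D.hom (fob F x) (fob F y). \<exists>f. (z, s, f) \<in> cls x y h"
      using cls_nonempty[OF xy] by blast
    then show "{fraction C S x y (z, s, c \<odot>\<^bsub>Hom C z y\<^esub> f) | z s f. (z, s, f) \<in> cls x y h} \<noteq> {}"
      using h by simp blast
  next
    fix p assume "p \<in> {fraction C S x y (z, s, c \<odot>\<^bsub>Hom C z y\<^esub> f) | z s f. (z, s, f) \<in> cls x y h}"
    then obtain z s f where p: "p = fraction C S x y (z, s, c \<odot>\<^bsub>Hom C z y\<^esub> f)"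
      "(z, s, f) \<in> cls x y h" by blast
    then have "represents x y (z, s, c \<odot>\<^bsub>Hom C z y\<^esub> f) (c \<odot>\<^bsub>Hom D (fob F x) (fob F y)\<^esub> h)"
      using xy h
      by (auto simp: cls_def represents_def C.Hom_smult D.Hom_smult fob_closed far_smult
        D.Cmp_smult_left far_closed)
    then show "p = cls x y (c \<odot>\<^bsub>Hom D (fob F x) (fob F y)\<^esub> h)"
      using p fraction_eq_cls xy by simp
  qed
  then show ?thesis by (simp add: serre_quotient_def)
qed

lemma Q_Cmp:
  assumes xyz: "x \<in> Ob C" "y \<in> Ob C" "z \<in> Ob C"
    and h: "h \<in> D.hom (fob F x) (fob F y)" and k: "k \<in> D.hom (fob F y) (fob F z)"
  shows "Cmp Q x y z (cls y z k) (cls x y h) = cls x z (Cmp D (fob F x) (fob F y) (fob F z) k h)"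
    (is "_ = ?R")
proof -
  let ?A = "{fraction C S x z (w, Cmp C w a x s u, Cmp C w b z g v) | a s f b t g w u v.
      (a, s, f) \<in> cls x y h \<and> (b, t, g) \<in> cls y z k \<and> w \<in> Ob C \<and>
      u \<in> inverted C S w a \<and> v \<in> C.hom w b \<and> Cmp C w a y f u = Cmp C w b y t v}"
  note [simp] = fob_closed far_closed D.Cmp_closed C.Cmp_closed
  have "\<Union>?A = ?R"
  proof (rule Union_singleton_image)
    \<comment> \<open>There is a contribution to the union: with e from a coreflective w to a, the
      map f after e factors through t, the denominator of the second roof.\<close>
    obtain a s where "\<forall>h\<in>D.hom (fob F x) (fob F y). \<exists>f. (a, s, f) \<in> cls x y h"
      using cls_nonempty[OF xyz(1,2)] by blast
    then obtain f where f: "(a, s, f) \<in> cls x y h" using h by blast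
    obtain b t where "\<forall>k\<in>D.hom (fob F y) (fob F z). \<exists>g. (b, t, g) \<in> cls y z k"
      using cls_nonempty[OF xyz(2,3)] by blast
    then obtain g where g: "(b, t, g) \<in> cls y z k" using k by blast
    have a: "a \<in> Ob C" "f \<in> C.hom a y" and b: "b \<in> Ob C" "t \<in> C.hom b y"
      "iso_arr D (fob F b) (fob F y) (far F b y t)"
      using f g by (simp_all add: cls_def represents_def)
    obtain w e where w: "w \<in> Ob C" "e \<in> inverted C S w a" "e \<in> C.hom w a"
      and co: "coreflective w"
      using coreflectionE[OF a(1)] by blast
    have "Cmp C w a y f e \<in> C.hom w y" using a w xyz by simp
    then obtain v where "v \<in> C.hom w b" "Cmp C w b y t v = Cmp C w a y f e"
      using coreflective_factor[OF xyz(2) b co] by blast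
    then have "\<exists>w v u. w \<in> Ob C \<and> u \<in> inverted C S w a \<and> v \<in> C.hom w b \<and>
        Cmp C w a y f u = Cmp C w b y t v" using w by metis
    then show "?A \<noteq> {}" using f g by simp blast
  next
    fix p assume "p \<in> ?A"
    then obtain a s f b t g w u v where p: "p = fraction C S x z (w, Cmp C w a x s u, Cmp C w b z g v)"
      and f: "(a, s, f) \<in> cls x y h" and g: "(b, t, g) \<in> cls y z k" and w: "w \<in> Ob C"
      "u \<in> inverted C S w a" "v \<in> C.hom w b" "Cmp C w a y f u = Cmp C w b y t v" by blast
    have a: "a \<in> Ob C" "s \<in> C.hom a x" "f \<in> C.hom a y"
        "iso_arr D (fob F a) (fob F x) (far F a x s)"
        "Cmp D (fob F a) (fob F x) (fob F y) h (far F a x s) = far F a y f"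
      and b: "b \<in> Ob C" "t \<in> C.hom b y" "g \<in> C.hom b z"
        "Cmp D (fob F b) (fob F y) (fob F z) k (far F b y t) = far F b z g"
      using f g by (simp_all add: cls_def represents_def)
    have u: "u \<in> C.hom w a" using w(2) by (rule inverted_closed)
    \<comment> \<open>The composite kh is moved past the new denominator by three relations in turn:
      h after F s is F f, the square f u = t v commutes, and k after F t is F g.\<close>
    have "Cmp D (fob F w) (fob F x) (fob F z) (Cmp D (fob F x) (fob F y) (fob F z) k h)
        (far F w x (Cmp C w a x s u)) =
      Cmp D (fob F w) (fob F y) (fob F z) k (Cmp D (fob F w) (fob F a) (fob F y)
        (Cmp D (fob F a) (fob F x) (fob F y) h (far F a x s)) (far F w a u))"
      using xyz h k w(1) a(1-4) u by (simp add: far_Cmp D.Cmp_assoc)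
    also have "\<dots> = Cmp D (fob F w) (fob F y) (fob F z) k (far F w y (Cmp C w b y t v))"
      unfolding a(5) w(4)[symmetric] using xyz w(1) a(1-3) u by (simp add: far_Cmp)
    also have "\<dots> = far F w z (Cmp C w b z g v)"
      using xyz k w(1,3) b by (simp add: far_Cmp D.Cmp_assoc)
    finally have "represents x z (w, Cmp C w a x s u, Cmp C w b z g v)
        (Cmp D (fob F x) (fob F y) (fob F z) k h)"
      using xyz h k w(1,3) a b u inverted_iso[OF w(1) a(1) w(2)]
      by (simp add: represents_def far_Cmp D.iso_arr_Cmp)
    then show "p = ?R" using p fraction_eq_cls xyz by simp
  qed
  then show ?thesis by (simp add: serre_quotient_def)
qed

lemma Ob_Q [simp]: "Ob Q = Ob C"
  by (simp add: serre_quotient_def)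

lemma linear_category_Q: "linear_category K Q"
proof (rule linear_category_image[where D = D and Fo = "fob F" and q = cls])
  show "linear_map K (Hom D (fob F x) (fob F y)) (Hom Q x y) (cls x y)"
    if "x \<in> Ob Q" "y \<in> Ob Q" for x y
    by (rule linear_mapI) (use that Q_carrier[of x y] in \<open>auto simp: Q_add Q_smult\<close>)
qed (use Q_carrier Q_zero Q_Idm Q_Cmp fob_closed D.linear_category_axioms in simp_all)

text \<open>A class is sent to its label, which is unique because \<open>cls x y\<close> is
  injective. On objects there is nothing new, since the Serre quotient keeps the objects of
  C.\<close>

definition induced where
  "induced = \<lparr>fob = fob F, far = (\<lambda>x y p. THE h. h \<in> D.hom (fob F x) (fob F y) \<and> p = cls x y h)\<rparr>"

lemma fob_induced [simp]: "fob induced = fob F"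
  by (simp add: induced_def)

lemma far_induced [simp]:
  assumes "x \<in> Ob C" "y \<in> Ob C" "h \<in> D.hom (fob F x) (fob F y)"
  shows "far induced x y (cls x y h) = h"
  unfolding induced_def using assms by (auto intro!: the_equality dest: cls_inj)

lemma Q_HomE:
  assumes "p \<in> carrier (Hom Q x y)" "x \<in> Ob C" "y \<in> Ob C"
  obtains h where "h \<in> D.hom (fob F x) (fob F y)" "p = cls x y h"
  using assms(1) unfolding Q_carrier[OF assms(2,3), symmetric] by blast

text \<open>On Hom spaces \<open>cls x y\<close> is a two-sided inverse, and the operations were
  computed on labels.\<close>

lemma fully_faithful_induced: "fully_faithful K Q D induced"
proof (intro fully_faithful.intro linear_functor.intro linear_category_Q D.linear_category_axioms
    fully_faithful_axioms.intro)
  fix x y z p q c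
  assume "x \<in> Ob Q"
  then have x: "x \<in> Ob C" by simp
  show "fob induced x \<in> Ob D" using x by (simp add: fob_closed)
  show "far induced x x (Idm Q x) = Idm D (fob induced x)"
    using x by (simp add: Q_Idm D.Idm_closed fob_closed)
  assume "y \<in> Ob Q"
  then have y: "y \<in> Ob C" by simp
  show "bij_betw (far induced x y) (carrier (Hom Q x y)) (D.hom (fob induced x) (fob induced y))"
    unfolding Q_carrier[OF x y, symmetric]
    by (rule bij_betw_byWitness[where f' = "cls x y"]) (use x y in auto)
  assume "p \<in> carrier (Hom Q x y)"
  then obtain h where h: "h \<in> D.hom (fob F x) (fob F y)" and p: "p = cls x y h"
    using Q_HomE x y by blast
  show "far induced x y p \<in> D.hom (fob induced x) (fob induced y)"
    using x y h p by simp
  {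
    assume "c \<in> carrier K"
    with x y h p show "far induced x y (c \<odot>\<^bsub>Hom Q x y\<^esub> p) =
      c \<odot>\<^bsub>Hom D (fob induced x) (fob induced y)\<^esub> far induced x y p"
      by (simp add: Q_smult D.Hom_smult fob_closed)
  }
  {
    fix q assume "q \<in> carrier (Hom Q x y)"
    then obtain k where "k \<in> D.hom (fob F x) (fob F y)" and "q = cls x y k"
      using Q_HomE x y by blast
    with x y h p show "far induced x y (p \<oplus>\<^bsub>Hom Q x y\<^esub> q) =
        far induced x y p \<oplus>\<^bsub>Hom D (fob induced x) (fob induced y)\<^esub> far induced x y q"
      by (simp add: Q_add D.Hom_add fob_closed)
  }
  assume "z \<in> Ob Q"
  then have z: "z \<in> Ob C" by simp
  assume "q \<in> carrier (Hom Q y z)"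
  then obtain k where "k \<in> D.hom (fob F y) (fob F z)" and "q = cls y z k"
    using Q_HomE y z by blast
  with x y z h p show "far induced x z (Cmp Q x y z q p) =
      Cmp D (fob induced x) (fob induced y) (fob induced z) (far induced y z q) (far induced x y p)"
    by (simp add: Q_Cmp D.Cmp_closed fob_closed)
qed

theorem serre_quotient_equivalence:
  assumes "\<And>d. d \<in> Ob D \<Longrightarrow> \<exists>x\<in>Ob C. isomorphic D (fob F x) d"
  shows "linear_equivalence K Q D induced"
  using assms by (intro fully_faithful.linear_equivalence_if_essentially_surjective
    fully_faithful_induced) simp

end

section \<open>Finitely presented modules\<close>

context linear_category
begin

lemma Hom_abelian_group: "\<lbrakk>x \<in> Ob C; y \<in> Ob C\<rbrakk> \<Longrightarrow> abelian_group (Hom C x y)"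
  using Hom_module[of x y] by (simp add: module_def)

section \<open>Representable modules and presentations in terms of elements\<close>

lemma cat_module_yoneda:
  assumes "c \<in> Ob C"
  shows "cat_module K C (yoneda C c)"
proof (rule cat_moduleI)
  show "module K (fob (yoneda C c) x)" if "x \<in> Ob C" for x
    using that assms by (simp add: yoneda_def Hom_module)
  show "far (yoneda C c) y x f \<in> lin_hom K (fob (yoneda C c) y) (fob (yoneda C c) x)"
    if "x \<in> Ob C" "y \<in> Ob C" "f \<in> hom x y" for x y f
    using linear_map_restrict[OF Cmp_linear_left[of x y c f] Hom_module] that assms
    by (simp add: yoneda_def)
qed (use assms in \<open>auto simp: yoneda_def Cmp_closed Cmp_assoc Cmp_Idm_right Cmp_add_right Cmp_smult_right
  linear_category_axioms\<close>)

lemma yoneda_simps [simp]: "fob (yoneda C c) x = Hom C x c"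
  "g \<in> hom y c \<Longrightarrow> far (yoneda C c) y x f g = Cmp C x y c g f"
  by (simp_all add: yoneda_def)

lemma nat_maps_yoneda:
  assumes X: "cat_module K C X" and c: "c \<in> Ob C" and v: "v \<in> carrier (fob X c)"
  shows "(\<lambda>x\<in>Ob C. \<lambda>g\<in>hom x c. far X c x g v) \<in> nat_maps K C (yoneda C c) X"
proof (rule nat_mapsI)
  fix x assume "x \<in> Ob C"
  then show "(\<lambda>x\<in>Ob C. \<lambda>g\<in>hom x c. far X c x g v) x \<in> lin_hom K (fob (yoneda C c) x) (fob X x)"
    using linear_map_restrict[OF cat_module_eval_linear[OF X _ c v] Hom_module] c by simp
qed (use assms in \<open>auto simp: Cmp_closed cat_module_Cmp\<close>)

text \<open>Naturality of \<open>\<epsilon>\<close> along g, evaluated at the identity of c.\<close>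

lemma yoneda_nat_maps_apply:
  assumes "c \<in> Ob C" "\<epsilon> \<in> nat_maps K C (yoneda C c) X" "x \<in> Ob C" "g \<in> hom x c"
  shows "\<epsilon> x g = far X c x g (\<epsilon> c (Idm C c))"
  using nat_maps_natural[OF assms(2,3,1,4), of "Idm C c"] assms by (simp add: Idm_closed Cmp_Idm_left)

text \<open>By Yoneda, an epimorphism from C(-,c) onto X is an element e of X(c) whose restrictions
  along morphisms into c exhaust X. This form avoids natural transformations between modules in
  different universes.\<close>

definition generates where
  "generates X c e \<longleftrightarrow> c \<in> Ob C \<and> e \<in> carrier (fob X c) \<and>
    (\<forall>x\<in>Ob C. \<forall>v\<in>carrier (fob X x). \<exists>g\<in>hom x c. far X c x g e = v)"

text \<open>The exact sequence C(-,c1) -> C(-,c0) -> X -> 0 in terms of its Yoneda data: the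
  morphism d and the element e, with the multiples of d as the relations of e.\<close>

definition presents where
  "presents X c1 c0 d e \<longleftrightarrow> generates X c0 e \<and> c1 \<in> Ob C \<and> d \<in> hom c1 c0 \<and>
    (\<forall>x\<in>Ob C. \<forall>g\<in>hom x c0. far X c0 x g e = \<zero>\<^bsub>fob X x\<^esub> \<longleftrightarrow> (\<exists>h\<in>hom x c1. g = Cmp C x c1 c0 d h))"

lemma generatesD:
  assumes "generates X c e"
  shows "c \<in> Ob C" "e \<in> carrier (fob X c)"
    "\<And>x v. \<lbrakk>x \<in> Ob C; v \<in> carrier (fob X x)\<rbrakk> \<Longrightarrow> \<exists>g\<in>hom x c. far X c x g e = v"
  using assms by (auto simp: generates_def)

lemma presentsD:
  assumes "presents X c1 c0 d e"
  shows "generates X c0 e" "c1 \<in> Ob C" "c0 \<in> Ob C" "d \<in> hom c1 c0" "e \<in> carrier (fob X c0)"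
    "\<And>x g. \<lbrakk>x \<in> Ob C; g \<in> hom x c0\<rbrakk>
      \<Longrightarrow> far X c0 x g e = \<zero>\<^bsub>fob X x\<^esub> \<longleftrightarrow> (\<exists>h\<in>hom x c1. g = Cmp C x c1 c0 d h)"
  using assms by (auto simp: generates_def presents_def)

lemma finitely_generated_iff:
  assumes X: "cat_module K C X"
  shows "finitely_generated K C X \<longleftrightarrow> (\<exists>c e. generates X c e)"
proof
  assume "finitely_generated K C X"
  then obtain c \<epsilon> where c: "c \<in> Ob C" and \<epsilon>: "\<epsilon> \<in> nat_maps K C (yoneda C c) X"
    and surj: "\<And>x. x \<in> Ob C \<Longrightarrow> \<epsilon> x ` hom x c = carrier (fob X x)"
    unfolding finitely_generated_def by blast
  have "generates X c (\<epsilon> c (Idm C c))" unfolding generates_def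
  proof (intro conjI ballI)
    show "\<epsilon> c (Idm C c) \<in> carrier (fob X c)" using surj[OF c] Idm_closed[OF c] by blast
    fix x v assume x: "x \<in> Ob C" and "v \<in> carrier (fob X x)"
    then obtain g where g: "g \<in> hom x c" "v = \<epsilon> x g" using surj by blast
    then show "\<exists>g\<in>hom x c. far X c x g (\<epsilon> c (Idm C c)) = v"
      using yoneda_nat_maps_apply[OF c \<epsilon> x g(1)] by (intro bexI[of _ g]) simp_all
  qed (rule c)
  then show "\<exists>c e. generates X c e" by blast
next
  assume "\<exists>c e. generates X c e"
  then obtain c e where g: "generates X c e" by blast
  note g' = generatesD[OF g]
  have "(\<lambda>x\<in>Ob C. \<lambda>g\<in>hom x c. far X c x g e) x ` hom x c = carrier (fob X x)" if "x \<in> Ob C" for x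
    using that g' cat_module_closed[OF X that g'(1)] by (auto simp: image_iff)
  then show "finitely_generated K C X"
    unfolding finitely_generated_def using nat_maps_yoneda[OF X g'(1,2)] g'(1)
    by (intro bexI[of _ c] bexI[of _ "\<lambda>x\<in>Ob C. \<lambda>g\<in>hom x c. far X c x g e"]) simp_all
qed

lemma finitely_presented_iff:
  assumes X: "cat_module K C X"
  shows "finitely_presented K C X \<longleftrightarrow> (\<exists>c1 c0 d e. presents X c1 c0 d e)"
proof
  assume "finitely_presented K C X"
  then obtain c1 c0 \<delta> \<epsilon> where c: "c1 \<in> Ob C" "c0 \<in> Ob C"
    and \<delta>: "\<delta> \<in> nat_maps K C (yoneda C c1) (yoneda C c0)" and \<epsilon>: "\<epsilon> \<in> nat_maps K C (yoneda C c0) X"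
    and *: "\<forall>x\<in>Ob C. \<epsilon> x ` hom x c0 = carrier (fob X x) \<and>
      \<delta> x ` hom x c1 = {g \<in> hom x c0. \<epsilon> x g = \<zero>\<^bsub>fob X x\<^esub>}"
    unfolding finitely_presented_def by (elim bexE) (rule that)
  have surj: "\<epsilon> x ` hom x c0 = carrier (fob X x)"
    and ker: "\<delta> x ` hom x c1 = {g \<in> hom x c0. \<epsilon> x g = \<zero>\<^bsub>fob X x\<^esub>}" if "x \<in> Ob C" for x
    using * that by simp_all
  define e where "e = \<epsilon> c0 (Idm C c0)"
  define d where "d = \<delta> c1 (Idm C c1)"
  have d: "d \<in> hom c1 c0"
    unfolding d_def using nat_maps_closed[OF \<delta> c(1), of "Idm C c1"] Idm_closed[OF c(1)] by simp
  have \<epsilon>_eq: "\<epsilon> x g = far X c0 x g e" if "x \<in> Ob C" "g \<in> hom x c0" for x g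
    unfolding e_def using yoneda_nat_maps_apply[OF c(2) \<epsilon> that] .
  have \<delta>_eq: "\<delta> x g = Cmp C x c1 c0 d g" if "x \<in> Ob C" "g \<in> hom x c1" for x g
    using yoneda_nat_maps_apply[OF c(1) \<delta> that] d by (simp add: d_def)
  have "presents X c1 c0 d e" unfolding presents_def generates_def
  proof (intro conjI ballI)
    show "e \<in> carrier (fob X c0)" unfolding e_def using surj[OF c(2)] Idm_closed[OF c(2)] by blast
    fix x assume x: "x \<in> Ob C"
    show "\<exists>g\<in>hom x c0. far X c0 x g e = v" if "v \<in> carrier (fob X x)" for v
      using that surj[OF x] \<epsilon>_eq[OF x] by force
    show "far X c0 x g e = \<zero>\<^bsub>fob X x\<^esub> \<longleftrightarrow> (\<exists>h\<in>hom x c1. g = Cmp C x c1 c0 d h)"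
      if g: "g \<in> hom x c0" for g
    proof -
      have "far X c0 x g e = \<zero>\<^bsub>fob X x\<^esub> \<longleftrightarrow> g \<in> \<delta> x ` hom x c1"
        unfolding ker[OF x] using g \<epsilon>_eq[OF x] by simp
      also have "\<dots> \<longleftrightarrow> (\<exists>h\<in>hom x c1. g = Cmp C x c1 c0 d h)"
        using \<delta>_eq[OF x] by (auto simp: image_iff)
      finally show ?thesis .
    qed
  qed (use c d in auto)
  then show "\<exists>c1 c0 d e. presents X c1 c0 d e" by blast
next
  assume "\<exists>c1 c0 d e. presents X c1 c0 d e"
  then obtain c1 c0 d e where p: "presents X c1 c0 d e" by blast
  note p' = presentsD[OF p]
  have \<delta>: "(\<lambda>x\<in>Ob C. \<lambda>g\<in>hom x c1. far (yoneda C c0) c1 x g d) \<in> nat_maps K C (yoneda C c1) (yoneda C c0)"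
    using nat_maps_yoneda[OF cat_module_yoneda[OF p'(3)] p'(2), of d] p'(4) by simp
  have \<epsilon>: "(\<lambda>x\<in>Ob C. \<lambda>g\<in>hom x c0. far X c0 x g e) \<in> nat_maps K C (yoneda C c0) X"
    using nat_maps_yoneda[OF X p'(3,5)] .
  show "finitely_presented K C X" unfolding finitely_presented_def
  proof (rule bexI[OF _ p'(2)], rule bexI[OF _ p'(3)], rule bexI[OF _ \<delta>], rule bexI[OF _ \<epsilon>],
      intro ballI conjI)
    fix x assume x: "x \<in> Ob C"
    show "(\<lambda>x\<in>Ob C. \<lambda>g\<in>hom x c0. far X c0 x g e) x ` hom x c0 = carrier (fob X x)"
      using x p' generatesD(3)[OF p'(1) x] cat_module_closed[OF X x p'(3)] by (auto simp: image_iff) metis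
    show "(\<lambda>x\<in>Ob C. \<lambda>g\<in>hom x c1. far (yoneda C c0) c1 x g d) x ` hom x c1 =
      {g \<in> hom x c0. (\<lambda>x\<in>Ob C. \<lambda>g\<in>hom x c0. far X c0 x g e) x g = \<zero>\<^bsub>fob X x\<^esub>}"
      using x p'(2,3,4) p'(6)[OF x] by (auto simp: Cmp_closed image_iff)
  qed
qed

lemma nat_maps_eq_if_generated:
  assumes "generates X c e" "\<eta> \<in> nat_maps K C X Y" "\<theta> \<in> nat_maps K C X Y" "\<eta> c e = \<theta> c e"
  shows "\<eta> = \<theta>"
proof (rule nat_maps_eqI[OF assms(2,3)])
  note g = generatesD[OF assms(1)]
  fix x v assume x: "x \<in> Ob C" and "v \<in> carrier (fob X x)"
  then obtain f where f: "f \<in> hom x c" "v = far X c x f e" using g(3) by blast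
  then show "\<eta> x v = \<theta> x v"
    using nat_maps_natural[OF assms(2) x g(1) f(1) g(2)] nat_maps_natural[OF assms(3) x g(1) f(1) g(2)]
      assms(4) by simp
qed

lemma presents_cong:
  assumes X: "cat_module K C X" and p: "presents X c1 c0 d e"
    and x: "x \<in> Ob C" and g: "g \<in> hom x c0" "g' \<in> hom x c0"
  shows "far X c0 x g e = far X c0 x g' e \<longleftrightarrow> (\<exists>h\<in>hom x c1. g \<ominus>\<^bsub>Hom C x c0\<^esub> g' = Cmp C x c1 c0 d h)"
proof -
  note p' = presentsD[OF p]
  have "abelian_group (fob X x)" using cat_module_fob[OF X x] by (simp add: module_def)
  moreover have "far X c0 x g e \<in> carrier (fob X x)" "far X c0 x g' e \<in> carrier (fob X x)"
    using cat_module_closed[OF X x p'(3) _ p'(5)] g by simp_all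
  ultimately have "far X c0 x g e = far X c0 x g' e \<longleftrightarrow>
      far X c0 x g e \<ominus>\<^bsub>fob X x\<^esub> far X c0 x g' e = \<zero>\<^bsub>fob X x\<^esub>"
    by (simp add: abelian_group.diff_eq_zero_iff)
  also have "far X c0 x g e \<ominus>\<^bsub>fob X x\<^esub> far X c0 x g' e = far X c0 x (g \<ominus>\<^bsub>Hom C x c0\<^esub> g') e"
    using linear_map_minus[OF cat_module_eval_linear[OF X x p'(3,5)] Hom_module[OF x p'(3)]
        cat_module_fob[OF X x] g] by simp
  finally show ?thesis using p'(6)[OF x Hom_minus[OF x p'(3) g]] by simp
qed

text \<open>X is the cokernel of the map of representables given by d. A map from X to Z is
  therefore an element of Z(c0) annihilated by d.\<close>

lemma presents_factor:
  assumes X: "cat_module K C X" and Z: "cat_module K C Z" and p: "presents X c1 c0 d e"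
    and z: "z \<in> carrier (fob Z c0)" "far Z c0 c1 d z = \<zero>\<^bsub>fob Z c1\<^esub>"
  obtains \<eta> where "\<eta> \<in> nat_maps K C X Z" "\<eta> c0 e = z"
proof -
  note p' = presentsD[OF p]
  have kill: "far Z c0 x g z = far Z c0 x g' z"
    if x: "x \<in> Ob C" and g: "g \<in> hom x c0" "g' \<in> hom x c0" "far X c0 x g e = far X c0 x g' e" for x g g'
  proof -
    obtain h where h: "h \<in> hom x c1" "g \<ominus>\<^bsub>Hom C x c0\<^esub> g' = Cmp C x c1 c0 d h"
      using presents_cong[OF X p x g(1,2)] g(3) by blast
    have "far Z c0 x (g \<ominus>\<^bsub>Hom C x c0\<^esub> g') z = far Z c1 x h \<zero>\<^bsub>fob Z c1\<^esub>"
      unfolding h(2) using cat_module_Cmp[OF Z x p'(2,3) h(1) p'(4) z(1)] z(2) by simp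
    also have "\<dots> = \<zero>\<^bsub>fob Z x\<^esub>"
      using linear_map_zero[OF cat_module_linear[OF Z x p'(2) h(1)] cat_module_fob[OF Z p'(2)]
          cat_module_fob[OF Z x]] .
    finally have "far Z c0 x g z \<ominus>\<^bsub>fob Z x\<^esub> far Z c0 x g' z = \<zero>\<^bsub>fob Z x\<^esub>"
      using linear_map_minus[OF cat_module_eval_linear[OF Z x p'(3) z(1)] Hom_module[OF x p'(3)]
        cat_module_fob[OF Z x] g(1,2)] by simp
    then show ?thesis
      using cat_module_fob[OF Z x] cat_module_closed[OF Z x p'(3) _ z(1)] g(1,2)
      by (simp add: module_def abelian_group.diff_eq_zero_iff)
  qed
  \<comment> \<open>A chosen way to write v as a restriction of e. By \<open>kill\<close>, another
    choice would give the same value of \<open>\<eta>\<close>.\<close>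
  define r where "r x v = (SOME g. g \<in> hom x c0 \<and> far X c0 x g e = v)" for x v
  define \<eta> where "\<eta> = (\<lambda>x\<in>Ob C. \<lambda>v\<in>carrier (fob X x). far Z c0 x (r x v) z)"
  have r: "r x v \<in> hom x c0 \<and> far X c0 x (r x v) e = v" if "x \<in> Ob C" "v \<in> carrier (fob X x)" for x v
    unfolding r_def using someI_ex[OF generatesD(3)[OF p'(1) that, unfolded Bex_def]] .
  have cl: "far X c0 x g e \<in> carrier (fob X x)" if "x \<in> Ob C" "g \<in> hom x c0" for x g
    using cat_module_closed[OF X that(1) p'(3) that(2) p'(5)] .
  have \<eta>: "\<eta> x (far X c0 x g e) = far Z c0 x g z" if "x \<in> Ob C" "g \<in> hom x c0" for x g
    using that cl[OF that] kill[OF that(1) _ that(2), of "r x (far X c0 x g e)"] r[OF that(1) cl[OF that]]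
    by (simp add: \<eta>_def)
  have ex: "\<exists>g\<in>hom x c0. v = far X c0 x g e" if "x \<in> Ob C" "v \<in> carrier (fob X x)" for x v
    using generatesD(3)[OF p'(1) that] by force
  have "\<eta> \<in> nat_maps K C X Z"
  proof (rule nat_mapsI)
    fix x assume x: "x \<in> Ob C"
    have "linear_map K (fob X x) (fob Z x) (\<eta> x)"
    proof (rule linear_mapI)
      fix v w c assume "v \<in> carrier (fob X x)"
      then obtain g where g: "g \<in> hom x c0" "v = far X c0 x g e" using ex[OF x] by blast
      show "\<eta> x v \<in> carrier (fob Z x)"
        using g x cat_module_closed[OF Z x p'(3) g(1) z(1)] by (simp add: \<eta>)
      show "\<eta> x (c \<odot>\<^bsub>fob X x\<^esub> v) = c \<odot>\<^bsub>fob Z x\<^esub> \<eta> x v" if "c \<in> carrier K"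
        using g x p' z that cat_module_smult[OF X x p'(3) that g(1) p'(5), symmetric]
          cat_module_smult[OF Z x p'(3) that g(1) z(1)]
        by (simp add: \<eta> Hom_smult)
      assume "w \<in> carrier (fob X x)"
      then obtain g' where g': "g' \<in> hom x c0" "w = far X c0 x g' e" using ex[OF x] by blast
      show "\<eta> x (v \<oplus>\<^bsub>fob X x\<^esub> w) = \<eta> x v \<oplus>\<^bsub>fob Z x\<^esub> \<eta> x w"
        using g g' x p' z cat_module_add[OF X x p'(3) g(1) g'(1) p'(5), symmetric]
          cat_module_add[OF Z x p'(3) g(1) g'(1) z(1)]
        by (simp add: \<eta> Hom_add)
    qed
    then show "\<eta> x \<in> lin_hom K (fob X x) (fob Z x)" using x by (simp add: lin_hom_iff \<eta>_def)
  next
    fix x y f v assume x: "x \<in> Ob C" and y: "y \<in> Ob C" and f: "f \<in> hom x y" and "v \<in> carrier (fob X y)"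
    then obtain g where g: "g \<in> hom y c0" "v = far X c0 y g e" using ex by blast
    have "\<eta> x (far X y x f v) = \<eta> x (far X c0 x (Cmp C x y c0 g f) e)"
      using cat_module_Cmp[OF X x y p'(3) f g(1) p'(5)] g by simp
    also have "\<dots> = far Z y x f (\<eta> y v)"
      using cat_module_Cmp[OF Z x y p'(3) f g(1) z(1)] x y f g p' by (simp add: \<eta> Cmp_closed)
    finally show "\<eta> x (far X y x f v) = far Z y x f (\<eta> y v)" .
  qed (simp add: \<eta>_def)
  moreover have "\<eta> c0 e = z"
    using \<eta>[OF p'(3) Idm_closed[OF p'(3)]] cat_module_Idm[OF X p'(3,5)] cat_module_Idm[OF Z p'(3) z(1)]
    by simp
  ultimately show thesis using that by blast
qed

lemma presents_vanishes:
  assumes X: "cat_module K C X" and p: "presents X c1 c0 d e"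
  shows "far X c0 c1 d e = \<zero>\<^bsub>fob X c1\<^esub>"
proof -
  note p' = presentsD[OF p]
  show ?thesis using p'(6)[OF p'(2,4)] p'(2,3,4) Idm_closed[OF p'(2)] Cmp_Idm_right[OF p'(2,3,4)] by metis
qed

end

section \<open>Kernels of maps between finitely presented modules\<close>

definition submodule_functor where
  "submodule_functor X N = \<lparr>fob = (\<lambda>x. (fob X x)\<lparr>carrier := N x\<rparr>),
    far = (\<lambda>y x f. restrict (far X y x f) (N y))\<rparr>"

definition kernel_functor where
  "kernel_functor X Y \<phi> = submodule_functor X (\<lambda>x. {v \<in> carrier (fob X x). \<phi> x v = \<zero>\<^bsub>fob Y x\<^esub>})"

definition inclusion where
  "inclusion C X = (\<lambda>x\<in>Ob C. \<lambda>v\<in>carrier (fob X x). v)"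

text \<open>The universe of the modules is \<open>'u\<close>, whereas the representable modules take values in \<open>'m\<close>;
  \<open>code\<close> transports them, and their quotients, into \<open>'u\<close>.\<close>

locale weak_pullback_category = linear_category K C
  for K :: "'k ring" and C :: "('o, 'm, 'k) lin_cat" +
  fixes code :: "'o \<Rightarrow> 'o \<Rightarrow> 'm \<Rightarrow> 'u"
  assumes cring_K: "cring K"
    and inj_code: "\<lbrakk>x \<in> Ob C; y \<in> Ob C\<rbrakk> \<Longrightarrow> inj_on (code x y) (carrier (Hom C x y))"
    and biproduct: "additive C"
    and weak_pullback: "\<lbrakk>a \<in> Ob C; b \<in> Ob C; c \<in> Ob C; f \<in> carrier (Hom C a c); g \<in> carrier (Hom C b c)\<rbrakk>
      \<Longrightarrow> \<exists>p\<in>Ob C. \<exists>u\<in>carrier (Hom C p a). \<exists>v\<in>carrier (Hom C p b).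
        Cmp C p a c f u = Cmp C p b c g v \<and>
        (\<forall>x\<in>Ob C. \<forall>r\<in>carrier (Hom C x a). \<forall>s\<in>carrier (Hom C x b).
          Cmp C x a c f r = Cmp C x b c g s \<longrightarrow> (\<exists>h\<in>carrier (Hom C x p). r = Cmp C x p a u h))"
begin

text \<open>Write y as the restriction of e along a morphism a from c to c0. The restriction of y
  along g vanishes iff a after g is a multiple of d, that is, iff g is one side of a commutative
  square over a and d. The leg k of a weak pullback of a and d therefore generates all such
  g.\<close>

lemma annihilator:
  assumes Y: "cat_module K C Y" and p: "presents Y c1 c0 d e" and c: "c \<in> Ob C"
    and y: "y \<in> carrier (fob Y c)"
  obtains b k where "b \<in> Ob C" "k \<in> hom b c"
    "\<And>x g. \<lbrakk>x \<in> Ob C; g \<in> hom x c\<rbrakk>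
      \<Longrightarrow> far Y c x g y = \<zero>\<^bsub>fob Y x\<^esub> \<longleftrightarrow> (\<exists>h\<in>hom x b. g = Cmp C x b c k h)"
proof -
  note p' = presentsD[OF p]
  obtain a where a: "a \<in> hom c c0" "far Y c0 c a e = y" using generatesD(3)[OF p'(1) c y] by blast
  obtain b k k' where b: "b \<in> Ob C" "k \<in> hom b c" "k' \<in> hom b c1"
    and eq: "Cmp C b c c0 a k = Cmp C b c1 c0 d k'"
    and pb: "\<And>x r s. \<lbrakk>x \<in> Ob C; r \<in> hom x c; s \<in> hom x c1; Cmp C x c c0 a r = Cmp C x c1 c0 d s\<rbrakk>
      \<Longrightarrow> \<exists>h\<in>hom x b. r = Cmp C x b c k h"
    using weak_pullback[OF c p'(2,3) a(1) p'(4)] by blast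
  show thesis
  proof (rule that[OF b(1,2)])
    fix x g assume x: "x \<in> Ob C" and g: "g \<in> hom x c"
    have "far Y c x g y = \<zero>\<^bsub>fob Y x\<^esub> \<longleftrightarrow> (\<exists>s\<in>hom x c1. Cmp C x c c0 a g = Cmp C x c1 c0 d s)"
      using p'(6)[OF x, of "Cmp C x c c0 a g"] cat_module_Cmp[OF Y x c p'(3) g a(1) p'(5)] a
        Cmp_closed[OF x c p'(3) g a(1)] by simp
    also have "\<dots> \<longleftrightarrow> (\<exists>h\<in>hom x b. g = Cmp C x b c k h)"
    proof
      assume "\<exists>s\<in>hom x c1. Cmp C x c c0 a g = Cmp C x c1 c0 d s"
      then show "\<exists>h\<in>hom x b. g = Cmp C x b c k h" using pb[OF x g] by blast
    next
      assume "\<exists>h\<in>hom x b. g = Cmp C x b c k h"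
      then obtain h where h: "h \<in> hom x b" "g = Cmp C x b c k h" by blast
      have "Cmp C x c c0 a g = Cmp C x b c0 (Cmp C b c c0 a k) h"
        using h x b c p' a by (simp add: Cmp_assoc)
      also have "\<dots> = Cmp C x c1 c0 d (Cmp C x b c1 k' h)"
        unfolding eq using h x b p' by (simp add: Cmp_assoc)
      finally show "\<exists>s\<in>hom x c1. Cmp C x c c0 a g = Cmp C x c1 c0 d s"
        using Cmp_closed[OF x b(1) p'(2) h(1) b(3)] by blast
    qed
    finally show "far Y c x g y = \<zero>\<^bsub>fob Y x\<^esub> \<longleftrightarrow> (\<exists>h\<in>hom x b. g = Cmp C x b c k h)" .
  qed
qed

lemma kernel_functor:
  fixes X Y :: "('o, 'm, ('k, 'u) module, 'u \<Rightarrow> 'u) fctr"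
  assumes X: "cat_module K C X" and Y: "cat_module K C Y" and \<phi>: "\<phi> \<in> nat_maps K C X Y"
  shows "cat_module K C (kernel_functor X Y \<phi>)" (is "linear_functor _ _ _ ?N")
    and "inclusion C (kernel_functor X Y \<phi>) \<in> nat_maps K C (kernel_functor X Y \<phi>) X"
proof -
  have sub: "carrier (fob ?N x) = {v \<in> carrier (fob X x). \<phi> x v = \<zero>\<^bsub>fob Y x\<^esub>}"
    "\<zero>\<^bsub>fob ?N x\<^esub> = \<zero>\<^bsub>fob X x\<^esub>" "v \<oplus>\<^bsub>fob ?N x\<^esub> w = v \<oplus>\<^bsub>fob X x\<^esub> w"
    "c \<odot>\<^bsub>fob ?N x\<^esub> v = c \<odot>\<^bsub>fob X x\<^esub> v" for x v w c
    by (simp_all add: kernel_functor_def submodule_functor_def)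
  have far_N: "far ?N y x f v = far X y x f v" if "v \<in> carrier (fob ?N y)" for x y f v
    using that by (simp add: kernel_functor_def submodule_functor_def)
  have mod: "module K (fob ?N x)" if x: "x \<in> Ob C" for x
  proof (rule module_jointly_embedded[where I = "UNIV :: unit set" and V = "\<lambda>_. fob X x"
    and j = "\<lambda>_ v. v"])
    interpret Xx: module K "fob X x" by (rule cat_module_fob[OF X x])
    interpret Yx: module K "fob Y x" by (rule cat_module_fob[OF Y x])
    note lin = nat_maps_linear[OF \<phi> x]
    show "\<zero>\<^bsub>fob ?N x\<^esub> \<in> carrier (fob ?N x)"
      using linear_map_zero[OF lin Xx.module_axioms Yx.module_axioms] by (simp add: sub)
    show "v \<oplus>\<^bsub>fob ?N x\<^esub> w \<in> carrier (fob ?N x)" if "v \<in> carrier (fob ?N x)" "w \<in> carrier (fob ?N x)"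
      for v w
      using that linear_map_add[OF lin] by (simp add: sub)
    show "c \<odot>\<^bsub>fob ?N x\<^esub> v \<in> carrier (fob ?N x)" if "c \<in> carrier K" "v \<in> carrier (fob ?N x)" for v c
      using that linear_map_smult[OF lin] by (simp add: sub)
  qed (use cring_K cat_module_fob[OF X x] in \<open>auto simp: sub linear_map_def\<close>)
  have cl: "far X y x f v \<in> carrier (fob ?N x)"
    if "x \<in> Ob C" "y \<in> Ob C" "f \<in> hom x y" "v \<in> carrier (fob ?N y)" for x y f v
    using that nat_maps_natural[OF \<phi> that(1-3), of v] cat_module_closed[OF X that(1-3), of v]
      linear_map_zero[OF cat_module_linear[OF Y that(1-3)] cat_module_fob[OF Y that(2)]
        cat_module_fob[OF Y that(1)]]
    by (simp add: sub)
  show N: "cat_module K C ?N"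
  proof (rule cat_moduleI)
    show "far ?N y x f \<in> lin_hom K (fob ?N y) (fob ?N x)"
      if "x \<in> Ob C" "y \<in> Ob C" "f \<in> hom x y" for x y f
    proof -
      have "linear_map K (fob ?N y) (fob ?N x) (far X y x f)"
        by (rule linear_mapI) (use that cl linear_map_add[OF cat_module_linear[OF X that]]
          linear_map_smult[OF cat_module_linear[OF X that]] in \<open>simp_all add: sub\<close>)
      from linear_map_restrict[OF this mod[OF that(2)]] show ?thesis
        by (simp add: kernel_functor_def submodule_functor_def)
    qed
    show "far ?N z x (Cmp C x y z g f) v = far ?N y x f (far ?N z y g v)"
      if "x \<in> Ob C" "y \<in> Ob C" "z \<in> Ob C" "f \<in> hom x y" "g \<in> hom y z" "v \<in> carrier (fob ?N z)"
      for x y z f g v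
      using that cat_module_Cmp[OF X that(1-5), of v] cl[OF that(2,3,5,6)]
        by (simp add: far_N) (simp add: sub)
  qed (use mod far_N linear_category_axioms
    in \<open>simp_all add: sub cat_module_Idm[OF X] cat_module_add[OF X] cat_module_smult[OF X]\<close>)
  show "inclusion C ?N \<in> nat_maps K C ?N X"
  proof (rule nat_mapsI)
    show "inclusion C ?N x \<in> lin_hom K (fob ?N x) (fob X x)" if "x \<in> Ob C" for x
      using that linear_map_restrict[OF _ mod[OF that], of "fob X x" "\<lambda>v. v"]
      by (simp add: inclusion_def linear_map_def sub)
    show "inclusion C ?N x (far ?N y x f v) = far X y x f (inclusion C ?N y v)"
      if "x \<in> Ob C" "y \<in> Ob C" "f \<in> hom x y" "v \<in> carrier (fob ?N y)" for x y f v
      using that cl[OF that] by (simp add: inclusion_def far_N)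
  qed (simp add: inclusion_def)
qed

lemma carrier_kernel_functor:
  "carrier (fob (kernel_functor X Y \<phi>) x) = {v \<in> carrier (fob X x). \<phi> x v = \<zero>\<^bsub>fob Y x\<^esub>}"
  by (simp add: kernel_functor_def submodule_functor_def)

text \<open>Annihilators of elements are used twice. Applied to the image of the generator e in Y,
  they give a morphism k such that the restriction n of e along k generates the kernel. Applied to
  n, as an element of X, they give the relations of n.\<close>

lemma kernel_finitely_presented:
  fixes X Y :: "('o, 'm, ('k, 'u) module, 'u \<Rightarrow> 'u) fctr"
  assumes X: "cat_module K C X" "finitely_presented K C X"
    and Y: "cat_module K C Y" "finitely_presented K C Y" and \<phi>: "\<phi> \<in> nat_maps K C X Y"
  shows "finitely_presented K C (kernel_functor X Y \<phi>)" (is "finitely_presented K C ?N")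
proof -
  obtain c1 c0 d e where p: "presents X c1 c0 d e" using X finitely_presented_iff by blast
  obtain b1 b0 d' e' where q: "presents Y b1 b0 d' e'" using Y finitely_presented_iff by blast
  note p' = presentsD[OF p]
  have far_N: "far ?N y x f v = far X y x f v" if "v \<in> carrier (fob ?N y)" for x y f v
    using that by (simp add: kernel_functor_def submodule_functor_def)
  obtain b k where b: "b \<in> Ob C" "k \<in> hom b c0" and
    gen: "\<And>x g. \<lbrakk>x \<in> Ob C; g \<in> hom x c0\<rbrakk>
      \<Longrightarrow> far Y c0 x g (\<phi> c0 e) = \<zero>\<^bsub>fob Y x\<^esub> \<longleftrightarrow> (\<exists>h\<in>hom x b. g = Cmp C x b c0 k h)"
    using annihilator[OF Y(1) q p'(3) nat_maps_closed[OF \<phi> p'(3,5)]] by blast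
  define n where "n = far X c0 b k e"
  have n: "n \<in> carrier (fob X b)" unfolding n_def using cat_module_closed[OF X(1) b(1) p'(3) b(2) p'(5)] .
  have nat: "\<phi> x (far X c0 x g e) = far Y c0 x g (\<phi> c0 e)" if "x \<in> Ob C" "g \<in> hom x c0" for x g
    using nat_maps_natural[OF \<phi> that(1) p'(3) that(2) p'(5)] .
  have "\<phi> b n = \<zero>\<^bsub>fob Y b\<^esub>"
    unfolding n_def nat[OF b] gen[OF b]
    by (rule bexI[OF _ Idm_closed[OF b(1)]]) (simp add: Cmp_Idm_right[OF b(1) p'(3) b(2)])
  then have n_N: "n \<in> carrier (fob ?N b)" using n by (simp add: carrier_kernel_functor)
  obtain b' k' where b': "b' \<in> Ob C" "k' \<in> hom b' b" and
    rel: "\<And>x g. \<lbrakk>x \<in> Ob C; g \<in> hom x b\<rbrakk>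
      \<Longrightarrow> far X b x g n = \<zero>\<^bsub>fob X x\<^esub> \<longleftrightarrow> (\<exists>h\<in>hom x b'. g = Cmp C x b' b k' h)"
    using annihilator[OF X(1) p b(1) n] by blast
  have "presents ?N b' b k' n" unfolding presents_def generates_def
  proof (intro conjI ballI)
    fix x v assume x: "x \<in> Ob C" and "v \<in> carrier (fob ?N x)"
    then have v: "v \<in> carrier (fob X x)" "\<phi> x v = \<zero>\<^bsub>fob Y x\<^esub>" by (simp_all add: carrier_kernel_functor)
    obtain g where g: "g \<in> hom x c0" "far X c0 x g e = v" using generatesD(3)[OF p'(1) x v(1)] by blast
    obtain h where h: "h \<in> hom x b" "g = Cmp C x b c0 k h" using gen[OF x g(1)] nat[OF x g(1)] g v by auto
    have "far X b x h n = v"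
      unfolding n_def using cat_module_Cmp[OF X(1) x b(1) p'(3) h(1) b(2) p'(5)] g h by simp
    then have "far ?N b x h n = v" by (simp add: far_N[OF n_N])
    with h show "\<exists>h\<in>hom x b. far ?N b x h n = v" by blast
  next
    fix x g assume x: "x \<in> Ob C" and g: "g \<in> hom x b"
    show "far ?N b x g n = \<zero>\<^bsub>fob ?N x\<^esub> \<longleftrightarrow> (\<exists>h\<in>hom x b'. g = Cmp C x b' b k' h)"
      using rel[OF x g] far_N[OF n_N] by (simp add: kernel_functor_def submodule_functor_def)
  qed (use b b' n_N in auto)
  then show ?thesis using finitely_presented_iff[OF kernel_functor(1)[OF X(1) Y(1) \<phi>]] by blast
qed

text \<open>Kernels are computed objectwise: a transformation killed by \<phi> already takes its
  values in the smaller carriers, so the same family of functions is the factorisation.\<close>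

lemma is_kernel_kernel_functor:
  fixes X Y :: "('o, 'm, ('k, 'u) module, 'u \<Rightarrow> 'u) fctr"
  assumes X: "cat_module K C X" "finitely_presented K C X"
    and Y: "cat_module K C Y" "finitely_presented K C Y" and \<phi>: "\<phi> \<in> nat_maps K C X Y"
  shows "is_kernel (mod_cat TYPE('u) K C) X Y \<phi> (kernel_functor X Y \<phi>)
    (inclusion C (kernel_functor X Y \<phi>))"
    (is "is_kernel ?M X Y \<phi> ?N ?i")
proof -
  note N = kernel_functor(1)[OF X(1) Y(1) \<phi>] and i = kernel_functor(2)[OF X(1) Y(1) \<phi>]
  note fp = kernel_finitely_presented[OF X Y \<phi>]
  have "\<exists>!h. h \<in> nat_maps K C Z ?N \<and> Cmp ?M Z ?N X ?i h = g"
    if Z: "cat_module K C Z" and g: "g \<in> nat_maps K C Z X" and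
      z: "Cmp ?M Z X Y \<phi> g = \<zero>\<^bsub>Hom ?M Z Y\<^esub>"
    for Z :: "('o, 'm, ('k, 'u) module, 'u \<Rightarrow> 'u) fctr" and g
  proof (rule ex1I[of _ g])
    have in_N: "g x v \<in> carrier (fob ?N x)" if "x \<in> Ob C" "v \<in> carrier (fob Z x)" for x v
    proof -
      have "\<phi> x (g x v) = Cmp ?M Z X Y \<phi> g x v" using that by simp
      also have "\<dots> = \<zero>\<^bsub>fob Y x\<^esub>" unfolding z using that by simp
      finally show ?thesis using nat_maps_closed[OF g that] by (simp add: carrier_kernel_functor)
    qed
    have "g \<in> nat_maps K C Z ?N"
    proof (rule nat_mapsI)
      show "g x \<in> lin_hom K (fob Z x) (fob ?N x)" if "x \<in> Ob C" for x
        using nat_maps_lin_hom[OF g that] in_N[OF that]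
        by (auto simp: lin_hom_iff linear_map_def kernel_functor_def submodule_functor_def)
      show "g x (far Z y x f v) = far ?N y x f (g y v)"
        if "x \<in> Ob C" "y \<in> Ob C" "f \<in> hom x y" "v \<in> carrier (fob Z y)" for x y f v
        using nat_maps_natural[OF g that] in_N[OF that(2,4)] 
        by (simp add: kernel_functor_def submodule_functor_def)
    qed (rule nat_maps_extensional[OF g])
    moreover have "Cmp ?M Z ?N X ?i g = g"
      by (rule nat_maps_eqI[OF _ g])
        (use nat_maps_Cmp[OF Z calculation i] in_N in \<open>simp_all add: inclusion_def\<close>)
    ultimately show "g \<in> nat_maps K C Z ?N \<and> Cmp ?M Z ?N X ?i g = g" by blast
    fix h assume h: "h \<in> nat_maps K C Z ?N \<and> Cmp ?M Z ?N X ?i h = g"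
    show "h = g"
    proof (rule nat_maps_eqI[of h K C Z ?N g X])
      show "h \<in> nat_maps K C Z ?N" "g \<in> nat_maps K C Z X" using h g by blast+
      fix x v assume xv: "x \<in> Ob C" "v \<in> carrier (fob Z x)"
      have "g x v = Cmp ?M Z ?N X ?i h x v" using h by simp
      then show "h x v = g x v" using xv nat_maps_closed[OF conjunct1[OF h] xv]
        by (simp add: inclusion_def)
    qed
  qed
  moreover have "Cmp ?M ?N X Y \<phi> ?i = \<zero>\<^bsub>Hom ?M ?N Y\<^esub>"
    by (auto simp: inclusion_def carrier_kernel_functor intro!: restrict_ext)
  ultimately show ?thesis
    unfolding is_kernel_def using N fp i by auto
qed

text \<open>The cokernel of a map of representables, built objectwise as a quotient of Hom spaces.
  As its values must have carriers in \<open>'u\<close>, each coset is replaced by a chosen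
  representative and this by its code.\<close>

lemma presented_module_exists:
  assumes c: "c1 \<in> Ob C" "c0 \<in> Ob C" and d: "d \<in> hom c1 c0"
  obtains P :: "('o, 'm, ('k, 'u) module, 'u \<Rightarrow> 'u) fctr" and e
  where "cat_module K C P" "presents P c1 c0 d e"
proof -
  have "\<exists>q. \<forall>g\<in>hom x c0. q g \<in> hom x c0 \<and> (\<forall>g'\<in>hom x c0. q g = q g' \<longleftrightarrow>
      (\<exists>h\<in>hom x c1. g \<ominus>\<^bsub>Hom C x c0\<^esub> g' = Cmp C x c1 c0 d h))" if x: "x \<in> Ob C" for x
  proof -
    interpret H: abelian_group "Hom C x c0" by (rule Hom_abelian_group[OF x c(2)])
    note lin = Cmp_linear_right[OF x c d]
    have "\<zero>\<^bsub>Hom C x c0\<^esub> = Cmp C x c1 c0 d \<zero>\<^bsub>Hom C x c1\<^esub>"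
      using Cmp_zero_right[OF x c d] by simp
    then have zero: "\<zero>\<^bsub>Hom C x c0\<^esub> \<in> Cmp C x c1 c0 d ` hom x c1" using Hom_zero[OF x c(1)] by blast
    have minus: "u \<ominus>\<^bsub>Hom C x c0\<^esub> v \<in> Cmp C x c1 c0 d ` hom x c1"
      if uv: "u \<in> Cmp C x c1 c0 d ` hom x c1" "v \<in> Cmp C x c1 c0 d ` hom x c1" for u v
    proof -
      obtain g h where gh: "g \<in> hom x c1" "h \<in> hom x c1" "u = Cmp C x c1 c0 d g" "v = Cmp C x c1 c0 d h"
        using uv by blast
      then have "u \<ominus>\<^bsub>Hom C x c0\<^esub> v = Cmp C x c1 c0 d (g \<ominus>\<^bsub>Hom C x c1\<^esub> h)"
        using linear_map_minus[OF lin Hom_module[OF x c(1)] Hom_module[OF x c(2)] gh(1,2)] by simp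
      then show ?thesis using Hom_minus[OF x c(1) gh(1,2)] by blast
    qed
    have sub: "Cmp C x c1 c0 d ` hom x c1 \<subseteq> hom x c0" using Cmp_closed[OF x c _ d] by blast
    obtain q where "\<And>g. g \<in> hom x c0 \<Longrightarrow> q g \<in> hom x c0"
      "\<And>g g'. \<lbrakk>g \<in> hom x c0; g' \<in> hom x c0\<rbrakk> \<Longrightarrow> q g = q g'
        \<longleftrightarrow> g \<ominus>\<^bsub>Hom C x c0\<^esub> g' \<in> Cmp C x c1 c0 d ` hom x c1"
      using H.coset_representatives[OF sub zero minus] by metis
    then show ?thesis by (intro exI[of _ q]) (auto simp: image_iff)
  qed
  then obtain q0 where q0: "\<And>x g. \<lbrakk>x \<in> Ob C; g \<in> hom x c0\<rbrakk> \<Longrightarrow> q0 x g \<in> hom x c0"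
    "\<And>x g g'. \<lbrakk>x \<in> Ob C; g \<in> hom x c0; g' \<in> hom x c0\<rbrakk> \<Longrightarrow> q0 x g = q0 x g' \<longleftrightarrow>
      (\<exists>h\<in>hom x c1. g \<ominus>\<^bsub>Hom C x c0\<^esub> g' = Cmp C x c1 c0 d h)"
    by metis
  define q where "q x g = code x c0 (q0 x g)" for x g
  have q_eq: "q x g = q x g' \<longleftrightarrow> (\<exists>h\<in>hom x c1. g \<ominus>\<^bsub>Hom C x c0\<^esub> g' = Cmp C x c1 c0 d h)"
    if "x \<in> Ob C" "g \<in> hom x c0" "g' \<in> hom x c0" for x g g'
    using that q0(2)[OF that] inj_on_eq_iff[OF inj_code[OF that(1) c(2)] q0(1)[OF that(1,2)]
      q0(1)[OF that(1,3)]]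
    by (simp add: q_def)
  define r where "r x = inv_into (hom x c0) (q x)" for x
  have r: "r x (q x g) \<in> hom x c0" "q x (r x (q x g)) = q x g" if "g \<in> hom x c0" for x g
    using that unfolding r_def by (auto intro: inv_into_into f_inv_into_f)
  define V where "V x = k_space (q x ` hom x c0) (q x \<zero>\<^bsub>Hom C x c0\<^esub>)
    (\<lambda>a b. q x (r x a \<oplus>\<^bsub>Hom C x c0\<^esub> r x b)) (\<lambda>k a. q x (k \<odot>\<^bsub>Hom C x c0\<^esub> r x a))" for x
  define P where "P = \<lparr>fob = V, far = (\<lambda>y x f. \<lambda>a\<in>q y ` hom y c0. q x (Cmp C x y c0 (r y a) f))\<rparr>"
  \<comment> \<open>A linear map that preserves multiples of d gives the same coset for all
    representatives. This covers scalars and restriction along a morphism; the sum has two arguments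
    and is treated separately.\<close>
  have respects: "q x (\<phi> (r y (q y g))) = q x (\<phi> g)"
    if x: "x \<in> Ob C" and y: "y \<in> Ob C" and g: "g \<in> hom y c0"
      and lin: "linear_map K (Hom C y c0) (Hom C x c0) \<phi>"
      and stable: "\<And>h. h \<in> hom y c1 \<Longrightarrow> \<exists>h'\<in>hom x c1. \<phi> (Cmp C y c1 c0 d h) = Cmp C x c1 c0 d h'"
    for x y g \<phi>
  proof -
    obtain h where h: "h \<in> hom y c1" "r y (q y g) \<ominus>\<^bsub>Hom C y c0\<^esub> g = Cmp C y c1 c0 d h"
      using q_eq[OF y r(1)[OF g] g] r(2)[OF g] by auto
    obtain h' where h': "h' \<in> hom x c1" "\<phi> (Cmp C y c1 c0 d h) = Cmp C x c1 c0 d h'" using stable h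
      by blast
    have "\<phi> (r y (q y g)) \<ominus>\<^bsub>Hom C x c0\<^esub> \<phi> g = Cmp C x c1 c0 d h'"
      using linear_map_minus[OF lin Hom_module[OF y c(2)] Hom_module[OF x c(2)] r(1)[OF g] g] h h' by simp
    then show ?thesis
      using q_eq[OF x linear_map_closed[OF lin r(1)[OF g]] linear_map_closed[OF lin g]] h' by blast
  qed
  have V: "carrier (V x) = q x ` hom x c0" "\<zero>\<^bsub>V x\<^esub> = q x \<zero>\<^bsub>Hom C x c0\<^esub>" for x
    by (simp_all add: V_def)
  have V_add: "q x g \<oplus>\<^bsub>V x\<^esub> q x g' = q x (g \<oplus>\<^bsub>Hom C x c0\<^esub> g')"
    if x: "x \<in> Ob C" and g: "g \<in> hom x c0" "g' \<in> hom x c0" for x g g'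
  proof -
    interpret H: module K "Hom C x c0" by (rule Hom_module[OF x c(2)])
    have "q x (r x (q x g) \<oplus>\<^bsub>Hom C x c0\<^esub> r x (q x g')) = q x (g \<oplus>\<^bsub>Hom C x c0\<^esub> g')"
    proof -
      obtain h h' where h: "h \<in> hom x c1" "r x (q x g) \<ominus>\<^bsub>Hom C x c0\<^esub> g = Cmp C x c1 c0 d h"
        and h': "h' \<in> hom x c1" "r x (q x g') \<ominus>\<^bsub>Hom C x c0\<^esub> g' = Cmp C x c1 c0 d h'"
        using q_eq[OF x r(1)[OF g(1)] g(1)] q_eq[OF x r(1)[OF g(2)] g(2)] r(2) g by auto
      have "(r x (q x g) \<oplus>\<^bsub>Hom C x c0\<^esub> r x (q x g')) \<ominus>\<^bsub>Hom C x c0\<^esub> (g \<oplus>\<^bsub>Hom C x c0\<^esub> g') =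
        (r x (q x g) \<ominus>\<^bsub>Hom C x c0\<^esub> g) \<oplus>\<^bsub>Hom C x c0\<^esub> (r x (q x g') \<ominus>\<^bsub>Hom C x c0\<^esub> g')"
        using g r(1) by (simp add: a_minus_def H.M.minus_add H.M.a_ac)
      also have "\<dots> = Cmp C x c1 c0 d (h \<oplus>\<^bsub>Hom C x c1\<^esub> h')"
        using h h' Cmp_add_right[OF x c h(1) h'(1) d] by simp
      finally show ?thesis
        using q_eq[OF x] g r(1) Hom_add[OF x c(1) h(1) h'(1)] by (simp add: Hom_add x c) blast
    qed
    then show ?thesis by (simp add: V_def)
  qed
  have V_smult: "k \<odot>\<^bsub>V x\<^esub> q x g = q x (k \<odot>\<^bsub>Hom C x c0\<^esub> g)"
    if x: "x \<in> Ob C" and g: "g \<in> hom x c0" and k: "k \<in> carrier K" for x g k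
  proof -
    interpret H: module K "Hom C x c0" by (rule Hom_module[OF x c(2)])
    have "linear_map K (Hom C x c0) (Hom C x c0) (\<lambda>g. k \<odot>\<^bsub>Hom C x c0\<^esub> g)"
      by (rule linear_mapI)
        (use k in \<open>auto simp: H.smult_r_distr H.R.m_comm simp flip: H.smult_assoc1\<close>)
    from respects[OF x x g this] show ?thesis
      using Cmp_smult_right[OF x c k _ d, symmetric] Hom_smult[OF x c(1) k]
      by (simp add: V_def) blast
  qed
  have far_P: "far P y x f (q y g) = q x (Cmp C x y c0 g f)"
    if x: "x \<in> Ob C" and y: "y \<in> Ob C" and f: "f \<in> hom x y" and g: "g \<in> hom y c0" for x y f g
    using respects[OF x y g Cmp_linear_left[OF x y c(2) f]] g Cmp_assoc[OF x y c f _ d, symmetric]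
      Cmp_closed[OF x y c(1) f]
    by (simp add: P_def) blast
  have V_lin: "linear_map K (Hom C x c0) (V x) (q x)" if "x \<in> Ob C" for x
    by (rule linear_mapI) (simp_all add: V that V_add V_smult)
  have V_mod: "module K (V x)" if "x \<in> Ob C" for x
    by (rule module_image[OF Hom_module[OF that c(2)] V_lin[OF that]]) (simp_all add: V)
  have fob_P: "fob P = V" by (simp add: P_def)
  have P: "cat_module K C P"
  proof (rule cat_moduleI)
    fix x y f assume x: "x \<in> Ob C" and y: "y \<in> Ob C" and f: "f \<in> hom x y"
    have "linear_map K (V y) (V x) (far P y x f)"
    proof (rule linear_mapI)
      fix v w k assume "v \<in> carrier (V y)"
      then obtain g where g: "g \<in> hom y c0" "v = q y g" by (auto simp: V)
      show "far P y x f v \<in> carrier (V x)"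
        using g far_P[OF x y f] Cmp_closed[OF x y c(2) f] by (simp add: V)
      show "far P y x f (k \<odot>\<^bsub>V y\<^esub> v) = k \<odot>\<^bsub>V x\<^esub> far P y x f v" if "k \<in> carrier K"
        using g that x y c f by (simp add: V_smult far_P Hom_smult Cmp_closed Cmp_smult_left)
      assume "w \<in> carrier (V y)"
      then obtain g' where g': "g' \<in> hom y c0" "w = q y g'" by (auto simp: V)
      show "far P y x f (v \<oplus>\<^bsub>V y\<^esub> w) = far P y x f v \<oplus>\<^bsub>V x\<^esub> far P y x f w"
        using g g' x y c f by (simp add: V_add far_P Hom_add Cmp_closed Cmp_add_left)
    qed
    then show "far P y x f \<in> lin_hom K (fob P y) (fob P x)"
      by (simp add: lin_hom_iff fob_P) (simp add: P_def V)
  next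
    show "far P x x (Idm C x) v = v" if x: "x \<in> Ob C" "v \<in> carrier (fob P x)" for x v
      using that c far_P[OF x(1) x(1) Idm_closed[OF x(1)]] by (auto simp: fob_P V Cmp_Idm_right)
    fix x y f g v assume x: "x \<in> Ob C" and y: "y \<in> Ob C" and f: "f \<in> hom x y"
    {
      fix z g assume zg: "z \<in> Ob C" "g \<in> hom y z" "v \<in> carrier (fob P z)"
      then obtain h where "h \<in> hom z c0" "v = q z h" by (auto simp: fob_P V)
      with x y f zg c show "far P z x (Cmp C x y z g f) v = far P y x f (far P z y g v)"
        by (simp add: far_P Cmp_closed Cmp_assoc)
    }
    assume "v \<in> carrier (fob P y)"
    then obtain h where h: "h \<in> hom y c0" "v = q y h" by (auto simp: fob_P V)
    show "far P y x (f \<oplus>\<^bsub>Hom C x y\<^esub> g) v = far P y x f v \<oplus>\<^bsub>fob P x\<^esub> far P y x g v" if "g \<in> hom x y"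
      using h x y f that c by (simp add: far_P fob_P V_add Hom_add Cmp_closed Cmp_add_right)
    show "far P y x (k \<odot>\<^bsub>Hom C x y\<^esub> f) v = k \<odot>\<^bsub>fob P x\<^esub> far P y x f v" if "k \<in> carrier K" for k
      using h x y f that c by (simp add: far_P fob_P V_smult Hom_smult Cmp_closed Cmp_smult_right)
  qed (use V_mod linear_category_axioms in \<open>simp_all add: fob_P\<close>)
  have far_gen: "far P c0 x g (q c0 (Idm C c0)) = q x g" if "x \<in> Ob C" "g \<in> hom x c0" for x g
    using far_P[OF that(1) c(2) that(2) Idm_closed[OF c(2)]] that c by (simp add: Cmp_Idm_left)
  have "presents P c1 c0 d (q c0 (Idm C c0))" unfolding presents_def generates_def
  proof (intro conjI ballI)
    show "q c0 (Idm C c0) \<in> carrier (fob P c0)" using Idm_closed[OF c(2)] by (simp add: fob_P V)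
    fix x assume x: "x \<in> Ob C"
    show "\<exists>g\<in>hom x c0. far P c0 x g (q c0 (Idm C c0)) = v" if "v \<in> carrier (fob P x)" for v
      using that far_gen[OF x] by (auto simp: fob_P V)
    fix g assume g: "g \<in> hom x c0"
    interpret H: module K "Hom C x c0" by (rule Hom_module[OF x c(2)])
    have "g \<ominus>\<^bsub>Hom C x c0\<^esub> \<zero>\<^bsub>Hom C x c0\<^esub> = g" using g by (simp add: a_minus_def)
    then show "far P c0 x g (q c0 (Idm C c0)) = \<zero>\<^bsub>fob P x\<^esub> \<longleftrightarrow> (\<exists>h\<in>hom x c1. g = Cmp C x c1 c0 d h)"
      using far_gen[OF x g] q_eq[OF x g, of "\<zero>\<^bsub>Hom C x c0\<^esub>"] by (simp add: fob_P V)
  qed (use c d in auto)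
  with P show thesis by (rule that)
qed

end

section \<open>Cokernels and inverted morphisms\<close>

lemma (in linear_category) binary_biproduct:
  assumes biproduct: "additive C" and x: "x \<in> Ob C" and y: "y \<in> Ob C"
  obtains z i0 i1 p0 p1 where "z \<in> Ob C" "i0 \<in> hom x z" "i1 \<in> hom y z" "p0 \<in> hom z x" "p1 \<in> hom z y"
    "Cmp C x z x p0 i0 = Idm C x" "Cmp C y z y p1 i1 = Idm C y"
    "Cmp C y z x p0 i1 = \<zero>\<^bsub>Hom C y x\<^esub>" "Cmp C x z y p1 i0 = \<zero>\<^bsub>Hom C x y\<^esub>"
    "Cmp C z x z i0 p0 \<oplus>\<^bsub>Hom C z z\<^esub> Cmp C z y z i1 p1 = Idm C z"
proof -
  have "set [x, y] \<subseteq> Ob C" using x y by simp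
  then obtain z where z: "z \<in> Ob C" and sum: "direct_sum C z [x, y]"
    using biproduct unfolding additive_def by blast
  obtain \<iota> \<pi> where 
    mem: "\<forall>i<length [x, y]. \<iota> i \<in> hom ([x, y] ! i) z \<and> \<pi> i \<in> hom z ([x, y] ! i)" and
    orth: "\<forall>i<length [x, y]. \<forall>j<length [x, y]. Cmp C ([x, y] ! j) z ([x, y] ! i) (\<pi> i) (\<iota> j) =
      (if i = j then Idm C ([x, y] ! i) else \<zero>\<^bsub>Hom C ([x, y] ! j) ([x, y] ! i)\<^esub>)" and
    sum: "(\<Oplus>\<^bsub>Hom C z z\<^esub>i\<in>{..<length [x, y]}. Cmp C z ([x, y] ! i) z (\<iota> i) (\<pi> i)) = Idm C z"
    using sum unfolding direct_sum_def by (elim exE conjE) (rule that)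
  interpret H: abelian_group "Hom C z z" by (rule Hom_abelian_group[OF z z])
  have m: "\<iota> 0 \<in> hom x z" "\<pi> 0 \<in> hom z x" "\<iota> 1 \<in> hom y z" "\<pi> 1 \<in> hom z y"
    using mem[rule_format, of 0] mem[rule_format, of 1] by simp_all
  have "{..<length [x, y]} = {0, 1}" by auto
  then have "Cmp C z x z (\<iota> 0) (\<pi> 0) \<oplus>\<^bsub>Hom C z z\<^esub> Cmp C z y z (\<iota> 1) (\<pi> 1) = Idm C z"
    using sum m x y z by (simp add: Cmp_closed)
  then show thesis
    using that[OF z m(1,3,2,4)] orth[rule_format, of 0 0] orth[rule_format, of 1 1]
      orth[rule_format, of 0 1] orth[rule_format, of 1 0] by simp
qed

context weak_pullback_category
begin

text \<open>Let X be generated over b0 and Y over c0. The map \<phi> lifts to a morphism a from b0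
  to c0, and the cokernel is presented by the map from the biproduct of b0 and c1 to c0 with
  components a and d: to the relations of Y one adds the image of the generator of X. Surjectivity
  and exactness are recorded objectwise as well, since evaluation at one object needs them in this
  form.\<close>

lemma cokernel_exists:
  fixes X Y :: "('o, 'm, ('k, 'u) module, 'u \<Rightarrow> 'u) fctr"
  assumes X: "cat_module K C X" "finitely_presented K C X"
    and Y: "cat_module K C Y" "finitely_presented K C Y" and \<phi>: "\<phi> \<in> nat_maps K C X Y"
  obtains P p where "cat_module K C P" "finitely_presented K C P" "p \<in> nat_maps K C Y P"
    "is_cokernel (mod_cat TYPE('u) K C) X Y \<phi> P p"
    "\<And>x v. \<lbrakk>x \<in> Ob C; v \<in> carrier (fob P x)\<rbrakk> \<Longrightarrow> \<exists>y\<in>carrier (fob Y x). p x y = v"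
    "\<And>x y. \<lbrakk>x \<in> Ob C; y \<in> carrier (fob Y x); p x y = \<zero>\<^bsub>fob P x\<^esub>\<rbrakk> \<Longrightarrow> \<exists>v\<in>carrier (fob X x). \<phi> x v = y"
proof -
  let ?M = "mod_cat TYPE('u) K C"
  obtain b1 b0 d' e' where q: "presents X b1 b0 d' e'" using X finitely_presented_iff by blast
  obtain c1 c0 d e where p: "presents Y c1 c0 d e" using Y finitely_presented_iff by blast
  note q' = presentsD[OF q] and p' = presentsD[OF p]
  obtain a where a: "a \<in> hom b0 c0" "far Y c0 b0 a e = \<phi> b0 e'"
    using generatesD(3)[OF p'(1) q'(3) nat_maps_closed[OF \<phi> q'(3,5)]] by blast
  obtain z i0 i1 \<pi>0 \<pi>1 where z: "z \<in> Ob C" and i: "i0 \<in> hom b0 z" "i1 \<in> hom c1 z"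
    and \<pi>: "\<pi>0 \<in> hom z b0" "\<pi>1 \<in> hom z c1"
    and orth: "Cmp C b0 z b0 \<pi>0 i0 = Idm C b0" "Cmp C c1 z c1 \<pi>1 i1 = Idm C c1"
      "Cmp C c1 z b0 \<pi>0 i1 = \<zero>\<^bsub>Hom C c1 b0\<^esub>" "Cmp C b0 z c1 \<pi>1 i0 = \<zero>\<^bsub>Hom C b0 c1\<^esub>"
    using binary_biproduct[OF biproduct q'(3) p'(2)] by metis
  define D where "D = Cmp C z b0 c0 a \<pi>0 \<oplus>\<^bsub>Hom C z c0\<^esub> Cmp C z c1 c0 d \<pi>1"
  have a\<pi>: "Cmp C z b0 c0 a \<pi>0 \<in> hom z c0" "Cmp C z c1 c0 d \<pi>1 \<in> hom z c0"
    using z q' p' a \<pi> by (simp_all add: Cmp_closed)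
  have D: "D \<in> hom z c0" unfolding D_def using a\<pi> z p' by (simp add: Hom_add)
  have D_Cmp: "Cmp C x z c0 D h = Cmp C x b0 c0 a (Cmp C x z b0 \<pi>0 h) \<oplus>\<^bsub>Hom C x c0\<^esub>
      Cmp C x c1 c0 d (Cmp C x z c1 \<pi>1 h)" if "x \<in> Ob C" "h \<in> hom x z" for x h
    unfolding D_def using that z q' p' a \<pi> a\<pi> by (simp add: Cmp_add_left Cmp_assoc)
  have D_i0: "Cmp C b0 z c0 D i0 = a"
  proof -
    interpret H: abelian_group "Hom C b0 c0" by (rule Hom_abelian_group[OF q'(3) p'(3)])
    show ?thesis using D_Cmp[OF q'(3) i(1)] orth a q' p' by (simp add: Cmp_Idm_right Cmp_zero_right)
  qed
  have D_i1: "Cmp C c1 z c0 D i1 = d"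
  proof -
    interpret H: abelian_group "Hom C c1 c0" by (rule Hom_abelian_group[OF p'(2,3)])
    show ?thesis using D_Cmp[OF p'(2) i(2)] orth a q' p' by (simp add: Cmp_Idm_right Cmp_zero_right)
  qed
  obtain P :: "('o, 'm, ('k, 'u) module, 'u \<Rightarrow> 'u) fctr" and E
    where P: "cat_module K C P" and P_p: "presents P z c0 D E"
    using presented_module_exists[OF z p'(3) D] by blast
  note P' = presentsD[OF P_p]
  have P_fp: "finitely_presented K C P" using finitely_presented_iff[OF P] P_p by blast
  have D_E: "far P c0 z D E = \<zero>\<^bsub>fob P z\<^esub>" by (rule presents_vanishes[OF P P_p])
  have far_zero: "far P y x f \<zero>\<^bsub>fob P y\<^esub> = \<zero>\<^bsub>fob P x\<^esub>" if "x \<in> Ob C" "y \<in> Ob C" "f \<in> hom x y" for x y f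
    using linear_map_zero[OF cat_module_linear[OF P that] cat_module_fob[OF P that(2)]
      cat_module_fob[OF P that(1)]] .
  have "far P c0 c1 d E = \<zero>\<^bsub>fob P c1\<^esub>"
    using cat_module_Cmp[OF P p'(2) z p'(3) i(2) D P'(5)] D_E D_i1 far_zero[OF p'(2) z i(2)] by simp
  then obtain r where r: "r \<in> nat_maps K C Y P" "r c0 e = E"
    using presents_factor[OF Y(1) P p P'(5)] by blast
  have r_far: "r x (far Y c0 x g e) = far P c0 x g E" if "x \<in> Ob C" "g \<in> hom x c0" for x g
    using nat_maps_natural[OF r(1) that(1) p'(3) that(2) p'(5)] r(2) by simp
  have surj: "\<exists>y\<in>carrier (fob Y x). r x y = v" if x: "x \<in> Ob C" and v: "v \<in> carrier (fob P x)" for x v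
  proof -
    obtain g where g: "g \<in> hom x c0" "far P c0 x g E = v" using generatesD(3)[OF P'(1) x v] by blast
    then show ?thesis using r_far[OF x g(1)] cat_module_closed[OF Y(1) x p'(3) g(1) p'(5)] by blast
  qed
  have exact: "\<exists>v\<in>carrier (fob X x). \<phi> x v = y"
    if x: "x \<in> Ob C" and y: "y \<in> carrier (fob Y x)" and 0: "r x y = \<zero>\<^bsub>fob P x\<^esub>" for x y
  proof -
    interpret Yx: module K "fob Y x" by (rule cat_module_fob[OF Y(1) x])
    obtain g where g: "g \<in> hom x c0" "far Y c0 x g e = y" using generatesD(3)[OF p'(1) x y] by blast
    then obtain h where h: "h \<in> hom x z" "g = Cmp C x z c0 D h"
      using P'(6)[OF x g(1)] r_far[OF x g(1)] 0 by auto
    let ?u = "Cmp C x z b0 \<pi>0 h" and ?w = "Cmp C x z c1 \<pi>1 h"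
    have uw: "?u \<in> hom x b0" "?w \<in> hom x c1" using x z h q' p' \<pi> by (simp_all add: Cmp_closed)
    \<comment> \<open>The part that passes through c1 is a relation of Y and vanishes; the part that
      passes through b0 comes from X.\<close>
    have "y = far Y c0 x (Cmp C x b0 c0 a ?u) e \<oplus>\<^bsub>fob Y x\<^esub> far Y c0 x (Cmp C x c1 c0 d ?w) e"
      using g h D_Cmp[OF x h(1)] uw x q' p' a cat_module_add[OF Y(1) x p'(3) _ _ p'(5)]
      by (simp add: Cmp_closed)
    also have "far Y c0 x (Cmp C x c1 c0 d ?w) e = \<zero>\<^bsub>fob Y x\<^esub>"
      using p'(6)[OF x Cmp_closed[OF x p'(2,3) uw(2) p'(4)]] uw by blast
    also have "far Y c0 x (Cmp C x b0 c0 a ?u) e = \<phi> x (far X b0 x ?u e')"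
      using cat_module_Cmp[OF Y(1) x q'(3) p'(3) uw(1) a(1) p'(5)] a
        nat_maps_natural[OF \<phi> x q'(3) uw(1) q'(5)] by simp
    finally have "y = \<phi> x (far X b0 x ?u e') \<oplus>\<^bsub>fob Y x\<^esub> \<zero>\<^bsub>fob Y x\<^esub>" .
    then show ?thesis
      using cat_module_closed[OF X(1) x q'(3) uw(1) q'(5)] nat_maps_closed[OF \<phi> x] by auto
  qed
  have r\<phi>: "r x (\<phi> x v) = \<zero>\<^bsub>fob P x\<^esub>" if x: "x \<in> Ob C" and v: "v \<in> carrier (fob X x)" for x v
  proof -
    obtain g where g: "g \<in> hom x b0" "far X b0 x g e' = v" using generatesD(3)[OF q'(1) x v] by blast
    have "\<phi> x v = far Y c0 x (Cmp C x b0 c0 a g) e"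
      using nat_maps_natural[OF \<phi> x q'(3) g(1) q'(5)]
        cat_module_Cmp[OF Y(1) x q'(3) p'(3) g(1) a(1) p'(5)]
        a g by simp
    then have "r x (\<phi> x v) = far P c0 x (Cmp C x b0 c0 a g) E"
      using r_far[OF x Cmp_closed[OF x q'(3) p'(3) g(1) a(1)]] by simp
    also have "Cmp C x b0 c0 a g = Cmp C x z c0 D (Cmp C x b0 z i0 g)"
      using Cmp_assoc[OF x q'(3) z p'(3) g(1) i(1) D] D_i0 by simp
    also have "far P c0 x (Cmp C x z c0 D (Cmp C x b0 z i0 g)) E = \<zero>\<^bsub>fob P x\<^esub>"
      using P'(6)[OF x Cmp_closed[OF x z p'(3) Cmp_closed[OF x q'(3) z g(1) i(1)] D]]
        Cmp_closed[OF x q'(3) z g(1) i(1)] by blast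
    finally show ?thesis .
  qed
  have coker: "is_cokernel ?M X Y \<phi> P r"
    unfolding is_cokernel_def is_kernel_def op_cat_simps
  proof (intro conjI ballI impI)
    show "P \<in> Ob ?M" using P P_fp by simp
    show "r \<in> carrier (Hom ?M Y P)" using r by simp
    show "Cmp ?M X Y P r \<phi> = \<zero>\<^bsub>Hom ?M X P\<^esub>" by (auto simp: r\<phi> intro!: restrict_ext)
    fix Z \<theta> assume "Z \<in> Ob ?M" and "\<theta> \<in> carrier (Hom ?M Y Z)"
      and 0: "Cmp ?M X Y Z \<theta> \<phi> = \<zero>\<^bsub>Hom ?M X Z\<^esub>"
    then have Z: "cat_module K C Z" and \<theta>: "\<theta> \<in> nat_maps K C Y Z" by simp_all
    have \<theta>\<phi>: "\<theta> b0 (\<phi> b0 e') = \<zero>\<^bsub>fob Z b0\<^esub>"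
    proof -
      have "\<theta> b0 (\<phi> b0 e') = Cmp ?M X Y Z \<theta> \<phi> b0 e'" using q' by simp
      then show ?thesis unfolding 0 using q' by simp
    qed
    let ?z = "\<theta> c0 e"
    have z_in: "?z \<in> carrier (fob Z c0)" using nat_maps_closed[OF \<theta> p'(3,5)] .
    have \<theta>_far: "\<theta> x (far Y c0 x g e) = far Z c0 x g ?z" if "x \<in> Ob C" "g \<in> hom x c0" for x g
      using nat_maps_natural[OF \<theta> that(1) p'(3) that(2) p'(5)] .
    have Z_zero: "far Z y x f \<zero>\<^bsub>fob Z y\<^esub> = \<zero>\<^bsub>fob Z x\<^esub>" if "x \<in> Ob C" "y \<in> Ob C" "f \<in> hom x y" for x y f
      using linear_map_zero[OF cat_module_linear[OF Z that] cat_module_fob[OF Z that(2)]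
        cat_module_fob[OF Z that(1)]] .
    interpret Zz: module K "fob Z z" by (rule cat_module_fob[OF Z z])
    have "far Z c0 c1 d ?z = \<zero>\<^bsub>fob Z c1\<^esub>"
      using \<theta>_far[OF p'(2,4)] presents_vanishes[OF Y(1) p]
        linear_map_zero[OF nat_maps_linear[OF \<theta> p'(2)] cat_module_fob[OF Y(1) p'(2)]
          cat_module_fob[OF Z p'(2)]] by simp
    moreover have "far Z c0 b0 a ?z = \<zero>\<^bsub>fob Z b0\<^esub>" using \<theta>_far[OF q'(3) a(1)] a(2) \<theta>\<phi> by simp
    moreover have "far Z c0 z D ?z = far Z b0 z \<pi>0 (far Z c0 b0 a ?z) \<oplus>\<^bsub>fob Z z\<^esub> far Z c1 z \<pi>1
      (far Z c0 c1 d ?z)"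
      unfolding D_def using cat_module_add[OF Z z p'(3) a\<pi> z_in]
        cat_module_Cmp[OF Z z q'(3) p'(3) \<pi>(1) a(1) z_in]
        cat_module_Cmp[OF Z z p'(2,3) \<pi>(2) p'(4) z_in] by simp
    ultimately have "far Z c0 z D ?z = \<zero>\<^bsub>fob Z z\<^esub>"
      using Z_zero[OF z q'(3) \<pi>(1)] Z_zero[OF z p'(2) \<pi>(2)] by simp
    then obtain h where h: "h \<in> nat_maps K C P Z" "h c0 E = ?z"
      using presents_factor[OF P Z P_p z_in] by blast
    \<comment> \<open>Since Y is generated by e and r sends e to E, a map k out of P factors
      \<theta> exactly when it sends E to the image of e under \<theta>. The map h does so, and P is
      generated by E, whence uniqueness.\<close>
    have comp: "Cmp ?M Y P Z k r = \<theta> \<longleftrightarrow> k c0 E = ?z" if k: "k \<in> nat_maps K C P Z" for k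
    proof
      assume "Cmp ?M Y P Z k r = \<theta>"
      then have "Cmp ?M Y P Z k r c0 e = ?z" by simp
      then show "k c0 E = ?z" using p' r by simp
    next
      assume "k c0 E = ?z"
      then show "Cmp ?M Y P Z k r = \<theta>"
        using nat_maps_Cmp[OF Y(1) r(1) k] p' r by (intro nat_maps_eq_if_generated[OF p'(1) _ \<theta>]) simp_all
    qed
    show "\<exists>!h. h \<in> carrier (Hom ?M P Z) \<and> Cmp ?M Y P Z h r = \<theta>"
    proof (rule ex1I[of _ h])
      show "h \<in> carrier (Hom ?M P Z) \<and> Cmp ?M Y P Z h r = \<theta>"
        using h comp[OF h(1)] by (simp only: mod_cat_simps)
      fix k assume "k \<in> carrier (Hom ?M P Z) \<and> Cmp ?M Y P Z k r = \<theta>"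
      then have k: "k \<in> nat_maps K C P Z" and "Cmp ?M Y P Z k r = \<theta>" by (simp_all only: mod_cat_simps)
      then have "k c0 E = ?z" using comp[OF k] by blast
      then show "k = h" using nat_maps_eq_if_generated[OF P'(1) k h(1)] h(2) by simp
    qed
  qed
  show thesis using that[OF P P_fp r(1) coker surj exact] .
qed

text \<open>\<open>inverted\<close> speaks of some kernel and some cokernel in S. By the universal
  properties, the inclusion of the objectwise kernel factors through the given kernel, and the map
  onto the objectwise cokernel factors through the given cokernel. Both given objects vanish at R,
  hence s is injective and surjective there. For the converse the objectwise kernel and cokernel
  themselves lie in S.\<close>

lemma inverted_iff_bij_betw:
  fixes X Y :: "('o, 'm, ('k, 'u) module, 'u \<Rightarrow> 'u) fctr"
  assumes R: "R \<in> Ob C"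
    and S: "S = {X \<in> Ob (mod_cat TYPE('u) K C). carrier (fob X R) = {\<zero>\<^bsub>fob X R\<^esub>}}"
    and X: "cat_module K C X" "finitely_presented K C X"
    and Y: "cat_module K C Y" "finitely_presented K C Y"
  shows "s \<in> inverted (mod_cat TYPE('u) K C) S X Y \<longleftrightarrow>
    s \<in> nat_maps K C X Y \<and> bij_betw (s R) (carrier (fob X R)) (carrier (fob Y R))"
proof (cases "s \<in> nat_maps K C X Y")
  case False
  then show ?thesis by (simp add: inverted_def)
next
  case s: True
  let ?M = "mod_cat TYPE('u) K C" and ?N = "kernel_functor X Y s"
  interpret XR: module K "fob X R" by (rule cat_module_fob[OF X(1) R])
  interpret YR: module K "fob Y R" by (rule cat_module_fob[OF Y(1) R])
  note lin = nat_maps_linear[OF s R]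
  note N = kernel_functor[OF X(1) Y(1) s] and N_fp = kernel_finitely_presented[OF X Y s]
    and N_ker = is_kernel_kernel_functor[OF X Y s]
  obtain P p where P: "cat_module K C P" "finitely_presented K C P" "p \<in> nat_maps K C Y P"
    and coker: "is_cokernel ?M X Y s P p"
    and surj: "\<And>x v. \<lbrakk>x \<in> Ob C; v \<in> carrier (fob P x)\<rbrakk> \<Longrightarrow> \<exists>y\<in>carrier (fob Y x). p x y = v"
    and exact: "\<And>x y. \<lbrakk>x \<in> Ob C; y \<in> carrier (fob Y x); p x y = \<zero>\<^bsub>fob P x\<^esub>\<rbrakk>
      \<Longrightarrow> \<exists>v\<in>carrier (fob X x). s x v = y"
    using cokernel_exists[OF X Y s] by metis
  interpret PR: module K "fob P R" by (rule cat_module_fob[OF P(1) R])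
  have zero_s: "s R \<zero>\<^bsub>fob X R\<^esub> = \<zero>\<^bsub>fob Y R\<^esub>"
    by (rule linear_map_zero[OF lin XR.module_axioms YR.module_axioms])
  show ?thesis
  proof
    assume "s \<in> inverted ?M S X Y"
    then obtain k i c q where k: "k \<in> S" "is_kernel ?M X Y s k i"
      and c: "c \<in> S" "is_cokernel ?M X Y s c q"
      unfolding inverted_def by blast
    have kM: "cat_module K C k" and k0: "carrier (fob k R) = {\<zero>\<^bsub>fob k R\<^esub>}" using k(1) by (simp_all add: S)
    have cM: "cat_module K C c" and c0: "carrier (fob c R) = {\<zero>\<^bsub>fob c R\<^esub>}" using c(1) by (simp_all add: S)
    have "\<exists>h. h \<in> nat_maps K C ?N k \<and> Cmp ?M ?N k X i h = inclusion C ?N"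
      using N_ker k(2) unfolding is_kernel_def mod_cat_simps(2) by blast
    then obtain h where h: "h \<in> nat_maps K C ?N k" "Cmp ?M ?N k X i h = inclusion C ?N" by blast
    have i: "i \<in> nat_maps K C k X" using k(2) by (simp add: is_kernel_def)
    have inj: "v = \<zero>\<^bsub>fob X R\<^esub>" if v: "v \<in> carrier (fob X R)" "s R v = \<zero>\<^bsub>fob Y R\<^esub>" for v
    proof -
      have vN: "v \<in> carrier (fob ?N R)" using v by (simp add: carrier_kernel_functor)
      have "v = Cmp ?M ?N k X i h R v" unfolding h(2) using R vN by (simp add: inclusion_def)
      also have "\<dots> = i R (h R v)" using R vN by simp
      also have "h R v = \<zero>\<^bsub>fob k R\<^esub>" using nat_maps_closed[OF h(1) R vN] k0 by simp
      also have "i R \<zero>\<^bsub>fob k R\<^esub> = \<zero>\<^bsub>fob X R\<^esub>"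
        by (rule linear_map_zero[OF nat_maps_linear[OF i R] cat_module_fob[OF kM R] XR.module_axioms])
      finally show ?thesis .
    qed
    have "inj_on (s R) (carrier (fob X R))"
    proof (rule inj_onI)
      fix v w assume vw: "v \<in> carrier (fob X R)" "w \<in> carrier (fob X R)" "s R v = s R w"
      have "s R (v \<ominus>\<^bsub>fob X R\<^esub> w) = \<zero>\<^bsub>fob Y R\<^esub>"
        using linear_map_minus[OF lin XR.module_axioms YR.module_axioms vw(1,2)] vw(3)
          YR.M.diff_eq_zero_iff[of "s R w" "s R w"] linear_map_closed[OF lin vw(2)] by simp
      then have "v \<ominus>\<^bsub>fob X R\<^esub> w = \<zero>\<^bsub>fob X R\<^esub>" using inj vw by simp
      then show "v = w" using XR.M.diff_eq_zero_iff vw by simp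
    qed
    moreover have "s R ` carrier (fob X R) = carrier (fob Y R)"
    proof (intro equalityI subsetI)
      fix y assume y: "y \<in> carrier (fob Y R)"
      have "\<exists>h. h \<in> nat_maps K C c P \<and> Cmp ?M Y c P h q = p"
        using c(2) coker unfolding is_cokernel_def is_kernel_def op_cat_simps mod_cat_simps(2) by blast
      then obtain h where h: "h \<in> nat_maps K C c P" "Cmp ?M Y c P h q = p" by blast
      have q: "q \<in> nat_maps K C Y c" using c(2) by (simp add: is_cokernel_def is_kernel_def)
      have "p R y = h R (q R y)" unfolding h(2)[symmetric] using R y by simp
      also have "q R y = \<zero>\<^bsub>fob c R\<^esub>" using nat_maps_closed[OF q R y] c0 by simp
      also have "h R \<zero>\<^bsub>fob c R\<^esub> = \<zero>\<^bsub>fob P R\<^esub>"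
        by (rule linear_map_zero[OF nat_maps_linear[OF h(1) R] cat_module_fob[OF cM R] PR.module_axioms])
      finally show "y \<in> s R ` carrier (fob X R)" using exact[OF R y] by blast
    qed (use nat_maps_closed[OF s R] in blast)
    ultimately show "s \<in> nat_maps K C X Y \<and> bij_betw (s R) (carrier (fob X R)) (carrier (fob Y R))"
      using s by (simp add: bij_betw_def)
  next
    assume "s \<in> nat_maps K C X Y \<and> bij_betw (s R) (carrier (fob X R)) (carrier (fob Y R))"
    then have bij: "inj_on (s R) (carrier (fob X R))" "s R ` carrier (fob X R) = carrier (fob Y R)"
      by (simp_all add: bij_betw_def)
    have "carrier (fob ?N R) = {\<zero>\<^bsub>fob ?N R\<^esub>}"
    proof -
      have "v = \<zero>\<^bsub>fob X R\<^esub>" if "v \<in> carrier (fob X R)" "s R v = \<zero>\<^bsub>fob Y R\<^esub>" for v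
        using inj_onD[OF bij(1), of v "\<zero>\<^bsub>fob X R\<^esub>"] that zero_s by simp
      then show ?thesis
        using zero_s by (auto simp: carrier_kernel_functor)
          (simp_all add: kernel_functor_def submodule_functor_def)
    qed
    then have NS: "?N \<in> S" using N(1) N_fp by (simp add: S)
    have "v = \<zero>\<^bsub>fob P R\<^esub>" if v: "v \<in> carrier (fob P R)" for v
    proof -
      obtain y where y: "y \<in> carrier (fob Y R)" "p R y = v" using surj[OF R v] by blast
      then have "y \<in> s R ` carrier (fob X R)" using bij(2) by simp
      then obtain x where x: "x \<in> carrier (fob X R)" "p R (s R x) = v" using y(2) by blast
      have "Cmp ?M X Y P p s = \<zero>\<^bsub>Hom ?M X P\<^esub>"
        using coker unfolding is_cokernel_def is_kernel_def op_cat_simps by blast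
      then have "Cmp ?M X Y P p s R x = \<zero>\<^bsub>Hom ?M X P\<^esub> R x" by simp
      then show ?thesis using R x by simp
    qed
    then have "carrier (fob P R) = {\<zero>\<^bsub>fob P R\<^esub>}" using PR.M.zero_closed by blast
    then have "P \<in> S" using P by (simp add: S)
    with NS N_ker coker s show "s \<in> inverted ?M S X Y" by (auto simp: inverted_def)
  qed
qed

end

section \<open>Modules over an ideal quotient\<close>

locale category_ideal = linear_category K C for K :: "'k ring" and C :: "('o, 'm, 'k) lin_cat" +
  fixes I :: "'o \<Rightarrow> 'o \<Rightarrow> 'm set"
  assumes ideal_subset: "\<lbrakk>x \<in> Ob C; y \<in> Ob C\<rbrakk> \<Longrightarrow> I x y \<subseteq> carrier (Hom C x y)"
    and ideal_zero: "\<lbrakk>x \<in> Ob C; y \<in> Ob C\<rbrakk> \<Longrightarrow> \<zero>\<^bsub>Hom C x y\<^esub> \<in> I x y"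
    and ideal_add: "\<lbrakk>x \<in> Ob C; y \<in> Ob C; f \<in> I x y; g \<in> I x y\<rbrakk> \<Longrightarrow> f \<oplus>\<^bsub>Hom C x y\<^esub> g \<in> I x y"
    and ideal_smult: "\<lbrakk>x \<in> Ob C; y \<in> Ob C; c \<in> carrier K; f \<in> I x y\<rbrakk> \<Longrightarrow> c \<odot>\<^bsub>Hom C x y\<^esub> f \<in> I x y"
    and ideal_Cmp_right: "\<lbrakk>x \<in> Ob C; y \<in> Ob C; z \<in> Ob C; f \<in> carrier (Hom C x y); g \<in> I y z\<rbrakk>
      \<Longrightarrow> Cmp C x y z g f \<in> I x z"
    and ideal_Cmp_left: "\<lbrakk>x \<in> Ob C; y \<in> Ob C; z \<in> Ob C; f \<in> I x y; g \<in> carrier (Hom C y z)\<rbrakk>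
      \<Longrightarrow> Cmp C x y z g f \<in> I x z"
begin

abbreviation "Q \<equiv> ideal_quotient C I"

definition coset where "coset x y f = I x y +>\<^bsub>Hom C x y\<^esub> f"

text \<open>Negatives are multiples by the scalar -1, so closure under scalars makes the ideal a
  subgroup, and the general facts on cosets of additive subgroups apply.\<close>

lemma abelian_subgroup_ideal:
  assumes "x \<in> Ob C" "y \<in> Ob C"
  shows "abelian_subgroup (I x y) (Hom C x y)"
proof -
  interpret H: module K "Hom C x y" by (rule Hom_module[OF assms])
  have "\<ominus>\<^bsub>Hom C x y\<^esub> f \<in> I x y" if "f \<in> I x y" for f
  proof -
    have "f \<in> hom x y" using that ideal_subset[OF assms] by blast
    then have "\<ominus>\<^bsub>Hom C x y\<^esub> f = (\<ominus>\<^bsub>K\<^esub> \<one>\<^bsub>K\<^esub>) \<odot>\<^bsub>Hom C x y\<^esub> f" by (simp add: H.smult_l_minus)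
    then show ?thesis using ideal_smult[OF assms _ that] by simp
  qed
  then have "submodule (I x y) K (Hom C x y)"
    by (intro H.submoduleI) (use ideal_subset[OF assms] ideal_zero[OF assms] ideal_add[OF assms]
      ideal_smult[OF assms] in auto)
  then show ?thesis
    by (intro abelian_subgroupI3 additive_subgroup.intro)
      (use H.M.abelian_group_axioms in \<open>auto simp: submodule_def\<close>)
qed

lemma coset_mem_iff:
  assumes "x \<in> Ob C" "y \<in> Ob C" "f \<in> hom x y" "g \<in> hom x y"
  shows "g \<in> coset x y f \<longleftrightarrow> g \<ominus>\<^bsub>Hom C x y\<^esub> f \<in> I x y"
  using abelian_subgroup.a_rcos_module[OF abelian_subgroup_ideal[OF assms(1,2)] assms(3,4)]
  by (simp add: coset_def a_minus_def)

lemma coset_subset: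
  assumes "x \<in> Ob C" "y \<in> Ob C" "f \<in> hom x y"
  shows "coset x y f \<subseteq> hom x y"
  using abelian_subgroup.a_elemrcos_carrier[OF abelian_subgroup_ideal[OF assms(1,2)] assms(3)]
  by (auto simp: coset_def)

lemma coset_self:
  assumes "x \<in> Ob C" "y \<in> Ob C" "f \<in> hom x y"
  shows "f \<in> coset x y f"
  using abelian_subgroup.a_rcos_self[OF abelian_subgroup_ideal[OF assms(1,2)] assms(3)]
  by (simp add: coset_def)

lemma coset_eq_iff:
  assumes "x \<in> Ob C" "y \<in> Ob C" "f \<in> hom x y" "g \<in> hom x y"
  shows "coset x y f = coset x y g \<longleftrightarrow> g \<ominus>\<^bsub>Hom C x y\<^esub> f \<in> I x y"
  unfolding coset_mem_iff[OF assms, symmetric]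
  using abelian_subgroup.a_repr_independence'[OF abelian_subgroup_ideal[OF assms(1,2)], of g f]
    coset_self[OF assms(1,2,4)] assms(3) by (auto simp: coset_def)

lemma Ob_Q [simp]: "Ob Q = Ob C"
  by (simp add: ideal_quotient_def)

lemma Q_simps:
  "carrier (Hom Q x y) = a_rcosets\<^bsub>Hom C x y\<^esub> (I x y)" "\<zero>\<^bsub>Hom Q x y\<^esub> = I x y"
  "p \<oplus>\<^bsub>Hom Q x y\<^esub> q = p <+>\<^bsub>Hom C x y\<^esub> q"
  "c \<odot>\<^bsub>Hom Q x y\<^esub> p = (\<Union>f\<in>p. coset x y (c \<odot>\<^bsub>Hom C x y\<^esub> f))"
  "Idm Q x = coset x x (Idm C x)"
  "Cmp Q x y z q p = (\<Union>g\<in>q. \<Union>f\<in>p. coset x z (Cmp C x y z g f))"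
  by (simp_all add: ideal_quotient_def coset_def)

lemma coset_image: "coset x y ` hom x y = carrier (Hom Q x y)"
  by (auto simp: Q_simps A_RCOSETS_def' coset_def a_r_coset_def')

lemma coset_add:
  assumes "x \<in> Ob C" "y \<in> Ob C" "f \<in> hom x y" "g \<in> hom x y"
  shows "coset x y (f \<oplus>\<^bsub>Hom C x y\<^esub> g) = coset x y f \<oplus>\<^bsub>Hom Q x y\<^esub> coset x y g"
  using abelian_subgroup.a_rcos_sum[OF abelian_subgroup_ideal[OF assms(1,2)] assms(3,4)]
  by (simp add: Q_simps coset_def)

lemma coset_smult:
  assumes xy: "x \<in> Ob C" "y \<in> Ob C" and c: "c \<in> carrier K" and f: "f \<in> hom x y"
  shows "coset x y (c \<odot>\<^bsub>Hom C x y\<^esub> f) = c \<odot>\<^bsub>Hom Q x y\<^esub> coset x y f"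
proof -
  interpret H: module K "Hom C x y" by (rule Hom_module[OF xy])
  have lin: "linear_map K (Hom C x y) (Hom C x y) (\<lambda>g. c \<odot>\<^bsub>Hom C x y\<^esub> g)"
    by (rule linear_mapI)
      (use c in \<open>auto simp: H.smult_r_distr H.R.m_comm simp flip: H.smult_assoc1\<close>)
  have "coset x y (c \<odot>\<^bsub>Hom C x y\<^esub> g) = coset x y (c \<odot>\<^bsub>Hom C x y\<^esub> f)" if g: "g \<in> coset x y f" for g
  proof -
    have g': "g \<in> hom x y" using g coset_subset[OF xy f] by blast
    then have "g \<ominus>\<^bsub>Hom C x y\<^esub> f \<in> I x y" using g coset_mem_iff[OF xy f] by blast
    then have "c \<odot>\<^bsub>Hom C x y\<^esub> (g \<ominus>\<^bsub>Hom C x y\<^esub> f) \<in> I x y" using ideal_smult[OF xy c] by blast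
    then show ?thesis
      using coset_eq_iff[OF xy Hom_smult[OF xy c f] Hom_smult[OF xy c g']]
        linear_map_minus[OF lin H.module_axioms H.module_axioms g' f] by simp
  qed
  then show ?thesis unfolding Q_simps using coset_self[OF xy f] by blast
qed

text \<open>The two factors are replaced one at a time: \<open>g' f'\<close> and \<open>g' f\<close>
  differ by \<open>g'\<close> after \<open>f' - f\<close>, while \<open>g' f\<close> and
  \<open>g f\<close> differ by \<open>g' - g\<close> after f, and both differences lie in the ideal.
  The union that defines composition is thus a single coset.\<close>

lemma coset_Cmp:
  assumes xyz: "x \<in> Ob C" "y \<in> Ob C" "z \<in> Ob C" and f: "f \<in> hom x y" and g: "g \<in> hom y z"
  shows "coset x z (Cmp C x y z g f) = Cmp Q x y z (coset y z g) (coset x y f)"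
proof -
  have "coset x z (Cmp C x y z g' f') = coset x z (Cmp C x y z g f)"
    if mem: "f' \<in> coset x y f" "g' \<in> coset y z g" for f' g'
  proof -
    have f': "f' \<in> hom x y" using mem coset_subset[OF xyz(1,2) f] by blast
    have g': "g' \<in> hom y z" using mem coset_subset[OF xyz(2,3) g] by blast
    have "f' \<ominus>\<^bsub>Hom C x y\<^esub> f \<in> I x y" using mem coset_mem_iff[OF xyz(1,2) f f'] by blast
    then have "Cmp C x y z g' (f' \<ominus>\<^bsub>Hom C x y\<^esub> f) \<in> I x z" using ideal_Cmp_left[OF xyz] g' by blast
    then have 1: "coset x z (Cmp C x y z g' f) = coset x z (Cmp C x y z g' f')"
      using coset_eq_iff[OF xyz(1,3) Cmp_closed[OF xyz f g'] Cmp_closed[OF xyz f' g']]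
        linear_map_minus[OF Cmp_linear_right[OF xyz g'] Hom_module[OF xyz(1,2)]
          Hom_module[OF xyz(1,3)] f' f] by simp
    have "g' \<ominus>\<^bsub>Hom C y z\<^esub> g \<in> I y z" using mem coset_mem_iff[OF xyz(2,3) g g'] by blast
    then have "Cmp C x y z (g' \<ominus>\<^bsub>Hom C y z\<^esub> g) f \<in> I x z" using ideal_Cmp_right[OF xyz f] by blast
    then have "coset x z (Cmp C x y z g f) = coset x z (Cmp C x y z g' f)"
      using coset_eq_iff[OF xyz(1,3) Cmp_closed[OF xyz f g] Cmp_closed[OF xyz f g']]
        linear_map_minus[OF Cmp_linear_left[OF xyz f] Hom_module[OF xyz(2,3)] Hom_module[OF xyz(1,3)]
          g' g] by simp
    with 1 show ?thesis by simp
  qed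
  then show ?thesis unfolding Q_simps using coset_self[OF xyz(1,2) f] coset_self[OF xyz(2,3) g] by blast
qed

lemma coset_zero:
  assumes "x \<in> Ob C" "y \<in> Ob C" "f \<in> I x y"
  shows "coset x y f = \<zero>\<^bsub>Hom Q x y\<^esub>"
  using abelian_subgroup.a_rcos_const[OF abelian_subgroup_ideal[OF assms(1,2)] assms(3)]
  by (simp add: Q_simps coset_def)

lemma linear_category_Q: "linear_category K Q"
proof (rule linear_category_image[where D = C and Fo = "\<lambda>x. x" and q = coset])
  show "linear_map K (Hom C x y) (Hom Q x y) (coset x y)" if "x \<in> Ob Q" "y \<in> Ob Q" for x y
    by (rule linear_mapI) (use that coset_image[of x y] in \<open>auto simp: coset_add coset_smult\<close>)
  show "coset x y \<zero>\<^bsub>Hom C x y\<^esub> = \<zero>\<^bsub>Hom Q x y\<^esub>" if "x \<in> Ob Q" "y \<in> Ob Q" for x y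
    using that by (intro coset_zero ideal_zero) simp_all
qed (use coset_image linear_category_axioms coset_Cmp in \<open>simp_all add: Q_simps(5)\<close>)

lemma Q_HomE:
  assumes "p \<in> carrier (Hom Q x y)"
  obtains f where "f \<in> hom x y" "p = coset x y f"
  using assms unfolding coset_image[symmetric] by blast

text \<open>In the quotient the identity of x is zero, so every module over the quotient vanishes at
  x, and the isomorphism carries this over to X.\<close>

lemma vanishes_if_inflated:
  fixes X :: "('o, 'm, ('k, 'u) module, 'u \<Rightarrow> 'u) fctr"
  assumes X: "X \<in> inflated_modules TYPE('u) K C I" and x: "x \<in> Ob C" "Idm C x \<in> I x x"
  shows "carrier (fob X x) = {\<zero>\<^bsub>fob X x\<^esub>}"
proof -
  let ?M = "mod_cat TYPE('u) K C"
  obtain Y where Y: "cat_module K Q Y" and X': "X \<in> Ob ?M"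
    and "isomorphic ?M X (comp_fctr Y (op_fctr (projection C I)))" (is "isomorphic _ _ ?W")
    using X by (auto simp: inflated_modules_def)
  then obtain f g where W: "cat_module K C ?W" and fg: "f \<in> nat_maps K C X ?W" "g \<in> nat_maps K C ?W X"
    "Cmp ?M X ?W X g f = Idm ?M X"
    unfolding isomorphic_def iso_arr_def by auto
  have W_fob: "fob ?W x = fob Y x" by (simp add: comp_fctr_def op_fctr_def projection_def)
  have xQ: "x \<in> Ob Q" using x by simp
  have Y_zero: "v = \<zero>\<^bsub>fob Y x\<^esub>" if v: "v \<in> carrier (fob Y x)" for v
  proof -
    have "v = far Y x x (Idm Q x) v" using cat_module_Idm[OF Y xQ v] by simp
    also have "Idm Q x = \<zero>\<^bsub>Hom Q x x\<^esub>" using coset_zero[OF x(1,1,2)] by (simp add: Q_simps(5))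
    also have "far Y x x \<zero>\<^bsub>Hom Q x x\<^esub> v = \<zero>\<^bsub>fob Y x\<^esub>"
      using linear_map_zero[OF cat_module_eval_linear[OF Y xQ xQ v]
        linear_category.Hom_module[OF linear_category_Q xQ xQ] cat_module_fob[OF Y xQ]] .
    finally show ?thesis .
  qed
  have XM: "cat_module K C X" using X' by simp
  interpret Xx: module K "fob X x" by (rule cat_module_fob[OF XM x(1)])
  have "v = \<zero>\<^bsub>fob X x\<^esub>" if v: "v \<in> carrier (fob X x)" for v
  proof -
    have "v = Idm ?M X x v" using x v by simp
    also have "\<dots> = g x (f x v)" unfolding fg(3)[symmetric] using x v by simp
    also have "f x v = \<zero>\<^bsub>fob ?W x\<^esub>"
      using nat_maps_closed[OF fg(1) x(1) v] Y_zero unfolding W_fob by blast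
    also have "g x \<zero>\<^bsub>fob ?W x\<^esub> = \<zero>\<^bsub>fob X x\<^esub>"
      by (rule linear_map_zero[OF nat_maps_linear[OF fg(2) x(1)] cat_module_fob[OF W x(1)]
        Xx.module_axioms])
    finally show ?thesis .
  qed
  then show ?thesis using Xx.M.zero_closed by blast
qed

text \<open>A module that kills the ideal factors through the projection, and its presentation stays
  one over the quotient: there a relation is a multiple of d only up to the ideal, and X does not
  notice the difference.\<close>

lemma inflated_if_kills_ideal:
  fixes X :: "('o, 'm, ('k, 'u) module, 'u \<Rightarrow> 'u) fctr"
  assumes X: "cat_module K C X" "finitely_presented K C X"
    and kill: "\<And>x y f v. \<lbrakk>x \<in> Ob C; y \<in> Ob C; f \<in> I x y; v \<in> carrier (fob X y)\<rbrakk>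
      \<Longrightarrow> far X y x f v = \<zero>\<^bsub>fob X x\<^esub>"
  shows "X \<in> inflated_modules TYPE('u) K C I"
proof -
  let ?M = "mod_cat TYPE('u) K C"
  interpret Q: linear_category K Q by (rule linear_category_Q)
  have eq: "far X y x f v = far X y x g v"
    if xy: "x \<in> Ob C" "y \<in> Ob C" and f: "f \<in> hom x y" "g \<in> hom x y" "coset x y f = coset x y g"
      and v: "v \<in> carrier (fob X y)" for x y f g v
  proof -
    have "g \<ominus>\<^bsub>Hom C x y\<^esub> f \<in> I x y" using coset_eq_iff[OF xy f(1,2)] f(3) by blast
    then have "far X y x g v \<ominus>\<^bsub>fob X x\<^esub> far X y x f v = \<zero>\<^bsub>fob X x\<^esub>"
      using kill[OF xy _ v] linear_map_minus[OF cat_module_eval_linear[OF X(1) xy v] Hom_module[OF xy]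
        cat_module_fob[OF X(1) xy(1)] f(2,1)] by simp
    then show ?thesis
      using cat_module_fob[OF X(1) xy(1)] cat_module_closed[OF X(1) xy _ v] f(1,2)
      by (simp add: module_def abelian_group.diff_eq_zero_iff)
  qed
  \<comment> \<open>Some morphism of the coset is picked to act; by \<open>eq\<close> its choice
    does not matter.\<close>
  define Y where "Y = \<lparr>fob = fob X,
    far = (\<lambda>y x p. \<lambda>v\<in>carrier (fob X y). far X y x (SOME f. f \<in> p) v)\<rparr>"
  have fob_Y: "fob Y = fob X" by (simp add: Y_def)
  have far_Y: "far Y y x (coset x y f) v = far X y x f v"
    if xy: "x \<in> Ob C" "y \<in> Ob C" and f: "f \<in> hom x y" and v: "v \<in> carrier (fob X y)" for x y f v
  proof -
    let ?g = "SOME g. g \<in> coset x y f"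
    have g: "?g \<in> coset x y f" by (rule someI[of _ f]) (rule coset_self[OF xy f])
    then have g': "?g \<in> hom x y" using coset_subset[OF xy f] by blast
    have "coset x y f = coset x y ?g" using g coset_mem_iff[OF xy f g'] coset_eq_iff[OF xy f g'] by blast
    then show ?thesis using eq[OF xy f g' _ v] v by (simp add: Y_def)
  qed
  have far_Y_ext: "far Y y x (coset x y f) = far X y x f"
    if xy: "x \<in> Ob C" "y \<in> Ob C" and f: "f \<in> hom x y" for x y f
  proof (rule extensionalityI[where A = "carrier (fob X y)"])
    show "far X y x f \<in> extensional (carrier (fob X y))"
      using cat_module_far[OF X(1) xy f] by (simp add: lin_hom_iff)
  qed (use far_Y[OF xy f] in \<open>auto simp: Y_def\<close>)
  have Y: "cat_module K Q Y"
  proof (rule cat_moduleI)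
    fix x y p v assume x: "x \<in> Ob Q" and y: "y \<in> Ob Q" and "p \<in> carrier (Hom Q x y)"
    then obtain f where f: "f \<in> hom x y" "p = coset x y f" by (auto elim: Q_HomE)
    have xy: "x \<in> Ob C" "y \<in> Ob C" using x y by simp_all
    show "far Y y x p \<in> lin_hom K (fob Y y) (fob Y x)"
      using far_Y_ext[OF xy f(1)] cat_module_far[OF X(1) xy f(1)] f(2) by (simp add: fob_Y)
    {
      fix z q assume z: "z \<in> Ob Q" and "q \<in> carrier (Hom Q y z)" and v: "v \<in> carrier (fob Y z)"
      then obtain g where g: "g \<in> hom y z" "q = coset y z g" by (auto elim: Q_HomE)
      show "far Y z x (Cmp Q x y z q p) v = far Y y x p (far Y z y q v)"
        using xy z f g v cat_module_closed[OF X(1) xy(2) _ g(1)]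
        by (simp add: fob_Y far_Y Cmp_closed cat_module_Cmp[OF X(1)] flip: coset_Cmp)
    }
    assume v: "v \<in> carrier (fob Y y)"
    {
      fix q assume "q \<in> carrier (Hom Q x y)"
      then obtain g where g: "g \<in> hom x y" "q = coset x y g" by (auto elim: Q_HomE)
      show "far Y y x (p \<oplus>\<^bsub>Hom Q x y\<^esub> q) v = far Y y x p v \<oplus>\<^bsub>fob Y x\<^esub> far Y y x q v"
        using xy f g v by (simp add: fob_Y far_Y Hom_add cat_module_add[OF X(1)] flip: coset_add)
    }
    show "far Y y x (c \<odot>\<^bsub>Hom Q x y\<^esub> p) v = c \<odot>\<^bsub>fob Y x\<^esub> far Y y x p v" if "c \<in> carrier K" for c
      using that xy f v by (simp add: fob_Y far_Y Hom_smult cat_module_smult[OF X(1)] flip: coset_smult)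
  next
    show "far Y x x (Idm Q x) v = v" if "x \<in> Ob Q" "v \<in> carrier (fob Y x)" for x v
      using that by (simp add: Q_simps(5) far_Y fob_Y Idm_closed cat_module_Idm[OF X(1)])
  qed (use cat_module_fob[OF X(1)] linear_category_Q in \<open>simp_all add: fob_Y\<close>)
  obtain c1 c0 d e where p: "presents X c1 c0 d e" using finitely_presented_iff[OF X(1)] X(2) by blast
  note p' = presentsD[OF p]
  have "Q.presents Y c1 c0 (coset c1 c0 d) e"
    unfolding Q.presents_def Q.generates_def Ob_Q fob_Y
  proof (intro conjI ballI)
    show "coset c1 c0 d \<in> carrier (Hom Q c1 c0)" using p'(4) coset_image by blast
    fix x assume x: "x \<in> Ob C"
    show "\<exists>q\<in>carrier (Hom Q x c0). far Y c0 x q e = v" if v: "v \<in> carrier (fob X x)" for v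
    proof -
      obtain g where g: "g \<in> hom x c0" "far X c0 x g e = v" using generatesD(3)[OF p'(1) x v] by blast
      show ?thesis
        by (rule bexI[of _ "coset x c0 g"]) (use g far_Y[OF x p'(3) g(1) p'(5)] coset_image in auto)
    qed
    fix q assume "q \<in> carrier (Hom Q x c0)"
    then obtain g where g: "g \<in> hom x c0" "q = coset x c0 g" by (auto elim: Q_HomE)
    show "far Y c0 x q e = \<zero>\<^bsub>fob X x\<^esub> \<longleftrightarrow> (\<exists>h\<in>carrier (Hom Q x c1). q = Cmp Q x c1 c0 (coset c1 c0 d) h)"
    proof
      assume "far Y c0 x q e = \<zero>\<^bsub>fob X x\<^esub>"
      then obtain h where h: "h \<in> hom x c1" "g = Cmp C x c1 c0 d h"
        using p'(6)[OF x g(1)] far_Y[OF x p'(3) g(1) p'(5)] g(2) by auto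
      then have "q = Cmp Q x c1 c0 (coset c1 c0 d) (coset x c1 h)"
        using coset_Cmp[OF x p'(2,3) h(1) p'(4)] g(2) by simp
      then show "\<exists>h\<in>carrier (Hom Q x c1). q = Cmp Q x c1 c0 (coset c1 c0 d) h"
        using h(1) coset_image[of x c1] by blast
    next
      assume "\<exists>h\<in>carrier (Hom Q x c1). q = Cmp Q x c1 c0 (coset c1 c0 d) h"
      then obtain h where h: "h \<in> hom x c1" "q = Cmp Q x c1 c0 (coset c1 c0 d) (coset x c1 h)"
        by (auto elim: Q_HomE)
      have dh: "Cmp C x c1 c0 d h \<in> hom x c0" by (rule Cmp_closed[OF x p'(2,3) h(1) p'(4)])
      have "coset x c0 g = coset x c0 (Cmp C x c1 c0 d h)"
        using coset_Cmp[OF x p'(2,3) h(1) p'(4)] g(2) h(2) by simp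
      then have "far X c0 x g e = far X c0 x (Cmp C x c1 c0 d h) e"
        using eq[OF x p'(3) g(1) dh _ p'(5)] by blast
      also have "\<dots> = \<zero>\<^bsub>fob X x\<^esub>" using p'(6)[OF x dh] h(1) by blast
      finally show "far Y c0 x q e = \<zero>\<^bsub>fob X x\<^esub>" using far_Y[OF x p'(3) g(1) p'(5)] g(2) by simp
    qed
  qed (use p' in auto)
  then have Y_fp: "finitely_presented K Q Y" using Q.finitely_presented_iff[OF Y] by blast
  let ?W = "comp_fctr Y (op_fctr (projection C I))"
  have W_fob: "fob ?W x = fob X x" for x by (simp add: comp_fctr_def op_fctr_def projection_def fob_Y)
  have W_far: "far ?W y x f = far X y x f" if "x \<in> Ob C" "y \<in> Ob C" "f \<in> hom x y" for x y f
    using far_Y_ext[OF that] by (simp add: comp_fctr_def op_fctr_def projection_def coset_def)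
  have W: "cat_module K C ?W"
    by (rule cat_moduleI)
      (simp_all add: W_fob W_far cat_module_fob[OF X(1)] cat_module_far[OF X(1)] Idm_closed Cmp_closed
        Hom_add
        Hom_smult cat_module_Idm[OF X(1)] cat_module_Cmp[OF X(1)] cat_module_add[OF X(1)]
        cat_module_smult[OF X(1)] linear_category_axioms)
  have "presents ?W c1 c0 d e"
    using p unfolding presents_def generates_def by (simp add: W_fob W_far)
  then have W_fp: "finitely_presented K C ?W" using finitely_presented_iff[OF W] by blast
  \<comment> \<open>The inflation of Y agrees with X on the objects and morphisms of C, but perhaps
    not as a record outside them. Hence identity maps form an isomorphism in place of an
    equation.\<close>
  let ?i = "\<lambda>x\<in>Ob C. \<lambda>v\<in>carrier (fob X x). v"
  have i: "?i \<in> nat_maps K C X ?W" "?i \<in> nat_maps K C ?W X"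
    using nat_maps_Idm[OF X(1)] by (simp_all add: nat_maps_def W_fob W_far)
  have "iso_arr ?M X ?W ?i"
    unfolding iso_arr_def mod_cat_simps
    by (rule conjI[OF i(1)], rule bexI[OF _ i(2)]) (auto simp: W_fob intro!: restrict_ext)
  then show ?thesis
    using X Y Y_fp W W_fp unfolding inflated_modules_def isomorphic_def by auto
qed

end

section \<open>Finite dimensional spaces\<close>

lemma submodule_iff:
  assumes "module K V"
  shows "submodule H K V \<longleftrightarrow> H \<subseteq> carrier V \<and> \<zero>\<^bsub>V\<^esub> \<in> H \<and> (\<forall>v\<in>H. \<forall>w\<in>H. v \<oplus>\<^bsub>V\<^esub> w \<in> H) \<and>
    (\<forall>c\<in>carrier K. \<forall>v\<in>H. c \<odot>\<^bsub>V\<^esub> v \<in> H)"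
proof
  interpret V: module K V by fact
  assume H: "submodule H K V"
  then interpret subgroup H "add_monoid V" by (simp add: submodule_def)
  show "H \<subseteq> carrier V \<and> \<zero>\<^bsub>V\<^esub> \<in> H \<and> (\<forall>v\<in>H. \<forall>w\<in>H. v \<oplus>\<^bsub>V\<^esub> w \<in> H) \<and>
    (\<forall>c\<in>carrier K. \<forall>v\<in>H. c \<odot>\<^bsub>V\<^esub> v \<in> H)"
    using V.submoduleE[OF H] one_closed by auto
next
  interpret V: module K V by fact
  assume H: "H \<subseteq> carrier V \<and> \<zero>\<^bsub>V\<^esub> \<in> H \<and> (\<forall>v\<in>H. \<forall>w\<in>H. v \<oplus>\<^bsub>V\<^esub> w \<in> H) \<and>
    (\<forall>c\<in>carrier K. \<forall>v\<in>H. c \<odot>\<^bsub>V\<^esub> v \<in> H)"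
  show "submodule H K V"
  proof (rule V.submoduleI)
    fix v assume v: "v \<in> H"
    then have "\<ominus>\<^bsub>V\<^esub> v = (\<ominus>\<^bsub>K\<^esub> \<one>\<^bsub>K\<^esub>) \<odot>\<^bsub>V\<^esub> v" using H by (auto simp: V.smult_l_minus)
    then show "\<ominus>\<^bsub>V\<^esub> v \<in> H" using H v by simp
  qed (use H in auto)
qed

lemma submodule_subset: "\<lbrakk>module K V; submodule H K V\<rbrakk> \<Longrightarrow> H \<subseteq> carrier V"
  by (simp add: submodule_iff)

definition k_span where "k_span K V S = \<Inter>{H. submodule H K V \<and> S \<subseteq> H}"

context module
begin

lemma submodule_k_span:
  assumes "S \<subseteq> carrier M"
  shows "submodule (k_span R M S) R M"
proof -
  have "k_span R M S \<subseteq> carrier M"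
    using carrier_is_submodule assms by (auto simp: k_span_def)
  then show ?thesis
    unfolding submodule_iff[OF module_axioms] by (auto simp: k_span_def submodule_iff[OF module_axioms])
qed

lemma k_span_superset: "S \<subseteq> k_span R M S"
  by (auto simp: k_span_def)

lemma k_span_least: "\<lbrakk>submodule H R M; S \<subseteq> H\<rbrakk> \<Longrightarrow> k_span R M S \<subseteq> H"
  by (auto simp: k_span_def)

text \<open>The elements cv + s of this shape form a submodule that contains v and S.\<close>

lemma k_span_insert:
  assumes S: "S \<subseteq> carrier M" and v: "v \<in> carrier M" and x: "x \<in> k_span R M (insert v S)"
  obtains c s where "c \<in> carrier R" "s \<in> k_span R M S" "x = c \<odot>\<^bsub>M\<^esub> v \<oplus>\<^bsub>M\<^esub> s"
proof -
  let ?T = "{c \<odot>\<^bsub>M\<^esub> v \<oplus>\<^bsub>M\<^esub> s | c s. c \<in> carrier R \<and> s \<in> k_span R M S}"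
  note sub = submodule_k_span[OF S, unfolded submodule_iff[OF module_axioms]]
  have sc: "s \<in> carrier M" if "s \<in> k_span R M S" for s using sub that by blast
  have "submodule ?T R M"
    unfolding submodule_iff[OF module_axioms]
  proof (intro conjI ballI)
    show "?T \<subseteq> carrier M" using v sc by auto
    have "\<zero>\<^bsub>M\<^esub> = \<zero> \<odot>\<^bsub>M\<^esub> v \<oplus>\<^bsub>M\<^esub> \<zero>\<^bsub>M\<^esub>" using v by simp
    then show "\<zero>\<^bsub>M\<^esub> \<in> ?T" using sub by blast
    fix x assume "x \<in> ?T"
    then obtain c s where x: "x = c \<odot>\<^bsub>M\<^esub> v \<oplus>\<^bsub>M\<^esub> s" "c \<in> carrier R" "s \<in> k_span R M S" by blast
    {
      fix y assume "y \<in> ?T"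
      then obtain d t where y: "y = d \<odot>\<^bsub>M\<^esub> v \<oplus>\<^bsub>M\<^esub> t" "d \<in> carrier R" "t \<in> k_span R M S" by blast
      have "x \<oplus>\<^bsub>M\<^esub> y = (c \<oplus> d) \<odot>\<^bsub>M\<^esub> v \<oplus>\<^bsub>M\<^esub> (s \<oplus>\<^bsub>M\<^esub> t)"
        using x y v sc by (simp add: smult_l_distr M.a_ac)
      moreover have "s \<oplus>\<^bsub>M\<^esub> t \<in> k_span R M S" using sub x y by blast
      ultimately show "x \<oplus>\<^bsub>M\<^esub> y \<in> ?T" using x(2) y(2) by blast
    }
    fix d assume d: "d \<in> carrier R"
    have "d \<odot>\<^bsub>M\<^esub> x = (d \<otimes> c) \<odot>\<^bsub>M\<^esub> v \<oplus>\<^bsub>M\<^esub> d \<odot>\<^bsub>M\<^esub> s"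
      using x d v sc by (simp add: smult_r_distr smult_assoc1)
    moreover have "d \<odot>\<^bsub>M\<^esub> s \<in> k_span R M S" using sub x d by blast
    ultimately show "d \<odot>\<^bsub>M\<^esub> x \<in> ?T" using x(2) d by blast
  qed
  moreover have "v = \<one> \<odot>\<^bsub>M\<^esub> v \<oplus>\<^bsub>M\<^esub> \<zero>\<^bsub>M\<^esub>" using v by simp
  then have "v \<in> ?T" using sub by blast
  moreover have "s \<in> ?T" if "s \<in> S" for s
  proof -
    have "s = \<zero> \<odot>\<^bsub>M\<^esub> v \<oplus>\<^bsub>M\<^esub> s" using that S v by auto
    then show ?thesis using k_span_superset that by blast
  qed
  ultimately have "k_span R M (insert v S) \<subseteq> ?T" by (intro k_span_least) blast+
  then show thesis using that x by blast
qed

lemma k_span_empty: "k_span R M {} = {\<zero>\<^bsub>M\<^esub>}"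
proof -
  have "submodule {\<zero>\<^bsub>M\<^esub>} R M" unfolding submodule_iff[OF module_axioms] by simp
  then have "k_span R M {} \<subseteq> {\<zero>\<^bsub>M\<^esub>}" by (rule k_span_least) simp
  moreover have "\<zero>\<^bsub>M\<^esub> \<in> k_span R M {}"
    using submodule_k_span[of "{}"] by (simp add: submodule_iff[OF module_axioms])
  ultimately show ?thesis by blast
qed

end

lemma fin_dim_iff:
  assumes "module K V"
  shows "fin_dim K V \<longleftrightarrow> (\<exists>S. finite S \<and> S \<subseteq> carrier V \<and> k_span K V S = carrier V)"
proof -
  interpret V: module K V by fact
  have span: "(\<forall>H. submodule H K V \<and> S \<subseteq> H \<longrightarrow> H = carrier V) \<longleftrightarrow> k_span K V S = carrier V"
    if S: "S \<subseteq> carrier V" for S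
  proof
    assume "\<forall>H. submodule H K V \<and> S \<subseteq> H \<longrightarrow> H = carrier V"
    then show "k_span K V S = carrier V" using V.submodule_k_span[OF S] V.k_span_superset by blast
  next
    assume *: "k_span K V S = carrier V"
    show "\<forall>H. submodule H K V \<and> S \<subseteq> H \<longrightarrow> H = carrier V"
    proof (intro allI impI)
      fix H assume H: "submodule H K V \<and> S \<subseteq> H"
      then show "H = carrier V" using V.k_span_least[of H S] * submodule_subset[OF assms, of H] by auto
    qed
  qed
  show ?thesis unfolding fin_dim_def by (intro ex_cong1 conj_cong refl span)
qed

text \<open>Induction on S by elimination. If W is not inside the span of S, some w in W has a
  nonzero coefficient c at the new vector v. Over a field c is invertible, so each element of W is a
  multiple of w plus an element of W in the span of S, and the induction hypothesis applies to the
  intersection of W with that span.\<close>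

lemma submodule_of_span_finitely_spanned:
  assumes K: "field K" and V: "module K V" and S: "finite S" "S \<subseteq> carrier V"
    and W: "submodule W K V" "W \<subseteq> k_span K V S"
  shows "\<exists>T. finite T \<and> T \<subseteq> W \<and> k_span K V T = W"
  using S W
proof (induction S arbitrary: W rule: finite_induct)
  case empty
  interpret V: module K V by fact
  have "\<zero>\<^bsub>V\<^esub> \<in> W" using empty.prems(2) submodule_iff[OF V, of W] by blast
  then have "W = {\<zero>\<^bsub>V\<^esub>}" using empty.prems(3) V.k_span_empty by blast
  then show ?case using V.k_span_empty by blast
next
  case (insert v S)
  interpret K: field K by fact
  interpret V: module K V by fact
  have S: "S \<subseteq> carrier V" and v: "v \<in> carrier V" using insert.prems by auto
  note W = insert.prems(2)[unfolded submodule_iff[OF V]]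
  note span = V.submodule_k_span[OF S, unfolded submodule_iff[OF V]]
  show ?case
  proof (cases "W \<subseteq> k_span K V S")
    case True
    then show ?thesis using insert.IH[OF S insert.prems(2)] by blast
  next
    case False
    then obtain w where w: "w \<in> W" "w \<notin> k_span K V S" by blast
    then obtain c s where cs: "c \<in> carrier K" "s \<in> k_span K V S" "w = c \<odot>\<^bsub>V\<^esub> v \<oplus>\<^bsub>V\<^esub> s"
      using V.k_span_insert[OF S v] insert.prems(3) by blast
    have s: "s \<in> carrier V" using span cs by blast
    have "c \<noteq> \<zero>\<^bsub>K\<^esub>" using cs w s v by auto
    then have c: "c \<in> Units K" using cs by (simp add: K.field_Units)
    have "submodule (W \<inter> k_span K V S) K V"
      unfolding submodule_iff[OF V] using W span by auto
    then obtain T where T: "finite T" "T \<subseteq> W" "k_span K V T = W \<inter> k_span K V S"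
      using insert.IH[OF S, of "W \<inter> k_span K V S"] by blast
    have wT: "insert w T \<subseteq> carrier V" using w T W by blast
    note spanT = V.submodule_k_span[OF wT, unfolded submodule_iff[OF V]]
    have "k_span K V (insert w T) = W"
    proof (intro equalityI subsetI)
      fix x assume "x \<in> k_span K V (insert w T)"
      then show "x \<in> W" using V.k_span_least[OF insert.prems(2), of "insert w T"] w T by blast
    next
      fix x assume x: "x \<in> W"
      then obtain d t where dt: "d \<in> carrier K" "t \<in> k_span K V S" "x = d \<odot>\<^bsub>V\<^esub> v \<oplus>\<^bsub>V\<^esub> t"
        using V.k_span_insert[OF S v] insert.prems(3) by blast
      have t: "t \<in> carrier V" using span dt by blast
      \<comment> \<open>The multiple of w by this scalar cancels the coefficient d of x at
        v.\<close>
      let ?e = "\<ominus>\<^bsub>K\<^esub> (d \<otimes>\<^bsub>K\<^esub> inv\<^bsub>K\<^esub> c)"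
      have e: "?e \<in> carrier K" using c dt by auto
      have "?e \<otimes>\<^bsub>K\<^esub> c = \<ominus>\<^bsub>K\<^esub> d"
        using c dt cs by (simp add: K.l_minus K.m_assoc K.Units_l_inv)
      then have "x \<oplus>\<^bsub>V\<^esub> ?e \<odot>\<^bsub>V\<^esub> w = d \<odot>\<^bsub>V\<^esub> v \<oplus>\<^bsub>V\<^esub> t \<oplus>\<^bsub>V\<^esub> ((\<ominus>\<^bsub>K\<^esub> d) \<odot>\<^bsub>V\<^esub> v \<oplus>\<^bsub>V\<^esub> ?e \<odot>\<^bsub>V\<^esub> s)"
        using dt cs v s e by (simp add: V.smult_r_distr flip: V.smult_assoc1)
      also have "\<dots> = t \<oplus>\<^bsub>V\<^esub> ?e \<odot>\<^bsub>V\<^esub> s"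
        using dt v s t e by (simp add: V.smult_l_minus V.M.a_assoc V.M.a_lcomm[of t] V.M.r_neg2)
      finally have y: "x \<oplus>\<^bsub>V\<^esub> ?e \<odot>\<^bsub>V\<^esub> w = t \<oplus>\<^bsub>V\<^esub> ?e \<odot>\<^bsub>V\<^esub> s" .
      have "t \<oplus>\<^bsub>V\<^esub> ?e \<odot>\<^bsub>V\<^esub> s \<in> k_span K V S" using span dt cs e by blast
      moreover have "x \<oplus>\<^bsub>V\<^esub> ?e \<odot>\<^bsub>V\<^esub> w \<in> W" using W x w e by blast
      ultimately have "x \<oplus>\<^bsub>V\<^esub> ?e \<odot>\<^bsub>V\<^esub> w \<in> k_span K V T" using T y by simp
      also have "k_span K V T \<subseteq> k_span K V (insert w T)"
        by (auto simp: k_span_def)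
      finally have y': "x \<oplus>\<^bsub>V\<^esub> ?e \<odot>\<^bsub>V\<^esub> w \<in> k_span K V (insert w T)" .
      have w': "w \<in> k_span K V (insert w T)" using V.k_span_superset by blast
      have "x = x \<oplus>\<^bsub>V\<^esub> ?e \<odot>\<^bsub>V\<^esub> w \<oplus>\<^bsub>V\<^esub> (\<ominus>\<^bsub>K\<^esub> ?e) \<odot>\<^bsub>V\<^esub> w"
        using x w W e by (simp add: V.smult_l_minus V.M.a_assoc V.M.r_neg subset_iff)
      then show "x \<in> k_span K V (insert w T)"
        using y' w' spanT e by (metis K.a_inv_closed)
    qed
    then show ?thesis using T w by (intro exI[of _ "insert w T"]) auto
  qed
qed

lemma submodule_carrier_update:
  assumes V: "module K V" and W: "submodule W K V"
  shows "module K (V\<lparr>carrier := W\<rparr>)"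
  using submodule.submodule_is_module[OF W V] .

lemma fin_dim_submodule:
  assumes K: "field K" and V: "module K V" "fin_dim K V" and W: "submodule W K V"
  shows "fin_dim K (V\<lparr>carrier := W\<rparr>)"
proof -
  obtain S where S: "finite S" "S \<subseteq> carrier V" "k_span K V S = carrier V"
    using V(2) unfolding fin_dim_iff[OF V(1)] by blast
  have "W \<subseteq> k_span K V S" using submodule_subset[OF V(1) W] S(3) by simp
  then obtain T where T: "finite T" "T \<subseteq> W" "k_span K V T = W"
    using submodule_of_span_finitely_spanned[OF K V(1) S(1,2) W] by blast
  have mod: "module K (V\<lparr>carrier := W\<rparr>)" by (rule submodule_carrier_update[OF V(1) W])
  have "H = W" if H: "submodule H K (V\<lparr>carrier := W\<rparr>)" "T \<subseteq> H" for H
  proof -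
    have "submodule H K V" and HW: "H \<subseteq> W"
      using H(1) W unfolding submodule_iff[OF V(1)] submodule_iff[OF mod] by auto
    then have "k_span K V T \<subseteq> H" using module.k_span_least[OF V(1)] H(2) by blast
    then show ?thesis using T HW by simp
  qed
  then show ?thesis unfolding fin_dim_def using T by (intro exI[of _ T]) simp
qed

text \<open>The images of a spanning set span, because the preimage of a submodule is a
  submodule.\<close>

lemma fin_dim_image:
  assumes V: "module K V" "fin_dim K V" and W: "module K W" and f: "linear_map K V W f"
    and surj: "f ` carrier V = carrier W"
  shows "fin_dim K W"
proof -
  interpret V: module K V by fact
  interpret W: module K W by fact
  obtain S where S: "finite S" "S \<subseteq> carrier V" "k_span K V S = carrier V"
    using V(2) unfolding fin_dim_iff[OF V(1)] by blast
  have "H = carrier W" if H: "submodule H K W" "f ` S \<subseteq> H" for H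
  proof -
    have "submodule {v \<in> carrier V. f v \<in> H} K V"
      using H(1) linear_map_zero[OF f V(1) W] linear_map_add[OF f] linear_map_smult[OF f]
      unfolding submodule_iff[OF V(1)] submodule_iff[OF W] by auto
    then have "k_span K V S \<subseteq> {v \<in> carrier V. f v \<in> H}"
      using S(2) H(2) by (intro V.k_span_least) auto
    then have "f ` carrier V \<subseteq> H" unfolding S(3) by blast
    then have "carrier W \<subseteq> H" unfolding surj .
    then show ?thesis using submodule_subset[OF W H(1)] by blast
  qed
  then show ?thesis unfolding fin_dim_def using S(1,2) linear_map_closed[OF f]
    by (intro exI[of _ "f ` S"]) auto
qed

text \<open>The code is a list of chosen coordinates with respect to S. Coordinates may fail to be
  unique, but they determine the vector. The common length n makes it possible to concatenate
  several codes without loss.\<close>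

lemma k_span_list_code:
  assumes V: "module K V" and S: "finite S" "S \<subseteq> carrier V"
  shows "\<exists>n code. inj_on code (k_span K V S) \<and>
    (\<forall>v\<in>k_span K V S. code v \<in> lists (carrier K) \<and> length (code v) = n)"
  using S
proof (induction S rule: finite_induct)
  case empty
  then show ?case
    by (intro exI[of _ 0] exI[of _ "\<lambda>_. []"]) (simp add: module.k_span_empty[OF V])
next
  case (insert v S)
  interpret V: module K V by fact
  have S: "S \<subseteq> carrier V" and v: "v \<in> carrier V" using insert.prems by auto
  obtain n code where inj: "inj_on code (k_span K V S)" and
    code: "\<forall>v\<in>k_span K V S. code v \<in> lists (carrier K) \<and> length (code v) = n"
    using insert.IH[OF S] by blast
  have "\<forall>x\<in>k_span K V (insert v S). \<exists>c s. c \<in> carrier K \<and> s \<in> k_span K V S \<and> x = c \<odot>\<^bsub>V\<^esub> v \<oplus>\<^bsub>V\<^esub> s"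
    using V.k_span_insert[OF S v] by blast
  then obtain c s where cs: "\<And>x. x \<in> k_span K V (insert v S) \<Longrightarrow>
      c x \<in> carrier K \<and> s x \<in> k_span K V S \<and> x = c x \<odot>\<^bsub>V\<^esub> v \<oplus>\<^bsub>V\<^esub> s x"
    by metis
  have "inj_on (\<lambda>x. c x # code (s x)) (k_span K V (insert v S))"
  proof (rule inj_onI)
    fix x y assume x: "x \<in> k_span K V (insert v S)" and y: "y \<in> k_span K V (insert v S)"
      and eq: "c x # code (s x) = c y # code (s y)"
    then have "s x = s y" using inj_onD[OF inj] cs by simp
    then show "x = y" using cs[OF x] cs[OF y] eq by simp
  qed
  then show ?case
    using cs code by (intro exI[of _ "Suc n"] exI[of _ "\<lambda>x. c x # code (s x)"]) simp
qed

text \<open>The vectors on which both maps agree form a submodule.\<close>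

lemma lin_hom_eq_on_spanning:
  assumes V: "module K V" and W: "module K W" and f: "f \<in> lin_hom K V W" and g: "g \<in> lin_hom K V W"
    and S: "k_span K V S = carrier V" "S \<subseteq> carrier V" and eq: "\<And>v. v \<in> S \<Longrightarrow> f v = g v"
  shows "f = g"
proof -
  interpret V: module K V by fact
  note lin = f[THEN linear_map_iff_lin_hom] g[THEN linear_map_iff_lin_hom]
  have "submodule {v \<in> carrier V. f v = g v} K V"
    unfolding submodule_iff[OF V]
    using linear_map_zero[OF lin(1) V W] linear_map_zero[OF lin(2) V W]
    by (auto simp: linear_map_add[OF lin(1)] linear_map_add[OF lin(2)]
        linear_map_smult[OF lin(1)] linear_map_smult[OF lin(2)])
  then have "carrier V \<subseteq> {v \<in> carrier V. f v = g v}"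
    using V.k_span_least[of "{v \<in> carrier V. f v = g v}" S] S eq by auto
  then show ?thesis by (intro lin_hom_eqI[OF f g]) auto
qed

text \<open>A linear map is determined by its values on a finite spanning list. The codes of these
  values are concatenated, and since all blocks have the same length, they can be read off
  again.\<close>

lemma lin_hom_list_code:
  assumes V: "module K V" "fin_dim K V" and W: "module K W" "fin_dim K W"
  shows "\<exists>code. inj_on code (lin_hom K V W) \<and> code ` lin_hom K V W \<subseteq> lists (carrier K)"
proof -
  obtain S where S: "finite S" "S \<subseteq> carrier V" "k_span K V S = carrier V"
    using V(2) unfolding fin_dim_iff[OF V(1)] by blast
  obtain vs where vs: "set vs = S" using finite_list[OF S(1)] by blast
  obtain T where "finite T" "T \<subseteq> carrier W" "k_span K W T = carrier W"
    using W(2) unfolding fin_dim_iff[OF W(1)] by blast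
  then obtain n code where inj: "inj_on code (carrier W)" and
    code: "\<And>w. w \<in> carrier W \<Longrightarrow> code w \<in> lists (carrier K) \<and> length (code w) = n"
    using k_span_list_code[OF W(1), of T] by auto
  have cl: "f v \<in> carrier W" if "f \<in> lin_hom K V W" "v \<in> S" for f v
    using lin_homD[OF that(1)] that(2) S(2) by auto
  have "inj_on (\<lambda>f. concat (map (\<lambda>v. code (f v)) vs)) (lin_hom K V W)"
  proof (rule inj_onI)
    fix f g assume f: "f \<in> lin_hom K V W" and g: "g \<in> lin_hom K V W"
      and eq: "concat (map (\<lambda>v. code (f v)) vs) = concat (map (\<lambda>v. code (g v)) vs)"
    have "\<forall>(x, y)\<in>set (zip (map (\<lambda>v. code (f v)) vs) (map (\<lambda>v. code (g v)) vs)). length x = length y"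
      using cl[OF f] cl[OF g] code vs by (auto simp: zip_map_map set_zip)
    then have "map (\<lambda>v. code (f v)) vs = map (\<lambda>v. code (g v)) vs"
      using eq by (intro concat_injective) auto
    then have "f v = g v" if "v \<in> S" for v
      using that vs inj_onD[OF inj] cl[OF f that] cl[OF g that] by auto
    then show "f = g" using lin_hom_eq_on_spanning[OF V(1) W(1) f g S(3,2)] by blast
  qed
  moreover have "concat (map (\<lambda>v. code (f v)) vs) \<in> lists (carrier K)" if "f \<in> lin_hom K V W" for f
  proof -
    have "set (code (f v)) \<subseteq> carrier K" if v: "v \<in> S" for v
      using code[OF cl[OF \<open>f \<in> lin_hom K V W\<close> v]] by (auto simp: in_lists_conv_set)
    then show ?thesis using vs by (auto simp: in_lists_conv_set)
  qed
  ultimately show ?thesis by (intro exI[of _ "\<lambda>f. concat (map (\<lambda>v. code (f v)) vs)"]) auto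
qed

section \<open>Direct sums and modules\<close>

context linear_category
begin

text \<open>\<open>direct_sum\<close> with its injections and projections named and with membership
  in C built in, so that one choice of them can be shared by several arguments.\<close>

definition sum_data where
  "sum_data z xs \<iota> \<pi> \<longleftrightarrow> z \<in> Ob C \<and> set xs \<subseteq> Ob C \<and>
    (\<forall>i<length xs. \<iota> i \<in> hom (xs ! i) z \<and> \<pi> i \<in> hom z (xs ! i)) \<and>
    (\<forall>i<length xs. \<forall>j<length xs. Cmp C (xs ! j) z (xs ! i) (\<pi> i) (\<iota> j) =
      (if i = j then Idm C (xs ! i) else \<zero>\<^bsub>Hom C (xs ! j) (xs ! i)\<^esub>)) \<and>
    (\<Oplus>\<^bsub>Hom C z z\<^esub>i\<in>{..<length xs}. Cmp C z (xs ! i) z (\<iota> i) (\<pi> i)) = Idm C z"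

lemma sum_data_exists:
  assumes "additive C" "set xs \<subseteq> Ob C"
  shows "\<exists>z \<iota> \<pi>. sum_data z xs \<iota> \<pi>"
proof -
  obtain z where z: "z \<in> Ob C" "direct_sum C z xs" using assms unfolding additive_def by blast
  have "\<exists>\<iota> \<pi>. sum_data z xs \<iota> \<pi>"
    using z(2) unfolding direct_sum_def sum_data_def by (simp only: z(1) assms(2) simp_thms)
  then show ?thesis ..
qed

context
  fixes z xs \<iota> \<pi>
  assumes data: "sum_data z xs \<iota> \<pi>"
begin

lemma sum_data_Ob: "z \<in> Ob C" "i < length xs \<Longrightarrow> xs ! i \<in> Ob C"
  using data by (auto simp: sum_data_def)

lemma sum_data_hom: "i < length xs \<Longrightarrow> \<iota> i \<in> hom (xs ! i) z" "i < length xs \<Longrightarrow> \<pi> i \<in> hom z (xs ! i)"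
  using data by (auto simp: sum_data_def)

lemma sum_data_orth: "\<lbrakk>i < length xs; j < length xs\<rbrakk> \<Longrightarrow> Cmp C (xs ! j) z (xs ! i) (\<pi> i) (\<iota> j) =
    (if i = j then Idm C (xs ! i) else \<zero>\<^bsub>Hom C (xs ! j) (xs ! i)\<^esub>)"
  using data by (auto simp: sum_data_def)

lemma sum_data_sum: "(\<Oplus>\<^bsub>Hom C z z\<^esub>i\<in>{..<length xs}. Cmp C z (xs ! i) z (\<iota> i) (\<pi> i)) = Idm C z"
  using data by (auto simp: sum_data_def)

text \<open>A morphism g into z is the sum over i of \<open>\<iota> i\<close> after
  \<open>\<pi> i\<close> after g, so maps that are linear in g agree once they agree on morphisms
  through a single summand.\<close>

lemma linear_maps_eq_on_sum:
  assumes x: "x \<in> Ob C" and V: "module K V" and \<phi>: "linear_map K (Hom C x z) V \<phi>"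
    and \<psi>: "linear_map K (Hom C x z) V \<psi>"
    and eq: "\<And>i k. \<lbrakk>i < length xs; k \<in> hom x (xs ! i)\<rbrakk>
      \<Longrightarrow> \<phi> (Cmp C x (xs ! i) z (\<iota> i) k) = \<psi> (Cmp C x (xs ! i) z (\<iota> i) k)"
    and g: "g \<in> hom x z"
  shows "\<phi> g = \<psi> g"
proof -
  note z = sum_data_Ob(1) and xi = sum_data_Ob(2) and \<iota> = sum_data_hom(1) and \<pi> = sum_data_hom(2)
  interpret V: module K V by fact
  have summand: "Cmp C x z z (Cmp C z (xs ! i) z (\<iota> i) (\<pi> i)) g =
    Cmp C x (xs ! i) z (\<iota> i) (Cmp C x z (xs ! i) (\<pi> i) g)"
    if "i < length xs" for i
    using Cmp_assoc[OF x z xi z g \<pi> \<iota>, symmetric] that by simp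
  have closed: "Cmp C x (xs ! i) z (\<iota> i) (Cmp C x z (xs ! i) (\<pi> i) g) \<in> hom x z" if "i < length xs" for i
    using that x z xi \<iota> \<pi> g by (simp add: Cmp_closed)
  have g_eq: "g = (\<Oplus>\<^bsub>Hom C x z\<^esub>i\<in>{..<length xs}. Cmp C x (xs ! i) z (\<iota> i) (Cmp C x z (xs ! i) (\<pi> i) g))"
  proof -
    interpret H: module K "Hom C x z" by (rule Hom_module[OF x z])
    have "g = Cmp C x z z (\<Oplus>\<^bsub>Hom C z z\<^esub>i\<in>{..<length xs}. Cmp C z (xs ! i) z (\<iota> i) (\<pi> i)) g"
      unfolding sum_data_sum using Cmp_Idm_left[OF x z g] by simp
    also have "\<dots> = (\<Oplus>\<^bsub>Hom C x z\<^esub>i\<in>{..<length xs}. Cmp C x z z (Cmp C z (xs ! i) z (\<iota> i) (\<pi> i)) g)"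
      by (rule linear_map_finsum[OF Cmp_linear_left[OF x z z g] Hom_module[OF z z] H.module_axioms])
        (use Cmp_closed z xi \<iota> \<pi> in auto)
    also have "\<dots> = (\<Oplus>\<^bsub>Hom C x z\<^esub>i\<in>{..<length xs}. Cmp C x (xs ! i) z (\<iota> i) (Cmp C x z (xs ! i) (\<pi> i) g))"
      by (rule H.M.finsum_cong'[OF refl]) (use summand closed in auto)
    finally show ?thesis .
  qed
  have expand: "\<chi> g = (\<Oplus>\<^bsub>V\<^esub>i\<in>{..<length xs}. \<chi> (Cmp C x (xs ! i) z (\<iota> i) (Cmp C x z (xs ! i) (\<pi> i) g)))"
    if \<chi>: "linear_map K (Hom C x z) V \<chi>" for \<chi>
    by (subst g_eq, rule linear_map_finsum[OF \<chi> Hom_module[OF x z] V]) (use closed in auto)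
  show ?thesis
    unfolding expand[OF \<phi>] expand[OF \<psi>]
    by (rule V.M.finsum_cong'[OF refl])
      (use eq linear_map_closed[OF \<psi>] closed Cmp_closed[OF x z xi g \<pi>] in auto)
qed

text \<open>Existence half of the fact that X sends the direct sum to a product. The
  \<open>v i\<close> are carried to X(z) along the projections and added; orthogonality of
  injections and projections gives the prescribed components.\<close>

lemma sum_data_glue:
  assumes X: "cat_module K C X" and v: "\<And>i. i < length xs \<Longrightarrow> v i \<in> carrier (fob X (xs ! i))"
  shows "\<exists>x\<in>carrier (fob X z). \<forall>i<length xs. far X z (xs ! i) (\<iota> i) x = v i"
proof -
  let ?n = "length xs"
  note z = sum_data_Ob(1) and xi = sum_data_Ob(2) and \<iota> = sum_data_hom(1) and \<pi> = sum_data_hom(2)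
    and orth = sum_data_orth
  interpret Xz: module K "fob X z" by (rule cat_module_fob[OF X z])
  let ?w = "\<lambda>i. far X (xs ! i) z (\<pi> i) (v i)"
  have w: "?w i \<in> carrier (fob X z)" if "i < ?n" for i
    using cat_module_closed[OF X z xi[OF that] \<pi>[OF that] v[OF that]] .
  show "\<exists>x\<in>carrier (fob X z). \<forall>i<?n. far X z (xs ! i) (\<iota> i) x = v i"
  proof (intro bexI[of _ "\<Oplus>\<^bsub>fob X z\<^esub>i\<in>{..<?n}. ?w i"] allI impI)
    show "(\<Oplus>\<^bsub>fob X z\<^esub>i\<in>{..<?n}. ?w i) \<in> carrier (fob X z)" using w by (intro Xz.M.finsum_closed) auto
    fix j assume j: "j < ?n"
    interpret Xj: module K "fob X (xs ! j)" by (rule cat_module_fob[OF X xi[OF j]])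
    have "far X z (xs ! j) (\<iota> j) (\<Oplus>\<^bsub>fob X z\<^esub>i\<in>{..<?n}. ?w i) =
        (\<Oplus>\<^bsub>fob X (xs ! j)\<^esub>i\<in>{..<?n}. far X z (xs ! j) (\<iota> j) (?w i))"
      by (rule linear_map_finsum[OF cat_module_linear[OF X xi[OF j] z \<iota>[OF j]]])
        (use w Xz.module_axioms Xj.module_axioms in auto)
    also have "\<dots> = (\<Oplus>\<^bsub>fob X (xs ! j)\<^esub>i\<in>{..<?n}. if j = i then v j else \<zero>\<^bsub>fob X (xs ! j)\<^esub>)"
    proof (rule Xj.M.finsum_cong'[OF refl])
      fix i assume "i \<in> {..<?n}"
      then have i: "i < ?n" by simp
      have "far X z (xs ! j) (\<iota> j) (?w i) =
        far X (xs ! i) (xs ! j) (if i = j then Idm C (xs ! i) else \<zero>\<^bsub>Hom C (xs ! j) (xs ! i)\<^esub>) (v i)"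
        using cat_module_Cmp[OF X xi[OF j] z xi[OF i] \<iota>[OF j] \<pi>[OF i] v[OF i]] orth[OF i j] by simp
      also have "\<dots> = (if j = i then v j else \<zero>\<^bsub>fob X (xs ! j)\<^esub>)"
        using cat_module_Idm[OF X xi[OF i] v[OF i]]
          linear_map_zero[OF cat_module_eval_linear[OF X xi[OF j] xi[OF i] v[OF i]]
            Hom_module[OF xi[OF j] xi[OF i]] Xj.module_axioms] by auto
      finally show "far X z (xs ! j) (\<iota> j) (?w i) = (if j = i then v j else \<zero>\<^bsub>fob X (xs ! j)\<^esub>)" .
    qed (use v j in auto)
    also have "\<dots> = v j" using j v by (intro Xj.M.finsum_singleton[of j "{..<?n}" "\<lambda>_. v j"]) auto
    finally show "far X z (xs ! j) (\<iota> j) (\<Oplus>\<^bsub>fob X z\<^esub>i\<in>{..<?n}. ?w i) = v j" .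
  qed
qed

text \<open>Uniqueness half: X applied to the decomposition of the identity of z recovers an element
  of X(z) from its components.\<close>

lemma sum_data_determined:
  assumes X: "cat_module K C X" and x: "x \<in> carrier (fob X z)" and y: "y \<in> carrier (fob X z)"
    and eq: "\<And>i. i < length xs \<Longrightarrow> far X z (xs ! i) (\<iota> i) x = far X z (xs ! i) (\<iota> i) y"
  shows "x = y"
proof -
  let ?n = "length xs"
  note z = sum_data_Ob(1) and xi = sum_data_Ob(2) and \<iota> = sum_data_hom(1) and \<pi> = sum_data_hom(2)
    and sum = sum_data_sum
  interpret Xz: module K "fob X z" by (rule cat_module_fob[OF X z])
  have expand: "x = (\<Oplus>\<^bsub>fob X z\<^esub>i\<in>{..<?n}. far X (xs ! i) z (\<pi> i) (far X z (xs ! i) (\<iota> i) x))"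
    if x: "x \<in> carrier (fob X z)" for x
  proof -
    have "x = far X z z (\<Oplus>\<^bsub>Hom C z z\<^esub>i\<in>{..<?n}. Cmp C z (xs ! i) z (\<iota> i) (\<pi> i)) x"
      unfolding sum using cat_module_Idm[OF X z x] by simp
    also have "\<dots> = (\<Oplus>\<^bsub>fob X z\<^esub>i\<in>{..<?n}. far X z z (Cmp C z (xs ! i) z (\<iota> i) (\<pi> i)) x)"
      by (rule linear_map_finsum[OF cat_module_eval_linear[OF X z z x] Hom_module[OF z z]
        Xz.module_axioms])
        (use Cmp_closed z xi \<iota> \<pi> in auto)
    also have "\<dots> = (\<Oplus>\<^bsub>fob X z\<^esub>i\<in>{..<?n}. far X (xs ! i) z (\<pi> i) (far X z (xs ! i) (\<iota> i) x))"
      using cat_module_Cmp[OF X z xi z \<pi> \<iota> x]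
        cat_module_closed[OF X z xi \<pi> cat_module_closed[OF X xi z \<iota> x]]
      by (intro Xz.M.finsum_cong'[OF refl]) auto
    finally show ?thesis .
  qed
  have "x = (\<Oplus>\<^bsub>fob X z\<^esub>i\<in>{..<?n}. far X (xs ! i) z (\<pi> i) (far X z (xs ! i) (\<iota> i) y))"
    unfolding expand[OF x, symmetric]
    by (subst expand[OF x], rule Xz.M.finsum_cong'[OF refl])
      (use eq cat_module_closed[OF X z xi \<pi> cat_module_closed[OF X xi z \<iota> y]] in auto)
  then show "x = y" using expand[OF y] by simp
qed

end

end

text \<open>In this way M(-,N) becomes a module over B also when N lies outside B.\<close>

lemma cat_module_full_sub:
  assumes "cat_module K C X" "S \<subseteq> Ob C"
  shows "cat_module K (full_sub C S) X"
  using assms by (auto simp: linear_functor_def subset_iff)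

section \<open>Modules over a finite dimensional algebra\<close>

lemma mod_alg_simps [simp]:
  "Ob (mod_alg TYPE('u) K A) = {M. right_mod K A M \<and> fin_dim K M}"
  "Hom (mod_alg TYPE('u) K A) M N = map_space M N (right_hom K A M N)"
  "Idm (mod_alg TYPE('u) K A) M = (\<lambda>m\<in>carrier M. m)"
  "Cmp (mod_alg TYPE('u) K A) L M N g f = compose (carrier L) g f"
  by (simp_all add: mod_alg_def)

lemma right_hom_linear: "f \<in> right_hom K A M N \<Longrightarrow> linear_map K M N f"
  and right_hom_lin_hom: "f \<in> right_hom K A M N \<Longrightarrow> f \<in> lin_hom K M N"
  and right_hom_extensional: "f \<in> right_hom K A M N \<Longrightarrow> f \<in> extensional (carrier M)"
  and right_hom_ract: "\<lbrakk>f \<in> right_hom K A M N; m \<in> carrier M; a \<in> carrier A\<rbrakk>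
    \<Longrightarrow> f (ract M m a) = ract N (f m) a"
  by (simp_all add: right_hom_def lin_hom_iff)

lemma right_hom_closed: "\<lbrakk>f \<in> right_hom K A M N; m \<in> carrier M\<rbrakk> \<Longrightarrow> f m \<in> carrier N"
  using linear_map_closed[OF right_hom_linear] .

lemma right_homI:
  "\<lbrakk>linear_map K M N f; f \<in> extensional (carrier M);
    \<And>m a. \<lbrakk>m \<in> carrier M; a \<in> carrier A\<rbrakk> \<Longrightarrow> f (ract M m a) = ract N (f m) a\<rbrakk>
    \<Longrightarrow> f \<in> right_hom K A M N"
  by (simp add: right_hom_def lin_hom_iff)

lemma right_hom_eqI:
  "\<lbrakk>f \<in> right_hom K A M N; g \<in> right_hom K A M N'; \<And>m. m \<in> carrier M \<Longrightarrow> f m = g m\<rbrakk> \<Longrightarrow> f = g"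
  by (rule lin_hom_eqI[OF right_hom_lin_hom right_hom_lin_hom])

lemma right_hom_compose:
  assumes "right_mod K A L" "f \<in> right_hom K A L X" "g \<in> right_hom K A X N"
  shows "compose (carrier L) g f \<in> right_hom K A L N"
proof (rule right_homI)
  show "linear_map K L N (compose (carrier L) g f)"
    using lin_hom_compose[OF right_mod.vector_space[OF assms(1)] right_hom_lin_hom[OF assms(2)]
      right_hom_lin_hom[OF assms(3)]] by (rule linear_map_iff_lin_hom)
qed (use right_mod.ract_closed[OF assms(1)] right_hom_closed[OF assms(2)] right_hom_ract[OF assms(2)]
  right_hom_ract[OF assms(3)] in \<open>simp_all add: compose_def\<close>)

lemma iso_arr_mod_alg_iff:
  assumes M: "right_mod K A M" and N: "right_mod K A N"
  shows "iso_arr (mod_alg TYPE('u) K A) M N f \<longleftrightarrow>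
    f \<in> right_hom K A M N \<and> bij_betw f (carrier M) (carrier N)"
proof
  assume "iso_arr (mod_alg TYPE('u) K A) M N f"
  then obtain g where f: "f \<in> right_hom K A M N" and g: "g \<in> right_hom K A N M"
    and gf: "compose (carrier M) g f = (\<lambda>m\<in>carrier M. m)"
      and fg: "compose (carrier N) f g = (\<lambda>m\<in>carrier N. m)"
    unfolding iso_arr_def by auto
  have "g (f m) = m" if "m \<in> carrier M" for m using fun_cong[OF gf, of m] that by (simp add: compose_def)
  moreover have "f (g n) = n" if "n \<in> carrier N" for n using fun_cong[OF fg, of n] that
    by (simp add: compose_def)
  ultimately have "bij_betw f (carrier M) (carrier N)"
    using right_hom_closed[OF f] right_hom_closed[OF g] by (intro bij_betw_byWitness[where f' = g]) auto
  with f show "f \<in> right_hom K A M N \<and> bij_betw f (carrier M) (carrier N)" by blast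
next
  assume f: "f \<in> right_hom K A M N \<and> bij_betw f (carrier M) (carrier N)"
  interpret M: right_mod K A M by fact
  interpret MM: module K M by (rule M.vector_space)
  let ?g = "inv_into (carrier M) f"
  have inj: "inj_on f (carrier M)" and surj: "f ` carrier M = carrier N" using f
    by (simp_all add: bij_betw_def)
  have g_cl: "?g n \<in> carrier M" if "n \<in> carrier N" for n using that surj by (metis inv_into_into)
  have fg: "f (?g n) = n" if "n \<in> carrier N" for n using that surj by (metis f_inv_into_f)
  have gf: "?g (f m) = m" if "m \<in> carrier M" for m using that inj by simp
  have f_cl: "f m \<in> carrier N" if "m \<in> carrier M" for m using that surj by blast
  note lin = right_hom_linear[OF conjunct1[OF f]]
  have g_eq: "?g n = m" if "m \<in> carrier M" "n = f m" for m n using gf that by simp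
  have "linear_map K N M ?g"
  proof (rule linear_mapI)
    fix v w c assume v: "v \<in> carrier N"
    show "?g v \<in> carrier M" using g_cl v .
    show "?g (c \<odot>\<^bsub>N\<^esub> v) = c \<odot>\<^bsub>M\<^esub> ?g v" if "c \<in> carrier K"
      by (rule g_eq) (use that v g_cl fg linear_map_smult[OF lin] in simp_all)
    assume w: "w \<in> carrier N"
    show "?g (v \<oplus>\<^bsub>N\<^esub> w) = ?g v \<oplus>\<^bsub>M\<^esub> ?g w"
      by (rule g_eq) (use v w g_cl fg linear_map_add[OF lin] in simp_all)
  qed
  then have "linear_map K N M (restrict ?g (carrier N))"
    using linear_map_restrict right_mod.vector_space[OF N] linear_map_iff_lin_hom by blast
  moreover have "restrict ?g (carrier N) (ract N n a) = ract M (restrict ?g (carrier N) n) a"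
    if "n \<in> carrier N" "a \<in> carrier A" for n a
  proof -
    have *: "ract N n a = f (ract M (?g n) a)"
      using that fg g_cl right_hom_ract[OF conjunct1[OF f]] by simp
    then show ?thesis using that g_cl f_cl M.ract_closed gf by simp
  qed
  ultimately have g: "restrict ?g (carrier N) \<in> right_hom K A N M" by (intro right_homI) simp_all
  show "iso_arr (mod_alg TYPE('u) K A) M N f" unfolding iso_arr_def
    using f g gf fg f_cl g_cl
    by (auto intro!: bexI[of _ "restrict ?g (carrier N)"] restrict_ext simp: compose_def)
qed

lemma right_submodule:
  assumes K: "field K" and M: "right_mod K A M" "fin_dim K M" and W: "submodule W K M"
    and act: "\<And>m a. \<lbrakk>m \<in> W; a \<in> carrier A\<rbrakk> \<Longrightarrow> ract M m a \<in> W"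
  shows "right_mod K A (M\<lparr>carrier := W\<rparr>)" "fin_dim K (M\<lparr>carrier := W\<rparr>)"
proof -
  interpret M: right_mod K A M by fact
  have sub: "w \<in> carrier M" if "w \<in> W" for w using submodule_subset[OF M.vector_space W] that by blast
  show "fin_dim K (M\<lparr>carrier := W\<rparr>)" by (rule fin_dim_submodule[OF K M.vector_space M(2) W])
  show "right_mod K A (M\<lparr>carrier := W\<rparr>)"
    by (rule right_mod.intro)
      (simp_all add: submodule_carrier_update[OF M.vector_space W] sub act M.ract_add_left
        M.ract_add_right
        M.ract_smult_left M.ract_smult_right M.ract_mult M.ract_one)
qed

text \<open>The object R below is a copy of the regular module in B, freely generated by u.\<close>

locale module_category =
  fixes K :: "'k ring" and A :: "('k, 'a) module" and B :: "('k, 'u, 'a) right_module set"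
    and R :: "('k, 'u, 'a) right_module" and u :: 'u
  assumes field: "field K"
    and algebra: "fd_algebra K A"
    and universe: "\<exists>\<iota> :: 'k list \<Rightarrow> 'u. inj_on \<iota> (lists (carrier K))"
    and subcategory: "B \<subseteq> Ob (mod_alg TYPE('u) K A)"
    and additive: "additive (full_sub (mod_alg TYPE('u) K A) B)"
    and functorially_finite: "functorially_finite K (mod_alg TYPE('u) K A) B"
    and R: "R \<in> B" and u: "u \<in> carrier R"
    and free: "\<And>(N :: ('k, 'u, 'a) right_module) v. \<lbrakk>right_mod K A N; fin_dim K N; v \<in> carrier N\<rbrakk>
      \<Longrightarrow> \<exists>h\<in>right_hom K A R N. h u = v"
    and cyclic: "r \<in> carrier R \<Longrightarrow> \<exists>a\<in>carrier A. r = ract R u a"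
begin

abbreviation M where "M \<equiv> mod_alg TYPE('u) K A"
abbreviation C where "C \<equiv> full_sub M B"

sublocale M: linear_category K M by (rule linear_category_mod_alg)
sublocale C: linear_category K C by (rule linear_category_full_sub[OF linear_category_mod_alg
  subcategory])

lemma cring: "cring K"
  using field by (simp add: field_def domain_def)

lemma B_right_mod: "x \<in> B \<Longrightarrow> right_mod K A x" and B_fin_dim: "x \<in> B \<Longrightarrow> fin_dim K x"
  using subcategory by auto

lemma R_mod: "right_mod K A R"
  using B_right_mod[OF R] .

lemma eq_if_eq_at_generator:
  assumes f: "f \<in> right_hom K A R N" and g: "g \<in> right_hom K A R N" and eq: "f u = g u"
  shows "f = g"
proof (rule right_hom_eqI[OF f g])
  fix r assume "r \<in> carrier R"
  then obtain a where "a \<in> carrier A" "r = ract R u a" using cyclic by blast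
  then show "f r = g r" using right_hom_ract[OF f u] right_hom_ract[OF g u] eq by simp
qed

section \<open>Maps out of R and covers by direct sums of copies of R\<close>

definition free_map :: "('k, 'u, 'a) right_module \<Rightarrow> 'u \<Rightarrow> 'u \<Rightarrow> 'u" where
  "free_map N v = (SOME h. h \<in> right_hom K A R N \<and> h u = v)"

lemma free_map:
  fixes N :: "('k, 'u, 'a) right_module"
  assumes "right_mod K A N" "fin_dim K N" "v \<in> carrier N"
  shows "free_map N v \<in> right_hom K A R N" "free_map N v u = v"
proof -
  have "\<exists>h. h \<in> right_hom K A R N \<and> h u = v" using free[OF assms] by blast
  from someI_ex[OF this] show "free_map N v \<in> right_hom K A R N" "free_map N v u = v"
    by (simp_all add: free_map_def)
qed

lemma free_map_unique:
  assumes "right_mod K A N" "fin_dim K N" "h \<in> right_hom K A R N"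
  shows "free_map N (h u) = h"
  using eq_if_eq_at_generator[OF free_map(1) assms(3)] free_map(2) assms
    right_hom_closed[OF assms(3) u] by blast

text \<open>One copy of R for each vector of a finite spanning list of N. The maps that send u to
  these vectors are elements of M(-,N) at R; this is a B-module even if N is outside B, so they glue
  to an element at z, which is the cover.\<close>

lemma free_cover:
  fixes N :: "('k, 'u, 'a) right_module"
  assumes N: "right_mod K A N" "fin_dim K N"
  obtains z n \<iota> \<pi> \<alpha> where "C.sum_data z (replicate n R) \<iota> \<pi>" "\<alpha> \<in> right_hom K A z N"
    "\<alpha> ` carrier z = carrier N"
proof -
  interpret N: module K N by (rule right_mod.vector_space[OF N(1)])
  obtain S where S: "finite S" "S \<subseteq> carrier N" "k_span K N S = carrier N"
    using N(2) unfolding fin_dim_iff[OF N.module_axioms] by blast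
  obtain vs where vs: "set vs = S" using finite_list[OF S(1)] by blast
  let ?n = "length vs"
  have vs_in: "vs ! i \<in> carrier N" if "i < ?n" for i using nth_mem[OF that] vs S(2) by blast
  have "set (replicate ?n R) \<subseteq> Ob C" using R by auto
  then obtain z \<iota> \<pi> where data: "C.sum_data z (replicate ?n R) \<iota> \<pi>"
    using C.sum_data_exists[OF additive] by blast
  have z: "z \<in> B" using C.sum_data_Ob(1)[OF data] by simp
  have "cat_module K M (yoneda M N)" by (rule M.cat_module_yoneda) (use N in simp)
  then have Y: "cat_module K C (yoneda M N)" by (rule cat_module_full_sub[OF _ subcategory])
  have "\<exists>\<alpha>\<in>carrier (fob (yoneda M N) z). \<forall>i<length (replicate ?n R).
      far (yoneda M N) z (replicate ?n R ! i) (\<iota> i) \<alpha> = free_map N (vs ! i)"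
    by (rule C.sum_data_glue[OF data Y]) (use free_map(1)[OF N vs_in] in simp)
  then obtain \<alpha> where \<alpha>: "\<alpha> \<in> right_hom K A z N"
    and \<alpha>_eq: "\<And>i. i < ?n \<Longrightarrow> compose (carrier R) \<alpha> (\<iota> i) = free_map N (vs ! i)"
    by auto
  have \<iota>: "\<iota> i \<in> right_hom K A R z" if "i < ?n" for i
    using C.sum_data_hom(1)[OF data, of i] that by simp
  note lin = right_hom_linear[OF \<alpha>]
  have zm: "module K z" using right_mod.vector_space[OF B_right_mod[OF z]] .
  interpret z: module K z by (rule zm)
  have "submodule (\<alpha> ` carrier z) K N"
    unfolding submodule_iff[OF N.module_axioms]
  proof (intro conjI ballI)
    show "\<alpha> ` carrier z \<subseteq> carrier N" using right_hom_closed[OF \<alpha>] by blast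
    show "\<zero>\<^bsub>N\<^esub> \<in> \<alpha> ` carrier z"
      using linear_map_zero[OF lin zm N.module_axioms] by (metis imageI z.M.zero_closed)
    fix x assume "x \<in> \<alpha> ` carrier z"
    then obtain a where a: "a \<in> carrier z" "x = \<alpha> a" by blast
    show "c \<odot>\<^bsub>N\<^esub> x \<in> \<alpha> ` carrier z" if "c \<in> carrier K" for c
      using a that linear_map_smult[OF lin that a(1), symmetric] by auto
    fix y assume "y \<in> \<alpha> ` carrier z"
    then obtain b where b: "b \<in> carrier z" "y = \<alpha> b" by blast
    show "x \<oplus>\<^bsub>N\<^esub> y \<in> \<alpha> ` carrier z"
      using a b linear_map_add[OF lin a(1) b(1), symmetric] by auto
  qed
  moreover have "S \<subseteq> \<alpha> ` carrier z"
  proof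
    fix s assume s: "s \<in> S"
    then obtain i where i: "i < ?n" "vs ! i = s" using vs by (auto simp: in_set_conv_nth)
    have "\<alpha> (\<iota> i u) = s"
      using fun_cong[OF \<alpha>_eq[OF i(1)], of u] u free_map(2)[OF N, of s] S s i by (auto simp: compose_def)
    then show "s \<in> \<alpha> ` carrier z" using right_hom_closed[OF \<iota>[OF i(1)] u] by blast
  qed
  ultimately have "k_span K N S \<subseteq> \<alpha> ` carrier z" by (rule N.k_span_least)
  then have "\<alpha> ` carrier z = carrier N" using S(3) right_hom_closed[OF \<alpha>] by blast
  then show thesis using that data \<alpha> by blast
qed

text \<open>In mod A the pullback of f and g is a submodule N of a biproduct of a and b, but N need
  not belong to B. Functorial finiteness provides a map n from an object q of B to N through which
  every map from an object of B to N factors. Composing n with the projections gives the weak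
  pullback; uniqueness is lost because n may have a kernel.\<close>

lemma weak_pullback_B:
  assumes a: "a \<in> Ob C" and b: "b \<in> Ob C" and c: "c \<in> Ob C"
    and f: "f \<in> C.hom a c" and g: "g \<in> C.hom b c"
  shows "\<exists>p\<in>Ob C. \<exists>v\<in>C.hom p a. \<exists>w\<in>C.hom p b.
    Cmp C p a c f v = Cmp C p b c g w \<and>
    (\<forall>x\<in>Ob C. \<forall>r\<in>C.hom x a. \<forall>s\<in>C.hom x b.
      Cmp C x a c f r = Cmp C x b c g s \<longrightarrow> (\<exists>h\<in>C.hom x p. r = Cmp C x p a v h))"
proof -
  obtain z i0 i1 p0 p1 where z: "z \<in> Ob C" and i: "i0 \<in> C.hom a z" "i1 \<in> C.hom b z"
    and p: "p0 \<in> C.hom z a" "p1 \<in> C.hom z b"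
    and orth: "Cmp C a z a p0 i0 = Idm C a" "Cmp C b z b p1 i1 = Idm C b"
      "Cmp C b z a p0 i1 = \<zero>\<^bsub>Hom C b a\<^esub>" "Cmp C a z b p1 i0 = \<zero>\<^bsub>Hom C a b\<^esub>"
    using C.binary_biproduct[OF additive a b] by metis
  have B: "a \<in> B" "b \<in> B" "c \<in> B" "z \<in> B" using a b c z by simp_all
  have f': "f \<in> right_hom K A a c" and g': "g \<in> right_hom K A b c"
    and p': "p0 \<in> right_hom K A z a" "p1 \<in> right_hom K A z b"
    using f g p by simp_all
  interpret z: right_mod K A z by (rule B_right_mod[OF B(4)])
  have ma: "module K a" and mb: "module K b" and mc: "module K c"
    using right_mod.vector_space[OF B_right_mod] B by blast+
  interpret zm: module K z by (rule z.vector_space)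
  interpret am: module K a by (rule ma)
  interpret bm: module K b by (rule mb)
  define W where "W = {v \<in> carrier z. f (p0 v) = g (p1 v)}"
  note lin = right_hom_linear[OF f'] right_hom_linear[OF g'] right_hom_linear[OF p'(1)]
    right_hom_linear[OF p'(2)]
  note cl = right_hom_closed[OF f'] right_hom_closed[OF g'] right_hom_closed[OF p'(1)]
    right_hom_closed[OF p'(2)]
  have W: "submodule W K z"
    unfolding submodule_iff[OF z.vector_space] W_def
    using linear_map_zero[OF lin(1) ma mc] linear_map_zero[OF lin(2) mb mc] 
      linear_map_zero[OF lin(3) z.vector_space ma] linear_map_zero[OF lin(4) z.vector_space mb]
    by (auto simp: linear_map_add[OF lin(1)] linear_map_add[OF lin(2)] linear_map_add[OF lin(3)]
      linear_map_add[OF lin(4)] linear_map_smult[OF lin(1)] linear_map_smult[OF lin(2)]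
      linear_map_smult[OF lin(3)] linear_map_smult[OF lin(4)] cl)
  have W_sub: "W \<subseteq> carrier z" by (auto simp: W_def)
  have act: "ract z m k \<in> W" if "m \<in> W" "k \<in> carrier A" for m k
    using that unfolding W_def
    by (simp add: z.ract_closed right_hom_ract[OF p'(1)] right_hom_ract[OF p'(2)] right_hom_ract[OF f']
      right_hom_ract[OF g'] cl)
  define N where "N = z\<lparr>carrier := W\<rparr>"
  have N: "right_mod K A N" "fin_dim K N"
    unfolding N_def using right_submodule[OF field B_right_mod[OF B(4)] B_fin_dim[OF B(4)] W act]
      by blast+
  have cN: "carrier N = W" by (simp add: N_def)
  have NM: "N \<in> Ob M" using N by simp
  have Y: "cat_module K C (yoneda M N)" by
    (rule cat_module_full_sub[OF M.cat_module_yoneda[OF NM] subcategory])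
  have "finitely_generated K C (yoneda M N)"
    using functorially_finite NM unfolding functorially_finite_def by blast
  then obtain q n where gen: "C.generates (yoneda M N) q n" using C.finitely_generated_iff[OF Y] by blast
  note gen' = C.generatesD[OF gen]
  have q: "q \<in> B" and n: "n \<in> right_hom K A q N" using gen'(1,2) by simp_all
  have lift: "\<exists>h\<in>right_hom K A x q. compose (carrier x) n h = k"
    if "x \<in> B" "k \<in> right_hom K A x N" for x k
    using gen'(3)[of x k] that n by auto
  let ?v = "compose (carrier q) p0 n" and ?w = "compose (carrier q) p1 n"
  have nW: "n y \<in> W" if "y \<in> carrier q" for y using right_hom_closed[OF n that] cN by simp
  have n_z: "n \<in> right_hom K A q z"
  proof (rule right_homI)
    show "linear_map K q z n"
      using right_hom_linear[OF n] W_sub by (auto simp: linear_map_def N_def)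
    show "n (ract q m k) = ract z (n m) k" if "m \<in> carrier q" "k \<in> carrier A" for m k
      using right_hom_ract[OF n that] by (simp add: N_def)
  qed (rule right_hom_extensional[OF n])
  have qC: "q \<in> Ob C" using q by simp
  have n_zC: "n \<in> C.hom q z" using n_z by simp
  have v: "?v \<in> C.hom q a" using C.Cmp_closed[OF qC z a n_zC p(1)] by simp
  have w: "?w \<in> C.hom q b" using C.Cmp_closed[OF qC z b n_zC p(2)] by simp
  have eq: "Cmp C q a c f ?v = Cmp C q b c g ?w"
    using nW by (auto simp: compose_def W_def intro!: restrict_ext)
  have "\<exists>h\<in>C.hom x q. r = Cmp C x q a ?v h"
    if x: "x \<in> Ob C" and r: "r \<in> C.hom x a" and s: "s \<in> C.hom x b"
      and rs: "Cmp C x a c f r = Cmp C x b c g s" for x r s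
  proof -
    have r': "r \<in> right_hom K A x a" and xB: "x \<in> B" using x r by simp_all
    interpret x: right_mod K A x by (rule B_right_mod[OF xB])
    \<comment> \<open>The map into the biproduct with components r and s. As f r = g s, its values
      lie in W.\<close>
    let ?k = "Cmp C x a z i0 r \<oplus>\<^bsub>Hom C x z\<^esub> Cmp C x b z i1 s"
    have ir: "Cmp C x a z i0 r \<in> C.hom x z" "Cmp C x b z i1 s \<in> C.hom x z"
      using C.Cmp_closed[OF x a z r i(1)] C.Cmp_closed[OF x b z s i(2)] .
    have k: "?k \<in> C.hom x z" by (rule C.Hom_add[OF x z ir])
    interpret Hxa: abelian_group "Hom C x a" by (rule C.Hom_abelian_group[OF x a])
    interpret Hxb: abelian_group "Hom C x b" by (rule C.Hom_abelian_group[OF x b])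
    have p0k: "Cmp C x z a p0 ?k = r"
    proof -
      have "Cmp C x z a p0 ?k = Cmp C x a a (Cmp C a z a p0 i0) r \<oplus>\<^bsub>Hom C x a\<^esub> Cmp C x b a
        (Cmp C b z a p0 i1) s"
        using C.Cmp_add_right[OF x z a ir p(1)] C.Cmp_assoc[OF x a z a r i(1) p(1)]
          C.Cmp_assoc[OF x b z a s i(2) p(1)] by metis
      also have "\<dots> = r"
        unfolding orth C.Cmp_Idm_left[OF x a r] C.Cmp_zero_left[OF x b a s] by (rule Hxa.r_zero[OF r])
      finally show ?thesis .
    qed
    have p1k: "Cmp C x z b p1 ?k = s"
    proof -
      have "Cmp C x z b p1 ?k = Cmp C x a b (Cmp C a z b p1 i0) r \<oplus>\<^bsub>Hom C x b\<^esub> Cmp C x b b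
        (Cmp C b z b p1 i1) s"
        using C.Cmp_add_right[OF x z b ir p(2)] C.Cmp_assoc[OF x a z b r i(1) p(2)]
          C.Cmp_assoc[OF x b z b s i(2) p(2)] by metis
      also have "\<dots> = s"
        unfolding orth C.Cmp_Idm_left[OF x b s] C.Cmp_zero_left[OF x a b r] by (rule Hxb.l_zero[OF s])
      finally show ?thesis .
    qed
    define k where "k = ?k"
    have kz: "k \<in> right_hom K A x z" using k by (simp add: k_def)
    have pk: "p0 (k y) = r y" "p1 (k y) = s y" if "y \<in> carrier x" for y
      using fun_cong[OF p0k, of y] fun_cong[OF p1k, of y] that by (simp_all add: k_def compose_def)
    have "f (r y) = g (s y)" if "y \<in> carrier x" for y
      using fun_cong[OF rs, of y] that by (simp add: compose_def)
    then have kW: "k y \<in> W" if "y \<in> carrier x" for y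
      using that pk right_hom_closed[OF kz] by (simp add: W_def)
    have "k \<in> right_hom K A x N"
    proof (rule right_homI)
      show "linear_map K x N k"
        using right_hom_linear[OF kz] kW by (auto simp: linear_map_def N_def)
      show "k (ract x m e) = ract N (k m) e" if "m \<in> carrier x" "e \<in> carrier A" for m e
        using right_hom_ract[OF kz that] by (simp add: N_def)
    qed (rule right_hom_extensional[OF kz])
    then obtain h where h: "h \<in> right_hom K A x q" "compose (carrier x) n h = k" using lift xB by blast
    have "r = Cmp C x q a ?v h"
    proof (rule right_hom_eqI[OF r'])
      show "Cmp C x q a ?v h \<in> right_hom K A x a" using C.Cmp_closed[OF x qC a _ v, of h] h by simp
      fix y assume y: "y \<in> carrier x"
      have "n (h y) = k y" using fun_cong[OF h(2), of y] y by (simp add: compose_def)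
      then show "r y = Cmp C x q a ?v h y"
        using y right_hom_closed[OF h(1) y] pk(1)[OF y] by (simp add: compose_def)
    qed
    then show ?thesis using h(1) by auto
  qed
  then show ?thesis using qC v w eq by blast
qed

text \<open>Linear maps between finite dimensional spaces are coded by lists of scalars, and these
  inject into \<open>'u\<close> by the assumption on the universe.\<close>

lemma Hom_code_exists:
  assumes "x \<in> B" "y \<in> B"
  shows "\<exists>code :: ('u \<Rightarrow> 'u) \<Rightarrow> 'u. inj_on code (C.hom x y)"
proof -
  obtain \<iota> :: "'k list \<Rightarrow> 'u" where \<iota>: "inj_on \<iota> (lists (carrier K))" using universe by blast
  obtain code where code: "inj_on code (lin_hom K x y)" "code ` lin_hom K x y \<subseteq> lists (carrier K)"
    using lin_hom_list_code[OF right_mod.vector_space[OF B_right_mod[OF assms(1)]] B_fin_dim[OF assms(1)]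
      right_mod.vector_space[OF B_right_mod[OF assms(2)]] B_fin_dim[OF assms(2)]] by blast
  have "inj_on (\<iota> \<circ> code) (lin_hom K x y)"
    using comp_inj_on[OF code(1) inj_on_subset[OF \<iota> code(2)]] .
  moreover have "C.hom x y \<subseteq> lin_hom K x y" using right_hom_lin_hom by auto
  ultimately show ?thesis using inj_on_subset by blast
qed

definition code :: "('k, 'u, 'a) right_module \<Rightarrow> ('k, 'u, 'a) right_module \<Rightarrow> ('u \<Rightarrow> 'u) \<Rightarrow> 'u" where
  "code x y = (SOME c. inj_on c (C.hom x y))"

sublocale C: weak_pullback_category K C code
proof (rule weak_pullback_category.intro[OF C.linear_category_axioms],
  rule weak_pullback_category_axioms.intro)
  show "inj_on (code x y) (C.hom x y)" if "x \<in> Ob C" "y \<in> Ob C" for x y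
    using someI_ex[OF Hom_code_exists[of x y]] that by (simp add: code_def)
qed (rule cring additive weak_pullback_B; assumption)+

end

section \<open>Projective modules and the ideal of maps factoring through them\<close>

context module_category
begin

abbreviation projectives :: "('k, 'u, 'a) right_module set" where "projectives \<equiv> proj_alg TYPE('u) K A"
abbreviation I where "I \<equiv> factoring M projectives"

lemma proj_algI:
  assumes P: "right_mod K A P" "fin_dim K P"
    and lift: "\<And>X N g f. \<lbrakk>X \<in> Ob M; N \<in> Ob M; g \<in> right_hom K A X N; f \<in> right_hom K A P N;
      g ` carrier X = carrier N\<rbrakk> \<Longrightarrow> \<exists>h\<in>right_hom K A P X. \<forall>v\<in>carrier P. g (h v) = f v"
  shows "P \<in> projectives"
  unfolding proj_alg_def
proof (intro CollectI conjI ballI impI)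
  show "P \<in> Ob M" using P by simp
  fix X N g f assume X: "X \<in> Ob M" "N \<in> Ob M" and g: "g \<in> right_hom K A X N"
    and f: "f \<in> right_hom K A P N"
    and "g ` carrier X = carrier N"
  then obtain h where h: "h \<in> right_hom K A P X" "\<forall>v\<in>carrier P. g (h v) = f v"
    using lift[OF X g f] by blast
  have "compose (carrier P) g h = f"
    by (rule extensionalityI[OF compose_extensional right_hom_extensional[OF f]])
      (use h in \<open>simp add: compose_def\<close>)
  then show "\<exists>h\<in>right_hom K A P X. compose (carrier P) g h = f" using h(1) by blast
qed

lemma proj_algD:
  assumes "P \<in> projectives" "X \<in> Ob M" "N \<in> Ob M" "g \<in> right_hom K A X N" "f \<in> right_hom K A P N"
    "g ` carrier X = carrier N"
  obtains h where "h \<in> right_hom K A P X" "\<And>v. v \<in> carrier P \<Longrightarrow> g (h v) = f v"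
proof -
  obtain h where h: "h \<in> right_hom K A P X" "compose (carrier P) g h = f"
    using assms unfolding proj_alg_def by blast
  show thesis
  proof (rule that[OF h(1)])
    fix v assume "v \<in> carrier P"
    then show "g (h v) = f v" using fun_cong[OF h(2), of v] by (simp add: compose_def)
  qed
qed

lemma projectives_Ob: "P \<in> projectives \<Longrightarrow> P \<in> Ob M"
  by (simp add: proj_alg_def)

text \<open>It suffices to choose a preimage of the image of u; freeness extends the choice to R,
  and maps out of R are compared at u.\<close>

lemma generator_projective: "R \<in> projectives"
proof (rule proj_algI)
  fix X N :: "('k, 'u, 'a) right_module" and g f
  assume X: "X \<in> Ob M" and g: "g \<in> right_hom K A X N" and f: "f \<in> right_hom K A R N"
    and surj: "g ` carrier X = carrier N"
  have "f u \<in> g ` carrier X" unfolding surj using right_hom_closed[OF f u] .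
  then obtain w where w: "w \<in> carrier X" "f u = g w" by blast
  have X': "right_mod K A X" "fin_dim K X" using X by simp_all
  note h = free_map[OF X' w(1)]
  have "compose (carrier R) g (free_map X w) = f"
  proof (rule eq_if_eq_at_generator)
    show "compose (carrier R) g (free_map X w) \<in> right_hom K A R N"
      by (rule right_hom_compose[OF R_mod h(1) g])
  qed (use f u w h in \<open>simp_all add: compose_def\<close>)
  then show "\<exists>h\<in>right_hom K A R X. \<forall>v\<in>carrier R. g (h v) = f v"
    using h(1) by (intro bexI[of _ "free_map X w"]) (auto simp: compose_def restrict_def)
qed (use R_mod B_fin_dim[OF R] in auto)

lemma yoneda_B: "N \<in> Ob M \<Longrightarrow> cat_module K C (yoneda M N)"
  by (rule cat_module_full_sub[OF M.cat_module_yoneda subcategory])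

text \<open>Lifts on the copies of R are glued to a map on z. That the glued map is a lift is tested
  on each copy.\<close>

lemma free_projective:
  assumes data: "C.sum_data z (replicate n R) \<iota> \<pi>"
  shows "z \<in> projectives"
proof -
  have z: "z \<in> B" using C.sum_data_Ob(1)[OF data] by simp
  note zm = B_right_mod[OF z]
  have \<iota>: "\<iota> i \<in> right_hom K A R z" if "i < n" for i
    using C.sum_data_hom(1)[OF data, of i] that by simp
  show ?thesis
  proof (rule proj_algI[OF zm B_fin_dim[OF z]])
    fix X N :: "('k, 'u, 'a) right_module" and g f
    assume X: "X \<in> Ob M" and N: "N \<in> Ob M" and g: "g \<in> right_hom K A X N" and f: "f \<in> right_hom K A z N"
      and surj: "g ` carrier X = carrier N"
    have X': "right_mod K A X" "fin_dim K X" using X by simp_all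
    have "\<exists>w. w \<in> carrier X \<and> g w = f (\<iota> i u)" if "i < n" for i
    proof -
      have "f (\<iota> i u) \<in> g ` carrier X"
        unfolding surj using right_hom_closed[OF f right_hom_closed[OF \<iota>[OF that] u]] .
      then show ?thesis by force
    qed
    then obtain w where w: "\<And>i. i < n \<Longrightarrow> w i \<in> carrier X" "\<And>i. i < n \<Longrightarrow> g (w i) = f (\<iota> i u)" by metis
    have "\<exists>h\<in>carrier (fob (yoneda M X) z). \<forall>i<length (replicate n R).
        far (yoneda M X) z (replicate n R ! i) (\<iota> i) h = free_map X (w i)"
      by (rule C.sum_data_glue[OF data yoneda_B[OF X]]) (use free_map(1)[OF X' w(1)] in simp)
    then obtain h where h: "h \<in> right_hom K A z X"
      and h_eq: "\<And>i. i < n \<Longrightarrow> compose (carrier R) h (\<iota> i) = free_map X (w i)" by auto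
    have gh: "compose (carrier z) g h \<in> right_hom K A z N" by (rule right_hom_compose[OF zm h g])
    have comp_eq: "compose (carrier z) g h = f"
    proof (rule C.sum_data_determined[OF data yoneda_B[OF N]])
      fix i assume "i < length (replicate n R)"
      then have i: "i < n" by simp
      have "compose (carrier R) (compose (carrier z) g h) (\<iota> i) = compose (carrier R) f (\<iota> i)"
      proof (rule eq_if_eq_at_generator)
        show "compose (carrier R) (compose (carrier z) g h) (\<iota> i) u = compose (carrier R) f (\<iota> i) u"
          using fun_cong[OF h_eq[OF i], of u] u free_map(2)[OF X' w(1)[OF i]] w(2)[OF i]
            right_hom_closed[OF \<iota>[OF i] u] by (simp add: compose_def)
      qed (use right_hom_compose[OF R_mod \<iota>[OF i]] gh f in blast)+
      then show "far (yoneda M N) z (replicate n R ! i) (\<iota> i) (compose (carrier z) g h) =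
          far (yoneda M N) z (replicate n R ! i) (\<iota> i) f"
        using i gh f by simp
    qed (use gh f in simp_all)
    have "g (h v) = f v" if "v \<in> carrier z" for v
      using fun_cong[OF comp_eq, of v] that by (simp add: compose_def)
    with h show "\<exists>h\<in>right_hom K A z X. \<forall>v\<in>carrier z. g (h v) = f v" by blast
  qed
qed

text \<open>The projective P in a factorisation ranges over all of mod A and need not lie in B. A
  free cover z of P splits, and z does lie in B, so the factorisation can be rerouted through
  z.\<close>

lemma factors_through_free:
  assumes x: "x \<in> Ob C" and y: "y \<in> Ob C" and f: "f \<in> I x y"
  obtains z n \<iota> \<pi> v w where "C.sum_data z (replicate n R) \<iota> \<pi>" "w \<in> C.hom x z" "v \<in> C.hom z y"
    "f = Cmp C x z y v w"
proof -
  obtain P v0 w0 where P: "P \<in> projectives" and w0: "w0 \<in> M.hom x P" and v0: "v0 \<in> M.hom P y"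
    and f_eq: "f = Cmp M x P y v0 w0" using f unfolding factoring_def by blast
  have PM: "P \<in> Ob M" using projectives_Ob[OF P] .
  have P': "right_mod K A P" "fin_dim K P" using PM by simp_all
  obtain z n \<iota> \<pi> \<alpha> where data: "C.sum_data z (replicate n R) \<iota> \<pi>"
    and \<alpha>: "\<alpha> \<in> right_hom K A z P" "\<alpha> ` carrier z = carrier P"
    by (rule free_cover[OF P'])
  have z: "z \<in> B" using C.sum_data_Ob(1)[OF data] by simp
  have zM: "z \<in> Ob M" and xM: "x \<in> Ob M" and yM: "y \<in> Ob M" using z x y subcategory by auto
  obtain \<sigma> where \<sigma>: "\<sigma> \<in> right_hom K A P z" and \<sigma>_eq: "\<And>v. v \<in> carrier P \<Longrightarrow> \<alpha> (\<sigma> v) = Idm M P v"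
    using proj_algD[OF P zM PM \<alpha>(1) _ \<alpha>(2), of "Idm M P"] M.Idm_closed[OF PM] by auto
  have \<alpha>': "\<alpha> \<in> M.hom z P" and \<sigma>': "\<sigma> \<in> M.hom P z" using \<alpha> \<sigma> by simp_all
  have "Cmp M P z P \<alpha> \<sigma> = Idm M P" using \<sigma>_eq by (auto simp: compose_def intro!: restrict_ext)
  then have "f = Cmp M x P y v0 (Cmp M x P P (Cmp M P z P \<alpha> \<sigma>) w0)"
    using f_eq M.Cmp_Idm_left[OF xM PM w0] by metis
  also have "\<dots> = Cmp M x z y (Cmp M z P y v0 \<alpha>) (Cmp M x P z \<sigma> w0)"
    using M.Cmp_assoc[OF xM PM zM PM w0 \<sigma>' \<alpha>'] M.Cmp_closed[OF xM PM zM w0 \<sigma>']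
      M.Cmp_assoc[OF xM zM PM yM _ \<alpha>' v0] by metis
  finally have "f = Cmp C x z y (Cmp M z P y v0 \<alpha>) (Cmp M x P z \<sigma> w0)" by simp
  moreover have "Cmp M x P z \<sigma> w0 \<in> C.hom x z" "Cmp M z P y v0 \<alpha> \<in> C.hom z y"
    using M.Cmp_closed[OF xM PM zM w0 \<sigma>'] M.Cmp_closed[OF zM PM yM \<alpha>' v0] by simp_all
  ultimately show thesis using that data by blast
qed

lemma factoringI:
  assumes "z \<in> B" "z \<in> projectives" "w \<in> C.hom x z" "v \<in> C.hom z y"
  shows "Cmp C x z y v w \<in> I x y"
  using assms unfolding factoring_def full_sub_simps by blast

text \<open>The lifts on p and q, each composed with the projection onto its summand, add up to a
  lift on t.\<close>

lemma biproduct_projective: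
  assumes p: "p \<in> B" "p \<in> projectives" and q: "q \<in> B" "q \<in> projectives" and t: "t \<in> B"
    and i: "i0 \<in> C.hom p t" "i1 \<in> C.hom q t"
    and \<pi>: "p0 \<in> C.hom t p" "p1 \<in> C.hom t q"
    and sum: "Cmp C t p t i0 p0 \<oplus>\<^bsub>Hom C t t\<^esub> Cmp C t q t i1 p1 = Idm C t"
  shows "t \<in> projectives"
proof (rule proj_algI[OF B_right_mod[OF t] B_fin_dim[OF t]])
  fix X N :: "('k, 'u, 'a) right_module" and g f
  assume X: "X \<in> Ob M" and N: "N \<in> Ob M" and g: "g \<in> right_hom K A X N" and f: "f \<in> right_hom K A t N"
    and surj: "g ` carrier X = carrier N"
  have i': "i0 \<in> right_hom K A p t" "i1 \<in> right_hom K A q t"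
    and \<pi>': "p0 \<in> right_hom K A t p" "p1 \<in> right_hom K A t q" using i \<pi> by simp_all
  have tM: "t \<in> Ob M" and pM: "p \<in> Ob M" and qM: "q \<in> Ob M" using t p q subcategory by auto
  obtain h0 where h0: "h0 \<in> right_hom K A p X" "\<And>v. v \<in> carrier p \<Longrightarrow> g (h0 v) = compose (carrier p) f i0 v"
    using proj_algD[OF p(2) X N g right_hom_compose[OF B_right_mod[OF p(1)] i'(1) f] surj] by metis
  obtain h1 where h1: "h1 \<in> right_hom K A q X" "\<And>v. v \<in> carrier q \<Longrightarrow> g (h1 v) = compose (carrier q) f i1 v"
    using proj_algD[OF q(2) X N g right_hom_compose[OF B_right_mod[OF q(1)] i'(2) f] surj] by metis
  let ?h = "Cmp M t p X h0 p0 \<oplus>\<^bsub>Hom M t X\<^esub> Cmp M t q X h1 p1"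
  have h: "?h \<in> right_hom K A t X"
    using M.Hom_add[OF tM X M.Cmp_closed[OF tM pM X, of p0 h0] M.Cmp_closed[OF tM qM X, of p1 h1]] \<pi>'
      h0(1) h1(1) by simp
  have "g (?h v) = f v" if v: "v \<in> carrier t" for v
  proof -
    have "i0 (p0 v) \<oplus>\<^bsub>t\<^esub> i1 (p1 v) = v" using fun_cong[OF sum, of v] v by (simp add: compose_def)
    then have "f v = f (i0 (p0 v)) \<oplus>\<^bsub>N\<^esub> f (i1 (p1 v))"
      using linear_map_add[OF right_hom_linear[OF f], of "i0 (p0 v)" "i1 (p1 v)"] v \<pi>' i'
        by (simp add: right_hom_closed)
    also have "\<dots> = g (h0 (p0 v)) \<oplus>\<^bsub>N\<^esub> g (h1 (p1 v))"
      using h0(2)[OF right_hom_closed[OF \<pi>'(1) v]] h1(2)[OF right_hom_closed[OF \<pi>'(2) v]]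
        right_hom_closed[OF \<pi>'(1) v] right_hom_closed[OF \<pi>'(2) v] by (simp add: compose_def)
    also have "\<dots> = g (?h v)"
      using v linear_map_add[OF right_hom_linear[OF g], of "h0 (p0 v)" "h1 (p1 v)"]
        right_hom_closed[OF h0(1)]
        right_hom_closed[OF h1(1)] right_hom_closed[OF \<pi>'(1) v] right_hom_closed[OF \<pi>'(2) v]
      by (simp add: compose_def)
    finally show ?thesis by simp
  qed
  with h show "\<exists>h\<in>right_hom K A t X. \<forall>v\<in>carrier t. g (h v) = f v" by blast
qed

text \<open>Factorisations are first moved into B. The point with content is then closure under
  sums: if f passes through s and g through \<open>s'\<close>, their sum passes through a biproduct
  of the two, which is again projective.\<close>

lemma category_ideal_projectives: "category_ideal K C I"
proof (rule category_ideal.intro[OF C.linear_category_axioms], rule category_ideal_axioms.intro)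
  have RC: "R \<in> Ob C" using R by simp
  fix x y z f g c assume x: "x \<in> Ob C" and y: "y \<in> Ob C"
  show "\<zero>\<^bsub>Hom C x y\<^esub> \<in> I x y"
    using factoringI[OF R generator_projective C.Hom_zero[OF x RC] C.Hom_zero[OF RC y]]
      C.Cmp_zero_right[OF x RC y C.Hom_zero[OF RC y]] by metis
  show "I x y \<subseteq> C.hom x y"
  proof
    fix f assume "f \<in> I x y"
    then show "f \<in> C.hom x y"
      using factors_through_free[OF x y] C.Cmp_closed[OF x _ y] C.sum_data_Ob(1) by metis
  qed
  {
    assume "f \<in> I x y"
    then obtain s n \<iota> \<pi> v w where data: "C.sum_data s (replicate n R) \<iota> \<pi>" and w: "w \<in> C.hom x s"
      and v: "v \<in> C.hom s y" and f: "f = Cmp C x s y v w"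
      using factors_through_free[OF x y] by metis
    have s: "s \<in> Ob C" "s \<in> B" "s \<in> projectives"
      using C.sum_data_Ob(1)[OF data] free_projective[OF data] by simp_all
    {
      assume "c \<in> carrier K"
      then show "c \<odot>\<^bsub>Hom C x y\<^esub> f \<in> I x y"
        using factoringI[OF s(2,3) w C.Hom_smult[OF s(1) y _ v]] C.Cmp_smult_left[OF x s(1) y _ w v] f
          by metis
    }
    {
      assume "g \<in> I x y"
      then obtain s' n' \<iota>' \<pi>' v' w' where data': "C.sum_data s' (replicate n' R) \<iota>' \<pi>'"
        and w': "w' \<in> C.hom x s'"
        and v': "v' \<in> C.hom s' y" and g: "g = Cmp C x s' y v' w'"
        using factors_through_free[OF x y] by metis
      have s': "s' \<in> Ob C" "s' \<in> B" "s' \<in> projectives"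
        using C.sum_data_Ob(1)[OF data'] free_projective[OF data'] by simp_all
      obtain t i0 i1 p0 p1 where t: "t \<in> Ob C" and i: "i0 \<in> C.hom s t" "i1 \<in> C.hom s' t"
        and p: "p0 \<in> C.hom t s" "p1 \<in> C.hom t s'"
        and orth: "Cmp C s t s p0 i0 = Idm C s" "Cmp C s' t s' p1 i1 = Idm C s'"
          "Cmp C s' t s p0 i1 = \<zero>\<^bsub>Hom C s' s\<^esub>" "Cmp C s t s' p1 i0 = \<zero>\<^bsub>Hom C s s'\<^esub>"
        and sum: "Cmp C t s t i0 p0 \<oplus>\<^bsub>Hom C t t\<^esub> Cmp C t s' t i1 p1 = Idm C t"
        using C.binary_biproduct[OF additive s(1) s'(1)] by metis
      have tB: "t \<in> B" using t by simp
      have t_proj: "t \<in> projectives" by (rule biproduct_projective[OF s(2,3) s'(2,3) tB i p sum])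
      interpret Hxs: abelian_group "Hom C x s" by (rule C.Hom_abelian_group[OF x s(1)])
      interpret Hxs': abelian_group "Hom C x s'" by (rule C.Hom_abelian_group[OF x s'(1)])
      let ?a = "Cmp C x s t i0 w" and ?b = "Cmp C x s' t i1 w'"
      have ab: "?a \<in> C.hom x t" "?b \<in> C.hom x t"
        using C.Cmp_closed[OF x s(1) t w i(1)] C.Cmp_closed[OF x s'(1) t w' i(2)] .
      \<comment> \<open>The map into the biproduct with components w and \<open>w'\<close>;
        following it by v and \<open>v'\<close> on the two summands gives f + g.\<close>
      define k where "k = ?a \<oplus>\<^bsub>Hom C x t\<^esub> ?b"
      have k: "k \<in> C.hom x t" unfolding k_def by (rule C.Hom_add[OF x t ab])
      have p0k: "Cmp C x t s p0 k = w"
      proof -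
        have "Cmp C x t s p0 k = Cmp C x s s (Cmp C s t s p0 i0) w \<oplus>\<^bsub>Hom C x s\<^esub> Cmp C x s' s
          (Cmp C s' t s p0 i1) w'"
          unfolding k_def using C.Cmp_add_right[OF x t s(1) ab p(1)]
            C.Cmp_assoc[OF x s(1) t s(1) w i(1) p(1)]
            C.Cmp_assoc[OF x s'(1) t s(1) w' i(2) p(1)] by metis
        then show ?thesis
          unfolding orth C.Cmp_Idm_left[OF x s(1) w] C.Cmp_zero_left[OF x s'(1) s(1) w']
            using Hxs.r_zero[OF w] by simp
      qed
      have p1k: "Cmp C x t s' p1 k = w'"
      proof -
        have "Cmp C x t s' p1 k = Cmp C x s s' (Cmp C s t s' p1 i0) w \<oplus>\<^bsub>Hom C x s'\<^esub> Cmp C x s' s'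
          (Cmp C s' t s' p1 i1) w'"
          unfolding k_def using C.Cmp_add_right[OF x t s'(1) ab p(2)]
            C.Cmp_assoc[OF x s(1) t s'(1) w i(1) p(2)]
            C.Cmp_assoc[OF x s'(1) t s'(1) w' i(2) p(2)] by metis
        then show ?thesis
          unfolding orth C.Cmp_Idm_left[OF x s'(1) w'] C.Cmp_zero_left[OF x s(1) s'(1) w]
            using Hxs'.l_zero[OF w'] by simp
      qed
      let ?v = "Cmp C t s y v p0" and ?v' = "Cmp C t s' y v' p1"
      have vv: "?v \<in> C.hom t y" "?v' \<in> C.hom t y"
        using C.Cmp_closed[OF t s(1) y p(1) v] C.Cmp_closed[OF t s'(1) y p(2) v'] .
      have "Cmp C x t y (?v \<oplus>\<^bsub>Hom C t y\<^esub> ?v') k = f \<oplus>\<^bsub>Hom C x y\<^esub> g"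
        using C.Cmp_add_left[OF x t y k vv] C.Cmp_assoc[OF x t s(1) y k p(1) v]
          C.Cmp_assoc[OF x t s'(1) y k p(2) v']
          p0k p1k f g by metis
      then show "f \<oplus>\<^bsub>Hom C x y\<^esub> g \<in> I x y"
        using factoringI[OF tB t_proj k C.Hom_add[OF t y vv]] by metis
    }
    {
      assume z: "z \<in> Ob C" and "g \<in> C.hom y z"
      then show "Cmp C x y z g f \<in> I x z"
        using factoringI[OF s(2,3) w C.Cmp_closed[OF s(1) y z v]] C.Cmp_assoc[OF x s(1) y z w v] f
          by metis
    }
  }
  {
    assume z: "z \<in> Ob C" and f: "f \<in> C.hom x y" and "g \<in> I y z"
    then obtain s n \<iota> \<pi> v w where data: "C.sum_data s (replicate n R) \<iota> \<pi>" and w: "w \<in> C.hom y s"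
      and v: "v \<in> C.hom s z" and g: "g = Cmp C y s z v w"
      using factors_through_free[OF y z] by metis
    have s: "s \<in> Ob C" "s \<in> B" "s \<in> projectives"
      using C.sum_data_Ob(1)[OF data] free_projective[OF data] by simp_all
    show "Cmp C x y z g f \<in> I x z"
      using factoringI[OF s(2,3) C.Cmp_closed[OF x y s(1) f w] v] C.Cmp_assoc[OF x y s(1) z f w v] g
        by metis
  }
qed

sublocale I: category_ideal K C I by (rule category_ideal_projectives)

section \<open>Modules inflated from the quotient and vanishing at R\<close>

lemma vanishes_on_free:
  fixes X :: "(('k, 'u, 'a) right_module, 'u \<Rightarrow> 'u, ('k, 'u) module, 'u \<Rightarrow> 'u) fctr"
  assumes X: "cat_module K C X" and 0: "carrier (fob X R) = {\<zero>\<^bsub>fob X R\<^esub>}"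
    and data: "C.sum_data z (replicate n R) \<iota> \<pi>" and v: "v \<in> carrier (fob X z)"
  shows "v = \<zero>\<^bsub>fob X z\<^esub>"
proof (rule C.sum_data_determined[OF data X v])
  have z: "z \<in> Ob C" and RC: "R \<in> Ob C" using C.sum_data_Ob(1)[OF data] R by simp_all
  interpret Xz: module K "fob X z" by (rule cat_module_fob[OF X z])
  show zero: "\<zero>\<^bsub>fob X z\<^esub> \<in> carrier (fob X z)" by simp
  fix i assume i: "i < length (replicate n R)"
  then have Ri: "replicate n R ! i = R" by simp
  have \<iota>: "\<iota> i \<in> C.hom R z" using C.sum_data_hom(1)[OF data i] unfolding Ri .
  show "far X z (replicate n R ! i) (\<iota> i) v = far X z (replicate n R ! i) (\<iota> i) \<zero>\<^bsub>fob X z\<^esub>"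
    unfolding Ri
    using cat_module_closed[OF X RC z \<iota> v] cat_module_closed[OF X RC z \<iota> zero] unfolding 0 by simp
qed

text \<open>The identity of R factors through a projective, namely R, so inflated modules vanish at
  R. Conversely, a module that vanishes at R vanishes on direct sums of copies of R and hence kills
  every morphism that factors through one of them.\<close>

lemma inflated_modules_eq:
  "inflated_modules TYPE('u) K C I = {X \<in> Ob (mod_cat TYPE('u) K C). carrier (fob X R) = {\<zero>\<^bsub>fob X R\<^esub>}}"
proof (rule Set.set_eqI, rule iffI)
  have RC: "R \<in> Ob C" using R by simp
  fix X assume X: "X \<in> inflated_modules TYPE('u) K C I"
  then have "X \<in> Ob (mod_cat TYPE('u) K C)" by (simp only: inflated_modules_def mem_Collect_eq)
  moreover have "Idm C R \<in> I R R"
    using factoringI[OF R generator_projective C.Idm_closed[OF RC] C.Idm_closed[OF RC]]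
      C.Cmp_Idm_left[OF RC RC C.Idm_closed[OF RC]] by metis
  then have "carrier (fob X R) = {\<zero>\<^bsub>fob X R\<^esub>}" by (rule I.vanishes_if_inflated[OF X RC])
  ultimately show "X \<in> {X \<in> Ob (mod_cat TYPE('u) K C). carrier (fob X R) = {\<zero>\<^bsub>fob X R\<^esub>}}" by blast
next
  fix X assume "X \<in> {X \<in> Ob (mod_cat TYPE('u) K C). carrier (fob X R) = {\<zero>\<^bsub>fob X R\<^esub>}}"
  then have X: "cat_module K C X" "finitely_presented K C X" and 0: "carrier (fob X R) = {\<zero>\<^bsub>fob X R\<^esub>}"
    by simp_all
  show "X \<in> inflated_modules TYPE('u) K C I"
  proof (rule I.inflated_if_kills_ideal[OF X])
    fix x y f v assume x: "x \<in> Ob C" and y: "y \<in> Ob C" and "f \<in> I x y" and v: "v \<in> carrier (fob X y)"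
    then obtain z n \<iota> \<pi> g h where data: "C.sum_data z (replicate n R) \<iota> \<pi>" and h: "h \<in> C.hom x z"
      and g: "g \<in> C.hom z y" and f: "f = Cmp C x z y g h"
      using factors_through_free[OF x y] by metis
    have z: "z \<in> Ob C" using C.sum_data_Ob(1)[OF data] .
    have "far X y x f v = far X z x h (far X y z g v)"
      unfolding f using cat_module_Cmp[OF X(1) x z y h g v] .
    also have "far X y z g v = \<zero>\<^bsub>fob X z\<^esub>"
      using vanishes_on_free[OF X(1) 0 data cat_module_closed[OF X(1) z y g v]] .
    also have "far X z x h \<zero>\<^bsub>fob X z\<^esub> = \<zero>\<^bsub>fob X x\<^esub>"
      using linear_map_zero[OF cat_module_linear[OF X(1) x z h] cat_module_fob[OF X(1) z]
        cat_module_fob[OF X(1) x]] .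
    finally show "far X y x f v = \<zero>\<^bsub>fob X x\<^esub>" .
  qed
qed

section \<open>Evaluation at the regular module\<close>

text \<open>For R = A and u = 1 this is left multiplication by a. Products are carried to composites
  in the same order, so a contravariant functor turns these endomorphisms into a right action of
  A.\<close>

definition rho :: "'a \<Rightarrow> 'u \<Rightarrow> 'u" where
  "rho a = free_map R (ract R u a)"

lemma rho: assumes "a \<in> carrier A" shows "rho a \<in> right_hom K A R R" "rho a u = ract R u a"
  using free_map[OF R_mod B_fin_dim[OF R] right_mod.ract_closed[OF R_mod u assms]]
    by (simp_all add: rho_def)

text \<open>An endomorphism of R is determined by the image of u, which has the form u a. Hence an
  A-linear map between values at R commutes with the action of every endomorphism of R.\<close>

lemma rho_surj:
  assumes "f \<in> right_hom K A R R"
  shows "\<exists>a\<in>carrier A. f = rho a"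
proof -
  obtain a where a: "a \<in> carrier A" "f u = ract R u a" using cyclic right_hom_closed[OF assms u] by blast
  then show ?thesis using eq_if_eq_at_generator[OF assms rho(1)] rho(2) by metis
qed

lemma rho_hom: "a \<in> carrier A \<Longrightarrow> rho a \<in> C.hom R R"
  using rho(1) by simp

lemma rho_ring:
  assumes a: "a \<in> carrier A" and b: "b \<in> carrier A" and c: "c \<in> carrier K"
  shows "rho (a \<oplus>\<^bsub>A\<^esub> b) = rho a \<oplus>\<^bsub>Hom C R R\<^esub> rho b"
    and "rho (c \<odot>\<^bsub>A\<^esub> a) = c \<odot>\<^bsub>Hom C R R\<^esub> rho a"
    and "rho (a \<otimes>\<^bsub>A\<^esub> b) = Cmp C R R R (rho a) (rho b)"
    and "rho \<one>\<^bsub>A\<^esub> = Idm C R"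
proof -
  interpret A: ring A using algebra by (simp add: fd_algebra_def)
  interpret AM: module K A using algebra by (simp add: fd_algebra_def)
  interpret R: right_mod K A R by (rule R_mod)
  have RC: "R \<in> Ob C" using R by simp
  have to: "f \<in> C.hom R R \<Longrightarrow> f \<in> right_hom K A R R" for f by simp
  show "rho (a \<oplus>\<^bsub>A\<^esub> b) = rho a \<oplus>\<^bsub>Hom C R R\<^esub> rho b"
    by (rule eq_if_eq_at_generator[OF rho(1) to[OF C.Hom_add[OF RC RC rho_hom[OF a] rho_hom[OF b]]]])
      (use a b u in \<open>simp_all add: rho(2) R.ract_add_right\<close>)
  show "rho (c \<odot>\<^bsub>A\<^esub> a) = c \<odot>\<^bsub>Hom C R R\<^esub> rho a"
    by (rule eq_if_eq_at_generator[OF rho(1) to[OF C.Hom_smult[OF RC RC c rho_hom[OF a]]]])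
      (use a c u in \<open>simp_all add: rho(2) R.ract_smult_right\<close>)
  show "rho (a \<otimes>\<^bsub>A\<^esub> b) = Cmp C R R R (rho a) (rho b)"
    by (rule eq_if_eq_at_generator[OF rho(1)
      to[OF C.Cmp_closed[OF RC RC RC rho_hom[OF b] rho_hom[OF a]]]])
      (use a b u in \<open>simp_all add: rho(2) R.ract_mult compose_def right_hom_ract[OF rho(1)]\<close>)
  show "rho \<one>\<^bsub>A\<^esub> = Idm C R"
    by (rule eq_if_eq_at_generator[OF rho(1) to[OF C.Idm_closed[OF RC]]])
      (use u in \<open>simp_all add: rho(2) R.ract_one\<close>)
qed

text \<open>The space X(R) with a acting through the endomorphism \<open>rho a\<close> of R. The
  fields are copied one by one because a right module is a larger record.\<close>

definition ev_ob :: "(('k, 'u, 'a) right_module, 'u \<Rightarrow> 'u, ('k, 'u) module, 'u \<Rightarrow> 'u) fctr \<Rightarrow>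
  ('k, 'u, 'a) right_module" where
  "ev_ob X = \<lparr>carrier = carrier (fob X R), mult = mult (fob X R), one = one (fob X R), zero =
    zero (fob X R),
    add = add (fob X R), smult = smult (fob X R), ract = (\<lambda>v a. far X R R (rho a) v)\<rparr>"

definition ev where "ev = \<lparr>fob = ev_ob, far = (\<lambda>X Y \<eta>. \<eta> R)\<rparr>"

lemma ev_ob_simps [simp]:
  "carrier (ev_ob X) = carrier (fob X R)" "\<zero>\<^bsub>ev_ob X\<^esub> = \<zero>\<^bsub>fob X R\<^esub>"
  "v \<oplus>\<^bsub>ev_ob X\<^esub> w = v \<oplus>\<^bsub>fob X R\<^esub> w" "c \<odot>\<^bsub>ev_ob X\<^esub> v = c \<odot>\<^bsub>fob X R\<^esub> v"
  "ract (ev_ob X) v a = far X R R (rho a) v"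
  by (simp_all add: ev_ob_def)

lemma ev_ob_lin_hom [simp]: "lin_hom K (ev_ob X) (ev_ob Y) = lin_hom K (fob X R) (fob Y R)"
  by (simp add: lin_hom_def)

lemma ev_simps [simp]: "fob ev = ev_ob" "far ev X Y \<eta> = \<eta> R"
  by (simp_all add: ev_def)

lemma module_ev_ob:
  assumes X: "cat_module K C X"
  shows "module K (ev_ob X)"
proof (rule module_image[where q = "\<lambda>v. v"])
  show "module K (fob X R)" using cat_module_fob[OF X, of R] R by simp
qed (simp_all add: linear_map_def)

lemma right_mod_ev_ob:
  assumes X: "cat_module K C X"
  shows "right_mod K A (ev_ob X)"
proof (rule right_mod.intro)
  have RC: "R \<in> Ob C" using R by simp
  interpret A: ring A using algebra by (simp add: fd_algebra_def)
  fix v w a b c assume v: "v \<in> carrier (ev_ob X)"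
  then have v': "v \<in> carrier (fob X R)" by simp
  show "ract (ev_ob X) v \<one>\<^bsub>A\<^esub> = v"
    using cat_module_Idm[OF X RC v'] rho_ring(4)[OF A.one_closed A.one_closed
      cring.cring_simprules(6)[OF cring]]
    by (simp del: full_sub_simps mod_alg_simps)
  assume a: "a \<in> carrier A"
  show "ract (ev_ob X) v a \<in> carrier (ev_ob X)" using cat_module_closed[OF X RC RC rho_hom[OF a] v']
    by simp
  {
    assume "w \<in> carrier (ev_ob X)"
    then show "ract (ev_ob X) (v \<oplus>\<^bsub>ev_ob X\<^esub> w) a = ract (ev_ob X) v a \<oplus>\<^bsub>ev_ob X\<^esub> ract (ev_ob X) w a"
      using linear_map_add[OF cat_module_linear[OF X RC RC rho_hom[OF a]] v'] by simp
  }
  {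
    assume c: "c \<in> carrier K"
    show "ract (ev_ob X) (c \<odot>\<^bsub>ev_ob X\<^esub> v) a = c \<odot>\<^bsub>ev_ob X\<^esub> ract (ev_ob X) v a"
      using linear_map_smult[OF cat_module_linear[OF X RC RC rho_hom[OF a]] c v'] by simp
    show "ract (ev_ob X) v (c \<odot>\<^bsub>A\<^esub> a) = c \<odot>\<^bsub>ev_ob X\<^esub> ract (ev_ob X) v a"
      using cat_module_smult[OF X RC RC c rho_hom[OF a] v'] rho_ring(2)[OF a a c]
      by (simp del: full_sub_simps mod_alg_simps)
  }
  assume b: "b \<in> carrier A"
  note zero = cring.cring_simprules(2)[OF cring]
  show "ract (ev_ob X) v (a \<oplus>\<^bsub>A\<^esub> b) = ract (ev_ob X) v a \<oplus>\<^bsub>ev_ob X\<^esub> ract (ev_ob X) v b"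
    using cat_module_add[OF X RC RC rho_hom[OF a] rho_hom[OF b] v'] rho_ring(1)[OF a b zero]
    by (simp del: full_sub_simps mod_alg_simps)
  show "ract (ev_ob X) v (a \<otimes>\<^bsub>A\<^esub> b) = ract (ev_ob X) (ract (ev_ob X) v a) b"
    using cat_module_Cmp[OF X RC RC RC rho_hom[OF b] rho_hom[OF a] v'] rho_ring(3)[OF a b zero]
    by (simp del: full_sub_simps mod_alg_simps)
qed (rule module_ev_ob[OF X])

text \<open>X(R) is a quotient of C(R,c0), and the latter is c0 because R is free on u.\<close>

lemma fin_dim_ev_ob:
  assumes X: "cat_module K C X" and fp: "finitely_presented K C X"
  shows "fin_dim K (ev_ob X)"
proof -
  have RC: "R \<in> Ob C" using R by simp
  obtain c1 c0 d e where p: "C.presents X c1 c0 d e" using C.finitely_presented_iff[OF X] fp by blast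
  note p' = C.presentsD[OF p]
  have c0: "c0 \<in> B" using p'(3) by simp
  note c0' = B_right_mod[OF c0] B_fin_dim[OF c0]
  note c0m = right_mod.vector_space[OF c0'(1)]
  interpret c0: module K c0 by (rule c0m)
  have hom: "free_map c0 v \<in> C.hom R c0" if "v \<in> carrier c0" for v using free_map(1)[OF c0' that] by simp
  have to: "f \<in> C.hom R c0 \<Longrightarrow> f \<in> right_hom K A R c0" for f by simp
  have add: "free_map c0 (v \<oplus>\<^bsub>c0\<^esub> w) = free_map c0 v \<oplus>\<^bsub>Hom C R c0\<^esub> free_map c0 w"
    if "v \<in> carrier c0" "w \<in> carrier c0" for v w
    by (rule eq_if_eq_at_generator[OF free_map(1)[OF c0']
      to[OF C.Hom_add[OF RC p'(3) hom[OF that(1)] hom[OF that(2)]]]])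
      (use that u in \<open>simp_all add: free_map(2)[OF c0']\<close>)
  have smult: "free_map c0 (c \<odot>\<^bsub>c0\<^esub> v) = c \<odot>\<^bsub>Hom C R c0\<^esub> free_map c0 v"
    if "v \<in> carrier c0" "c \<in> carrier K" for v c
    by (rule eq_if_eq_at_generator[OF free_map(1)[OF c0']
      to[OF C.Hom_smult[OF RC p'(3) that(2) hom[OF that(1)]]]])
      (use that u in \<open>simp_all add: free_map(2)[OF c0']\<close>)
  let ?f = "\<lambda>v. far X c0 R (free_map c0 v) e"
  show ?thesis
  proof (rule fin_dim_image[OF c0m c0'(2) module_ev_ob[OF X]])
    show "linear_map K c0 (ev_ob X) ?f"
    proof (rule linear_mapI)
      fix v w c assume v: "v \<in> carrier c0"
      show "?f v \<in> carrier (ev_ob X)" using cat_module_closed[OF X RC p'(3) hom[OF v] p'(5)] by simp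
      show "?f (c \<odot>\<^bsub>c0\<^esub> v) = c \<odot>\<^bsub>ev_ob X\<^esub> ?f v" if c: "c \<in> carrier K"
        using cat_module_smult[OF X RC p'(3) c hom[OF v] p'(5)] smult[OF v c]
          by (simp del: full_sub_simps mod_alg_simps)
      assume w: "w \<in> carrier c0"
      show "?f (v \<oplus>\<^bsub>c0\<^esub> w) = ?f v \<oplus>\<^bsub>ev_ob X\<^esub> ?f w"
        using cat_module_add[OF X RC p'(3) hom[OF v] hom[OF w] p'(5)] add[OF v w]
          by (simp del: full_sub_simps mod_alg_simps)
    qed
    show "?f ` carrier c0 = carrier (ev_ob X)"
    proof (intro equalityI subsetI)
      fix x assume "x \<in> carrier (ev_ob X)"
      then have "x \<in> carrier (fob X R)" by simp
      then obtain g where g: "g \<in> C.hom R c0" "far X c0 R g e = x" using C.generatesD(3)[OF p'(1) RC]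
        by blast
      then have g': "g \<in> right_hom K A R c0" by simp
      have "?f (g u) = x" using free_map_unique[OF c0' g'] g(2) by simp
      then show "x \<in> ?f ` carrier c0" using right_hom_closed[OF g' u] by blast
    next
      fix x assume "x \<in> ?f ` carrier c0"
      then show "x \<in> carrier (ev_ob X)" using cat_module_closed[OF X RC p'(3) hom p'(5)] by auto
    qed
  qed
qed

text \<open>A-linearity of the component at R is naturality along the endomorphisms
  \<open>rho a\<close>.\<close>

lemma nat_maps_at_R:
  assumes "\<eta> \<in> nat_maps K C X Y"
  shows "\<eta> R \<in> right_hom K A (ev_ob X) (ev_ob Y)"
proof -
  have RC: "R \<in> Ob C" using R by simp
  show ?thesis
    unfolding right_hom_def using nat_maps_lin_hom[OF assms RC]
      nat_maps_natural[OF assms RC RC rho_hom] by simp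
qed

lemma linear_functor_ev: "linear_functor K (mod_cat TYPE('u) K C) M ev"
proof (rule linear_functor.intro)
  fix X assume "X \<in> Ob (mod_cat TYPE('u) K C)"
  then show "fob ev X \<in> Ob M" using right_mod_ev_ob fin_dim_ev_ob by simp
qed (use R nat_maps_at_R in \<open>simp_all add: compose_def\<close>)

text \<open>The module W is the value at N of a left adjoint of evaluation, constructed from a
  presentation of N by direct sums of copies of R.\<close>

lemma ev_left_adjoint:
  fixes N :: "('k, 'u, 'a) right_module"
  assumes N: "right_mod K A N" "fin_dim K N"
  obtains W \<theta> where "cat_module K C W" "finitely_presented K C W"
    "\<theta> \<in> right_hom K A (ev_ob W) N" "bij_betw \<theta> (carrier (ev_ob W)) (carrier N)"
    "\<forall>Z. cat_module K C Z \<longrightarrow>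
      bij_betw (\<lambda>\<eta>. \<eta> R) (nat_maps K C W Z) (right_hom K A (ev_ob W) (ev_ob Z))"
proof -
  have RC: "R \<in> Ob C" using R by simp
  have Nm: "module K N" using right_mod.vector_space[OF N(1)] .
  obtain z n \<iota> \<pi> \<alpha> where data: "C.sum_data z (replicate n R) \<iota> \<pi>" and \<alpha>: "\<alpha> \<in> right_hom K A z N"
    and \<alpha>_surj: "\<alpha> ` carrier z = carrier N" by (rule free_cover[OF N])
  have zC: "z \<in> Ob C" using C.sum_data_Ob(1)[OF data] .
  have zB: "z \<in> B" using zC by simp
  note z' = B_right_mod[OF zB] B_fin_dim[OF zB]
  have zm: "module K z" using right_mod.vector_space[OF z'(1)] .
  interpret z: module K z by (rule zm)
  interpret N: module K N by (rule Nm)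
  have \<iota>: "\<iota> i \<in> C.hom R z" if "i < n" for i
    using C.sum_data_hom(1)[OF data, of i] that by (simp del: full_sub_simps mod_alg_simps)
  note \<alpha>_lin = right_hom_linear[OF \<alpha>]
  \<comment> \<open>This L is the kernel of the free cover \<open>\<alpha>\<close>, not the left
    adjoint. It is finite dimensional and so has a free cover \<open>\<beta>\<close> of its own;
    together they present N by two free modules that lie in B.\<close>
  define L where "L = {v \<in> carrier z. \<alpha> v = \<zero>\<^bsub>N\<^esub>}"
  have L: "submodule L K z"
    unfolding submodule_iff[OF zm] L_def using linear_map_zero[OF \<alpha>_lin zm Nm]
    by (auto simp: linear_map_add[OF \<alpha>_lin] linear_map_smult[OF \<alpha>_lin])
  have N_act: "ract N \<zero>\<^bsub>N\<^esub> a = \<zero>\<^bsub>N\<^esub>" if "a \<in> carrier A" for a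
    using linear_map_zero[OF right_mod_linear[OF N(1) that] Nm Nm] .
  have act: "ract z m a \<in> L" if "m \<in> L" "a \<in> carrier A" for m a
    using that right_mod.ract_closed[OF z'(1)] right_hom_ract[OF \<alpha>] N_act by (simp add: L_def)
  define N' where "N' = z\<lparr>carrier := L\<rparr>"
  have N': "right_mod K A N'" "fin_dim K N'"
    unfolding N'_def using right_submodule[OF field z' L act] by blast+
  have cN': "carrier N' = L" by (simp add: N'_def)
  obtain z1 n1 \<iota>1 \<pi>1 \<beta> where data1: "C.sum_data z1 (replicate n1 R) \<iota>1 \<pi>1"
    and \<beta>: "\<beta> \<in> right_hom K A z1 N'"
    and \<beta>_surj: "\<beta> ` carrier z1 = carrier N'" by (rule free_cover[OF N'])
  have z1C: "z1 \<in> Ob C" using C.sum_data_Ob(1)[OF data1] .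
  have z1B: "z1 \<in> B" using z1C by simp
  note z1' = B_right_mod[OF z1B] B_fin_dim[OF z1B]
  have \<beta>_z: "\<beta> \<in> right_hom K A z1 z"
  proof (rule right_homI)
    show "linear_map K z1 z \<beta>" using right_hom_linear[OF \<beta>] by (auto simp: linear_map_def N'_def L_def)
    show "\<beta> (ract z1 m a) = ract z (\<beta> m) a" if "m \<in> carrier z1" "a \<in> carrier A" for m a
      using right_hom_ract[OF \<beta> that] by (simp add: N'_def)
  qed (rule right_hom_extensional[OF \<beta>])
  have \<beta>C: "\<beta> \<in> C.hom z1 z" using \<beta>_z by simp
  obtain W :: "(('k, 'u, 'a) right_module, 'u \<Rightarrow> 'u, ('k, 'u) module, 'u \<Rightarrow> 'u) fctr" and E
    where W: "cat_module K C W" and p: "C.presents W z1 z \<beta> E"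
    by (rule C.presented_module_exists[OF z1C zC \<beta>C])
  note p' = C.presentsD[OF p]
  have W_fp: "finitely_presented K C W" using C.finitely_presented_iff[OF W] p by blast
  have WR: "module K (fob W R)" by (rule cat_module_fob[OF W RC])
  have HRz: "module K (Hom C R z)" by (rule C.Hom_module[OF RC zC])
  have Hom_right: "g \<in> right_hom K A x y" if "g \<in> C.hom x y" for g x y using that by simp
  \<comment> \<open>Relations of E at R are tested at u: as R is free, g is a multiple of
    \<open>\<beta>\<close> iff g u lies in the image of \<open>\<beta>\<close>, which is the kernel
    of \<open>\<alpha>\<close>.\<close>
  have ker: "far W z R g E = \<zero>\<^bsub>fob W R\<^esub> \<longleftrightarrow> \<alpha> (g u) = \<zero>\<^bsub>N\<^esub>" if g: "g \<in> C.hom R z" for g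
  proof -
    have gu: "g u \<in> carrier z" using right_hom_closed[OF Hom_right[OF g] u] .
    have "far W z R g E = \<zero>\<^bsub>fob W R\<^esub> \<longleftrightarrow> (\<exists>h\<in>C.hom R z1. g = Cmp C R z1 z \<beta> h)"
      using p'(6)[OF RC g] .
    also have "\<dots> \<longleftrightarrow> g u \<in> L"
    proof
      assume "\<exists>h\<in>C.hom R z1. g = Cmp C R z1 z \<beta> h"
      then obtain h where h: "h \<in> right_hom K A R z1" "g = Cmp C R z1 z \<beta> h" by auto
      have "g u = \<beta> (h u)" using h(2) u by (simp add: compose_def)
      then show "g u \<in> L" using right_hom_closed[OF \<beta> right_hom_closed[OF h(1) u]] cN' by simp
    next
      assume "g u \<in> L"
      then have "g u \<in> \<beta> ` carrier z1" using \<beta>_surj cN' by simp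
      then obtain w where w: "w \<in> carrier z1" "g u = \<beta> w" by blast
      note h = free_map[OF z1' w(1)]
      have hC: "free_map z1 w \<in> C.hom R z1" using h(1) by simp
      have "g = Cmp C R z1 z \<beta> (free_map z1 w)"
        by (rule eq_if_eq_at_generator[OF Hom_right[OF g] Hom_right[OF C.Cmp_closed[OF RC z1C zC hC \<beta>C]]])
          (use w u h(2) in \<open>simp add: compose_def\<close>)
      then show "\<exists>h\<in>C.hom R z1. g = Cmp C R z1 z \<beta> h" using hC by blast
    qed
    also have "\<dots> \<longleftrightarrow> \<alpha> (g u) = \<zero>\<^bsub>N\<^esub>" using gu by (simp add: L_def)
    finally show ?thesis .
  qed
  have lin1: "linear_map K (Hom C R z) (fob W R) (\<lambda>g. far W z R g E)"
    by (rule cat_module_eval_linear[OF W RC zC p'(5)])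
  have surj1: "(\<lambda>g. far W z R g E) ` C.hom R z = carrier (fob W R)"
  proof (intro equalityI subsetI)
    fix v assume "v \<in> carrier (fob W R)"
    then show "v \<in> (\<lambda>g. far W z R g E) ` C.hom R z" using C.generatesD(3)[OF p'(1) RC] by blast
  next
    fix v assume "v \<in> (\<lambda>g. far W z R g E) ` C.hom R z"
    then show "v \<in> carrier (fob W R)" using linear_map_closed[OF lin1] by blast
  qed
  have lin2: "linear_map K (Hom C R z) N (\<lambda>g. \<alpha> (g u))"
    by (rule linear_mapI)
      (use u in \<open>simp_all add: right_hom_closed[OF \<alpha>] right_hom_closed linear_map_add[OF \<alpha>_lin]
        linear_map_smult[OF \<alpha>_lin]\<close>)
  \<comment> \<open>W(R) and N are quotients of C(R,z) by the same kernel, and this identifies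
    them.\<close>
  obtain \<theta> where \<theta>: "\<theta> \<in> lin_hom K (fob W R) N" and \<theta>_inj: "inj_on \<theta> (carrier (fob W R))"
    and *: "\<forall>g\<in>C.hom R z. \<theta> (far W z R g E) = \<alpha> (g u)"
    by (rule linear_factor[OF HRz WR Nm lin1 surj1 lin2 ker])
  have \<theta>_eq: "\<theta> (far W z R g E) = \<alpha> (g u)" if "g \<in> C.hom R z" for g using * that by blast
  have W_gen: "\<exists>g\<in>C.hom R z. v = far W z R g E" if "v \<in> carrier (fob W R)" for v
    using C.generatesD(3)[OF p'(1) RC that] by force
  have W_act: "far W R R r (far W z R g E) = far W z R (Cmp C R R z g r) E"
    if "g \<in> C.hom R z" "r \<in> C.hom R R" for g r
    using cat_module_Cmp[OF W RC RC zC that(2,1) p'(5)] by simp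
  have \<theta>_hom: "\<theta> \<in> right_hom K A (ev_ob W) N"
  proof (rule right_homI)
    show "linear_map K (ev_ob W) N \<theta>" using \<theta> by (simp add: lin_hom_iff linear_map_def)
    show "\<theta> \<in> extensional (carrier (ev_ob W))" using \<theta> by (simp add: lin_hom_iff)
    fix v a assume v: "v \<in> carrier (ev_ob W)" and a: "a \<in> carrier A"
    obtain g where g: "g \<in> C.hom R z" "v = far W z R g E" using W_gen[of v] v by auto
    have "\<theta> (far W R R (rho a) v) = \<alpha> (Cmp C R R z g (rho a) u)"
      unfolding g(2) W_act[OF g(1) rho_hom[OF a]]
        by (rule \<theta>_eq[OF C.Cmp_closed[OF RC RC zC rho_hom[OF a] g(1)]])
    also have "\<dots> = ract N (\<alpha> (g u)) a"
      using u rho(2)[OF a] right_hom_ract[OF Hom_right[OF g(1)] u a]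
        right_hom_ract[OF \<alpha> right_hom_closed[OF Hom_right[OF g(1)] u] a]
      by (simp add: compose_def)
    finally show "\<theta> (ract (ev_ob W) v a) = ract N (\<theta> v) a" using \<theta>_eq[OF g(1)] g(2) by simp
  qed
  have "carrier N \<subseteq> \<theta> ` carrier (fob W R)"
  proof
    fix m assume "m \<in> carrier N"
    then have "m \<in> \<alpha> ` carrier z" using \<alpha>_surj by simp
    then obtain v where v: "v \<in> carrier z" "m = \<alpha> v" by blast
    have g: "free_map z v \<in> C.hom R z" using free_map(1)[OF z' v(1)] by simp
    have "m = \<theta> (far W z R (free_map z v) E)" using \<theta>_eq[OF g] free_map(2)[OF z' v(1)] v(2) by simp
    then show "m \<in> \<theta> ` carrier (fob W R)" using linear_map_closed[OF lin1 g] by blast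
  qed
  then have \<theta>_bij: "bij_betw \<theta> (carrier (ev_ob W)) (carrier N)"
    using \<theta>_inj lin_homD[OF \<theta>] by (auto simp: bij_betw_def)
  \<comment> \<open>To extend h to all of B an image x of E in Z(z) has to be found. Its component
    on each copy of R is forced: it is the value of h at the matching component of E. Such an x
    exists because z is a direct sum of copies of R.\<close>
  have full: "\<exists>\<eta>\<in>nat_maps K C W Z. \<eta> R = h"
    if Z: "cat_module K C Z" and h: "h \<in> right_hom K A (ev_ob W) (ev_ob Z)"
    for h and Z :: "(('k, 'u, 'a) right_module, 'u \<Rightarrow> 'u, ('k, 'u) module, 'u \<Rightarrow> 'u) fctr"
  proof -
    have ZR: "module K (fob Z R)" by (rule cat_module_fob[OF Z RC])
    have h_lin: "linear_map K (fob W R) (fob Z R) h"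
      using right_hom_linear[OF h] by (simp add: linear_map_def)
    have h_act: "h (far W R R r v) = far Z R R r (h v)" if r: "r \<in> C.hom R R"
      and v: "v \<in> carrier (fob W R)" for r v
    proof -
      obtain a where "a \<in> carrier A" "r = rho a" using rho_surj[OF Hom_right[OF r]] by blast
      then show ?thesis using right_hom_ract[OF h, of v a] v by simp
    qed
    have "\<exists>x\<in>carrier (fob Z z). \<forall>i<length (replicate n R). far Z z (replicate n R ! i) (\<iota> i) x =
      h (far W z R (\<iota> i) E)"
      by (rule C.sum_data_glue[OF data Z])
        (use linear_map_closed[OF h_lin linear_map_closed[OF lin1 \<iota>]] in simp)
    then obtain x where x: "x \<in> carrier (fob Z z)"
      and x_eq: "\<And>i. i < n \<Longrightarrow> far Z z R (\<iota> i) x = h (far W z R (\<iota> i) E)"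
      by auto
    \<comment> \<open>Known for the injections by the choice of x. It extends to all g because g is
      a sum of maps through the copies of R and h commutes with endomorphisms of R.\<close>
    have eq: "far Z z R g x = h (far W z R g E)" if g: "g \<in> C.hom R z" for g
    proof (rule C.linear_maps_eq_on_sum[OF data RC ZR _ _ _ g])
      show "linear_map K (Hom C R z) (fob Z R) (\<lambda>g. far Z z R g x)"
        by (rule cat_module_eval_linear[OF Z RC zC x])
      show "linear_map K (Hom C R z) (fob Z R) (\<lambda>g. h (far W z R g E))"
        by (rule linear_map_compose[OF lin1 h_lin])
      fix i k assume "i < length (replicate n R)" and k: "k \<in> C.hom R (replicate n R ! i)"
      then have i: "i < n" and Ri: "replicate n R ! i = R" by simp_all
      have k': "k \<in> C.hom R R" using k unfolding Ri .
      have "far Z z R (Cmp C R R z (\<iota> i) k) x = far Z R R k (h (far W z R (\<iota> i) E))"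
        using cat_module_Cmp[OF Z RC RC zC k' \<iota>[OF i] x] x_eq[OF i] by simp
      also have "\<dots> = h (far W z R (Cmp C R R z (\<iota> i) k) E)"
        using h_act[OF k' linear_map_closed[OF lin1 \<iota>[OF i]]] W_act[OF \<iota>[OF i] k'] by simp
      finally show "far Z z R (Cmp C R (replicate n R ! i) z (\<iota> i) k) x =
          h (far W z R (Cmp C R (replicate n R ! i) z (\<iota> i) k) E)" unfolding Ri .
    qed
    interpret Zz1: module K "fob Z z1" by (rule cat_module_fob[OF Z z1C])
    \<comment> \<open>The relation \<open>\<beta>\<close> must kill x. As z1 is also a direct sum of
      copies of R, this may be tested at R, where the relation already kills E.\<close>
    have "far Z z z1 \<beta> x = \<zero>\<^bsub>fob Z z1\<^esub>"
    proof (rule C.sum_data_determined[OF data1 Z])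
      show "far Z z z1 \<beta> x \<in> carrier (fob Z z1)" by (rule cat_module_closed[OF Z z1C zC \<beta>C x])
      fix i assume i: "i < length (replicate n1 R)"
      then have Ri: "replicate n1 R ! i = R" by simp
      have \<iota>1: "\<iota>1 i \<in> C.hom R z1" using C.sum_data_hom(1)[OF data1 i] unfolding Ri .
      note c = C.Cmp_closed[OF RC z1C zC \<iota>1 \<beta>C]
      have "far Z z1 R (\<iota>1 i) (far Z z z1 \<beta> x) = h (far W z R (Cmp C R z1 z \<beta> (\<iota>1 i)) E)"
        using cat_module_Cmp[OF Z RC z1C zC \<iota>1 \<beta>C x] eq[OF c] by simp
      also have "far W z R (Cmp C R z1 z \<beta> (\<iota>1 i)) E = \<zero>\<^bsub>fob W R\<^esub>" using p'(6)[OF RC c] \<iota>1 by blast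
      also have "h \<zero>\<^bsub>fob W R\<^esub> = \<zero>\<^bsub>fob Z R\<^esub>" by (rule linear_map_zero[OF h_lin WR ZR])
      also have "\<dots> = far Z z1 R (\<iota>1 i) \<zero>\<^bsub>fob Z z1\<^esub>"
        using linear_map_zero[OF cat_module_linear[OF Z RC z1C \<iota>1] Zz1.module_axioms ZR] by simp
      finally show "far Z z1 (replicate n1 R ! i) (\<iota>1 i) (far Z z z1 \<beta> x) =
          far Z z1 (replicate n1 R ! i) (\<iota>1 i) \<zero>\<^bsub>fob Z z1\<^esub>" unfolding Ri .
    qed simp
    then obtain \<eta> where \<eta>: "\<eta> \<in> nat_maps K C W Z" "\<eta> z E = x" by (rule C.presents_factor[OF W Z p x])
    have "\<eta> R = h"
    proof (rule lin_hom_eqI[OF nat_maps_lin_hom[OF \<eta>(1) RC]])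
      show "h \<in> lin_hom K (fob W R) (fob Z R)" using right_hom_lin_hom[OF h] by simp
      fix v assume "v \<in> carrier (fob W R)"
      then obtain g where g: "g \<in> C.hom R z" "v = far W z R g E" using W_gen by blast
      show "\<eta> R v = h v"
        using nat_maps_natural[OF \<eta>(1) RC zC g(1) p'(5)] \<eta>(2) eq[OF g(1)] g(2) by simp
    qed
    then show ?thesis using \<eta>(1) by blast
  qed
  \<comment> \<open>W is generated by E, and the image of E in Z(z) is determined by its components
    at the copies of R.\<close>
  have faithful: "\<eta> = \<eta>'"
    if Z: "cat_module K C Z" and \<eta>: "\<eta> \<in> nat_maps K C W Z" "\<eta>' \<in> nat_maps K C W Z" "\<eta> R = \<eta>' R"
    for \<eta> \<eta>' and Z :: "(('k, 'u, 'a) right_module, 'u \<Rightarrow> 'u, ('k, 'u) module, 'u \<Rightarrow> 'u) fctr"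
  proof (rule C.nat_maps_eq_if_generated[OF p'(1) \<eta>(1,2)])
    show "\<eta> z E = \<eta>' z E"
    proof (rule C.sum_data_determined[OF data Z])
      fix i assume "i < length (replicate n R)"
      then have i: "i < n" and Ri: "replicate n R ! i = R" by simp_all
      show "far Z z (replicate n R ! i) (\<iota> i) (\<eta> z E) = far Z z (replicate n R ! i) (\<iota> i) (\<eta>' z E)"
        unfolding Ri using nat_maps_natural[OF \<eta>(1) RC zC \<iota>[OF i] p'(5)]
          nat_maps_natural[OF \<eta>(2) RC zC \<iota>[OF i] p'(5)]
          \<eta>(3) by simp
    qed (use nat_maps_closed[OF \<eta>(1) zC p'(5)] nat_maps_closed[OF \<eta>(2) zC p'(5)] in simp_all)
  qed
  have "bij_betw (\<lambda>\<eta>. \<eta> R) (nat_maps K C W Z) (right_hom K A (ev_ob W) (ev_ob Z))"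
    if Z: "cat_module K C Z" for Z :: "(('k, 'u, 'a) right_module, 'u \<Rightarrow> 'u, ('k, 'u) module, 'u \<Rightarrow> 'u)
      fctr"
    unfolding bij_betw_def
  proof (intro conjI inj_onI equalityI subsetI)
    fix h assume "h \<in> right_hom K A (ev_ob W) (ev_ob Z)"
    then obtain \<eta> where "\<eta> \<in> nat_maps K C W Z" "\<eta> R = h" using full[OF Z] by blast
    then show "h \<in> (\<lambda>\<eta>. \<eta> R) ` nat_maps K C W Z" by blast
  qed (use faithful[OF Z] nat_maps_at_R in auto)
  then show thesis using that[OF W W_fp \<theta>_hom \<theta>_bij] by blast
qed

text \<open>Here W is built from N = X(R). The counit from W to X is found by lifting the
  isomorphism \<open>\<theta>\<close> from W(R) to X(R) through the bijection of the adjunction; it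
  is inverted because its component at R is \<open>\<theta>\<close>.\<close>

lemma localising_functor_ev:
  "localising_functor K (mod_cat TYPE('u) K C) M ev (inflated_modules TYPE('u) K C I)"
proof (intro localising_functor.intro localising_functor_axioms.intro linear_category_mod_cat cring
    M.linear_category_axioms linear_functor_ev)
  let ?M = "mod_cat TYPE('u) K C" and ?S = "inflated_modules TYPE('u) K C I"
  have RC: "R \<in> Ob C" using R by simp
  note inverted = C.inverted_iff_bij_betw[OF RC inflated_modules_eq]
  fix X Y s assume X: "X \<in> Ob ?M"
  then have X': "cat_module K C X" "finitely_presented K C X" by simp_all
  {
    assume "Y \<in> Ob ?M" and s: "s \<in> inverted ?M ?S X Y"
    then have Y': "cat_module K C Y" "finitely_presented K C Y" by simp_all
    have "s \<in> nat_maps K C X Y" "bij_betw (s R) (carrier (fob X R)) (carrier (fob Y R))"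
      using s inverted[OF X' Y'] by blast+
    then show "iso_arr M (fob ev X) (fob ev Y) (far ev X Y s)"
      using nat_maps_at_R iso_arr_mod_alg_iff[OF right_mod_ev_ob[OF X'(1)] right_mod_ev_ob[OF Y'(1)]]
        by simp
  }
  obtain W \<theta> where W: "cat_module K C W" "finitely_presented K C W"
    and \<theta>: "\<theta> \<in> right_hom K A (ev_ob W) (ev_ob X)" "bij_betw \<theta> (carrier (ev_ob W)) (carrier (ev_ob X))"
    and bij: "\<forall>Z. cat_module K C Z \<longrightarrow>
      bij_betw (\<lambda>\<eta>. \<eta> R) (nat_maps K C W Z) (right_hom K A (ev_ob W) (ev_ob Z))"
    by (rule ev_left_adjoint[OF right_mod_ev_ob[OF X'(1)] fin_dim_ev_ob[OF X']])
  have "\<theta> \<in> (\<lambda>\<eta>. \<eta> R) ` nat_maps K C W X"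
    using bij X'(1) \<theta>(1) by (simp add: bij_betw_def)
  then obtain e where e: "e \<in> nat_maps K C W X" "e R = \<theta>" by blast
  have "e \<in> inverted ?M ?S W X" using inverted[OF W X'] e \<theta>(2) by simp
  moreover have "bij_betw (far ev W Z) (carrier (Hom ?M W Z)) (M.hom (fob ev W) (fob ev Z))"
    if "Z \<in> Ob ?M" for Z
    using bij that by (simp add: ev_def)
  moreover have "W \<in> Ob ?M" using W by simp
  ultimately show "\<exists>w\<in>Ob ?M. \<exists>e\<in>inverted ?M ?S w X. \<forall>z\<in>Ob ?M.
      bij_betw (far ev w z) (carrier (Hom ?M w z)) (M.hom (fob ev w) (fob ev z))" by blast
qed

text \<open>What remains is essential surjectivity of evaluation, and it comes from the isomorphism
  between W(R) and N for the module W presented by a free presentation of N.\<close>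

theorem equivalence:
  "\<exists>F. linear_equivalence K (serre_quotient (mod_cat TYPE('u) K C) (inflated_modules TYPE('u) K C I)) M F"
proof -
  have "\<exists>X\<in>Ob (mod_cat TYPE('u) K C). isomorphic M (fob ev X) N" if "N \<in> Ob M" for N
  proof -
    have N: "right_mod K A N" "fin_dim K N" using that by simp_all
    obtain W \<theta> where W: "cat_module K C W" "finitely_presented K C W"
      and \<theta>: "\<theta> \<in> right_hom K A (ev_ob W) N" "bij_betw \<theta> (carrier (ev_ob W)) (carrier N)"
      by (rule ev_left_adjoint[OF N])
    have "isomorphic M (fob ev W) N"
      using iso_arr_mod_alg_iff[OF right_mod_ev_ob[OF W(1)] N(1)] \<theta> W right_mod_ev_ob fin_dim_ev_ob N
      by (auto simp: isomorphic_def)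
    then show ?thesis using W by auto
  qed
  then show ?thesis
    using localising_functor.serre_quotient_equivalence[OF localising_functor_ev] by blast
qed

end

section \<open>The free cyclic generator supplied by a copy of A in B\<close>

theorem corollary2p8:
  fixes K :: "'k ring" and A :: "('k, 'a) module" and B :: "('k, 'u, 'a) right_module set"
  assumes field: "field K"
    and algebra: "fd_algebra K A"
    and universe: "\<exists>\<iota> :: 'k list \<Rightarrow> 'u. inj_on \<iota> (lists (carrier K))"
    and subcategory: "B \<subseteq> Ob (mod_alg TYPE('u) K A)"
    and additive: "additive (full_sub (mod_alg TYPE('u) K A) B)"
    and krull_schmidt: "krull_schmidt (full_sub (mod_alg TYPE('u) K A) B)"
    and functorially_finite: "functorially_finite K (mod_alg TYPE('u) K A) B"
    and contains_A: "\<exists>R\<in>B. isomorphic_modules K A (regular_module A) R"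
  shows "\<exists>F. linear_equivalence K
    (serre_quotient
      (mod_cat TYPE('u) K (full_sub (mod_alg TYPE('u) K A) B))
      (inflated_modules TYPE('u) K (full_sub (mod_alg TYPE('u) K A) B)
        (factoring (mod_alg TYPE('u) K A) (proj_alg TYPE('u) K A))))
    (mod_alg TYPE('u) K A) F"
proof -
  obtain R \<phi> where R: "R \<in> B" and \<phi>: "\<phi> \<in> right_hom K A (regular_module A) R"
    and bij: "bij_betw \<phi> (carrier (regular_module A)) (carrier R)"
    using contains_A unfolding isomorphic_modules_def by blast
  have reg: "carrier (regular_module A) = carrier A" "ract (regular_module A) = mult A"
    "add (regular_module A) = add A" "smult (regular_module A) = smult A"
    by (simp_all add: regular_module_def)
  interpret A: ring A using algebra by (simp add: fd_algebra_def)
  interpret AM: module K A using algebra by (simp add: fd_algebra_def)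
  have R_mod: "right_mod K A R" using subcategory R by auto
  interpret R: right_mod K A R by (rule R_mod)
  have \<phi>_cl: "\<phi> a \<in> carrier R" if "a \<in> carrier A" for a using right_hom_closed[OF \<phi>] that
    by (simp add: reg)
  have \<phi>_ract: "\<phi> (b \<otimes>\<^bsub>A\<^esub> a) = ract R (\<phi> b) a" if "a \<in> carrier A" "b \<in> carrier A" for a b
    using right_hom_ract[OF \<phi>, of b a] that by (simp add: reg)
  have ex: "\<exists>a\<in>carrier A. r = \<phi> a" if "r \<in> carrier R" for r
  proof -
    have "r \<in> \<phi> ` carrier A" using bij that by (simp add: bij_betw_def reg)
    then show ?thesis by blast
  qed
  have inj: "inj_on \<phi> (carrier A)" using bij by (simp add: bij_betw_def reg)
  have \<phi>_add: "\<phi> (a \<oplus>\<^bsub>A\<^esub> b) = \<phi> a \<oplus>\<^bsub>R\<^esub> \<phi> b" if "a \<in> carrier A" "b \<in> carrier A" for a b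
    using linear_map_add[OF right_hom_linear[OF \<phi>], of a b] that by (simp add: reg)
  have \<phi>_smult: "\<phi> (c \<odot>\<^bsub>A\<^esub> a) = c \<odot>\<^bsub>R\<^esub> \<phi> a" if "a \<in> carrier A" "c \<in> carrier K" for a c
    using linear_map_smult[OF right_hom_linear[OF \<phi>], of c a] that by (simp add: reg)
  have "\<exists>h\<in>right_hom K A R N. h (\<phi> \<one>\<^bsub>A\<^esub>) = v"
    if N: "right_mod K A N" "fin_dim K N" and v: "v \<in> carrier N" for N :: "('k, 'u, 'a) right_module"
      and v
  proof -
    interpret N: right_mod K A N by (rule N(1))
    \<comment> \<open>The homomorphism from A to N that sends a to v a, transported to R along
      \<open>\<phi>\<close>.\<close>
    define h where "h = (\<lambda>r\<in>carrier R. ract N v (inv_into (carrier A) \<phi> r))"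
    have h: "h (\<phi> a) = ract N v a" if "a \<in> carrier A" for a
      using that inj \<phi>_cl by (simp add: h_def)
    have "h \<in> right_hom K A R N"
    proof (rule right_homI)
      show "linear_map K R N h"
      proof (rule linear_mapI)
        fix r s c assume "r \<in> carrier R"
        then obtain a where a: "a \<in> carrier A" "r = \<phi> a" using ex by blast
        show "h r \<in> carrier N" using a h v N.ract_closed by simp
        show "h (c \<odot>\<^bsub>R\<^esub> r) = c \<odot>\<^bsub>N\<^esub> h r" if "c \<in> carrier K"
          using a that v h by (simp add: N.ract_smult_right flip: \<phi>_smult)
        assume "s \<in> carrier R"
        then obtain b where b: "b \<in> carrier A" "s = \<phi> b" using ex by blast
        show "h (r \<oplus>\<^bsub>R\<^esub> s) = h r \<oplus>\<^bsub>N\<^esub> h s"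
          using a b v h by (simp add: N.ract_add_right flip: \<phi>_add)
      qed
      fix r b assume "r \<in> carrier R" and b: "b \<in> carrier A"
      then obtain a where a: "a \<in> carrier A" "r = \<phi> a" using ex by blast
      show "h (ract R r b) = ract N (h r) b"
        using a b v h by (simp add: N.ract_mult flip: \<phi>_ract)
    qed (simp add: h_def)
    moreover have "h (\<phi> \<one>\<^bsub>A\<^esub>) = v" using h v N.ract_one by simp
    ultimately show ?thesis by blast
  qed
  moreover have "\<exists>a\<in>carrier A. r = ract R (\<phi> \<one>\<^bsub>A\<^esub>) a" if r: "r \<in> carrier R" for r
  proof -
    obtain a where a: "a \<in> carrier A" "r = \<phi> a" using ex[OF r] by blast
    then show ?thesis using \<phi>_ract[OF a(1) A.one_closed] by (intro bexI[of _ a]) simp_all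
  qed
  ultimately interpret module_category K A B R "\<phi> \<one>\<^bsub>A\<^esub>"
    by (intro module_category.intro field algebra universe subcategory additive functorially_finite R
        \<phi>_cl A.one_closed)
  show ?thesis by (rule equivalence)
qed

end
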